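(* Let $\epsilon>0$ be fixed (small) and let $\sigma>\frac12+\epsilon$ be fixed. Let $\varphi_1$ be a Jacob's ladder and for sufficiently large $y$ write $[y]^1=\varphi_1^{-1}(y)$. For $x,y,z,n\in\mathbb{N}$ with $n\geq3$ put $u=u(\tau)=\frac{2\pi^2}{\zeta^4(2\sigma)}\frac{x^n+y^n}{z^n}\tau$ and \[ L(x,y,z,n)=\lim_{\tau\to\infty}\frac{1}{\tau}\,\frac{\left\{\int_{u}^{[u]^1}|\zeta(\sigma+it)|^2{\rm d}t\right\}^4\int_0^{u}\left|\zeta\left(\frac{1}{2}+it\right)\right|^4{\rm d}t}{\sum_{s=0}^4c_s\left\{\int_{u}^{[u]^1}\left|\zeta\left(\frac{1}{2}+it\right)\right|^2{\rm d}t\right\}^{4-s}\left\{\int_{u}^{[u]^1}|\zeta(\sigma+it)|^2{\rm d}t\right\}^s}, \] where $c_0=1$ and $c_s=2\pi^2\{\zeta(2\sigma)\}^{-s}a_s$, $s=1,2,3,4$. Then the condition "$L(x,y,z,n)\neq 1$ for all $x,y,z,n\in\mathbb{N}$ with $n\geq 3$" is equivalent to the Fermat-Wiles theorem (that $x^n+y^n=z^n$ has no solutions in positive integers $x,y,z$ for $n\geq 3$).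
   Context: $\zeta$ is the Riemann zeta-function. The constants $a_0,\dots,a_4$ are those of the Ingham / Heath-Brown fourth moment formula: $\int_0^T|\zeta(\frac12+it)|^4{\rm d}t=T\sum_{s=0}^4a_s\ln^{4-s}T+\mathcal{O}(T^{7/8+\epsilon})$ as $T\to\infty$, with $a_0=\frac{1}{2\pi^2}$. A Jacob's ladder (in the sense of J. Moser) is a function $\varphi_1(T)=\frac12\varphi(T)$, where $\varphi(T)=x(T)$ is a solution of the nonlinear integral equation $\int_0^{\mu[x(T)]}Z^2(t)e^{-\frac{2}{x(T)}t}{\rm d}t=\int_0^T Z^2(t){\rm d}t$, with $Z(t)$ the Hardy function (so $Z^2(t)=|\zeta(\frac12+it)|^2$) and $\mu$ an increasing function with $\mu(y)\geq 7y\ln y$; it is known that $\varphi_1$ is increasing for sufficiently large arguments, so $\varphi_1^{-1}(y)$ is defined for sufficiently large $y$. *)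

theory Defs
  imports "HOL-Complex_Analysis.Complex_Analysis" "HOL-Library.Landau_Symbols"
begin

(* The analytic continuation of the Dirichlet series to the punctured plane; it is unique by the
   identity theorem. The value 0 at the pole s = 1 is only a convention. *)
definition zeta :: "complex \<Rightarrow> complex" where
  "zeta = (THE f. f holomorphic_on (- {1}) \<and>
             (\<forall>s. Re s > 1 \<longrightarrow> f s = (\<Sum>k. 1 / of_nat (Suc k) powr s)) \<and> f 1 = 0)"

definition riemann_siegel_theta :: "real \<Rightarrow> real" where
  "riemann_siegel_theta t = Im (ln_Gamma (1 / 4 + \<i> * of_real (t / 2))) - t / 2 * ln pi"

(* Hardy's function takes real values, so its square is the squared norm used below; it is typed as
   complex because that it is real depends on the functional equation of zeta. *)
definition hardy_Z :: "real \<Rightarrow> complex" where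
  "hardy_Z t = exp (\<i> * of_real (riemann_siegel_theta t)) * zeta (1 / 2 + \<i> * of_real t)"

definition zeta_moment :: "nat \<Rightarrow> real \<Rightarrow> real \<Rightarrow> real \<Rightarrow> real" where
  "zeta_moment k \<sigma> A B = integral {A..B} (\<lambda>t. norm (zeta (of_real \<sigma> + \<i> * of_real t)) ^ k)"

(* The formula determines a 0, ..., a 4 uniquely, so this predicate identifies the constants;
   a s for s > 4 is never used. *)
definition fourth_moment_constants :: "(nat \<Rightarrow> real) \<Rightarrow> bool" where
  "fourth_moment_constants a \<longleftrightarrow>
     a 0 = 1 / (2 * pi ^ 2) \<and>
     (\<forall>\<epsilon>>0. (\<lambda>T. zeta_moment 4 (1 / 2) 0 T - T * (\<Sum>s\<le>4. a s * ln T ^ (4 - s)))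
              \<in> O[at_top](\<lambda>T. T powr (7 / 8 + \<epsilon>)))"

(* A ladder is a function on the half-line [T0, oo); its values below T0 are irrelevant.
   Likewise the admissible function \<mu> lives on a half-line [y0, oo) of positive reals. *)
definition jacobs_ladder :: "real \<Rightarrow> (real \<Rightarrow> real) \<Rightarrow> bool" where
  "jacobs_ladder T0 \<phi>1 \<longleftrightarrow> T0 > 0 \<and>
     (\<exists>\<mu> \<phi> y0. y0 > 0 \<and> mono_on {y0..} \<mu> \<and> (\<forall>y\<ge>y0. \<mu> y \<ge> 7 * y * ln y) \<and>
        (\<forall>T\<ge>T0. \<phi> T \<ge> y0 \<and>
           integral {0..\<mu> (\<phi> T)} (\<lambda>t. norm (hardy_Z t) ^ 2 * exp (- (2 / \<phi> T) * t)) =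
             integral {0..T} (\<lambda>t. norm (hardy_Z t) ^ 2) \<and>
           \<phi>1 T = \<phi> T / 2))"

(* The inverse of the ladder on its domain; meaningful for all sufficiently large arguments. *)
definition ladder_inv :: "real \<Rightarrow> (real \<Rightarrow> real) \<Rightarrow> real \<Rightarrow> real" where
  "ladder_inv T0 \<phi>1 = inv_into {T0..} \<phi>1"

definition zeta_real :: "real \<Rightarrow> real" where
  "zeta_real x = Re (zeta (of_real x))"

definition moment_coeff :: "(nat \<Rightarrow> real) \<Rightarrow> real \<Rightarrow> nat \<Rightarrow> real" where
  "moment_coeff a \<sigma> s = (if s = 0 then 1 else 2 * pi ^ 2 * a s / zeta_real (2 * \<sigma>) ^ s)"

definition fermat_arg :: "real \<Rightarrow> nat \<Rightarrow> nat \<Rightarrow> nat \<Rightarrow> nat \<Rightarrow> real \<Rightarrow> real" where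
  "fermat_arg \<sigma> x y z n \<tau> =
     2 * pi ^ 2 / zeta_real (2 * \<sigma>) ^ 4 * ((real x ^ n + real y ^ n) / real z ^ n) * \<tau>"

definition fermat_quotient ::
  "(nat \<Rightarrow> real) \<Rightarrow> real \<Rightarrow> (real \<Rightarrow> real) \<Rightarrow> real \<Rightarrow> nat \<Rightarrow> nat \<Rightarrow> nat \<Rightarrow> nat \<Rightarrow> real \<Rightarrow> real" where
  "fermat_quotient a T0 \<phi>1 \<sigma> x y z n \<tau> =
     (let u = fermat_arg \<sigma> x y z n \<tau>;
          v = ladder_inv T0 \<phi>1 u
      in 1 / \<tau> * (zeta_moment 2 \<sigma> u v ^ 4 * zeta_moment 4 (1 / 2) 0 u /
           (\<Sum>s\<le>4. moment_coeff a \<sigma> s * zeta_moment 2 (1 / 2) u v ^ (4 - s) *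
                    zeta_moment 2 \<sigma> u v ^ s)))"

definition fermat_limit ::
  "(nat \<Rightarrow> real) \<Rightarrow> real \<Rightarrow> (real \<Rightarrow> real) \<Rightarrow> real \<Rightarrow> nat \<Rightarrow> nat \<Rightarrow> nat \<Rightarrow> nat \<Rightarrow> real" where
  "fermat_limit a T0 \<phi>1 \<sigma> x y z n = Lim at_top (fermat_quotient a T0 \<phi>1 \<sigma> x y z n)"

definition fermat_wiles :: bool where
  "fermat_wiles \<longleftrightarrow>
     (\<forall>(x::nat) (y::nat) (z::nat) (n::nat). x > 0 \<and> y > 0 \<and> z > 0 \<and> n \<ge> 3 \<longrightarrow> x ^ n + y ^ n \<noteq> z ^ n)"

end

theory Submission
  imports Defs "HOL-Real_Asymp.Real_Asymp" "HOL-Probability.Probability"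
begin

text \<open>
  Let \<open>v = [u]^1\<close>, and let \<open>A\<close> and \<open>B\<close> be the second moments over \<open>[u, v]\<close> on the lines \<open>\<sigma>\<close> and \<open>1/2\<close>.
  Dividing the quotient by \<open>A^4\<close> shows that it only depends on \<open>B / A\<close> and on the fourth moment, so that
  everything follows from \<open>B / A \<sim> ln u / \<zeta>(2 \<sigma>)\<close>: the limit is then \<open>(x^n + y^n) / z^n\<close>.

  Writing \<open>I\<close> for the second moment over \<open>[0, T]\<close> on the critical line, the integral equation says
  \<open>I(v) = F\<close>, where \<open>F\<close> is the integral of \<open>I'(t) e^{-t/u}\<close> up to a point beyond \<open>14 u ln (2 u)\<close>.
  From \<open>I(T) = T ln T + C T + o(T)\<close> and the positivity of the integral of \<open>x ln x e^{-x}\<close> over the half-line one gets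
  \<open>F - I(u) \<ge> c u\<close>, hence \<open>v - u\<close> is at least of order \<open>u / ln u\<close>. On intervals of that length the second
  moments obey \<open>B \<sim> (v - u) ln u\<close> and \<open>A \<sim> \<zeta>(2 \<sigma>) (v - u)\<close>.

  These short-interval asymptotics come from means against Gaussians of width \<open>H = T^{9/10}\<close> centred at \<open>t0\<close>. In such
  a mean, zeta may be replaced by the Dirichlet series smoothed by \<open>e^{-n/X}\<close> with \<open>X = T^{5/2}\<close>. For a fixed
  shift \<open>h\<close> the off-diagonal sum over \<open>m\<close>, in the variable \<open>l = ln (1 + h/m)\<close>, is a sum of values of a function
  which becomes an integral over \<open>l\<close> up to a negligible error; the sum over \<open>h\<close> under the integral is then almost
  geometric and the resulting integral can be evaluated. No functional equation is needed.
\<close>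

subsection \<open>Continuation of the zeta function\<close>

text \<open>The difference F - I(u) lies one logarithm below its main terms: F and I(u) share u ln u
  + C u, because t e^{-t/u} / u integrates to u. Hence I is needed with error o(T), with some
  constant C, which cancels; a mean square to leading order would say nothing about v - u. The
  weights are Gaussian because their Fourier transforms are Gaussian too: a pair m, n enters with a
  factor that is negligible unless ln (n/m) is at most of order 1/H. The integral over l has the
  singularity l^{\<alpha> - 1}: for \<alpha> > 0 it is integrable and only the diagonal survives;
  for \<alpha> = 0 it is cut off near l = 1/X and produces the logarithm. The smoothed series
  requires Re s < 1, so \<sigma> \<ge> 1 is done with Dirichlet polynomials. All errors are powers:
  the width T^{9/10}, the margin T^{19/20} of the windows and the final error T^{24/25} stay below u
  / ln u.\<close>

definition cell_integral :: "(real \<Rightarrow> real) \<Rightarrow> complex \<Rightarrow> nat \<Rightarrow> complex" where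
  "cell_integral p w n = integral {0..1} (\<lambda>y. of_real (p y) * of_real (real (Suc n) + y) powr (- w))"

lemma continuous_on_shift_powr [continuous_intros]:
  "continuous_on {0..1} (\<lambda>y. complex_of_real (real (Suc n) + y) powr w)"
proof -
  have "continuous_on {0..1} (\<lambda>y. exp (w * of_real (ln (real (Suc n) + y))))"
    by (intro continuous_intros) auto
  moreover have "exp (w * of_real (ln (real (Suc n) + y))) = complex_of_real (real (Suc n) + y) powr w"
    if "y \<in> {0..1}" for y
  proof -
    have "real (Suc n) + y > 0" using that by (auto intro: add_pos_nonneg)
    then show ?thesis using Ln_of_real[of "real (Suc n) + y"] by (simp add: powr_def del: of_nat_Suc of_real_add)
  qed
  ultimately show ?thesis by (rule continuous_on_eq)
qed

lemma cell_integrable: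
  assumes "continuous_on {0..1} p"
  shows "(\<lambda>y. complex_of_real (p y) * of_real (real (Suc n) + y) powr w) integrable_on {0..1}"
  by (intro integrable_continuous_interval continuous_intros assms)

lemma norm_shift_powr:
  assumes "y \<in> {0..1}"
  shows "norm (complex_of_real (real (Suc n) + y) powr w) = (real (Suc n) + y) powr Re w"
  using assms by (subst norm_powr_real_powr) auto

lemma cell_integral_bound:
  assumes "continuous_on {0..1} p" "\<And>y. y \<in> {0..1} \<Longrightarrow> \<bar>p y\<bar> \<le> B" "Re w \<ge> 0"
  shows "norm (cell_integral p w n) \<le> B * real (Suc n) powr (- Re w)"
proof -
  have "norm (cell_integral p w n) \<le> (B * real (Suc n) powr (- Re w)) * (1 - 0)"
    unfolding cell_integral_def
  proof (rule integral_bound)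
    show "continuous_on {0..1} (\<lambda>y. complex_of_real (p y) * complex_of_real (real (Suc n) + y) powr - w)"
      by (intro continuous_intros assms)
    fix y :: real assume y: "y \<in> {0..1}"
    have B: "B \<ge> 0" using assms(2)[of 0] by auto
    show "norm (complex_of_real (p y) * complex_of_real (real (Suc n) + y) powr - w) \<le> B * real (Suc n) powr - Re w"
      unfolding norm_mult norm_shift_powr[OF y]
      using y assms B by (auto intro!: mult_mono powr_mono2')
  qed auto
  then show ?thesis by simp
qed

lemma cell_integral_holomorphic:
  assumes "continuous_on {0..1} p"
  shows "(\<lambda>w. cell_integral p w n) holomorphic_on UNIV"
proof -
  define L where "L y = complex_of_real (ln (real (Suc n) + y))" for y
  have eq: "complex_of_real (real (Suc n) + y) powr (-w) = exp (- w * L y)" if "y \<in> {0..1}" for y w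
  proof -
    have "real (Suc n) + y > 0" using that by (auto intro: add_pos_nonneg)
    then show ?thesis using Ln_of_real[of "real (Suc n) + y"] by (simp add: powr_def L_def del: of_nat_Suc of_real_add)
  qed
  have "(\<lambda>w. integral (cbox 0 1) (\<lambda>y. of_real (p y) * exp (- w * L y))) holomorphic_on UNIV"
  proof (rule leibniz_rule_holomorphic[where fx = "\<lambda>w y. of_real (p y) * (exp (- w * L y) * (- L y))"])
    have L: "continuous_on {0..1} L" unfolding L_def by (intro continuous_intros) auto
    show "(\<lambda>y. of_real (p y) * exp (- w * L y)) integrable_on cbox 0 1" for w
      unfolding cbox_interval by (intro integrable_continuous_interval continuous_intros assms L)
    show "continuous_on (UNIV \<times> cbox 0 1) (\<lambda>(w, y). complex_of_real (p y) * (exp (- w * L y) * - L y))"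
      unfolding case_prod_beta
      by (intro continuous_intros continuous_on_compose2[OF assms] continuous_on_compose2[OF L]) auto
  qed (auto intro!: derivative_eq_intros)
  moreover have "integral (cbox 0 1) (\<lambda>y. of_real (p y) * exp (- w * L y)) = cell_integral p w n" for w
    unfolding cell_integral_def cbox_interval by (rule integral_cong) (simp only: eq)
  ultimately show ?thesis by simp
qed

lemma continuous_on_unit_bounded:
  fixes p :: "real \<Rightarrow> real"
  assumes "continuous_on {0..1} p"
  obtains B where "B \<ge> 0" "\<And>y. y \<in> {0..1} \<Longrightarrow> \<bar>p y\<bar> \<le> B"
proof -
  have "bounded (p ` {0..1})" using assms compact_continuous_image compact_imp_bounded by blast
  then obtain B where B: "\<forall>x\<in>p ` {0..1}. norm x \<le> B" using bounded_iff by metis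
  then have "\<bar>p y\<bar> \<le> B" if "y \<in> {0..1}" for y using that by auto
  moreover have "B \<ge> 0" using B by (force dest: bspec[of _ _ "p 0"])
  ultimately show ?thesis using that by blast
qed

lemma summable_Suc_powr: "c > 1 \<Longrightarrow> summable (\<lambda>n. real (Suc n) powr (- c))"
  using summable_real_powr_iff[of "-c"] by (subst summable_Suc_iff) auto

lemma summable_cell_integral:
  assumes "continuous_on {0..1} p" "Re w > 1"
  shows "summable (cell_integral p w)"
proof -
  obtain B where B: "B \<ge> 0" "\<And>y. y \<in> {0..1} \<Longrightarrow> \<bar>p y\<bar> \<le> B"
    using continuous_on_unit_bounded assms by metis
  show ?thesis
  proof (rule summable_comparison_test')
    show "summable (\<lambda>n. B * real (Suc n) powr (- Re w))"
      by (intro summable_mult summable_Suc_powr assms)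
    show "norm (cell_integral p w n) \<le> B * real (Suc n) powr (- Re w)" for n
      by (rule cell_integral_bound) (use assms B in auto)
  qed
qed

lemma cell_sum_holomorphic:
  assumes p: "continuous_on {0..1} p"
  shows "(\<lambda>w. suminf (cell_integral p w)) holomorphic_on {w. Re w > 1}"
proof (rule holomorphic_uniform_sequence[where f = "\<lambda>N w. \<Sum>n<N. cell_integral p w n"])
  show "open {w. Re w > 1}" by (simp add: open_halfspace_Re_gt)
  show "(\<lambda>w. \<Sum>n<N. cell_integral p w n) holomorphic_on {w. Re w > 1}" for N
    by (intro holomorphic_intros holomorphic_on_subset[OF cell_integral_holomorphic[OF p]]) auto
  fix x assume x: "x \<in> {w. Re w > 1}"
  obtain B where B: "B \<ge> 0" "\<And>y. y \<in> {0..1} \<Longrightarrow> \<bar>p y\<bar> \<le> B"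
    using continuous_on_unit_bounded p by metis
  \<comment> \<open>Half the distance to the line Re = 1, so that the closed disc stays in Re w
    \<ge> 1 + d and one convergent majorant serves all of it.\<close>
  define d where "d = (Re x - 1) / 2"
  have d: "d > 0" using x by (auto simp: d_def)
  have Re: "Re w \<ge> 1 + d" if "w \<in> cball x d" for w
  proof -
    have "\<bar>Re (x - w)\<bar> \<le> d" using that abs_Re_le_cmod[of "x - w"] by (simp add: dist_norm)
    then show ?thesis using d unfolding d_def minus_complex.sel by argo
  qed
  show "\<exists>d>0. cball x d \<subseteq> {w. Re w > 1} \<and>
          uniform_limit (cball x d) (\<lambda>N w. \<Sum>n<N. cell_integral p w n) (\<lambda>w. suminf (cell_integral p w)) sequentially"
  proof (intro exI[of _ d] conjI d subsetI)
    show "w \<in> {w. Re w > 1}" if "w \<in> cball x d" for w using Re[OF that] d by auto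
    show "uniform_limit (cball x d) (\<lambda>N w. \<Sum>n<N. cell_integral p w n) (\<lambda>w. suminf (cell_integral p w)) sequentially"
    proof (rule Weierstrass_m_test)
      show "summable (\<lambda>n. B * real (Suc n) powr (- (1 + d)))"
        by (intro summable_mult summable_Suc_powr) (use d in auto)
      fix n w assume w: "w \<in> cball x d"
      have "norm (cell_integral p w n) \<le> B * real (Suc n) powr (- Re w)"
        by (rule cell_integral_bound) (use p B Re[OF w] d in auto)
      also have "\<dots> \<le> B * real (Suc n) powr (- (1 + d))"
        by (intro mult_left_mono powr_mono) (use Re[OF w] B in auto)
      finally show "norm (cell_integral p w n) \<le> B * real (Suc n) powr (- (1 + d))" .
    qed
  qed
qed

lemma has_vector_derivative_shift_powr:
  assumes "y \<ge> 0"
  shows "((\<lambda>y. complex_of_real (real (Suc n) + y) powr w) has_vector_derivative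
            w * complex_of_real (real (Suc n) + y) powr (w - 1)) (at y within S)"
proof -
  have "((\<lambda>z. (of_nat (Suc n) + z) powr w) has_field_derivative
          w * (of_nat (Suc n) + of_real y) powr (w - 1)) (at (of_real y))"
    by (rule derivative_eq_intros refl | use assms in \<open>simp add: complex_nonpos_Reals_iff\<close>)+
  then have "((\<lambda>z. (of_nat (Suc n) + of_real z) powr w) has_vector_derivative
          w * (of_nat (Suc n) + of_real y) powr (w - 1)) (at y)"
    by (rule has_vector_derivative_real_field)
  then show ?thesis using has_vector_derivative_at_within by fastforce
qed

lemma cell_integral_by_parts:
  assumes p: "continuous_on {0..1} p" and P: "\<And>y. y \<in> {0..1} \<Longrightarrow> (P has_real_derivative p y) (at y within {0..1})"
  shows "cell_integral p w n = of_real (P 1) * of_real (real (Suc n) + 1) powr (- w)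
           - of_real (P 0) * of_real (real (Suc n)) powr (- w) + w * cell_integral P (w + 1) n"
proof -
  have cP: "continuous_on {0..1} P" using P by (meson DERIV_continuous continuous_on_eq_continuous_within)
  have 1: "((\<lambda>y. of_real (p y) * of_real (real (Suc n) + y) powr (- w) +
             of_real (P y) * (- w * of_real (real (Suc n) + y) powr (- w - 1))) has_integral
         (of_real (P 1) * of_real (real (Suc n) + 1) powr (- w) - of_real (P 0) * of_real (real (Suc n) + 0) powr (- w))) {0..1}"
  proof (rule fundamental_theorem_of_calculus)
    fix y :: real assume y: "y \<in> {0..1}"
    have "((\<lambda>y. complex_of_real (P y)) has_vector_derivative of_real (p y)) (at y within {0..1})"
      using P[OF y] by (simp add: has_real_derivative_iff_has_vector_derivative has_vector_derivative_of_real)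
    then have "((\<lambda>y. of_real (P y) * of_real (real (Suc n) + y) powr (- w)) has_vector_derivative
         of_real (P y) * (- w * of_real (real (Suc n) + y) powr (- w - 1)) + of_real (p y) * of_real (real (Suc n) + y) powr (- w)) (at y within {0..1})"
      using y by (intro has_vector_derivative_mult has_vector_derivative_shift_powr) auto
    then show "((\<lambda>y. of_real (P y) * of_real (real (Suc n) + y) powr (- w)) has_vector_derivative
         of_real (p y) * of_real (real (Suc n) + y) powr (- w) + of_real (P y) * (- w * of_real (real (Suc n) + y) powr (- w - 1))) (at y within {0..1})"
      by (simp add: add.commute)
  qed auto
  have 2: "((\<lambda>y. of_real (p y) * of_real (real (Suc n) + y) powr (- w)) has_integral cell_integral p w n) {0..1}"
    unfolding cell_integral_def by (intro integrable_integral cell_integrable p)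
  have 3: "((\<lambda>y. (- w) * (of_real (P y) * of_real (real (Suc n) + y) powr (- (w + 1)))) has_integral (- w) * cell_integral P (w + 1) n) {0..1}"
    unfolding cell_integral_def by (intro has_integral_mult_right integrable_integral cell_integrable cP)
  have "(\<lambda>y. of_real (p y) * of_real (real (Suc n) + y) powr (- w) +
             of_real (P y) * (- w * of_real (real (Suc n) + y) powr (- w - 1))) =
        (\<lambda>y. of_real (p y) * of_real (real (Suc n) + y) powr (- w) +
             (- w) * (of_real (P y) * of_real (real (Suc n) + y) powr (- (w + 1))))"
    by (simp add: fun_eq_iff)
  with has_integral_unique[OF 1] has_integral_add[OF 2 3]
  have "of_real (P 1) * of_real (real (Suc n) + 1) powr (- w) - of_real (P 0) * of_real (real (Suc n) + 0) powr (- w)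
     = cell_integral p w n + (- w) * cell_integral P (w + 1) n"
    by simp
  then show ?thesis by (simp add: algebra_simps)
qed

lemma powr_neg_tendsto_0:
  assumes "Re w > 0"
  shows "(\<lambda>n. complex_of_real (real (Suc n)) powr (- w)) \<longlonglongrightarrow> 0"
proof -
  have "(\<lambda>n. real (Suc n) powr (- Re w)) \<longlonglongrightarrow> 0"
    using assms by real_asymp
  moreover have "norm (complex_of_real (real (Suc n)) powr (- w)) = real (Suc n) powr (- Re w)" for n
    by (subst norm_powr_real_powr) auto
  ultimately have "(\<lambda>n. norm (complex_of_real (real (Suc n)) powr (- w))) \<longlonglongrightarrow> 0"
    by presburger
  then show ?thesis by (rule tendsto_norm_zero_cancel)
qed

lemma telescope_powr_sums:
  assumes "Re w > 0"
  shows "(\<lambda>n. of_real (real (Suc n) + 1) powr (- w) - complex_of_real (real (Suc n)) powr (- w)) sums (-1)"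
  using telescope_sums[OF powr_neg_tendsto_0[OF assms]] by (simp add: add.commute)

text \<open>Integrating by parts against the primitive of \<open>p\<close> that again has mean zero gains one power, and with it
  one more unit strip.\<close>

lemma cell_sum_extends:
  assumes "continuous_on {0..1} p" "integral {0..1} p = 0"
  shows "\<exists>h. h holomorphic_on {w. Re w > 1 - real j} \<and> (\<forall>w. Re w > 1 \<longrightarrow> h w = suminf (cell_integral p w))"
  using assms
proof (induction j arbitrary: p)
  case 0
  then show ?case using cell_sum_holomorphic[of p] by auto
next
  case (Suc j)
  define P0 where "P0 = (\<lambda>y. integral {0..y} p)"
  define c where "c = integral {0..1} P0"
  define P where "P = (\<lambda>y. P0 y - c)"
  have P0: "(P0 has_real_derivative p y) (at y within {0..1})" if "y \<in> {0..1}" for y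
    unfolding P0_def using Suc.prems(1) that by (rule integral_has_real_derivative)
  then have P: "(P has_real_derivative p y) (at y within {0..1})" if "y \<in> {0..1}" for y
    unfolding P_def using that by (auto intro!: derivative_eq_intros)
  have cP0: "continuous_on {0..1} P0" using P0 by (meson DERIV_continuous continuous_on_eq_continuous_within)
  then have cP: "continuous_on {0..1} P" unfolding P_def by (intro continuous_intros)
  have "integral {0..1} P = integral {0..1} P0 - integral {0..1::real} (\<lambda>_. c)"
    unfolding P_def by (rule Henstock_Kurzweil_Integration.integral_diff) (use cP0 in \<open>auto intro: integrable_continuous_interval\<close>)
  then have "integral {0..1} P = 0" by (simp add: c_def)
  with Suc.IH cP obtain h where h: "h holomorphic_on {w. Re w > 1 - real j}"
    "\<And>w. Re w > 1 \<Longrightarrow> h w = suminf (cell_integral P w)" by blast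
  \<comment> \<open>Mean zero of \<open>p\<close> makes the primitive equal at both ends, so the
    boundary terms of all cells form a telescoping series; its sum -1 turns them into the constant
    \<open>c\<close>.\<close>
  have P01: "P 0 = - c" "P 1 = - c" using Suc.prems(2) by (auto simp: P_def P0_def)
  show ?case
  proof (intro exI[of _ "\<lambda>w. of_real c + w * h (w + 1)"] conjI allI impI)
    have "(h \<circ> (\<lambda>w. w + 1)) holomorphic_on {w. Re w > 1 - real (Suc j)}"
      by (rule holomorphic_on_compose_gen[OF _ h(1)]) (auto intro!: holomorphic_intros)
    then show "(\<lambda>w. of_real c + w * h (w + 1)) holomorphic_on {w. Re w > 1 - real (Suc j)}"
      unfolding o_def by (intro holomorphic_intros)
    fix w :: complex assume w: "Re w > 1"
    have sums: "(\<lambda>n. - of_real c * (of_real (real (Suc n) + 1) powr (- w) - complex_of_real (real (Suc n)) powr (- w))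
            + w * cell_integral P (w + 1) n) sums (- of_real c * (-1) + w * suminf (cell_integral P (w + 1)))"
      using w by (intro sums_add sums_mult telescope_powr_sums summable_sums summable_cell_integral cP) auto
    have bp: "cell_integral p w n = - of_real c * (of_real (real (Suc n) + 1) powr (- w) - complex_of_real (real (Suc n)) powr (- w))
            + w * cell_integral P (w + 1) n" for n
      using cell_integral_by_parts[OF Suc.prems(1) P, of w n] by (simp add: P01 ring_distribs)
    have "(\<lambda>n. cell_integral p w n) sums (of_real c + w * suminf (cell_integral P (w + 1)))"
      unfolding bp using sums by simp
    then show "of_real c + w * h (w + 1) = suminf (cell_integral p w)"
      using h(2)[of "w + 1"] w by (simp add: sums_iff)
  qed
qed

text \<open>The half-planes \<open>H j\<close> exhaust the plane, and the extensions agree on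
  overlaps by the identity theorem, since they agree for Re w > 1. Hence each point may be evaluated
  with any index whose half-plane contains it.\<close>

lemma cell_sum_extends_entire:
  assumes "continuous_on {0..1} p" "integral {0..1} p = 0"
  shows "\<exists>h. h holomorphic_on UNIV \<and> (\<forall>w. Re w > 1 \<longrightarrow> h w = suminf (cell_integral p w))"
proof -
  define H where "H j = {w. Re w > 1 - real j}" for j
  from cell_sum_extends[OF assms] obtain h where h: "\<And>j. h j holomorphic_on H j"
    "\<And>j w. Re w > 1 \<Longrightarrow> h j w = suminf (cell_integral p w)" unfolding H_def by metis
  have opn: "open (H j)" for j by (simp add: H_def open_halfspace_Re_gt)
  have agree: "h j w = h k w" if "w \<in> H j" "j \<le> k" for j k w
  proof (rule analytic_continuation_open[of "{w. Re w > 1}" "H j" "h j" "h k"])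
    show "open {w. Re w > 1}" by (simp add: open_halfspace_Re_gt)
    have "(2::complex) \<in> {w. Re w > 1}" by simp
    then show "{w. Re w > 1} \<noteq> {}" by blast
    show "connected (H j)" unfolding H_def by (intro convex_connected convex_halfspace_Re_gt)
    show "{w. Re w > 1} \<subseteq> H j" by (auto simp: H_def)
    show "h k holomorphic_on H j" by (rule holomorphic_on_subset[OF h(1)]) (use that in \<open>auto simp: H_def\<close>)
  qed (use that opn h in auto)
  define f where "f w = h (nat \<lceil>2 - Re w\<rceil>) w" for w
  have f: "f w = h k w" if "w \<in> H k" for w k
  proof -
    have "w \<in> H (nat \<lceil>2 - Re w\<rceil>)" unfolding H_def mem_Collect_eq by linarith
    then show ?thesis unfolding f_def using agree that by (metis nat_le_linear)
  qed
  have "f holomorphic_on (\<Union>k. H k)"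
  proof (rule holomorphic_on_UN_open)
    show "f holomorphic_on H k" for k using h(1)[of k] f by (simp cong: holomorphic_cong)
  qed (use opn in auto)
  moreover have "(\<Union>k. H k) = UNIV"
  proof -
    have "w \<in> H (nat \<lceil>2 - Re w\<rceil>)" for w unfolding H_def mem_Collect_eq by linarith
    then show ?thesis by blast
  qed
  moreover have "f w = suminf (cell_integral p w)" if "Re w > 1" for w
    using f[of w 0] h(2)[OF that, of 0] that by (simp add: H_def)
  ultimately show ?thesis by auto
qed

lemma cell_integral_const:
  assumes "w \<noteq> 1"
  shows "cell_integral (\<lambda>_. c) w n =
     of_real c * (of_real (real (Suc n) + 1) powr (1 - w) - of_real (real (Suc n)) powr (1 - w)) / (1 - w)"
proof -
  \<comment> \<open>Integration by parts read backwards: for the zero function with constant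
    primitive \<open>c\<close> the left side vanishes, and the remaining integral is the one
    sought.\<close>
  have "cell_integral (\<lambda>_. 0) (w - 1) n = 0" by (simp add: cell_integral_def)
  moreover have "cell_integral (\<lambda>_. 0) (w - 1) n = of_real c * of_real (real (Suc n) + 1) powr (- (w - 1))
           - of_real c * of_real (real (Suc n)) powr (- (w - 1)) + (w - 1) * cell_integral (\<lambda>_. c) (w - 1 + 1) n"
    by (rule cell_integral_by_parts) (auto intro!: derivative_eq_intros)
  ultimately show ?thesis using assms by (simp add: field_simps)
qed

lemma cell_integral_add:
  assumes "continuous_on {0..1} p" "continuous_on {0..1} q"
  shows "cell_integral (\<lambda>y. p y + q y) w n = cell_integral p w n + cell_integral q w n"
  unfolding cell_integral_def using cell_integrable[OF assms(1)] cell_integrable[OF assms(2)]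
  by (subst Henstock_Kurzweil_Integration.integral_add[symmetric]) (auto simp: algebra_simps)

text \<open>One step of Euler--Maclaurin summation; adding up over \<open>n\<close> continues the zeta function.\<close>

lemma powr_cell_expansion:
  assumes "s \<noteq> 0" "s \<noteq> 1"
  shows "of_real (real (Suc n)) powr (- s) =
      (of_real (real (Suc n) + 1) powr (1 - s) - of_real (real (Suc n)) powr (1 - s)) / (1 - s)
      - (of_real (real (Suc n) + 1) powr (- s) - of_real (real (Suc n)) powr (- s)) / 2
      + s * cell_integral (\<lambda>y. 1/2 - y) (s + 1) n"
proof -
  \<comment> \<open>The primitive y - 1 vanishes at the right end, so exactly the term of index
    \<open>n\<close> remains; afterwards 1 - y is split into its mean 1/2 and the mean-zero part 1/2
    - y.\<close>
  have "cell_integral (\<lambda>_. 1) s n = of_real (1 - 1) * of_real (real (Suc n) + 1) powr (- s)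
      - of_real (0 - 1) * of_real (real (Suc n)) powr (- s) + s * cell_integral (\<lambda>y. y - 1) (s + 1) n"
    by (rule cell_integral_by_parts) (auto intro!: derivative_eq_intros)
  moreover have "cell_integral (\<lambda>y. y - 1) (s + 1) n = - cell_integral (\<lambda>y. 1 - y) (s + 1) n"
    unfolding cell_integral_def by (subst integral_neg[symmetric]) (auto simp: algebra_simps intro!: integral_cong)
  moreover have "cell_integral (\<lambda>y. 1 - y) (s + 1) n = cell_integral (\<lambda>_. 1/2) (s + 1) n + cell_integral (\<lambda>y. 1/2 - y) (s + 1) n"
    by (subst cell_integral_add[symmetric]) (auto intro!: continuous_intros)
  ultimately have 1: "of_real (real (Suc n)) powr (- s) = cell_integral (\<lambda>_. 1) s n
      + (s * cell_integral (\<lambda>_. 1/2) (s + 1) n + s * cell_integral (\<lambda>y. 1/2 - y) (s + 1) n)"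
    by (simp add: ring_distribs)
  have 2: "cell_integral (\<lambda>_. 1) s n =
     (of_real (real (Suc n) + 1) powr (1 - s) - of_real (real (Suc n)) powr (1 - s)) / (1 - s)"
    using cell_integral_const[of s 1 n] assms by simp
  have 3: "s * cell_integral (\<lambda>_. 1/2) (s + 1) n =
     - ((of_real (real (Suc n) + 1) powr (- s) - of_real (real (Suc n)) powr (- s)) / 2)"
    using cell_integral_const[of "s + 1" "1/2" n] assms by (simp add: field_simps)
  have gen: "a = x + (y + z) \<Longrightarrow> x = x' \<Longrightarrow> y = - d \<Longrightarrow> a = x' - d + z" for a x y z x' d :: complex
    by simp
  show ?thesis by (rule gen[OF 1 2 3])
qed

text \<open>For Re w > 1 this is the integral of (1/2 - {x}) x^{-w} over [1, infinity), with {x} the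
  fractional part: the first Euler-Maclaurin remainder. \<open>SOME\<close> picks its continuation,
  which is unique by the identity theorem.\<close>

definition eta_entire :: "complex \<Rightarrow> complex" where
  "eta_entire = (SOME h. h holomorphic_on UNIV \<and> (\<forall>w. Re w > 1 \<longrightarrow> h w = suminf (cell_integral (\<lambda>y. 1/2 - y) w)))"

lemma eta_entire: "eta_entire holomorphic_on UNIV"
    "\<And>w. Re w > 1 \<Longrightarrow> eta_entire w = suminf (cell_integral (\<lambda>y. 1/2 - y) w)"
proof -
  have "((\<lambda>x. 1/2 - x) has_integral (1/2 - 1^2/2 - (0/2 - 0^2/2))) {0..1::real}"
    by (rule fundamental_theorem_of_calculus)
       (auto intro!: derivative_eq_intros simp flip: has_real_derivative_iff_has_vector_derivative)
  then have "integral {0..1} (\<lambda>y. 1/2 - y :: real) = 0" by (simp add: has_integral_iff)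
  then have "\<exists>h. h holomorphic_on UNIV \<and> (\<forall>w. Re w > 1 \<longrightarrow> h w = suminf (cell_integral (\<lambda>y. 1/2 - y) w))"
    by (intro cell_sum_extends_entire continuous_intros)
  then have "eta_entire holomorphic_on UNIV \<and> (\<forall>w. Re w > 1 \<longrightarrow> eta_entire w = suminf (cell_integral (\<lambda>y. 1/2 - y) w))"
    unfolding eta_entire_def by (rule someI_ex)
  then show "eta_entire holomorphic_on UNIV"
    "\<And>w. Re w > 1 \<Longrightarrow> eta_entire w = suminf (cell_integral (\<lambda>y. 1/2 - y) w)" by auto
qed

lemma sums_eta_entire: "Re w > 1 \<Longrightarrow> cell_integral (\<lambda>y. 1/2 - y) w sums eta_entire w"
  unfolding eta_entire(2) by (intro summable_sums summable_cell_integral continuous_intros)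

text \<open>The value at \<open>1\<close> is the conventional value of \<open>zeta\<close> at its pole.\<close>

definition zeta_formula :: "complex \<Rightarrow> complex" where
  "zeta_formula s = (if s = 1 then 0 else 1 / (s - 1) + 1 / 2 + s * eta_entire (s + 1))"

lemma zeta_formula_holomorphic: "zeta_formula holomorphic_on (- {1})"
proof -
  have "(eta_entire \<circ> (\<lambda>s. s + 1)) holomorphic_on (- {1})"
    by (intro holomorphic_on_compose holomorphic_intros holomorphic_on_subset[OF eta_entire(1)]) auto
  then have "(\<lambda>s. 1 / (s - 1) + 1 / 2 + s * eta_entire (s + 1)) holomorphic_on (- {1})"
    unfolding o_def by (intro holomorphic_intros) auto
  then show ?thesis by (rule holomorphic_transform) (auto simp: zeta_formula_def)
qed

lemma zeta_formula_sums:
  assumes s: "Re s > 1"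
  shows "(\<lambda>n. of_real (real (Suc n)) powr (- s)) sums zeta_formula s"
proof -
  have s0: "s \<noteq> 0" "s \<noteq> 1" using s by auto
  have "(\<lambda>n. (of_real (real (Suc n) + 1) powr (- (s - 1)) - of_real (real (Suc n)) powr (- (s - 1))) / (1 - s)
      - (of_real (real (Suc n) + 1) powr (- s) - of_real (real (Suc n)) powr (- s)) / 2
      + s * cell_integral (\<lambda>y. 1/2 - y) (s + 1) n) sums ((-1) / (1 - s) - (-1) / 2 + s * eta_entire (s + 1))"
    using s by (intro sums_add sums_diff sums_divide sums_mult telescope_powr_sums sums_eta_entire) auto
  also have "(-1) / (1 - s) - (-1) / 2 + s * eta_entire (s + 1) = zeta_formula s"
    using s0 by (simp add: zeta_formula_def field_simps)
  finally show ?thesis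
    unfolding minus_diff_eq by (simp only: powr_cell_expansion[OF s0, symmetric])
qed

text \<open>Uniqueness behind \<open>THE\<close> is the identity theorem on the punctured plane,
  which is connected; at the pole both functions have the prescribed value 0.\<close>

lemma zeta_eq_formula: "zeta = zeta_formula"
  unfolding zeta_def
proof (rule the_equality)
  have eq: "1 / of_nat (Suc k) powr s = of_real (real (Suc k)) powr (- s)" for k and s :: complex
    by (simp add: powr_minus field_simps)
  show "zeta_formula holomorphic_on - {1} \<and> (\<forall>s. 1 < Re s \<longrightarrow> zeta_formula s = (\<Sum>k. 1 / of_nat (Suc k) powr s)) \<and> zeta_formula 1 = 0"
    using zeta_formula_holomorphic zeta_formula_sums by (auto simp: eq sums_iff zeta_formula_def simp del: of_nat_Suc)
  fix f assume f: "f holomorphic_on - {1} \<and> (\<forall>s. 1 < Re s \<longrightarrow> f s = (\<Sum>k. 1 / of_nat (Suc k) powr s)) \<and> f 1 = 0"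
  have "f s = zeta_formula s" if "s \<noteq> 1" for s
  proof (rule analytic_continuation_open[of "{w. Re w > 1}" "- {1}" f zeta_formula])
    show "open {w. Re w > 1}" by (simp add: open_halfspace_Re_gt)
    have "(2::complex) \<in> {w. Re w > 1}" by simp
    then show "{w. Re w > 1} \<noteq> {}" by blast
    show "connected (- {1::complex})" by (rule connected_punctured_universe) simp
    show "f z = zeta_formula z" if "z \<in> {w. Re w > 1}" for z
      using that f zeta_formula_sums[of z] by (simp add: eq sums_iff del: of_nat_Suc)
  qed (use f that zeta_formula_holomorphic in auto)
  then show "f = zeta_formula" using f by (auto simp: fun_eq_iff zeta_formula_def)
qed

lemma zeta_holomorphic: "zeta holomorphic_on - {1}"
  by (simp add: zeta_eq_formula zeta_formula_holomorphic)

lemma zeta_sums: "Re s > 1 \<Longrightarrow> (\<lambda>n. of_real (real (Suc n)) powr (- s)) sums zeta s"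
  unfolding zeta_eq_formula by (rule zeta_formula_sums)

text \<open>With |1/2 - y| \<le> 1/2 the bound becomes an exact integral whose value is a difference
  of consecutive terms, so that the remainders telescope in \<open>zeta_approx\<close>.\<close>

lemma norm_cell_integral_half:
  assumes "Re s > 0"
  shows "norm (cell_integral (\<lambda>y. 1/2 - y) (s + 1) n) \<le>
     (real (Suc n) powr (- Re s) - (real (Suc n) + 1) powr (- Re s)) / (2 * Re s)"
proof -
  have "((\<lambda>y. (real (Suc n) + y) powr (- Re s - 1) / 2) has_integral
       (- ((real (Suc n) + 1) powr (- Re s) / (2 * Re s)) - (- ((real (Suc n) + 0) powr (- Re s) / (2 * Re s))))) {0..1}"
    by (rule fundamental_theorem_of_calculus)
       (use assms in \<open>auto intro!: derivative_eq_intros simp flip: has_real_derivative_iff_has_vector_derivative\<close>)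
  then have I: "((\<lambda>y. (real (Suc n) + y) powr (- Re s - 1) / 2) has_integral
       (real (Suc n) powr (- Re s) - (real (Suc n) + 1) powr (- Re s)) / (2 * Re s)) {0..1}"
    by (simp add: diff_divide_distrib)
  have "norm (cell_integral (\<lambda>y. 1/2 - y) (s + 1) n) \<le> integral {0..1} (\<lambda>y. (real (Suc n) + y) powr (- Re s - 1) / 2)"
    unfolding cell_integral_def
  proof (rule integral_norm_bound_integral)
    fix y :: real assume y: "y \<in> {0..1}"
    have "\<bar>1/2 - y\<bar> \<le> 1/2" by (rule abs_leI) (use y in auto)
    then have "\<bar>1/2 - y\<bar> * (real (Suc n) + y) powr (- Re s - 1) \<le> 1/2 * (real (Suc n) + y) powr (- Re s - 1)"
      by (rule mult_right_mono) auto
    then show "norm (complex_of_real (1/2 - y) * complex_of_real (real (Suc n) + y) powr - (s + 1)) \<le> (real (Suc n) + y) powr (- Re s - 1) / 2"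
      unfolding norm_mult norm_shift_powr[OF y] norm_of_real by (simp add: minus_diff_commute)
  next
    show "(\<lambda>y. complex_of_real (1/2 - y) * complex_of_real (real (Suc n) + y) powr - (s + 1)) integrable_on {0..1}"
      by (intro cell_integrable continuous_intros)
  qed (use I in auto)
  then show ?thesis by (simp only: integral_unique[OF I])
qed

text \<open>Summing the cell expansion over the first \<open>N\<close> terms and comparing with the
  continued formula leaves s times the tail of the remainder series, minus half of the last term.
  The range Re s > 0 covers the strip as well as the lines \<sigma> \<ge> 1, where this estimate is
  used directly.\<close>

lemma zeta_approx:
  assumes s: "Re s > 0" "s \<noteq> 1"
  shows "norm (zeta s - ((\<Sum>n<Suc N. of_real (real (Suc n)) powr (- s)) - of_real (real (Suc N)) powr (1 - s) / (1 - s)))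
     \<le> norm s / Re s * real (Suc N) powr (- Re s)"
proof -
  define e where "e = cell_integral (\<lambda>y. 1/2 - y) (s + 1)"
  have s0: "s \<noteq> 0" using s by auto
  have e: "e sums eta_entire (s + 1)" unfolding e_def by (rule sums_eta_entire) (use s in simp)
  have tel: "(\<Sum>n<N. of_real (real (Suc (Suc n))) powr a) - (\<Sum>n<N. of_real (real (Suc n)) powr a) =
      complex_of_real (real (Suc N)) powr a - 1" for a
    using sum_lessThan_telescope[of "\<lambda>n. complex_of_real (real (Suc n)) powr a" N] by (simp add: sum_subtractf)
  have "(\<Sum>n<N. of_real (real (Suc n)) powr (- s)) = (\<Sum>n<N. (of_real (real (Suc (Suc n))) powr (1 - s) - of_real (real (Suc n)) powr (1 - s)) / (1 - s)
      - (of_real (real (Suc (Suc n))) powr (- s) - of_real (real (Suc n)) powr (- s)) / 2 + s * e n)"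
    by (intro sum.cong refl, subst powr_cell_expansion[OF s0 s(2)]) (simp add: e_def add.commute)
  also have "\<dots> = (of_real (real (Suc N)) powr (1 - s) - 1) / (1 - s) - (of_real (real (Suc N)) powr (- s) - 1) / 2 + s * (\<Sum>n<N. e n)"
    unfolding sum.distrib sum_subtractf sum_divide_distrib[symmetric] sum_distrib_left[symmetric]
    by (simp only: tel)
  finally have A: "(\<Sum>n<N. of_real (real (Suc n)) powr (- s)) = \<dots>" .
  have se: "summable e" using e by (simp add: sums_iff)
  have "zeta s = 1 / (s - 1) + 1 / 2 + s * (\<Sum>n. e n)"
    using e s by (simp add: zeta_eq_formula zeta_formula_def sums_iff)
  also have "(\<Sum>n. e n) = (\<Sum>n. e (n + N)) + (\<Sum>n<N. e n)" by (rule suminf_split_initial_segment[OF se])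
  finally have "zeta s - ((\<Sum>n<Suc N. of_real (real (Suc n)) powr (- s)) - of_real (real (Suc N)) powr (1 - s) / (1 - s))
     = s * (\<Sum>n. e (n + N)) - of_real (real (Suc N)) powr (- s) / 2"
  proof -
    have gen: "z = 1 / (s - 1) + 1 / 2 + s * (T + S) \<Longrightarrow>
        z - ((q - 1) / (1 - s) - (p - 1) / 2 + s * S + p - q / (1 - s)) = s * T - p / 2" for z T S p q :: complex
    proof -
      assume z: "z = 1 / (s - 1) + 1 / 2 + s * (T + S)"
      have "1 / (s - 1) = - (1 / (1 - s))" by (metis divide_minus_right minus_diff_eq)
      then show ?thesis unfolding z by (simp add: diff_divide_distrib ring_distribs)
    qed
    assume "zeta s = 1 / (s - 1) + 1 / 2 + s * ((\<Sum>n. e (n + N)) + sum e {..<N})"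
    from gen[OF this] show ?thesis unfolding sum.lessThan_Suc A .
  qed
  then have "norm (zeta s - ((\<Sum>n<Suc N. of_real (real (Suc n)) powr (- s)) - of_real (real (Suc N)) powr (1 - s) / (1 - s)))
     \<le> norm s * norm (\<Sum>n. e (n + N)) + norm (complex_of_real (real (Suc N)) powr (- s)) / 2"
    by (metis norm_triangle_ineq4 norm_mult norm_divide norm_numeral)
  also have "norm (complex_of_real (real (Suc N)) powr (- s)) = real (Suc N) powr (- Re s)"
    by (subst norm_powr_real_powr) auto
  finally have B: "norm (zeta s - ((\<Sum>n<Suc N. of_real (real (Suc n)) powr (- s)) - of_real (real (Suc N)) powr (1 - s) / (1 - s)))
     \<le> norm s * norm (\<Sum>n. e (n + N)) + real (Suc N) powr (- Re s) / 2" .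
  define g where "g n = real (Suc (n + N)) powr (- Re s)" for n
  have g0: "g \<longlonglongrightarrow> 0" unfolding g_def using s by real_asymp
  have "(\<lambda>n. (g n - g (Suc n)) / (2 * Re s)) sums ((g 0 - 0) / (2 * Re s))"
    by (intro sums_divide telescope_sums' g0)
  moreover have "norm (e (n + N)) \<le> (g n - g (Suc n)) / (2 * Re s)" for n
    using norm_cell_integral_half[OF s(1), of "n + N"] by (simp add: e_def g_def add.commute)
  ultimately have "norm (\<Sum>n. e (n + N)) \<le> g 0 / (2 * Re s)"
    by (metis (no_types, lifting) diff_zero suminf_le norm_suminf_le sums_iff)
  then have "norm s * norm (\<Sum>n. e (n + N)) \<le> norm s * (g 0 / (2 * Re s))" by (rule mult_left_mono) simp
  \<comment> \<open>The tail takes one half of the claimed bound; as |s| \<ge> Re s, the half term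
    fits into the other half.\<close>
  moreover have "norm s / Re s \<ge> 1" using s complex_Re_le_cmod[of s] by simp
  then have "g 0 * 1 \<le> g 0 * (norm s / Re s)" by (rule mult_left_mono) (simp add: g_def)
  ultimately show ?thesis using B by (simp add: g_def field_simps)
qed

subsection \<open>Exponentially smoothed Dirichlet series\<close>

lemma gamma_integral_scaled:
  assumes "Re z > 0" "X > 0"
  shows "(\<lambda>x. complex_of_real x powr (z - 1) * of_real (exp (- x / X))) absolutely_integrable_on {0<..}"
    and "integral {0<..} (\<lambda>x. complex_of_real x powr (z - 1) * of_real (exp (- x / X))) = Gamma z * of_real X powr z"
proof -
  let ?f = "\<lambda>t. complex_of_real t powr (z - 1) / of_real (exp t)"
  let ?h = "\<lambda>x. complex_of_real x powr (z - 1) * of_real (exp (- x / X))"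
  have img: "(\<lambda>x. x / X) ` {0<..} = {0<..}"
    using assms by (auto simp: image_iff intro!: bexI[of _ "x * X" for x])
  have "?f absolutely_integrable_on {0<..}" "integral {0<..} ?f = Gamma z"
    using absolutely_integrable_Gamma_integral'[OF assms(1)] Gamma_integral_complex'[OF assms(1)]
    by (auto simp: has_integral_iff)
  then have "(\<lambda>x. \<bar>1 / X\<bar> *\<^sub>R ?f (x / X)) absolutely_integrable_on {0<..} \<and>
        integral {0<..} (\<lambda>x. \<bar>1 / X\<bar> *\<^sub>R ?f (x / X)) = Gamma z"
    by (subst has_absolute_integral_change_of_variables_real[where g = "\<lambda>x. x / X" and h = "\<lambda>_. 1 / X"])
       (use assms img in \<open>auto intro!: derivative_eq_intros inj_onI\<close>)
  then have *: "set_integrable lebesgue {0<..} (\<lambda>x. \<bar>1 / X\<bar> *\<^sub>R ?f (x / X))"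
     "integral {0<..} (\<lambda>x. \<bar>1 / X\<bar> *\<^sub>R ?f (x / X)) = Gamma z" by auto
  have eq: "of_real X powr z * (\<bar>1 / X\<bar> *\<^sub>R ?f (x / X)) = ?h x" if "x \<in> {0<..}" for x
  proof -
    have "complex_of_real x powr (z - 1) = (of_real X * of_real (x / X)) powr (z - 1)"
      using assms by simp
    also have "\<dots> = of_real X powr (z - 1) * of_real (x / X) powr (z - 1)"
      by (rule powr_times_real) (use assms that in auto)
    finally have 1: "complex_of_real x powr (z - 1) = of_real X powr (z - 1) * of_real (x / X) powr (z - 1)" .
    have "of_real X powr z = of_real X powr (z - 1) * complex_of_real X"
      using assms powr_add[of "complex_of_real X" "z - 1" 1] by simp
    then show ?thesis unfolding 1 using assms
      by (simp add: scaleR_conv_of_real exp_minus field_simps)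
  qed
  have "set_integrable lebesgue {0<..} (\<lambda>x. of_real X powr z * (\<bar>1 / X\<bar> *\<^sub>R ?f (x / X)))"
    by (rule set_integrable_mult_right[OF *(1)])
  then show "?h absolutely_integrable_on {0<..}"
    by (rule set_integrable_cong[THEN iffD1, rotated -1]) (simp_all only: eq)
  have "integral {0<..} ?h = integral {0<..} (\<lambda>x. of_real X powr z * (\<bar>1 / X\<bar> *\<^sub>R ?f (x / X)))"
    by (rule integral_cong) (simp only: eq)
  also have "\<dots> = of_real X powr z * Gamma z"
    using *(2) by (simp only: integral_mult_right)
  finally show "integral {0<..} ?h = Gamma z * of_real X powr z" by (simp add: mult.commute)
qed

lemma gamma_integral_scaled_real:
  fixes a X :: real
  assumes "a < 1" "X > 0"
  shows "(\<lambda>x. x powr (- a) * exp (- x / X)) absolutely_integrable_on {0<..}"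
    and "integral {0<..} (\<lambda>x. x powr (- a) * exp (- x / X)) = Gamma (1 - a) * X powr (1 - a)"
proof -
  let ?h = "\<lambda>x. complex_of_real x powr (of_real (1 - a) - 1) * of_real (exp (- x / X))"
  let ?k = "\<lambda>x. x powr (- a) * exp (- x / X)"
  have I: "?h absolutely_integrable_on {0<..}" "integral {0<..} ?h = Gamma (of_real (1 - a)) * of_real X powr of_real (1 - a)"
    by (rule gamma_integral_scaled; use assms in simp)+
  have Re: "Re (?h x) = ?k x" if "x \<in> {0<..}" for x
    using that powr_of_real[of x "-a"] by simp
  have "(Re \<circ> ?h) absolutely_integrable_on {0<..}"
    by (rule absolutely_integrable_linear[OF I(1) bounded_linear_Re])
  then show "?k absolutely_integrable_on {0<..}"
    by (rule set_integrable_cong[THEN iffD1, rotated -1]) (simp_all only: Re o_def)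
  have "integral {0<..} ?k = integral {0<..} (Re \<circ> ?h)"
    by (rule integral_cong) (use Re in auto)
  also have "\<dots> = Re (integral {0<..} ?h)"
    by (rule integral_linear[OF _ bounded_linear_Re]) (use I(1) set_lebesgue_integral_eq_integral(1) in blast)
  also have "\<dots> = Gamma (1 - a) * X powr (1 - a)"
    unfolding I(2) Gamma_complex_of_real using assms powr_of_real[of X "1 - a"] by simp
  finally show "integral {0<..} ?k = Gamma (1 - a) * X powr (1 - a)" .
qed

text \<open>The classical route to a smoothed series shifts a contour. Here the difference
  \<open>f\<close> of x^{-s} and its smoothed version \<open>E\<close> is compared with its own
  integral: it vanishes at 0 and for fixed s has total variation O(X^{-Re s}), so its sum and its
  integral differ by no more than that.\<close>

locale exp_smoothing =
  fixes s :: complex and X :: real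
  assumes s: "0 < Re s" "Re s < 1" and X: "X > 0"
begin

definition "E x = complex_of_real x powr (- s) * of_real (exp (- x / X))"
definition "g x = x powr (- Re s) * exp (- x / X) / X"
definition "G x = integral {0..x} g"
definition "f x = complex_of_real x powr (- s) * of_real (1 - exp (- x / X))"
definition "\<phi> x = x powr (- Re s) * (1 - exp (- x / X))"
text \<open>A primitive of a majorant of \<open>norm (f' x)\<close>: of the two terms of \<open>f'\<close>, the one with \<open>x powr (- s - 1)\<close> has
  norm \<open>norm s / Re s * (g x - \<phi>' x)\<close>.\<close>

definition "K x = - (norm s / Re s) * \<phi> x + (norm s / Re s + 1) * G x"

lemma E_integral: "E absolutely_integrable_on {0..}" "integral {0..} E = Gamma (1 - s) * of_real X powr (1 - s)"
proof -
  have E: "E = (\<lambda>x. complex_of_real x powr (1 - s - 1) * of_real (exp (- x / X)))"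
    by (simp add: E_def fun_eq_iff)
  have 1: "E absolutely_integrable_on {0<..}" "integral {0<..} E = Gamma (1 - s) * of_real X powr (1 - s)"
    unfolding E by (rule gamma_integral_scaled; use s X in simp)+
  have sd: "sym_diff {0<..} {0..} = {0::real}" by auto
  show "E absolutely_integrable_on {0..}"
    by (rule absolutely_integrable_spike_set[OF 1(1)]) (auto simp: sd intro: negligible_subset[of "{0}"])
  show "integral {0..} E = Gamma (1 - s) * of_real X powr (1 - s)"
    unfolding 1(2)[symmetric] by (rule integral_spike_set; rule negligible_subset[of "{0}"]) auto
qed

lemma g_integral: "g integrable_on {0..}" "integral {0..} g = Gamma (1 - Re s) * X powr (- Re s)"
proof -
  have 1: "(\<lambda>x. x powr (- Re s) * exp (- x / X)) absolutely_integrable_on {0<..}"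
     "integral {0<..} (\<lambda>x. x powr (- Re s) * exp (- x / X)) = Gamma (1 - Re s) * X powr (1 - Re s)"
    by (rule gamma_integral_scaled_real; use s X in simp)+
  have 2: "g absolutely_integrable_on {0<..}" unfolding g_def
    using set_integrable_divide[OF 1(1)] by simp
  show "g integrable_on {0..}"
    by (rule integrable_spike_set[OF set_lebesgue_integral_eq_integral(1)[OF 2]]; rule negligible_subset[of "{0}"]) auto
  have "integral {0..} g = integral {0<..} g"
    by (rule integral_spike_set; rule negligible_subset[of "{0}"]) auto
  also have "\<dots> = Gamma (1 - Re s) * X powr (1 - Re s) / X" unfolding g_def using 1(2) by simp
  also have "\<dots> = Gamma (1 - Re s) * X powr (- Re s)" using X by (simp add: powr_diff powr_minus field_simps)
  finally show "integral {0..} g = Gamma (1 - Re s) * X powr (- Re s)" .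
qed

lemma g_nonneg: "g x \<ge> 0" using X by (simp add: g_def)

lemma g_integrable: "a \<ge> 0 \<Longrightarrow> g integrable_on {a..b}"
  by (rule integrable_on_subinterval[OF g_integral(1)]) auto

lemma G_le: "G x \<le> Gamma (1 - Re s) * X powr (- Re s)"
  unfolding G_def g_integral(2)[symmetric]
  by (rule integral_subset_le) (auto simp: g_integrable g_integral g_nonneg)

lemma G_deriv:
  assumes "x > 0" shows "(G has_real_derivative g x) (at x)"
proof -
  \<comment> \<open>\<open>g\<close> is unbounded at 0, so the fundamental theorem is applied on an
    interval around \<open>x\<close> that stays away from 0.\<close>
  have "continuous_on {x/2..2*x} g" unfolding g_def using assms X
    by (intro continuous_intros) auto
  then have "((\<lambda>y. integral {x/2..y} g) has_real_derivative g x) (at x within {x/2..2*x})"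
    by (rule integral_has_real_derivative) (use assms in auto)
  then have "((\<lambda>y. integral {x/2..y} g) has_real_derivative g x) (at x)"
    using at_within_Icc_at[of "x/2" x "2*x"] assms by simp
  then have "((\<lambda>y. integral {0..x/2} g + integral {x/2..y} g) has_real_derivative g x) (at x)"
    by (auto intro!: derivative_eq_intros)
  then show ?thesis
  proof (rule has_field_derivative_transform_within_open[where S = "{x/2<..}"])
    fix y assume "y \<in> {x/2<..}"
    then show "integral {0..x/2} g + integral {x/2..y} g = G y" unfolding G_def using assms
      by (intro Henstock_Kurzweil_Integration.integral_combine g_integrable) auto
  qed (use assms in auto)
qed

lemma \<phi>_deriv:
  assumes "x > 0" shows "(\<phi> has_real_derivative - Re s * x powr (- Re s - 1) * (1 - exp (- x / X)) + g x) (at x)"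
  unfolding \<phi>_def g_def using assms X by (auto intro!: derivative_eq_intros)

lemma f_deriv:
  assumes "x > 0" shows "(f has_vector_derivative - s * of_real x powr (- s - 1) * of_real (1 - exp (- x / X))
       + of_real x powr (- s) * of_real (exp (- x / X) / X)) (at x)"
proof -
  have "((\<lambda>z. z powr (- s)) has_field_derivative - s * of_real x powr (- s - 1)) (at (of_real x))"
    by (rule derivative_eq_intros refl | use assms in \<open>simp add: complex_nonpos_Reals_iff\<close>)+
  then have 1: "((\<lambda>y. complex_of_real y powr (- s)) has_vector_derivative - s * of_real x powr (- s - 1)) (at x)"
    by (rule has_vector_derivative_real_field)
  have "((\<lambda>y. 1 - exp (- y / X)) has_real_derivative exp (- x / X) / X) (at x)"
    using X by (auto intro!: derivative_eq_intros)
  then have 2: "((\<lambda>y. complex_of_real (1 - exp (- y / X))) has_vector_derivative of_real (exp (- x / X) / X)) (at x)"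
    by (intro has_vector_derivative_of_real) (simp add: has_real_derivative_iff_has_vector_derivative)
  show ?thesis unfolding f_def using has_vector_derivative_mult[OF 1 2] by (simp add: add.commute)
qed

text \<open>On [0, x] the factor u^{-Re s} is at least x^{-Re s}; with this factor frozen, the
  integral of \<open>g\<close> is exactly \<open>\<phi> x\<close>.\<close>

lemma \<phi>_le_G:
  assumes "x \<ge> 0" shows "\<phi> x \<le> G x"
proof -
  have "((\<lambda>u. x powr (- Re s) * exp (- u / X) / X) has_integral
          (- (x powr (- Re s) * exp (- x / X)) - (- (x powr (- Re s) * exp (- 0 / X))))) {0..x}"
    by (rule fundamental_theorem_of_calculus[OF assms])
       (use X in \<open>auto intro!: derivative_eq_intros simp flip: has_real_derivative_iff_has_vector_derivative\<close>)
  then have 1: "((\<lambda>u. x powr (- Re s) * exp (- u / X) / X) has_integral \<phi> x) {0..x}"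
    by (simp add: \<phi>_def algebra_simps)
  have "(g has_integral G x) {0..x}" unfolding G_def by (rule integrable_integral[OF g_integrable]) simp
  \<comment> \<open>The convention \<open>0 powr a = 0\<close> makes \<open>g 0\<close> vanish and
    would break the pointwise inequality, so this one point gets another value.\<close>
  then have 2: "((\<lambda>u. if u = 0 then x powr (- Re s) / X else g u) has_integral G x) {0..x}"
    by (rule has_integral_spike_finite[of "{0}", rotated 2]) auto
  show ?thesis
  proof (rule has_integral_le[OF 1 2])
    fix u assume u: "u \<in> {0..x}"
    show "x powr (- Re s) * exp (- u / X) / X \<le> (if u = 0 then x powr (- Re s) / X else g u)"
      unfolding g_def using u X s by (auto intro!: divide_right_mono mult_right_mono powr_mono2')
  qed
qed

lemma norm_f: "norm (f x) = \<phi> x" if "x \<ge> 0"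
proof (cases "x = 0")
  case False
  then have "exp (- x / X) \<le> 1" using that X by simp
  then show ?thesis using that False unfolding f_def \<phi>_def norm_mult norm_of_real
    by (subst norm_powr_real_powr) auto
qed (simp add: f_def \<phi>_def)

text \<open>For positive \<open>a\<close> this is the bound of the derivative of \<open>f\<close> by
  that of \<open>K\<close>. At \<open>a = 0\<close> the derivatives may blow up, and
  \<open>\<phi>_le_G\<close> gives the increment directly.\<close>

lemma f_increment:
  assumes "0 \<le> a" "a \<le> b"
  shows "norm (f b - f a) \<le> K b - K a"
proof -
  have c0: "norm s / Re s \<ge> 0" using s by simp
  consider "a = b" | "a = 0" "b > 0" | "0 < a" "a < b" using assms by linarith
  then show ?thesis
  proof cases
    case 2
    have "\<phi> b \<le> K b" unfolding K_def
      using mult_left_mono[OF \<phi>_le_G[of b] c0] \<phi>_le_G[of b] 2 by (simp add: algebra_simps)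
    moreover have "K 0 = 0" "f 0 = 0" by (simp_all add: K_def \<phi>_def G_def f_def)
    ultimately show ?thesis using 2 norm_f[of b] by simp
  next
    case 3
    let ?f' = "\<lambda>x. - s * of_real x powr (- s - 1) * of_real (1 - exp (- x / X))
       + of_real x powr (- s) * of_real (exp (- x / X) / X)"
    let ?K' = "\<lambda>x. norm s * x powr (- Re s - 1) * (1 - exp (- x / X)) + g x"
    have K': "(K has_real_derivative ?K' x) (at x)" if "x > 0" for x
      unfolding K_def using s
      by (auto intro!: derivative_eq_intros \<phi>_deriv[OF that] G_deriv[OF that] simp: field_simps)
    show ?thesis
    proof (rule differentiable_bound_general[where f' = ?f' and \<phi>' = ?K'])
      show "continuous_on {a..b} f"
        by (intro continuous_at_imp_continuous_on ballI has_vector_derivative_continuous[OF f_deriv]) (use 3 in auto)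
      show "continuous_on {a..b} K"
        by (intro continuous_at_imp_continuous_on ballI DERIV_isCont[OF K']) (use 3 in auto)
      fix x assume x: "a < x" "x < b"
      show "(f has_vector_derivative ?f' x) (at x)" by (rule f_deriv) (use x 3 in auto)
      show "(K has_vector_derivative ?K' x) (at x)"
        using K'[of x] x 3 by (simp add: has_real_derivative_iff_has_vector_derivative)
      have e: "exp (- x / X) \<le> 1" using x 3 X by simp
      have "norm (?f' x) \<le> norm (- s * of_real x powr (- s - 1) * of_real (1 - exp (- x / X))) + norm (of_real x powr (- s) * of_real (exp (- x / X) / X) :: complex)"
        by (rule norm_triangle_ineq)
      also have "\<dots> = ?K' x" unfolding norm_mult norm_of_real g_def using x 3 X e
        by (subst norm_powr_real_powr, simp, simp, subst norm_powr_real_powr) auto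
      finally show "norm (?f' x) \<le> ?K' x" .
    qed (use 3 in auto)
  qed auto
qed

lemma powr_integral: "((\<lambda>x. complex_of_real x powr (- s)) has_integral of_real (real N) powr (1 - s) / (1 - s)) {0..real N}"
proof -
  have s1: "1 - s \<noteq> 0" using s by auto
  have "((\<lambda>x. complex_of_real x powr (- s)) has_integral (of_real (real N) powr (1 - s) / (1 - s) - of_real 0 powr (1 - s) / (1 - s))) {0..real N}"
  proof (rule fundamental_theorem_of_calculus_interior)
    show "continuous_on {0..real N} (\<lambda>a. complex_of_real a powr (1 - s) / (1 - s))"
      using s s1 by (intro continuous_intros continuous_on_powr_complex) auto
    fix x assume x: "x \<in> {0<..<real N}"
    have "((\<lambda>z. z powr (1 - s) / (1 - s)) has_field_derivative of_real x powr (- s)) (at (of_real x))"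
      by (rule derivative_eq_intros refl | use x s1 in \<open>simp add: complex_nonpos_Reals_iff\<close>)+
    then show "((\<lambda>a. complex_of_real a powr (1 - s) / (1 - s)) has_vector_derivative of_real x powr (- s)) (at x)"
      by (rule has_vector_derivative_real_field)
  qed simp
  then show ?thesis by simp
qed

lemma f_eq: "f x = complex_of_real x powr (- s) - E x" by (simp add: f_def E_def ring_distribs)

lemma E_integrable: "a \<ge> 0 \<Longrightarrow> E integrable_on {a..b}"
  by (rule integrable_on_subinterval[OF set_lebesgue_integral_eq_integral(1)[OF E_integral(1)]]) auto

lemma f_has_integral: "(f has_integral (of_real (real N) powr (1 - s) / (1 - s) - integral {0..real N} E)) {0..real N}"
  unfolding f_eq by (intro has_integral_diff powr_integral integrable_integral E_integrable) simp

text \<open>On a unit interval the value at the right end differs from the mean by at most the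
  increment of \<open>K\<close>, and these increments add up from \<open>K 0 = 0\<close>.\<close>

lemma f_sum_integral: "norm ((\<Sum>n<N. f (real (Suc n))) - integral {0..real N} f) \<le> K (real N)"
proof (induction N)
  case 0
  then show ?case by (simp add: K_def \<phi>_def G_def)
next
  case (Suc N)
  have int: "f integrable_on {0..real (Suc N)}" using f_has_integral[of "Suc N"] by blast
  have int1: "f integrable_on {real N..real (Suc N)}" by (rule integrable_on_subinterval[OF int]) auto
  have comb: "integral {0..real N} f + integral {real N..real (Suc N)} f = integral {0..real (Suc N)} f"
    by (rule Henstock_Kurzweil_Integration.integral_combine) (use int in auto)
  have d: "((\<lambda>x. f (real (Suc N)) - f x) has_integral (f (real (Suc N)) - integral {real N..real (Suc N)} f)) {real N..real (Suc N)}"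
    using has_integral_diff[OF has_integral_const_real[of "f (real (Suc N))" "real N" "real (Suc N)"] integrable_integral[OF int1]] by simp
  have "norm (f (real (Suc N)) - integral {real N..real (Suc N)} f) \<le> (K (real (Suc N)) - K (real N)) * measure lborel {real N..real (Suc N)}"
  proof (rule has_integral_bound_real[OF _ finite.emptyI d])
    show "0 \<le> K (real (Suc N)) - K (real N)"
      by (rule order_trans[OF norm_ge_zero f_increment]) auto
    fix x assume "x \<in> {real N..real (Suc N)} - {}"
    then have x: "x \<in> {real N..real (Suc N)}" by simp
    have "norm (f (real (Suc N)) - f x) \<le> K (real (Suc N)) - K x" by (rule f_increment) (use x in auto)
    moreover have "0 \<le> K x - K (real N)"
      by (rule order_trans[OF norm_ge_zero f_increment]) (use x in auto)
    ultimately show "norm (f (real (Suc N)) - f x) \<le> K (real (Suc N)) - K (real N)" by simp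
  qed
  then have "norm (f (real (Suc N)) - integral {real N..real (Suc N)} f) \<le> K (real (Suc N)) - K (real N)" by simp
  moreover have eq: "(\<Sum>n<Suc N. f (real (Suc n))) - integral {0..real (Suc N)} f =
      ((\<Sum>n<N. f (real (Suc n))) - integral {0..real N} f) + (f (real (Suc N)) - integral {real N..real (Suc N)} f)"
    unfolding comb[symmetric] by simp
  ultimately show ?case unfolding eq using Suc.IH
      norm_triangle_ineq[of "(\<Sum>n<N. f (real (Suc n))) - integral {0..real N} f" "f (real (Suc N)) - integral {real N..real (Suc N)} f"]
    by linarith
qed

lemma integral_E_tendsto: "(\<lambda>N. integral {0..real N} E) \<longlonglongrightarrow> integral {0..} E"
proof -
  have "(\<lambda>N. integral {0..} (\<lambda>x. if x \<in> {0..real N} then E x else 0)) \<longlonglongrightarrow> integral {0..} E"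
  proof (rule dominated_convergence(2)[where h = "\<lambda>x. norm (E x)"])
    show "(\<lambda>x. if x \<in> {0..real N} then E x else 0) integrable_on {0..}" for N
      by (subst integrable_restrict_Int) (use E_integrable[of 0 "real N"] in \<open>simp add: Int_absorb2\<close>)
    show "(\<lambda>x. norm (E x)) integrable_on {0..}"
      using E_integral(1) absolutely_integrable_on_def by blast
    show "(\<lambda>N. if x \<in> {0..real N} then E x else 0) \<longlonglongrightarrow> E x" if "x \<in> {0..}" for x
    proof (rule tendsto_eventually)
      show "\<forall>\<^sub>F N in sequentially. (if x \<in> {0..real N} then E x else 0) = E x"
        by (rule eventually_mono[OF eventually_ge_at_top[of "nat \<lceil>x\<rceil>"]]) (use that in \<open>auto simp: nat_le_iff ceiling_le_iff\<close>)
    qed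
  qed auto
  moreover have "integral {0..} (\<lambda>x. if x \<in> {0..real N} then E x else 0) = integral {0..real N} E" for N
    by (subst integral_restrict_Int) (simp add: Int_absorb2)
  ultimately show ?thesis by simp
qed

lemma summable_E: "summable (\<lambda>n. norm (E (real (Suc n))))"
proof (rule summable_comparison_test')
  have "exp (- 1 / X) < 1" using X by simp
  then show "summable (\<lambda>n. exp (- 1 / X) ^ n)" by (intro summable_geometric) auto
  fix n
  have "norm (E (real (Suc n))) = real (Suc n) powr (- Re s) * exp (- real (Suc n) / X)"
    unfolding E_def norm_mult by (subst norm_powr_real_powr) auto
  also have "\<dots> \<le> 1 * exp (- real n / X)"
    using s X by (intro mult_mono) (auto simp: powr_minus inverse_le_1_iff ge_one_powr_ge_zero field_simps)
  finally show "norm (norm (E (real (Suc n)))) \<le> exp (- 1 / X) ^ n" by (simp add: exp_of_nat_mult[symmetric])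
qed

text \<open>By \<open>zeta_approx\<close>, zeta(s) is the limit of partial sums minus the integral
  of x^{-s} over [0, N]. Subtracting the same expression for \<open>E\<close> leaves the sum minus
  the integral of \<open>f\<close>, which is bounded uniformly in N. The Gamma term is the full
  integral of \<open>E\<close>, the trace of the pole at 1.\<close>

theorem zeta_smooth_approx:
  "norm (zeta s - ((\<Sum>n. E (real (Suc n))) - Gamma (1 - s) * of_real X powr (1 - s)))
     \<le> (norm s / Re s + 1) * (Gamma (1 - Re s) * X powr (- Re s))"
proof -
  let ?A = "\<lambda>N. (\<Sum>n<N. of_real (real (Suc n)) powr (- s)) - of_real (real N) powr (1 - s) / (1 - s)"
  have s1: "s \<noteq> 1" using s by auto
  have "(\<lambda>N. ?A (Suc N) - zeta s) \<longlonglongrightarrow> 0"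
  proof (rule Lim_null_comparison)
    show "\<forall>\<^sub>F N in sequentially. norm (?A (Suc N) - zeta s) \<le> norm s / Re s * real (Suc N) powr (- Re s)"
      using zeta_approx[OF s(1) s1] by (intro always_eventually allI) (subst norm_minus_commute)
    show "(\<lambda>N. norm s / Re s * real (Suc N) powr (- Re s)) \<longlonglongrightarrow> 0" using s by real_asymp
  qed
  then have "(\<lambda>N. ?A (Suc N)) \<longlonglongrightarrow> zeta s" by (simp only: LIM_zero_iff)
  then have 1: "?A \<longlonglongrightarrow> zeta s" by (rule LIMSEQ_imp_Suc)
  have 2: "(\<lambda>N. \<Sum>n<N. E (real (Suc n))) \<longlonglongrightarrow> (\<Sum>n. E (real (Suc n)))"
    using summable_LIMSEQ[OF summable_norm_cancel[OF summable_E]] .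
  have eq: "?A N - ((\<Sum>n<N. E (real (Suc n))) - integral {0..real N} E) = (\<Sum>n<N. f (real (Suc n))) - integral {0..real N} f" for N
    unfolding integral_unique[OF f_has_integral] f_eq sum_subtractf by (simp only: algebra_simps)
  have "(\<lambda>N. ?A N - ((\<Sum>n<N. E (real (Suc n))) - integral {0..real N} E)) \<longlonglongrightarrow> zeta s - ((\<Sum>n. E (real (Suc n))) - integral {0..} E)"
    by (intro tendsto_diff 1 2 integral_E_tendsto)
  then have "(\<lambda>N. (\<Sum>n<N. f (real (Suc n))) - integral {0..real N} f) \<longlonglongrightarrow> zeta s - ((\<Sum>n. E (real (Suc n))) - integral {0..} E)"
    unfolding eq .
  moreover have "norm ((\<Sum>n<N. f (real (Suc n))) - integral {0..real N} f) \<le> (norm s / Re s + 1) * (Gamma (1 - Re s) * X powr (- Re s))" for N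
  proof -
    have c0: "norm s / Re s \<ge> 0" using s by simp
    have "K (real N) \<le> (norm s / Re s + 1) * G (real N)" unfolding K_def
      using c0 s(1) norm_f[of "real N"] by (simp flip: norm_f)
    also have "\<dots> \<le> (norm s / Re s + 1) * (Gamma (1 - Re s) * X powr (- Re s))"
      by (intro mult_left_mono G_le) (use c0 in auto)
    finally show ?thesis by (rule order_trans[OF f_sum_integral])
  qed
  ultimately show ?thesis unfolding E_integral(2)[symmetric] by (intro Lim_norm_ubound[of sequentially]) auto
qed

end

subsection \<open>Gaussian mean squares of Dirichlet series\<close>

lemma normal_density_iexp:
  assumes "H > 0"
  shows "has_bochner_integral lborel (\<lambda>t. normal_density \<mu> H t *\<^sub>R iexp (l * t)) (iexp (l * \<mu>) * of_real (exp (- (H\<^sup>2 * l\<^sup>2) / 2)))"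
proof -
  have "(CLINT x|std_normal_distribution. iexp (u * x)) = of_real (exp (- u\<^sup>2 / 2))" for u
    using char_std_normal_distribution by (simp add: char_def fun_eq_iff)
  then have 1: "(LINT x|lborel. std_normal_density x *\<^sub>R iexp (u * x)) = of_real (exp (- u\<^sup>2 / 2))" for u
    by (subst (asm) integral_density) auto
  have int: "integrable lborel (\<lambda>x. std_normal_density x *\<^sub>R iexp (u * x))" for u
    by (rule Bochner_Integration.integrable_bound[OF integrable_normal_density[of 1 0]]) auto
  have nd: "normal_density \<mu> H (\<mu> + H * x) = std_normal_density x / H" for x
    using assms by (simp add: normal_density_def real_sqrt_mult power2_eq_square divide_simps)
  have eq: "normal_density \<mu> H (\<mu> + H * x) *\<^sub>R iexp (l * (\<mu> + H * x)) =
      (iexp (l * \<mu>) / of_real H) * (std_normal_density x *\<^sub>R iexp ((l * H) * x))" for x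
    unfolding nd by (simp add: scaleR_conv_of_real ring_distribs exp_add mult_ac)
  have "has_bochner_integral lborel (\<lambda>x. std_normal_density x *\<^sub>R iexp ((l * H) * x)) (of_real (exp (- (l * H)\<^sup>2 / 2)))"
    using 1[of "l * H"] int[of "l * H"] unfolding has_bochner_integral_iff by blast
  from has_bochner_integral_mult_right[OF this, of "iexp (l * \<mu>) / of_real H"]
  have "has_bochner_integral lborel (\<lambda>x. normal_density \<mu> H (\<mu> + H * x) *\<^sub>R iexp (l * (\<mu> + H * x)))
     ((iexp (l * \<mu>) / of_real H) * of_real (exp (- (l * H)\<^sup>2 / 2)))" unfolding eq .
  also have "(iexp (l * \<mu>) / of_real H) * of_real (exp (- (l * H)\<^sup>2 / 2)) = (iexp (l * \<mu>) * of_real (exp (- (H\<^sup>2 * l\<^sup>2) / 2))) /\<^sub>R \<bar>H\<bar>"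
    using assms by (simp add: scaleR_conv_of_real power_mult_distrib field_simps)
  finally show ?thesis using assms by (subst lborel_has_bochner_integral_real_affine_iff[of H _ _ \<mu>]) auto
qed

text \<open>The real part, at frequency \<open>l\<close>, of the characteristic function of the
  normal law with mean \<open>t0\<close> and standard deviation \<open>H\<close>.\<close>

definition gauss_cos :: "real \<Rightarrow> real \<Rightarrow> real \<Rightarrow> real" where
  "gauss_cos t0 H l = cos (t0 * l) * exp (- (H\<^sup>2 * l\<^sup>2) / 2)"

lemma gauss_cos_minus [simp]: "gauss_cos t0 H (- l) = gauss_cos t0 H l"
  by (simp add: gauss_cos_def)

lemma abs_gauss_cos_le: "\<bar>gauss_cos t0 H l\<bar> \<le> exp (- (H\<^sup>2 * l\<^sup>2) / 2)"
  by (simp add: gauss_cos_def abs_mult mult_left_le_one_le)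

lemma normal_density_cos:
  assumes "H > 0"
  shows "has_bochner_integral lborel (\<lambda>t. normal_density t0 H t * cos (l * t)) (gauss_cos t0 H l)"
proof -
  have "has_bochner_integral lborel (\<lambda>t. Re (normal_density t0 H t *\<^sub>R iexp (l * t))) (Re (iexp (l * t0) * of_real (exp (- (H\<^sup>2 * l\<^sup>2) / 2))))"
    by (rule has_bochner_integral_bounded_linear[OF bounded_linear_Re normal_density_iexp[OF assms]])
  then show ?thesis by (simp add: gauss_cos_def Re_exp mult.commute)
qed

lemma norm_square_sum_cos:
  fixes a w :: "nat \<Rightarrow> real"
  shows "(norm (\<Sum>n<N. of_real (a n) * cis (- t * w n)))\<^sup>2 = (\<Sum>m<N. \<Sum>n<N. a m * a n * cos ((w n - w m) * t))"
proof -
  let ?z = "\<Sum>n<N. of_real (a n) * cis (- t * w n)"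
  have "(norm ?z)\<^sup>2 = Re (?z * cnj ?z)" using complex_norm_square[of ?z] by (metis Re_complex_of_real)
  also have "?z * cnj ?z = (\<Sum>m<N. \<Sum>n<N. of_real (a m * a n) * cis ((w n - w m) * t))"
    unfolding cnj_sum sum_product
    by (intro sum.cong refl) (simp add: cis_cnj cis_mult mult_ac cis_divide ring_distribs)
  also have "Re \<dots> = (\<Sum>m<N. \<Sum>n<N. a m * a n * cos ((w n - w m) * t))" by simp
  finally show ?thesis .
qed

text \<open>Squares are cofinal among the finite sets of pairs, so an unconditional sum may be
  computed along them.\<close>

lemma has_sum_imp_square_limit:
  fixes f :: "nat \<times> nat \<Rightarrow> real"
  assumes "(f has_sum S) UNIV"
  shows "(\<lambda>N. \<Sum>m<N. \<Sum>n<N. f (m, n)) \<longlonglongrightarrow> S"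
proof -
  have "filterlim (\<lambda>N. {..<N} \<times> {..<N}) (finite_subsets_at_top UNIV) sequentially"
    unfolding filterlim_finite_subsets_at_top
  proof (intro allI impI)
    fix X :: "(nat \<times> nat) set" assume "finite X \<and> X \<subseteq> UNIV"
    then have "finite (fst ` X \<union> snd ` X)" by blast
    then obtain k where k: "\<forall>i\<in>fst ` X \<union> snd ` X. i < k" using finite_nat_set_iff_bounded by blast
    show "\<forall>\<^sub>F N in sequentially. finite ({..<N} \<times> {..<N}) \<and> X \<subseteq> {..<N} \<times> {..<N} \<and> {..<N} \<times> {..<N} \<subseteq> UNIV"
      using eventually_ge_at_top[of k]
    proof eventually_elim
      case (elim N)
      have "x \<in> {..<N} \<times> {..<N}" if "x \<in> X" for x
        using bspec[OF k, of "fst x"] bspec[OF k, of "snd x"] elim that by (auto simp: mem_Times_iff)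
      then show ?case by auto
    qed
  qed
  with assms have "(\<lambda>N. sum f ({..<N} \<times> {..<N})) \<longlonglongrightarrow> S"
    unfolding has_sum_def by (rule filterlim_compose)
  then show ?thesis by (simp add: sum.cartesian_product)
qed

text \<open>For partial sums the mean is a finite double sum of cosines. All partial sums are
  bounded by the constant \<open>A\<close>, so dominated convergence passes to the limit in the
  mean, while the double series is absolutely summable and its sum can be read off along
  squares.\<close>

lemma dirichlet_gaussian_mean:
  fixes a w :: "nat \<Rightarrow> real"
  assumes a: "\<And>n. a n \<ge> 0" "summable a" and H: "H > 0"
  defines "D \<equiv> \<lambda>t. \<Sum>n. of_real (a n) * cis (- t * w n)"
  shows "integrable lborel (\<lambda>t. normal_density t0 H t * (norm (D t))\<^sup>2)"
    and "((\<lambda>(m, n). a m * a n * gauss_cos t0 H (w n - w m)) has_sum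
            (LINT t|lborel. normal_density t0 H t * (norm (D t))\<^sup>2)) UNIV"
    and "(\<lambda>(m, n). a m * a n) summable_on (UNIV :: (nat \<times> nat) set)"
proof -
  define P where "P N t = (\<Sum>n<N. of_real (a n) * cis (- t * w n))" for N t
  define A where "A = suminf a"
  have A: "(a has_sum A) UNIV" using a by (intro norm_summable_imp_has_sum) (auto simp: A_def summable_sums)
  have normP: "norm (P N t) \<le> A" for N t
  proof -
    have "norm (P N t) \<le> (\<Sum>n<N. a n)" unfolding P_def
      by (rule order_trans[OF norm_sum]) (auto simp: norm_mult a intro!: sum_mono)
    also have "\<dots> \<le> A" unfolding A_def by (rule sum_le_suminf) (use a in auto)
    finally show ?thesis .
  qed
  have sD: "summable (\<lambda>n. of_real (a n) * cis (- t * w n))" for t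
    by (rule summable_comparison_test'[OF a(2)]) (auto simp: norm_mult a)
  have PD: "(\<lambda>N. P N t) \<longlonglongrightarrow> D t" for t
    unfolding P_def D_def by (rule summable_LIMSEQ[OF sD])
  have meas[measurable]: "P N \<in> borel_measurable borel" for N
    unfolding P_def by (intro borel_measurable_continuous_onI continuous_intros)
  have [measurable]: "D \<in> borel_measurable borel"
    by (rule borel_measurable_LIMSEQ_metric[OF meas PD])

  have bound: "norm (normal_density t0 H t * (norm (P N t))\<^sup>2) \<le> normal_density t0 H t * A\<^sup>2" for N t
    using normP[of N t] by (simp add: abs_mult mult_left_mono power_mono)
  have lim: "(\<lambda>N. normal_density t0 H t * (norm (P N t))\<^sup>2) \<longlonglongrightarrow> normal_density t0 H t * (norm (D t))\<^sup>2" for t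
    by (intro tendsto_intros PD)
  have intA: "integrable lborel (\<lambda>t. normal_density t0 H t * A\<^sup>2)" using H by simp
  show "integrable lborel (\<lambda>t. normal_density t0 H t * (norm (D t))\<^sup>2)"
    by (rule integrable_dominated_convergence[OF _ _ intA AE_I2[OF lim] AE_I2[OF bound]]) measurable
  have L: "(\<lambda>N. LINT t|lborel. normal_density t0 H t * (norm (P N t))\<^sup>2) \<longlonglongrightarrow> (LINT t|lborel. normal_density t0 H t * (norm (D t))\<^sup>2)"
    by (rule integral_dominated_convergence[OF _ _ intA AE_I2[OF lim] AE_I2[OF bound]]) measurable
  have sq: "(LINT t|lborel. normal_density t0 H t * (norm (P N t))\<^sup>2) = (\<Sum>m<N. \<Sum>n<N. a m * a n * gauss_cos t0 H (w n - w m))" for N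
  proof -
    have "normal_density t0 H t * (norm (P N t))\<^sup>2 = (\<Sum>m<N. \<Sum>n<N. (a m * a n) * (normal_density t0 H t * cos ((w n - w m) * t)))" for t
      unfolding P_def norm_square_sum_cos sum_distrib_left by (simp add: mult_ac)
    moreover have "has_bochner_integral lborel (\<lambda>t. \<Sum>m<N. \<Sum>n<N. (a m * a n) * (normal_density t0 H t * cos ((w n - w m) * t)))
       (\<Sum>m<N. \<Sum>n<N. (a m * a n) * gauss_cos t0 H (w n - w m))"
      by (intro has_bochner_integral_sum has_bochner_integral_mult_right normal_density_cos H)
    ultimately show ?thesis by (simp add: has_bochner_integral_integral_eq)
  qed
  have "((\<lambda>n. a m * a n) has_sum (a m * A)) UNIV" for m by (intro has_sum_cmult_right A)
  moreover have "(\<lambda>m. a m * A) summable_on UNIV" using A has_sum_cmult_left summable_on_def by blast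
  ultimately have "(\<lambda>(m, n). a m * a n) summable_on (UNIV \<times> UNIV)"
    using a by (intro summable_on_SigmaI) auto
  then show pair: "(\<lambda>(m, n). a m * a n) summable_on (UNIV :: (nat \<times> nat) set)" by simp
  have "(\<lambda>(m, n). a m * a n * gauss_cos t0 H (w n - w m)) summable_on UNIV"
  proof (rule abs_summable_summable, rule summable_on_comparison_test[OF pair])
    fix x :: "nat \<times> nat"
    obtain m n where x: "x = (m, n)" by force
    have "\<bar>gauss_cos t0 H (w n - w m)\<bar> \<le> 1" using abs_gauss_cos_le[of t0 H "w n - w m"] by (rule order_trans) simp
    then have "a m * a n * \<bar>gauss_cos t0 H (w n - w m)\<bar> \<le> a m * a n * 1" by (intro mult_left_mono) (simp_all add: a)
    then show "norm (case x of (m, n) \<Rightarrow> a m * a n * gauss_cos t0 H (w n - w m)) \<le> (case x of (m, n) \<Rightarrow> a m * a n)"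
      by (simp add: x abs_mult a)
  qed auto
  then obtain S where S: "((\<lambda>(m, n). a m * a n * gauss_cos t0 H (w n - w m)) has_sum S) UNIV"
    unfolding summable_on_def by blast
  from has_sum_imp_square_limit[OF this] L have "S = (LINT t|lborel. normal_density t0 H t * (norm (D t))\<^sup>2)"
    unfolding sq by (auto intro: LIMSEQ_unique)
  with S show "((\<lambda>(m, n). a m * a n * gauss_cos t0 H (w n - w m)) has_sum
            (LINT t|lborel. normal_density t0 H t * (norm (D t))\<^sup>2)) UNIV" by simp
qed

text \<open>The pairs above the diagonal are indexed by their shift \<open>Suc h\<close> and their
  smaller member \<open>m\<close>, because the off-diagonal part is later summed over
  \<open>m\<close> for each fixed shift.\<close>

lemma has_sum_symmetric_split:
  fixes f :: "nat \<times> nat \<Rightarrow> real"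
  assumes sym: "\<And>m n. f (m, n) = f (n, m)" and S: "(f has_sum S) UNIV"
  obtains T where "((\<lambda>(h, m). f (m, m + Suc h)) has_sum T) UNIV" "(\<lambda>n. f (n, n)) sums (S - 2 * T)"
proof -
  define U where "U = {(m, n :: nat). m < n}"
  define L where "L = {(m, n :: nat). n < m}"
  define G where "G = {(m, n :: nat). m = n}"
  have summ: "f summable_on B" for B
    using S summable_on_subset_banach[of f UNIV B] by (auto simp: summable_on_def)
  obtain T where T: "(f has_sum T) U" using summ[of U] by (auto simp: summable_on_def)
  obtain Q where Q: "(f has_sum Q) G" using summ[of G] by (auto simp: summable_on_def)
  have "bij_betw (\<lambda>(m, n). (n, m)) U L" by (rule bij_betwI[of _ _ _ "\<lambda>(m, n). (n, m)"]) (auto simp: U_def L_def)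
  from has_sum_reindex_bij_betw[OF this, of f T] T have L: "(f has_sum T) L"
    by (simp add: case_prod_unfold sym[of "snd _"])
  have "bij_betw (\<lambda>(h, m). (m, m + Suc h)) UNIV U"
    by (rule bij_betwI[of _ _ _ "\<lambda>(m, n). (n - m - 1, m)"]) (auto simp: U_def)
  from has_sum_reindex_bij_betw[OF this, of f T] T have 1: "((\<lambda>(h, m). f (m, m + Suc h)) has_sum T) UNIV"
    by (simp add: case_prod_unfold)
  have "bij_betw (\<lambda>n. (n, n)) UNIV G" by (rule bij_betwI[of _ _ _ fst]) (auto simp: G_def)
  from has_sum_reindex_bij_betw[OF this, of f Q] Q have 2: "(\<lambda>n. f (n, n)) sums Q"
    using has_sum_imp_sums by blast
  have "(f has_sum (Q + (T + T))) (G \<union> (U \<union> L))"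
    by (intro has_sum_Un_disjoint Q T L) (auto simp: G_def U_def L_def)
  moreover have "G \<union> (U \<union> L) = UNIV" by (auto simp: G_def U_def L_def)
  ultimately have "S = Q + (T + T)" using S has_sum_unique by metis
  with 1 2 that show ?thesis by simp
qed

subsection \<open>The off-diagonal sum\<close>

text \<open>Increments are controlled only for positive arguments, since the functions to come
  depend on h/x. The first unit interval is therefore charged the full value \<open>K 1\<close>, and
  the telescoping starts from there.\<close>

lemma sum_integral_increment_bound:
  fixes f :: "real \<Rightarrow> real" and K :: "real \<Rightarrow> real"
  assumes inc: "\<And>a b. 0 < a \<Longrightarrow> a \<le> b \<Longrightarrow> \<bar>f b - f a\<bar> \<le> K b - K a"
    and K: "\<And>x. x > 0 \<Longrightarrow> K x \<ge> 0" and int: "f integrable_on {0..real N}"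
  shows "N > 0 \<Longrightarrow> \<bar>(\<Sum>n<N. f (real (Suc n))) - integral {0..real N} f\<bar> \<le> K (real N)"
  using int
proof (induction N)
  case (Suc N)
  define K0 where "K0 = (if N = 0 then 0 else K (real N))"
  have int1: "f integrable_on {real N..real (Suc N)}" "f integrable_on {0..real N}"
    by (rule integrable_on_subinterval[OF Suc.prems(2)]; auto)+
  have comb: "integral {0..real N} f + integral {real N..real (Suc N)} f = integral {0..real (Suc N)} f"
    by (rule Henstock_Kurzweil_Integration.integral_combine) (use Suc.prems in auto)
  have d: "((\<lambda>x. f (real (Suc N)) - f x) has_integral (f (real (Suc N)) - integral {real N..real (Suc N)} f)) {real N..real (Suc N)}"
    using has_integral_diff[OF has_integral_const_real[of "f (real (Suc N))" "real N" "real (Suc N)"] integrable_integral[OF int1(1)]] by simp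
  have mono: "0 \<le> K x - K0" if "x \<ge> real N" "x > 0" for x
  proof (cases "N = 0")
    case False
    then show ?thesis using order_trans[OF abs_ge_zero inc[of "real N" x]] that by (simp add: K0_def)
  qed (use K[OF that(2)] in \<open>simp add: K0_def\<close>)
  have "norm (f (real (Suc N)) - integral {real N..real (Suc N)} f) \<le> (K (real (Suc N)) - K0) * measure lborel {real N..real (Suc N)}"
  proof (rule has_integral_bound_real[where S = "{0}", OF _ _ d])
    show "0 \<le> K (real (Suc N)) - K0" by (rule mono) auto
    fix x assume x: "x \<in> {real N..real (Suc N)} - {0}"
    have "\<bar>f (real (Suc N)) - f x\<bar> \<le> K (real (Suc N)) - K x" by (rule inc) (use x in auto)
    moreover have "0 \<le> K x - K0" by (rule mono) (use x in auto)
    ultimately show "norm (f (real (Suc N)) - f x) \<le> K (real (Suc N)) - K0" by simp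
  qed simp
  then have 1: "\<bar>f (real (Suc N)) - integral {real N..real (Suc N)} f\<bar> \<le> K (real (Suc N)) - K0" by simp
  have 2: "\<bar>(\<Sum>n<N. f (real (Suc n))) - integral {0..real N} f\<bar> \<le> K0"
    using Suc.IH[OF _ int1(2)] by (cases "N = 0") (auto simp: K0_def)
  have eq: "(\<Sum>n<Suc N. f (real (Suc n))) - integral {0..real (Suc N)} f =
      ((\<Sum>n<N. f (real (Suc n))) - integral {0..real N} f) + (f (real (Suc N)) - integral {real N..real (Suc N)} f)"
    unfolding comb[symmetric] by simp
  show ?case unfolding eq using 1 2 by linarith
qed auto

lemma integral_to_infinity:
  fixes f :: "real \<Rightarrow> 'a :: euclidean_space"
  assumes "f absolutely_integrable_on {0<..}"
  shows "f integrable_on {0..real N}" "(\<lambda>N. integral {0..real N} f) \<longlonglongrightarrow> integral {0<..} f"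
proof -
  have int: "f integrable_on {0<..}" by (rule set_lebesgue_integral_eq_integral(1)[OF assms])
  have "f integrable_on {0<..} \<longleftrightarrow> f integrable_on {0..}"
    by (rule integrable_spike_set_eq, rule negligible_subset[of "{0}"]) auto
  then show intN: "f integrable_on {0..real N}" for N
    using int integrable_on_subinterval[of f "{0..}" 0 "real N"] by auto
  have "(\<lambda>N. integral {0<..} (\<lambda>x. if x \<in> {0..real N} then f x else 0)) \<longlonglongrightarrow> integral {0<..} f"
  proof (rule dominated_convergence(2)[where h = "\<lambda>x. norm (f x)"])
    have "f integrable_on {0<..} \<inter> {0..real N}" for N
      by (rule integrable_spike_set[OF intN]; rule negligible_subset[of "{0}"]) auto
    then show "(\<lambda>x. if x \<in> {0..real N} then f x else 0) integrable_on {0<..}" for N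
      by (subst integrable_restrict_Int) (simp add: Int_commute)
    show "(\<lambda>x. norm (f x)) integrable_on {0<..}"
      using assms absolutely_integrable_on_def by blast
    show "(\<lambda>N. if x \<in> {0..real N} then f x else 0) \<longlonglongrightarrow> f x" if "x \<in> {0<..}" for x
    proof (rule tendsto_eventually)
      show "\<forall>\<^sub>F N in sequentially. (if x \<in> {0..real N} then f x else 0) = f x"
        by (rule eventually_mono[OF eventually_ge_at_top[of "nat \<lceil>x\<rceil>"]]) (use that in \<open>auto simp: nat_le_iff ceiling_le_iff\<close>)
    qed
  qed auto
  moreover have "integral {0<..} (\<lambda>x. if x \<in> {0..real N} then f x else 0) = integral {0..real N} f" for N
    by (subst integral_restrict_Int, rule integral_spike_set; rule negligible_subset[of "{0}"]) auto
  ultimately show "(\<lambda>N. integral {0..real N} f) \<longlonglongrightarrow> integral {0<..} f" by simp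
qed

section \<open>Exponentially damped harmonic sums\<close>

lemma harmonic_exp_sums:
  assumes "z > 0"
  shows "(\<lambda>n. exp (- real (Suc n) * z) / real (Suc n)) sums (- ln (1 - exp (- z)))"
proof -
  define q where "q = exp (- z)"
  have q: "0 < q" "q < 1" using assms by (auto simp: q_def)
  have pw: "exp (- real (Suc n) * z) = q ^ Suc n" for n
    using exp_of_nat_mult[of "Suc n" "- z"] by (simp add: q_def algebra_simps)
  have s: "summable (\<lambda>n. q ^ Suc n / real (Suc n))"
  proof (rule summable_comparison_test')
    show "summable (\<lambda>n. q ^ n)" using q by (intro summable_geometric) auto
    fix n
    have "q ^ Suc n / real (Suc n) \<le> q ^ n / 1"
      using q by (intro frac_le) (auto simp: mult_left_le_one_le)
    then show "norm (q ^ Suc n / real (Suc n)) \<le> q ^ n" using q by simp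
  qed
  have "ln (1 - q) = (\<Sum>n. (- 1) ^ n * (1 / real (n + 1)) * (1 - q - 1) ^ Suc n)"
    using q by (intro ln_series) auto
  also have "\<dots> = (\<Sum>n. - (q ^ Suc n / real (Suc n)))"
  proof (rule suminf_cong)
    fix n show "(- 1) ^ n * (1 / real (n + 1)) * (1 - q - 1) ^ Suc n = - (q ^ Suc n / real (Suc n))"
      by (cases "even n") simp_all
  qed
  also have "\<dots> = - (\<Sum>n. q ^ Suc n / real (Suc n))" by (rule suminf_minus[OF s])
  finally show ?thesis unfolding pw q_def[symmetric] using s by (simp add: sums_iff)
qed

lemma harmonic_exp_sum:
  assumes "X \<ge> 1"
  shows "summable (\<lambda>n. exp (- real (Suc n) / (2 * X)) / real (Suc n))"
    and "(\<Sum>n. exp (- real (Suc n) / (2 * X)) / real (Suc n)) \<le> ln (4 * X)"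
proof -
  define z where "z = 1 / (2 * X)"
  have z: "0 < z" "z \<le> 1/2" using assms by (auto simp: z_def field_simps)
  have "- real (Suc n) / (2 * X) = - real (Suc n) * z" for n by (simp add: z_def)
  then have s: "(\<lambda>n. exp (- real (Suc n) / (2 * X)) / real (Suc n)) sums (- ln (1 - exp (- z)))"
    using harmonic_exp_sums[OF z(1)] by (simp only:)
  then show "summable (\<lambda>n. exp (- real (Suc n) / (2 * X)) / real (Suc n))" by (rule sums_summable)
  have "exp (- z) \<le> 1 / (1 + z)" using exp_ge_add_one_self[of z] z by (simp add: exp_minus field_simps)
  also have "\<dots> \<le> 1 - z / 2" using z by (simp add: field_simps)
  finally have "- ln (1 - exp (- z)) \<le> - ln (z / 2)" using z by simp
  also have "\<dots> = ln (4 * X)" using assms by (simp add: z_def ln_div)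
  finally show "(\<Sum>n. exp (- real (Suc n) / (2 * X)) / real (Suc n)) \<le> ln (4 * X)"
    using s by (simp add: sums_iff)
qed

lemma two_times_le_exp: assumes "(w::real) \<ge> 0" shows "2 * w \<le> exp w"
proof -
  have "(w - 1)\<^sup>2 \<ge> 0" by simp
  then have "2 * w \<le> 1 + w + w\<^sup>2 / 2" by (simp add: power2_eq_square algebra_simps)
  also have "\<dots> \<le> exp w" by (rule exp_lower_Taylor_quadratic[OF assms])
  finally show ?thesis .
qed

text \<open>Twice the hyperbolic sine and cosine of \<open>l / 2\<close>.\<close>

definition sh :: "real \<Rightarrow> real" where "sh l = exp (l / 2) - exp (- l / 2)"
definition ch :: "real \<Rightarrow> real" where "ch l = exp (l / 2) + exp (- l / 2)"

lemma sh_pos: "l > 0 \<Longrightarrow> sh l > 0" by (simp add: sh_def)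
lemma ch_pos: "ch l > 0" by (simp add: ch_def add_pos_pos)
lemma sh_le_ch: "sh l \<le> ch l" by (simp add: sh_def ch_def)
lemma ch_sh: "(ch l)\<^sup>2 - (sh l)\<^sup>2 = 4"
  by (simp add: sh_def ch_def power2_eq_square algebra_simps flip: exp_add)
lemma sh_eq: "sh l = exp (l / 2) * (1 - exp (- l))"
  by (simp add: sh_def algebra_simps flip: exp_add)
lemma sh_le: "sh l \<le> exp (l / 2)" by (simp add: sh_def)
lemma sh_le_times: "sh l \<le> l * exp (l / 2)"
  unfolding sh_eq using exp_ge_add_one_self[of "- l"] by (subst mult.commute) (simp add: mult_right_mono)
lemma ch_le: "l \<ge> 0 \<Longrightarrow> ch l \<le> 2 * exp (l / 2)" by (simp add: ch_def)
lemma sh_ge: assumes "l \<ge> 0" shows "sh l \<ge> l"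
proof -
  have "\<And>x. 0 \<le> x \<Longrightarrow> x \<le> l \<Longrightarrow> ((\<lambda>l. sh l - l) has_real_derivative (exp (x/2) + exp (-x/2)) / 2 - 1) (at x)"
    unfolding sh_def by (auto intro!: derivative_eq_intros simp: field_simps)
  moreover have "(exp (x/2) + exp (-x/2)) / 2 - 1 \<ge> 0" for x :: real
  proof -
    have "exp (x/2) + exp (-x/2) \<ge> 2" using exp_ge_add_one_self[of "x/2"] exp_ge_add_one_self[of "-x/2"] by linarith
    then show ?thesis by simp
  qed
  ultimately have "sh 0 - 0 \<le> sh l - l" by (intro DERIV_nonneg_imp_nondecreasing[OF assms]) blast
  then show ?thesis by (simp add: sh_def)
qed

lemma sh_deriv: "(sh has_real_derivative ch l / 2) (at l)"
  unfolding sh_def ch_def by (auto intro!: derivative_eq_intros simp: field_simps)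
lemma ch_deriv: "(ch has_real_derivative sh l / 2) (at l)"
  unfolding sh_def ch_def by (auto intro!: derivative_eq_intros simp: field_simps)

text \<open>With \<open>\<alpha> = 2 \<sigma> - 1\<close> and \<open>l = ln (1 + h / m)\<close>, the number \<open>r h l\<close> is the term of the off-diagonal sum that belongs to
  the pair \<open>m\<close>, \<open>m + h\<close>; indeed \<open>h * y l = (2 m + h) / X\<close> and \<open>(sh l / h)^2 = 1 / (m (m + h))\<close>. The function \<open>p h\<close> is
  what \<open>r h\<close> becomes after the change of variables from \<open>m\<close> to \<open>l\<close>.\<close>

locale offdiag =
  fixes \<alpha> X H t0 :: real
  assumes \<alpha>: "0 \<le> \<alpha>" "\<alpha> < 1" and X: "X \<ge> 1" and H: "H \<ge> 1" and t0: "t0 \<ge> 0"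
begin

definition "y l = ch l / (X * sh l)"
definition "c l = gauss_cos t0 H l"
definition "r h l = (sh l / h) powr (1 + \<alpha>) * exp (- h * y l) * c l"
definition "p h l = sh l powr (\<alpha> - 1) * h powr (- \<alpha>) * exp (- h * y l) * c l"
text \<open>A bound for the total variation of \<open>r h\<close>: the integral over l of the
  derivative bound in \<open>r_deriv_bound\<close>. The ratio t0 / H stems from differentiating cos
  (t0 l) at the Gaussian scale l = 1/H.\<close>

definition "B h = 3 * exp (9/2) * (1 + t0 / H) / h * exp (- h / (2 * X)) / H"

lemma y_ge: "l > 0 \<Longrightarrow> y l \<ge> 1 / X"
  unfolding y_def using sh_pos[of l] sh_le_ch[of l] X by (simp add: field_simps)

lemma y_deriv: "l > 0 \<Longrightarrow> (y has_real_derivative - 2 / (X * (sh l)\<^sup>2)) (at l)"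
proof -
  assume l: "l > 0"
  have "(y has_real_derivative (sh l / 2 * (X * sh l) - ch l * (X * (ch l / 2))) / ((X * sh l) * (X * sh l))) (at l)"
    unfolding y_def using sh_pos[OF l] X by (auto intro!: derivative_eq_intros sh_deriv ch_deriv)
  moreover have "(sh l / 2 * (X * sh l) - ch l * (X * (ch l / 2))) / ((X * sh l) * (X * sh l)) = - (((ch l)\<^sup>2 - (sh l)\<^sup>2) / 2) / (X * (sh l)\<^sup>2)"
    using sh_pos[OF l] X by (simp add: field_simps power2_eq_square)
  ultimately show ?thesis by (simp add: ch_sh)
qed

lemma c_deriv: "(c has_real_derivative (- t0 * sin (t0 * l) - H\<^sup>2 * l * cos (t0 * l)) * exp (- (H\<^sup>2 * l\<^sup>2) / 2)) (at l)"
  unfolding c_def gauss_cos_def by (auto intro!: derivative_eq_intros simp: field_simps)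

lemma abs_c: "\<bar>c l\<bar> \<le> exp (- (H\<^sup>2 * l\<^sup>2) / 2)" unfolding c_def by (rule abs_gauss_cos_le)

lemma sh_powr_le:
  assumes "l > 0" "h \<ge> 1" shows "(sh l / h) powr \<alpha> \<le> exp (l / 2)"
proof -
  have "sh l / h \<le> exp (l / 2)" using sh_le[of l] assms sh_pos[of l]
    by (smt (verit) div_by_1 frac_le)
  then have "(sh l / h) powr \<alpha> \<le> exp (l / 2) powr \<alpha>"
    using sh_pos[of l] assms \<alpha> by (intro powr_mono2) auto
  also have "\<dots> \<le> exp (l / 2) powr 1" using assms \<alpha> by (intro powr_mono) auto
  finally show ?thesis by simp
qed

text \<open>The Gaussian pays for e^l, for the polynomial and for a further e^{-H l}. As H \<ge> 1,
  everything is bounded in terms of z = H l and t0 / H: one has 3 + z + z^2 \<le> 3 e^z, and 9/2 is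
  the maximum of 3 z - z^2 / 2.\<close>

lemma gauss_poly_bound:
  assumes "l \<ge> 0"
  shows "exp (- (H\<^sup>2 * l\<^sup>2) / 2) * exp l * (3 + l * t0 + H\<^sup>2 * l\<^sup>2) \<le> 3 * exp (9/2) * (1 + t0 / H) * exp (- H * l)"
proof -
  define z where "z = H * l"
  have z: "z \<ge> 0" "l \<le> z" using assms H by (auto simp: z_def mult_le_cancel_right1)
  have e: "exp z \<ge> 1 + z + z\<^sup>2 / 2"
    using z exp_lower_Taylor_quadratic by simp
  have "3 + l * t0 + H\<^sup>2 * l\<^sup>2 = 3 + (t0 / H) * z + z\<^sup>2" using H by (simp add: z_def power_mult_distrib)
  also have "\<dots> \<le> (1 + t0 / H) * (3 + z + z\<^sup>2)" using t0 H z by (simp add: algebra_simps)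
  also have "\<dots> \<le> (1 + t0 / H) * (3 * exp z)"
    using e z t0 H zero_le_power2[of z] by (intro mult_left_mono) (linarith, simp)
  finally have 1: "3 + l * t0 + H\<^sup>2 * l\<^sup>2 \<le> (1 + t0 / H) * (3 * exp z)" .
  have "exp (- (H\<^sup>2 * l\<^sup>2) / 2) * exp l * (3 + l * t0 + H\<^sup>2 * l\<^sup>2) \<le> exp (- z\<^sup>2 / 2) * exp z * ((1 + t0 / H) * (3 * exp z))"
    using 1 z t0 H assms by (intro mult_mono) (auto simp: z_def power_mult_distrib)
  also have "\<dots> = 3 * (1 + t0 / H) * exp (- z\<^sup>2 / 2 + z + z)" by (simp only: exp_add mult_ac)
  also have "\<dots> \<le> 3 * (1 + t0 / H) * exp (9 / 2 - z)"
  proof -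
    have "(z - 3)\<^sup>2 \<ge> 0" by simp
    then have "- z\<^sup>2 / 2 + z + z \<le> 9 / 2 - z" by (simp add: power2_eq_square algebra_simps)
    then show ?thesis using t0 H by (intro mult_left_mono) auto
  qed
  also have "9 / 2 - z = 9 / 2 + - z" by simp
  also have "3 * (1 + t0 / H) * exp (9 / 2 + - z) = 3 * exp (9/2) * (1 + t0 / H) * exp (- H * l)"
    by (simp only: exp_add) (simp add: z_def)
  finally show ?thesis .
qed

text \<open>\<open>d1\<close>, \<open>d2\<close>, \<open>d3\<close> differentiate the power of
  \<open>sh\<close>, the exponential and the oscillating Gaussian in turn. Only half of the decay
  e^{-h/X} is kept, as \<open>Q\<close>; the other half absorbs the factor of size
  \<open>h * y l\<close> that comes from differentiating the exponential.\<close>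

lemma r_deriv_bound:
  assumes l: "l > 0" and h: "h \<ge> 1"
  obtains d where "(r h has_real_derivative d) (at l)" "\<bar>d\<bar> \<le> B h * H * exp (- H * l)"
proof -
  define S where "S = sh l"
  have S: "S > 0" unfolding S_def using l by (rule sh_pos)
  define Y where "Y = exp (- h * y l)"
  define E where "E = exp (- (H\<^sup>2 * l\<^sup>2) / 2)"
  define Q where "Q = exp (- h / (2 * X))"
  define c' where "c' = (- t0 * sin (t0 * l) - H\<^sup>2 * l * cos (t0 * l)) * E"
  define d1 where "d1 = (1 + \<alpha>) * (S / h) powr \<alpha> * (ch l / 2 / h) * Y * c l"
  define d2 where "d2 = (S / h) powr (1 + \<alpha>) * (Y * (h * (2 / (X * S\<^sup>2)))) * c l"
  define d3 where "d3 = (S / h) powr (1 + \<alpha>) * Y * c'"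
  have pw: "(S / h) powr (1 + \<alpha>) = (S / h) * (S / h) powr \<alpha>"
    using S h by (simp add: powr_add)
  have "((\<lambda>l. (sh l / h) powr (1 + \<alpha>)) has_real_derivative (1 + \<alpha>) * (S / h) powr \<alpha> * (ch l / 2 / h)) (at l)"
    using S h unfolding S_def by (auto intro!: derivative_eq_intros sh_deriv)
  moreover have "((\<lambda>l. exp (- h * y l)) has_real_derivative Y * (h * (2 / (X * S\<^sup>2)))) (at l)"
    unfolding Y_def S_def using h l by (auto intro!: derivative_eq_intros y_deriv)
  moreover have "(c has_real_derivative c') (at l)" unfolding c'_def E_def by (rule c_deriv)
  ultimately have "(r h has_real_derivative
      ((1 + \<alpha>) * (S / h) powr \<alpha> * (ch l / 2 / h) * Y + (Y * (h * (2 / (X * S\<^sup>2)))) * (S / h) powr (1 + \<alpha>)) * c l + c' * ((S / h) powr (1 + \<alpha>) * Y)) (at l)"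
    unfolding r_def S_def Y_def by (intro DERIV_mult)
  then have D: "(r h has_real_derivative d1 + d2 + d3) (at l)"
    by (simp add: d1_def d2_def d3_def algebra_simps)
  have hy: "h / X \<le> h * y l" using y_ge[OF l] h X by (simp add: field_simps mult_left_mono)
  have hX: "h / (2 * X) \<le> h / X" using h X by (simp add: field_simps)
  have YQ: "Y \<le> Q" unfolding Y_def Q_def using hy hX by simp
  have Y0: "Y \<ge> 0" and Q0: "Q \<ge> 0" and E0: "E \<ge> 0" by (simp_all add: Y_def Q_def E_def)
  have cE: "\<bar>c l\<bar> \<le> E" unfolding E_def by (rule abs_c)
  have SP: "(S / h) powr \<alpha> \<le> exp (l / 2)" unfolding S_def by (rule sh_powr_le[OF l h])
  define e where "e = exp (l / 2)"
  have e: "e \<ge> 1" "exp l = e * e" using l by (auto simp: e_def simp flip: exp_add)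
  have QEh: "Q * E / h \<ge> 0" using Q0 E0 h by simp
  have "\<bar>d1\<bar> = (1 + \<alpha>) * (S / h) powr \<alpha> * (ch l / 2 / h) * Y * \<bar>c l\<bar>"
    unfolding d1_def abs_mult using \<alpha> S h Y0 ch_pos[of l] by simp
  also have "\<dots> \<le> 2 * e * (e / h) * Q * E"
  proof -
    have "ch l / 2 / h \<le> e / h" using ch_le[of l] l h by (intro divide_right_mono) (auto simp: e_def)
    then show ?thesis
      using \<alpha> S h Y0 ch_pos[of l] SP YQ cE Q0 e unfolding e_def[symmetric]
      by (intro mult_mono) auto
  qed
  also have "\<dots> = Q * E / h * (exp l * 2)" by (simp add: e)
  finally have 1: "\<bar>d1\<bar> \<le> Q * E / h * (exp l * 2)" .
  have 2: "\<bar>d2\<bar> \<le> Q * E / h * (exp l * 1)"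
  proof -
    have a: "(S / h) powr (1 + \<alpha>) * (Y * (h * (2 / (X * S\<^sup>2)))) = (S / h) powr \<alpha> * (Y * (2 / (X * S)))"
      unfolding pw using S h X by (simp add: power2_eq_square field_simps)
    have "ch l \<ge> 2" using exp_ge_add_one_self[of "l/2"] exp_ge_add_one_self[of "-l/2"] unfolding ch_def by linarith
    then have "2 / (X * S) \<le> y l" unfolding y_def S_def using sh_pos[OF l] X by (intro divide_right_mono) auto
    then have "Y * (2 / (X * S)) \<le> Y * y l" using Y0 by (intro mult_left_mono)
    also have "\<dots> = (h * y l) * exp (- (h * y l)) / h" using h by (simp add: Y_def)
    also have "\<dots> \<le> exp (- (h * y l) / 2) / h"
    proof (rule divide_right_mono)
      let ?z = "h * y l"
      have "0 \<le> ?z" using hy h X order_trans[of 0 "h / X"] by simp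
      then have "?z \<le> exp (?z/2)" using two_times_le_exp[of "?z/2"] by simp
      then have "?z * exp (- ?z) \<le> exp (?z/2) * exp (- ?z)" by (intro mult_right_mono) auto
      then show "?z * exp (- ?z) \<le> exp (- ?z / 2)" by (simp flip: exp_add)
    qed (use h in simp)
    also have "\<dots> \<le> Q / h" unfolding Q_def using hy h by (intro divide_right_mono) auto
    finally have b: "Y * (2 / (X * S)) \<le> Q / h" .
    have "\<bar>d2\<bar> = (S / h) powr \<alpha> * (Y * (2 / (X * S))) * \<bar>c l\<bar>"
      unfolding d2_def a abs_mult using Y0 S X by simp
    also have "\<dots> \<le> e * (Q / h) * E"
      using SP b cE Y0 S X Q0 h unfolding e_def by (intro mult_mono) auto
    also have "\<dots> \<le> (e * e) * (Q / h) * E" using e Q0 h E0 by (intro mult_right_mono) auto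
    finally show ?thesis by (simp add: e mult_ac)
  qed
  have 3: "\<bar>d3\<bar> \<le> Q * E / h * (exp l * (l * t0 + H\<^sup>2 * l\<^sup>2))"
  proof -
    have "\<bar>- t0 * sin (t0 * l) - H\<^sup>2 * l * cos (t0 * l)\<bar> \<le> \<bar>t0 * sin (t0 * l)\<bar> + \<bar>H\<^sup>2 * l * cos (t0 * l)\<bar>"
      by linarith
    also have "\<dots> \<le> t0 * 1 + H\<^sup>2 * l * 1" unfolding abs_mult using t0 l by (intro add_mono mult_mono) auto
    finally have "\<bar>c'\<bar> \<le> (t0 + H\<^sup>2 * l) * E" unfolding c'_def abs_mult using E0 by (simp add: mult_right_mono)
    moreover have "(S / h) powr (1 + \<alpha>) \<le> (l * e / h) * e"
      unfolding pw using sh_le_times[of l] SP S h l unfolding S_def e_def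
      by (intro mult_mono divide_right_mono) auto
    ultimately have "\<bar>d3\<bar> \<le> (l * e / h * e) * Q * ((t0 + H\<^sup>2 * l) * E)"
      unfolding d3_def abs_mult using YQ Y0 Q0 e l h by (intro mult_mono) auto
    then show ?thesis by (simp add: e power2_eq_square algebra_simps)
  qed
  have "\<bar>d1 + d2 + d3\<bar> \<le> \<bar>d1\<bar> + \<bar>d2\<bar> + \<bar>d3\<bar>" by linarith
  also have "\<dots> \<le> Q * E / h * (exp l * 2) + Q * E / h * (exp l * 1) + Q * E / h * (exp l * (l * t0 + H\<^sup>2 * l\<^sup>2))"
    by (intro add_mono 1 2 3)
  also have "\<dots> = Q / h * (E * exp l * (3 + l * t0 + H\<^sup>2 * l\<^sup>2))" by (simp add: algebra_simps)
  also have "\<dots> \<le> Q / h * (3 * exp (9/2) * (1 + t0 / H) * exp (- H * l))"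
    unfolding E_def using Q0 h l by (intro mult_left_mono gauss_poly_bound) auto
  also have "\<dots> = B h * H * exp (- H * l)" using H by (simp add: B_def Q_def)
  finally show ?thesis using D that by blast
qed

lemma B_nonneg: "h \<ge> 1 \<Longrightarrow> B h \<ge> 0" unfolding B_def using t0 H by simp

lemma r_increment:
  assumes "0 < l1" "l1 \<le> l2" "h \<ge> 1"
  shows "\<bar>r h l2 - r h l1\<bar> \<le> B h * exp (- H * l1) - B h * exp (- H * l2)"
proof (cases "l1 = l2")
  case False
  have "\<forall>l. \<exists>d. l > 0 \<longrightarrow> (r h has_real_derivative d) (at l) \<and> \<bar>d\<bar> \<le> B h * H * exp (- H * l)"
    using r_deriv_bound[OF _ assms(3)] by metis
  then obtain d where d: "\<And>l. l > 0 \<Longrightarrow> (r h has_real_derivative d l) (at l)" "\<And>l. l > 0 \<Longrightarrow> \<bar>d l\<bar> \<le> B h * H * exp (- H * l)"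
    by metis
  let ?\<phi> = "\<lambda>l. - (B h * exp (- H * l))"
  have \<phi>: "(?\<phi> has_real_derivative B h * H * exp (- H * l)) (at l)" for l
    by (auto intro!: derivative_eq_intros)
  have "norm (r h l2 - r h l1) \<le> ?\<phi> l2 - ?\<phi> l1"
  proof (rule differentiable_bound_general[where f' = d and \<phi>' = "\<lambda>l. B h * H * exp (- H * l)"])
    show "continuous_on {l1..l2} (r h)"
      by (intro continuous_at_imp_continuous_on ballI DERIV_isCont[OF d(1)]) (use assms in auto)
    show "continuous_on {l1..l2} ?\<phi>" by (intro continuous_intros)
  qed (use assms False d \<phi> in \<open>auto simp: has_real_derivative_iff_has_vector_derivative[symmetric]\<close>)
  then show ?thesis by simp
qed simp

text \<open>Far from sharp in X, but integrable in l and summable in h: it justifies integrating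
  \<open>p h\<close> and exchanging the sum over h with the integral.\<close>

lemma p_bound:
  assumes l: "l > 0" and h: "h \<ge> 1"
  shows "\<bar>p h l\<bar> \<le> 2 * exp 2 * X * exp (- h / (2 * X)) * exp (- l)"
proof -
  have S: "sh l > 0" using l by (rule sh_pos)
  have hy: "h / X \<le> h * y l" using y_ge[OF l] h X by (simp add: field_simps mult_left_mono)
  have y0: "y l > 0" unfolding y_def using S ch_pos[of l] X by simp
  have "\<bar>p h l\<bar> = sh l powr (\<alpha> - 1) * h powr (- \<alpha>) * exp (- h * y l) * \<bar>c l\<bar>"
    unfolding p_def abs_mult by simp
  also have "\<dots> \<le> sh l powr (\<alpha> - 1) * 1 * exp (- h * y l) * exp (- (H\<^sup>2 * l\<^sup>2) / 2)"
    using abs_c[of l] h \<alpha> by (intro mult_mono) (auto simp: powr_minus inverse_le_1_iff ge_one_powr_ge_zero)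
  \<comment> \<open>One half of the exponential is at most \<open>2 / y l\<close>, hence at most a
    multiple of \<open>sh l\<close>, and cancels the singularity of the power of \<open>sh\<close>
    at 0; the other half keeps the decay in h.\<close>
  also have "exp (- h * y l) = exp (- (h * y l / 2)) * exp (- (h * y l) / 2)" by (simp flip: exp_add)
  also have "exp (- (h * y l / 2)) \<le> 2 / y l"
  proof -
    have "h * y l / 2 \<le> exp (h * y l / 2)" using exp_ge_add_one_self[of "h * y l / 2"] by linarith
    moreover have "y l \<le> h * y l" using h y0 by simp
    ultimately have "y l / 2 \<le> exp (h * y l / 2)" by linarith
    then show ?thesis using y0 by (simp add: exp_minus field_simps)
  qed
  also have "2 / y l \<le> 2 * X * sh l" unfolding y_def
  proof -
    have "ch l \<ge> 1" using exp_ge_add_one_self[of "l/2"] exp_ge_add_one_self[of "-l/2"] unfolding ch_def by linarith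
    then show "2 / (ch l / (X * sh l)) \<le> 2 * X * sh l" using S X by (simp add: field_simps)
  qed
  also have "exp (- (h * y l) / 2) \<le> exp (- h / (2 * X))" using hy X by (simp add: field_simps)
  finally have "\<bar>p h l\<bar> \<le> (sh l powr (\<alpha> - 1) * sh l) * (2 * X * exp (- h / (2 * X))) * exp (- (H\<^sup>2 * l\<^sup>2) / 2)"
    using X S by (simp add: mult_ac)
  also have "sh l powr (\<alpha> - 1) * sh l = sh l powr \<alpha>" using S by (simp add: powr_diff)
  also have "sh l powr \<alpha> \<le> exp (l / 2)" using sh_powr_le[OF l, of 1] by simp
  also have "exp (- (H\<^sup>2 * l\<^sup>2) / 2) \<le> exp (- l\<^sup>2 / 2)" using H by (simp add: mult_le_cancel_right1)
  finally have "\<bar>p h l\<bar> \<le> 2 * X * exp (- h / (2 * X)) * (exp (l / 2) * exp (- l\<^sup>2 / 2))"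
    using X by (simp add: mult_ac)
  also have "exp (l / 2) * exp (- l\<^sup>2 / 2) \<le> exp 2 * exp (- l)"
  proof -
    have "(l - 3/2)\<^sup>2 \<ge> 0" by simp
    then have "l / 2 + - l\<^sup>2 / 2 \<le> 2 + - l" by (simp add: power2_eq_square algebra_simps)
    then show ?thesis by (simp flip: exp_add)
  qed
  finally show ?thesis using X by (simp add: mult_ac)
qed

definition "q h x = r h (ln (1 + h / x))"

lemma p_continuous: "h \<ge> 1 \<Longrightarrow> continuous_on {0<..} (p h)"
proof -
  have 1: "continuous_on {0<..} sh" "continuous_on {0<..} ch" unfolding sh_def ch_def by (intro continuous_intros; simp)+
  have 2: "continuous_on {0<..} c" unfolding c_def gauss_cos_def by (intro continuous_intros) auto
  have 3: "sh l \<noteq> 0" if "l \<in> {0<..}" for l using sh_pos[of l] that by auto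
  show "continuous_on {0<..} (p h)"
    unfolding p_def y_def using X 3 by (intro continuous_intros 1 2) auto
qed

lemma exp_minus_integrable: "(\<lambda>l::real. exp (- l)) integrable_on {0<..}"
    "integral {0<..} (\<lambda>l::real. exp (- l)) = 1"
proof -
  have 1: "((\<lambda>l::real. exp (- 1 * l)) has_integral exp (- 1 * 0) / 1) {0..}"
    by (rule has_integral_exp_minus_to_infinity) simp
  then have "((\<lambda>l::real. exp (- l)) has_integral 1) {0..}" by simp
  then have "((\<lambda>l::real. exp (- l)) has_integral 1) {0<..}"
    by (rule has_integral_spike_set_eq[of "{0..}" "{0<..}", THEN iffD1, rotated 2])
       ((rule negligible_subset[of "{0}"]; auto)+)
  then show "(\<lambda>l::real. exp (- l)) integrable_on {0<..}" "integral {0<..} (\<lambda>l::real. exp (- l)) = 1"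
    by (auto simp: has_integral_iff)
qed

lemma p_integrable: "h \<ge> 1 \<Longrightarrow> p h absolutely_integrable_on {0<..}"
proof (rule measurable_bounded_by_integrable_imp_absolutely_integrable)
  assume h: "h \<ge> 1"
  show "p h \<in> borel_measurable (lebesgue_on {0<..})"
    by (rule continuous_imp_measurable_on_sets_lebesgue[OF p_continuous[OF h]]) simp
  show "(\<lambda>l. 2 * exp 2 * X * exp (- h / (2 * X)) * exp (- l)) integrable_on {0<..}"
    by (intro integrable_on_mult_right exp_minus_integrable)
  show "norm (p h l) \<le> 2 * exp 2 * X * exp (- h / (2 * X)) * exp (- l)" if "l \<in> {0<..}" for l
    using p_bound[of l h] that h by simp
qed auto

text \<open>The substitution x = h / (e^l - 1) inverts l = ln (1 + h/x). Its Jacobian h / (sh l)^2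
  is what turns \<open>r h\<close> into \<open>p h\<close>.\<close>

lemma q_integral:
  assumes h: "h \<ge> 1"
  shows "q h absolutely_integrable_on {0<..}" "integral {0<..} (q h) = integral {0<..} (p h)"
proof -
  define g where "g l = h / (exp l - 1)" for l :: real
  define g' where "g' l = - h * exp l / (exp l - 1)\<^sup>2" for l :: real
  have eq: "\<bar>g' l\<bar> *\<^sub>R q h (g l) = p h l" if "l \<in> {0<..}" for l
  proof -
    have l: "l > 0" using that by simp
    have S: "sh l > 0" using l by (rule sh_pos)
    have e: "exp l > 1" using l by simp
    have 1: "q h (g l) = r h l" using h e by (simp add: q_def g_def)
    have "exp l - 1 = exp (l / 2) * sh l" by (simp add: sh_def algebra_simps flip: exp_add)
    then have "(exp l - 1)\<^sup>2 = exp l * (sh l)\<^sup>2" by (simp add: power_mult_distrib flip: exp_double)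
    then have 2: "\<bar>g' l\<bar> = h / (sh l)\<^sup>2" using h by (simp add: g'_def abs_mult)
    have "(sh l / h) powr (1 + \<alpha>) = sh l powr (1 + \<alpha>) * h powr (- 1 - \<alpha>)"
      using S h by (simp add: powr_divide powr_minus divide_simps flip: powr_add)
    moreover have "sh l powr (1 + \<alpha>) = sh l powr (\<alpha> - 1) * (sh l)\<^sup>2"
      using S by (simp add: powr_add powr_diff power2_eq_square)
    moreover have "h powr (- 1 - \<alpha>) = h powr (- \<alpha>) / h"
      using h by (simp add: powr_diff powr_minus field_simps)
    ultimately show ?thesis using 1 2 S h by (simp add: r_def p_def)
  qed
  have img: "g ` {0<..} = {0<..}"
  proof
    show "{0<..} \<subseteq> g ` {0<..}"
    proof
      fix x :: real assume x: "x \<in> {0<..}"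
      then have "g (ln (1 + h / x)) = x" using h by (simp add: g_def add_pos_pos)
      moreover have "h / x > 0" using x h by simp
      then have "ln (1 + h / x) > 0" by (intro ln_gt_zero) linarith
      ultimately show "x \<in> g ` {0<..}" by (metis greaterThan_iff image_eqI)
    qed
  qed (use h in \<open>auto simp: g_def\<close>)
  have "inj_on g {0<..}" unfolding g_def using h by (auto intro!: inj_onI simp: field_simps)
  moreover have "(g has_field_derivative g' l) (at l within {0<..})" if "l \<in> {0<..}" for l
  proof -
    have "exp l \<noteq> 1" using that by simp
    then show ?thesis unfolding g_def g'_def by (auto intro!: derivative_eq_intros simp: power2_eq_square)
  qed
  ultimately have "(\<lambda>l. \<bar>g' l\<bar> *\<^sub>R q h (g l)) absolutely_integrable_on {0<..} \<and> integral {0<..} (\<lambda>l. \<bar>g' l\<bar> *\<^sub>R q h (g l)) = integral {0<..} (p h)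
       \<longleftrightarrow> q h absolutely_integrable_on g ` {0<..} \<and> integral (g ` {0<..}) (q h) = integral {0<..} (p h)"
    by (intro has_absolute_integral_change_of_variables_real) auto
  moreover have "(\<lambda>l. \<bar>g' l\<bar> *\<^sub>R q h (g l)) absolutely_integrable_on {0<..}"
    by (rule set_integrable_cong[THEN iffD1, OF refl refl _ p_integrable[OF h]]) (simp only: eq)
  moreover have "integral {0<..} (\<lambda>l. \<bar>g' l\<bar> *\<^sub>R q h (g l)) = integral {0<..} (p h)"
    by (rule integral_cong) (simp only: eq)
  ultimately show "q h absolutely_integrable_on {0<..}" "integral {0<..} (q h) = integral {0<..} (p h)"
    unfolding img by auto
qed

text \<open>As x runs over the half-line, l = ln (1 + h/x) runs over it monotonically, so
  \<open>q h\<close> has the same total variation as \<open>r h\<close>; sum and integral therefore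
  differ by at most \<open>B h\<close>.\<close>

lemma q_sum_integral:
  assumes h: "h \<ge> 1" and S: "(\<lambda>n. q h (real (Suc n))) sums S"
  shows "\<bar>S - integral {0<..} (p h)\<bar> \<le> B h"
proof -
  define K where "K x = B h * exp (- H * ln (1 + h / x))" for x
  have "\<bar>(\<Sum>n<Suc N. q h (real (Suc n))) - integral {0..real (Suc N)} (q h)\<bar> \<le> B h" for N
  proof -
    have "\<bar>(\<Sum>n<Suc N. q h (real (Suc n))) - integral {0..real (Suc N)} (q h)\<bar> \<le> K (real (Suc N))"
    proof (rule sum_integral_increment_bound)
      fix a b :: real assume ab: "0 < a" "a \<le> b"
      have "h / b \<le> h / a" using ab h by (intro divide_left_mono) auto
      moreover have "h / b > 0" "h / a > 0" using ab h by auto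
      ultimately have "\<bar>r h (ln (1 + h / a)) - r h (ln (1 + h / b))\<bar> \<le> B h * exp (- H * ln (1 + h / b)) - B h * exp (- H * ln (1 + h / a))"
        using h by (intro r_increment) auto
      then show "\<bar>q h b - q h a\<bar> \<le> K b - K a" unfolding q_def K_def by (subst abs_minus_commute)
    qed (use B_nonneg[OF h] integral_to_infinity(1)[OF q_integral(1)[OF h], of "Suc N"] in \<open>auto simp: K_def\<close>)
    also have "\<dots> \<le> B h * 1" unfolding K_def using B_nonneg[OF h] h H
      by (intro mult_left_mono) auto
    finally show ?thesis by simp
  qed
  moreover have "(\<lambda>N. (\<Sum>n<Suc N. q h (real (Suc n))) - integral {0..real (Suc N)} (q h)) \<longlonglongrightarrow> S - integral {0<..} (q h)"
    using S integral_to_infinity(2)[OF q_integral(1)[OF h]] unfolding sums_def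
    by (intro tendsto_diff LIMSEQ_Suc[of "\<lambda>N. \<Sum>n<N. q h (real (Suc n))"] LIMSEQ_Suc[of "\<lambda>N. integral {0..real N} (q h)"])
  ultimately have "norm (S - integral {0<..} (q h)) \<le> B h"
    by (intro Lim_norm_ubound[of sequentially]) auto
  then show ?thesis by (simp add: q_integral(2)[OF h])
qed

text \<open>The polylogarithm of order \<alpha> at e^{-z}.\<close>

definition "Gs z = (\<Sum>n. real (Suc n) powr (- \<alpha>) * exp (- real (Suc n) * z))"

lemma summable_Gs:
  assumes "z > 0" shows "summable (\<lambda>n. real (Suc n) powr (- \<alpha>) * exp (- real (Suc n) * z))"
proof (rule summable_comparison_test')
  show "summable (\<lambda>n. exp (- z) ^ n)" using assms by (intro summable_geometric) auto
  fix n
  have "real (Suc n) powr (- \<alpha>) * exp (- real (Suc n) * z) \<le> 1 * exp (- real n * z)"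
    using \<alpha> assms by (intro mult_mono) (auto simp: powr_minus inverse_le_1_iff ge_one_powr_ge_zero algebra_simps)
  then show "norm (real (Suc n) powr (- \<alpha>) * exp (- real (Suc n) * z)) \<le> exp (- z) ^ n"
    by (simp flip: exp_of_nat_mult)
qed

lemma p_sums: "l > 0 \<Longrightarrow> (\<lambda>n. p (real (Suc n)) l) sums (sh l powr (\<alpha> - 1) * Gs (y l) * c l)"
proof -
  assume l: "l > 0"
  have "y l > 0" using y_ge[OF l] X by (smt (verit) divide_pos_pos)
  from summable_sums[OF summable_Gs[OF this]]
  have "(\<lambda>n. sh l powr (\<alpha> - 1) * (real (Suc n) powr (- \<alpha>) * exp (- real (Suc n) * y l)) * c l) sums (sh l powr (\<alpha> - 1) * Gs (y l) * c l)"
    unfolding Gs_def by (intro sums_mult sums_mult2)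
  then show ?thesis unfolding p_def by (simp only: mult.assoc)
qed

lemma p_integral_sums:
  "(\<lambda>l. sh l powr (\<alpha> - 1) * Gs (y l) * c l) absolutely_integrable_on {0<..}"
  "(\<lambda>n. integral {0<..} (p (real (Suc n)))) sums integral {0<..} (\<lambda>l. sh l powr (\<alpha> - 1) * Gs (y l) * c l)"
proof -
  let ?F = "\<lambda>n l. indicator {0<..} l *\<^sub>R p (real (Suc n)) l"
  define C where "C n = 2 * exp 2 * X * exp (- real (Suc n) / (2 * X))" for n
  have I: "integrable lebesgue (?F n)" for n
    using p_integrable[of "real (Suc n)"] unfolding set_integrable_def by simp
  have exp_abs: "(\<lambda>l::real. exp (- l)) absolutely_integrable_on {0<..}"
    by (rule nonnegative_absolutely_integrable_1[OF exp_minus_integrable(1)]) auto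
  have bnd: "norm (?F n l) \<le> C n * (indicator {0<..} l * exp (- l))" for n l
    using p_bound[of l "real (Suc n)"] by (auto simp: indicator_def C_def)
  have sumC: "summable C"
  proof -
    have "C = (\<lambda>n. 2 * exp 2 * X * exp (- 1 / (2 * X)) * exp (- 1 / (2 * X)) ^ n)"
    proof
      fix n
      have "- real (Suc n) / (2 * X) = - 1 / (2 * X) + real n * (- 1 / (2 * X))"
        using X by (simp add: field_simps)
      then show "C n = 2 * exp 2 * X * exp (- 1 / (2 * X)) * exp (- 1 / (2 * X)) ^ n"
        unfolding C_def by (simp only: exp_add exp_of_nat_mult mult.assoc)
    qed
    moreover have "summable (\<lambda>n. 2 * exp 2 * X * exp (- 1 / (2 * X)) * exp (- 1 / (2 * X)) ^ n)"
      using X by (intro summable_mult summable_geometric) auto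
    ultimately show ?thesis by simp
  qed
  have s1: "AE l in lebesgue. summable (\<lambda>n. norm (?F n l))"
  proof (rule AE_I2)
    fix l :: real
    show "summable (\<lambda>n. norm (?F n l))"
      by (rule summable_comparison_test'[OF summable_mult2[OF sumC]]) (use bnd in simp)
  qed
  have s2: "summable (\<lambda>n. LINT l|lebesgue. norm (?F n l))"
  proof (rule summable_comparison_test'[OF sumC])
    fix n
    have "(LINT l|lebesgue. norm (?F n l)) \<le> (LINT l|lebesgue. C n * (indicator {0<..} l * exp (- l)))"
      by (rule integral_mono) (use I bnd exp_abs in \<open>auto simp: set_integrable_def\<close>)
    also have "\<dots> = C n * integral {0<..} (\<lambda>l::real. exp (- l))"
      using set_lebesgue_integral_eq_integral(2)[OF exp_abs] by (simp add: set_lebesgue_integral_def)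
    finally show "norm (LINT l|lebesgue. norm (?F n l)) \<le> C n"
      by (simp add: exp_minus_integrable)
  qed
  have eq: "(\<Sum>n. ?F n l) = indicator {0<..} l *\<^sub>R (sh l powr (\<alpha> - 1) * Gs (y l) * c l)" for l
    using p_sums[of l] by (cases "l > 0") (auto simp: sums_iff)
  show abs: "(\<lambda>l. sh l powr (\<alpha> - 1) * Gs (y l) * c l) absolutely_integrable_on {0<..}"
    using integrable_suminf[OF I s1 s2] unfolding eq set_integrable_def .
  have "(\<lambda>n. LINT l|lebesgue. ?F n l) sums (LINT l|lebesgue. (\<Sum>n. ?F n l))"
    by (rule sums_integral[OF I s1 s2])
  moreover have "(LINT l|lebesgue. ?F n l) = integral {0<..} (p (real (Suc n)))" for n
    using set_lebesgue_integral_eq_integral(2)[OF p_integrable[of "real (Suc n)"]] by (simp add: set_lebesgue_integral_def)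
  ultimately show "(\<lambda>n. integral {0<..} (p (real (Suc n)))) sums integral {0<..} (\<lambda>l. sh l powr (\<alpha> - 1) * Gs (y l) * c l)"
    unfolding eq using set_lebesgue_integral_eq_integral(2)[OF abs] by (simp add: set_lebesgue_integral_def)
qed

text \<open>Summing the errors \<open>B h\<close> over the shifts costs only the factor ln (4 X).
  The total, of order (1 + t0/H) ln X / H, is small when H exceeds the square root of t0 by a power
  and X is polynomial in t0.\<close>

theorem offdiag_main:
  assumes T: "((\<lambda>(h, m). q (real (Suc h)) (real (Suc m))) has_sum T) UNIV"
  shows "\<bar>T - integral {0<..} (\<lambda>l. sh l powr (\<alpha> - 1) * Gs (y l) * c l)\<bar> \<le> 3 * exp (9/2) * (1 + t0 / H) / H * ln (4 * X)"
proof -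
  let ?f = "\<lambda>(h, m). q (real (Suc h)) (real (Suc m))"
  let ?P = "\<lambda>h. integral {0<..} (p (real (Suc h)))"
  have slice: "\<exists>S. ((\<lambda>m. q (real (Suc h)) (real (Suc m))) has_sum S) UNIV" for h
  proof -
    have "?f summable_on (Pair h ` UNIV)"
      by (rule summable_on_subset_banach[of _ UNIV]) (use T in \<open>auto simp: summable_on_def\<close>)
    then have "(?f \<circ> Pair h) summable_on UNIV"
      by (subst (asm) summable_on_reindex) (auto intro: inj_onI)
    then show ?thesis by (simp add: summable_on_def o_def)
  qed
  then obtain S where S: "\<And>h. ((\<lambda>m. q (real (Suc h)) (real (Suc m))) has_sum S h) UNIV" by metis
  have "(S has_sum T) UNIV"
    by (rule has_sum_SigmaD[where f = ?f and B = "\<lambda>_. UNIV"]) (use T S in auto)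
  then have ST: "S sums T" by (rule has_sum_imp_sums)
  let ?C = "3 * exp (9/2) * (1 + t0 / H) / H"
  have bound: "\<bar>S h - ?P h\<bar> \<le> ?C * (exp (- real (Suc h) / (2 * X)) / real (Suc h))" for h
    using q_sum_integral[OF _ has_sum_imp_sums[OF S[of h]]] by (simp add: B_def mult_ac)
  have "(\<lambda>h. S h - ?P h) sums (T - integral {0<..} (\<lambda>l. sh l powr (\<alpha> - 1) * Gs (y l) * c l))"
    by (intro sums_diff ST p_integral_sums)
  then have "\<bar>T - integral {0<..} (\<lambda>l. sh l powr (\<alpha> - 1) * Gs (y l) * c l)\<bar> = norm (\<Sum>h. S h - ?P h)"
    by (simp add: sums_iff)
  also have "\<dots> \<le> (\<Sum>h. ?C * (exp (- real (Suc h) / (2 * X)) / real (Suc h)))"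
    by (rule norm_suminf_le) (use bound in simp, intro summable_mult harmonic_exp_sum X)
  also have "\<dots> = ?C * (\<Sum>h. exp (- real (Suc h) / (2 * X)) / real (Suc h))"
    by (rule suminf_mult) (intro harmonic_exp_sum X)
  also have "\<dots> \<le> ?C * ln (4 * X)"
    by (intro mult_left_mono harmonic_exp_sum X) (use t0 H in simp)
  finally show ?thesis .
qed

end

subsection \<open>Evaluation of the off-diagonal integral\<close>

lemma exp_dominated_integral:
  fixes f :: "real \<Rightarrow> real"
  assumes "continuous_on {0<..} f" "\<And>l. l > 0 \<Longrightarrow> \<bar>f l\<bar> \<le> C * exp (- a * l)" "a > 0"
  shows "f absolutely_integrable_on {0<..}" "\<bar>integral {0<..} f\<bar> \<le> C / a"
proof -
  have "((\<lambda>l::real. exp (- a * l)) has_integral exp (- a * 0) / a) {0..}"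
    by (rule has_integral_exp_minus_to_infinity) fact
  then have "((\<lambda>l::real. exp (- a * l)) has_integral exp (- a * 0) / a) {0<..}"
    by (rule has_integral_spike_set_eq[of "{0..}" "{0<..}", THEN iffD1, rotated 2])
       ((rule negligible_subset[of "{0}"]; auto)+)
  from has_integral_mult_right[OF this, of C]
  have 1: "((\<lambda>l. C * exp (- a * l)) has_integral C / a) {0<..}" by simp
  show 2: "f absolutely_integrable_on {0<..}"
    by (rule measurable_bounded_by_integrable_imp_absolutely_integrable[OF continuous_imp_measurable_on_sets_lebesgue[OF assms(1)] _ has_integral_integrable[OF 1]])
       (use assms in auto)
  have "norm (integral {0<..} f) \<le> integral {0<..} (\<lambda>l. C * exp (- a * l))"
    by (rule integral_norm_bound_integral) (use 1 2 assms in \<open>auto simp: set_lebesgue_integral_eq_integral(1) has_integral_iff\<close>)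
  then show "\<bar>integral {0<..} f\<bar> \<le> C / a" using 1 by (simp add: has_integral_iff)
qed

lemma gauss_le_exp: "exp (- (H\<^sup>2 * l\<^sup>2) / 2) \<le> 2 * exp (- H * l)" for H l :: real
proof -
  have "(H * l - 1)\<^sup>2 \<ge> 0" by simp
  then have "- (H\<^sup>2 * l\<^sup>2) / 2 \<le> 1 / 2 + - H * l" by (simp add: power2_eq_square algebra_simps)
  then have "exp (- (H\<^sup>2 * l\<^sup>2) / 2) \<le> exp (1 / 2) * exp (- H * l)" by (simp flip: exp_add)
  also note exp_half_le2
  finally show ?thesis by simp
qed

definition "gauss_K = 3 * exp (9/2 :: real)"

lemma gauss_poly:
  assumes "H \<ge> 1" "l \<ge> 0"
  shows "l\<^sup>2 * exp (- (H\<^sup>2 * l\<^sup>2) / 2) \<le> gauss_K / H\<^sup>2 * exp (- H * l)"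
    and "l * exp (l / 2) * exp (- (H\<^sup>2 * l\<^sup>2) / 2) \<le> gauss_K / H * exp (- H * l)"
    and "exp (l / 2) * exp (- (H\<^sup>2 * l\<^sup>2) / 2) \<le> gauss_K * exp (- H * l)"
proof -
  \<comment> \<open>An instance with t0 = 0, taken for its bound
    \<open>gauss_poly_bound\<close>.\<close>
  interpret Z: offdiag 0 1 H 0 by standard (use assms in auto)
  let ?E = "exp (- (H\<^sup>2 * l\<^sup>2) / 2)"
  have *: "?E * exp l * (3 + H\<^sup>2 * l\<^sup>2) \<le> gauss_K * exp (- H * l)"
    using Z.gauss_poly_bound[OF assms(2)] by (simp add: gauss_K_def)
  have gen: "a * ?E \<le> gauss_K * exp (- H * l)" if "a \<le> exp l * (3 + H\<^sup>2 * l\<^sup>2)" for a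
  proof -
    have "a * ?E \<le> (exp l * (3 + H\<^sup>2 * l\<^sup>2)) * ?E" by (rule mult_right_mono[OF that]) simp
    also have "\<dots> = ?E * exp l * (3 + H\<^sup>2 * l\<^sup>2)" by (simp only: mult_ac)
    also note *
    finally show ?thesis .
  qed
  have el: "exp l \<ge> 1" using assms by simp
  have el2: "exp (l / 2) \<le> exp l" using assms by simp
  have "H\<^sup>2 * l\<^sup>2 \<le> 1 * (3 + H\<^sup>2 * l\<^sup>2)" by simp
  also have "\<dots> \<le> exp l * (3 + H\<^sup>2 * l\<^sup>2)" by (rule mult_right_mono[OF el]) simp
  finally have "H\<^sup>2 * l\<^sup>2 * ?E \<le> gauss_K * exp (- H * l)" by (rule gen)
  then show "l\<^sup>2 * ?E \<le> gauss_K / H\<^sup>2 * exp (- H * l)" using assms by (simp add: field_simps)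
  have "(H * l - 1)\<^sup>2 \<ge> 0" "0 \<le> H\<^sup>2 * l\<^sup>2" by simp_all
  then have "H * l \<le> 3 + H\<^sup>2 * l\<^sup>2" by (simp add: power2_eq_square algebra_simps)
  then have "exp (l / 2) * (H * l) \<le> exp l * (3 + H\<^sup>2 * l\<^sup>2)" using assms el2 by (intro mult_mono) auto
  then have "exp (l / 2) * (H * l) * ?E \<le> gauss_K * exp (- H * l)" by (rule gen)
  then show "l * exp (l / 2) * ?E \<le> gauss_K / H * exp (- H * l)" using assms by (simp add: field_simps)
  have "exp (l / 2) * 1 \<le> exp l * (3 + H\<^sup>2 * l\<^sup>2)" using el2 by (intro mult_mono) auto
  then show "exp (l / 2) * ?E \<le> gauss_K * exp (- H * l)" using gen by simp
qed

lemma gauss_K_pos: "gauss_K > 0" by (simp add: gauss_K_def)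

lemma even_integral_half:
  fixes f :: "real \<Rightarrow> real"
  assumes f: "integrable lborel f" and even: "\<And>x. f (- x) = f x"
  shows "integral {0<..} f = (LINT x|lborel. f x) / 2"
proof -
  have i1: "integrable lborel (\<lambda>x. indicator {0<..} x *\<^sub>R f x)" and i2: "integrable lborel (\<lambda>x. indicator {..0} x *\<^sub>R f x)"
    by (rule integrable_mult_indicator[OF _ f]; simp)+
  have "(LINT x|lborel. f x) = (LINT x|lborel. indicator {0<..} x *\<^sub>R f x + indicator {..0} x *\<^sub>R f x)"
    by (rule Bochner_Integration.integral_cong) (auto simp: indicator_def)
  also have "\<dots> = (LINT x|lborel. indicator {0<..} x *\<^sub>R f x) + (LINT x|lborel. indicator {..0} x *\<^sub>R f x)"
    by (rule Bochner_Integration.integral_add[OF i1 i2])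
  also have "(LINT x|lborel. indicator {..0} x *\<^sub>R f x) = (LINT x|lborel. indicator {..0} (- x) *\<^sub>R f (- x))"
    using lborel_integral_real_affine[of "-1" "\<lambda>x. indicator {..0} x *\<^sub>R f x" 0] by simp
  also have "\<dots> = (LINT x|lborel. indicator {0<..} x *\<^sub>R f x)"
  proof (rule integral_cong_AE)
    show "AE x in lborel. indicator {..0} (- x) *\<^sub>R f (- x) = indicator {0<..} x *\<^sub>R f x"
      using AE_lborel_singleton[of 0] by eventually_elim (auto simp: indicator_def even)
  qed (use f in \<open>measurable\<close>)
  finally have "(LINT x|lborel. f x) = 2 * (LINT x|lborel. indicator {0<..} x *\<^sub>R f x)" by simp
  moreover have "(LINT x|lborel. indicator {0<..} x *\<^sub>R f x) = integral {0<..} f"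
    using set_borel_integral_eq_integral(2)[of "{0<..}" f] i1 by (simp add: set_integrable_def set_lebesgue_integral_def)
  ultimately show ?thesis by simp
qed

text \<open>Up to a factor the Gaussian in l is the normal density of deviation 1/H, so its
  characteristic function applies with frequency t. The result is tiny as soon as t is much larger
  than H.\<close>

lemma integral_gauss_cos:
  assumes "H > 0"
  shows "integral {0<..} (gauss_cos t H) = sqrt (pi / 2) / H * exp (- (t\<^sup>2 / H\<^sup>2) / 2)"
proof -
  have 1: "has_bochner_integral lborel (\<lambda>l. normal_density 0 (1 / H) l * cos (t * l)) (gauss_cos 0 (1 / H) t)"
    by (rule normal_density_cos) (use assms in simp)
  have nd: "sqrt (2 * pi) / H * normal_density 0 (1 / H) l = exp (- (H\<^sup>2 * l\<^sup>2) / 2)" for l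
    using assms by (simp add: normal_density_def real_sqrt_mult real_sqrt_divide power_divide field_simps)
  have "has_bochner_integral lborel (\<lambda>l. sqrt (2 * pi) / H * (normal_density 0 (1 / H) l * cos (t * l))) (sqrt (2 * pi) / H * gauss_cos 0 (1 / H) t)"
    by (rule has_bochner_integral_mult_right[OF 1])
  also have "(\<lambda>l. sqrt (2 * pi) / H * (normal_density 0 (1 / H) l * cos (t * l))) = gauss_cos t H"
    unfolding mult.assoc[symmetric] nd by (simp add: gauss_cos_def fun_eq_iff)
  finally have 2: "has_bochner_integral lborel (gauss_cos t H) (sqrt (2 * pi) / H * gauss_cos 0 (1 / H) t)" .
  have "integral {0<..} (gauss_cos t H) = (LINT x|lborel. gauss_cos t H x) / 2"
    by (rule even_integral_half) (use 2 in \<open>auto simp: has_bochner_integral_iff\<close>)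
  also have "\<dots> = sqrt (2 * pi) / H * gauss_cos 0 (1 / H) t / 2"
    using 2 by (simp add: has_bochner_integral_iff)
  also have "sqrt (2 * pi) = 2 * sqrt (pi / 2)"
    by (simp add: real_sqrt_mult real_sqrt_divide field_simps)
  also have "gauss_cos 0 (1 / H) t = exp (- (t\<^sup>2 / H\<^sup>2) / 2)" by (simp add: gauss_cos_def power_divide)
  finally show ?thesis by simp
qed

section \<open>Hyperbolic functions near 0\<close>

lemma ch_ge_2: "ch l \<ge> 2"
  using exp_ge_add_one_self[of "l/2"] exp_ge_add_one_self[of "-l/2"] unfolding ch_def by linarith

lemma ch_minus_2: assumes "l \<ge> 0" shows "ch l - 2 \<le> l\<^sup>2 / 4 * exp (l / 2)"
proof -
  have "ch l - 2 = (sh (l / 2))\<^sup>2"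
    by (simp add: ch_def sh_def power2_eq_square algebra_simps flip: exp_add)
  also have "\<dots> \<le> (l / 2 * exp (l / 2 / 2))\<^sup>2"
    using sh_le_times[of "l/2"] sh_ge[of "l/2"] assms by (intro power_mono) auto
  finally show ?thesis by (simp add: power_mult_distrib power_divide flip: exp_double)
qed

lemma ch_ge_exp: "ch l \<ge> exp (l / 2)" by (simp add: ch_def)

text \<open>The inequality tanh x \<le> x at x = l / 2.\<close>

lemma two_sh_le: assumes "l \<ge> 0" shows "2 * sh l \<le> l * ch l"
proof -
  have "\<And>x. 0 \<le> x \<Longrightarrow> x \<le> l \<Longrightarrow> ((\<lambda>l. l * ch l - 2 * sh l) has_real_derivative x * (sh x / 2)) (at x)"
    by (auto intro!: derivative_eq_intros sh_deriv ch_deriv)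
  moreover have "x * (sh x / 2) \<ge> 0" if "x \<ge> 0" for x using sh_ge[OF that] that by simp
  ultimately have "0 * ch 0 - 2 * sh 0 \<le> l * ch l - 2 * sh l"
    by (intro DERIV_nonneg_imp_nondecreasing[OF assms]) blast
  then show ?thesis by (simp add: sh_def)
qed

lemma sh_minus: assumes "l \<ge> 0" shows "sh l - l \<le> l ^ 3 / 8 * exp (l / 2)"
proof -
  have "sh l - l \<le> l * (ch l - 2) / 2" using two_sh_le[OF assms] by (simp add: algebra_simps)
  also have "\<dots> \<le> l * (l\<^sup>2 / 4 * exp (l / 2)) / 2"
    by (intro divide_right_mono mult_left_mono ch_minus_2 assms) simp
  finally show ?thesis by (simp add: power2_eq_square power3_eq_cube)
qed

lemma inverse_sh_diff:
  assumes "l > 0" shows "0 \<le> 1 / l - 1 / sh l" "1 / l - 1 / sh l \<le> l / 8 * exp (l / 2)"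
proof -
  have s: "sh l > 0" "sh l \<ge> l" using sh_pos[OF assms] sh_ge[of l] assms by auto
  show "0 \<le> 1 / l - 1 / sh l" using s assms by (simp add: field_simps)
  have "1 / l - 1 / sh l = (sh l - l) / (l * sh l)" using s assms by (simp add: field_simps)
  also have "\<dots> \<le> (l ^ 3 / 8 * exp (l / 2)) / (l * l)"
    using s assms sh_minus[of l] by (intro frac_le mult_left_mono) auto
  finally show "1 / l - 1 / sh l \<le> l / 8 * exp (l / 2)" using assms by (simp add: power3_eq_cube)
qed

lemma coth_diff:
  assumes "l > 0" shows "0 \<le> ch l / sh l - 2 / l" "ch l / sh l - 2 / l \<le> l / 4 * exp (l / 2)"
proof -
  have s: "sh l > 0" "sh l \<ge> l" using sh_pos[OF assms] sh_ge[of l] assms by auto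
  have eq: "ch l / sh l - 2 / l = (l * ch l - 2 * sh l) / (l * sh l)" using s assms by (simp add: field_simps)
  show "0 \<le> ch l / sh l - 2 / l" unfolding eq using two_sh_le[of l] s assms by simp
  have "l * ch l - 2 * sh l \<le> l * (ch l - 2)" using s by (simp add: algebra_simps)
  also have "\<dots> \<le> l * (l\<^sup>2 / 4 * exp (l / 2))" using assms by (intro mult_left_mono ch_minus_2) auto
  finally have "(l * ch l - 2 * sh l) / (l * sh l) \<le> (l * (l\<^sup>2 / 4 * exp (l / 2))) / (l * l)"
    using s assms two_sh_le[of l] by (intro frac_le mult_left_mono) auto
  then show "ch l / sh l - 2 / l \<le> l / 4 * exp (l / 2)" unfolding eq using assms by (simp add: power2_eq_square)
qed

text \<open>What remains of the geometric sum \<open>1 / (e^z - 1)\<close>, up to sign, when its pole is removed.\<close>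

definition beta :: "real \<Rightarrow> real" where "beta z = 1 / z - 1 / (exp z - 1)"

text \<open>Because 1 / (e^z - 1) = (coth (z/2) - 1) / 2, bounds for \<open>beta\<close> follow from
  those for the hyperbolic cotangent.\<close>

lemma beta_alt: "z > 0 \<Longrightarrow> beta z = 1 / 2 - (ch z / sh z - 2 / z) / 2"
proof -
  assume z: "z > 0"
  have "exp z - 1 = exp (z / 2) * sh z" by (simp add: sh_def algebra_simps flip: exp_add)
  moreover have "ch z = 2 * exp (- z / 2) + sh z" by (simp add: ch_def sh_def)
  ultimately show ?thesis using sh_pos[OF z] z by (simp add: beta_def exp_minus field_simps)
qed

lemma beta_bounds:
  assumes "z > 0"
  shows "0 \<le> beta z" "beta z \<le> 1 / 2" "beta z \<le> 1 / z" "1 - 2 * beta z \<le> z / 4 * exp (z / 2)"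
proof -
  have "exp z - 1 \<ge> z" using exp_ge_add_one_self[of z] by linarith
  then show "0 \<le> beta z" using assms by (simp add: beta_def field_simps)
  show "beta z \<le> 1 / z" using assms by (simp add: beta_def)
  have gen: "0 \<le> D \<Longrightarrow> 1 / 2 - D / 2 \<le> 1 / 2" "D \<le> E \<Longrightarrow> 1 - 2 * (1 / 2 - D / 2) \<le> E" for D E :: real
    by simp_all
  show "beta z \<le> 1 / 2" unfolding beta_alt[OF assms] by (rule gen(1)[OF coth_diff(1)[OF assms]])
  show "1 - 2 * beta z \<le> z / 4 * exp (z / 2)" unfolding beta_alt[OF assms] by (rule gen(2)[OF coth_diff(2)[OF assms]])
qed

lemma beta_deriv: "z > 0 \<Longrightarrow> (beta has_real_derivative 1 / (sh z)\<^sup>2 - 1 / z\<^sup>2) (at z)"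
proof -
  assume z: "z > 0"
  have "exp z - 1 = exp (z / 2) * sh z" by (simp add: sh_def algebra_simps flip: exp_add)
  then have e: "(exp z - 1)\<^sup>2 = exp z * (sh z)\<^sup>2" by (simp add: power_mult_distrib flip: exp_double)
  have "(beta has_real_derivative - 1 / z\<^sup>2 - - exp z / (exp z - 1)\<^sup>2) (at z)"
    unfolding beta_def using z by (auto intro!: derivative_eq_intros simp: power2_eq_square)
  then show ?thesis unfolding e by simp
qed

text \<open>The derivative 1 / (sh z)^2 - 1 / z^2 is bounded: for z \<le> 1 the double poles cancel,
  as factoring the difference of squares shows, and for z > 1 its absolute value is at most 1 /
  z^2.\<close>

lemma beta_lipschitz:
  assumes "0 < a" "0 < b" shows "\<bar>beta a - beta b\<bar> \<le> \<bar>a - b\<bar>"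
proof -
  have d: "\<bar>1 / (sh z)\<^sup>2 - 1 / z\<^sup>2\<bar> \<le> 1" if z: "z > 0" for z
  proof -
    have s: "sh z > 0" "sh z \<ge> z" using sh_pos[OF z] sh_ge[of z] z by auto
    have i: "0 \<le> 1 / z - 1 / sh z" using inverse_sh_diff(1)[OF z] .
    have sq: "1 / z\<^sup>2 - 1 / (sh z)\<^sup>2 = (1 / z - 1 / sh z) * (1 / z + 1 / sh z)"
      unfolding power_one_over[symmetric] by (simp only: power2_eq_square algebra_simps)
    moreover have "(1 / z - 1 / sh z) * (1 / z + 1 / sh z) \<ge> 0" using i s z by simp
    ultimately have eq: "\<bar>1 / (sh z)\<^sup>2 - 1 / z\<^sup>2\<bar> = (1 / z - 1 / sh z) * (1 / z + 1 / sh z)"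
      by linarith
    have si: "1 / sh z \<le> 1 / z" using i by simp
    show ?thesis
    proof (cases "z \<le> 1")
      case True
      have "exp (z / 2) \<le> exp (1 / 2)" using True by simp
      also have "\<dots> \<le> 2" by (rule exp_half_le2)
      finally have "z / 8 * exp (z / 2) \<le> z / 8 * 2" using z by (intro mult_left_mono) auto
      then have "(1 / z - 1 / sh z) \<le> z / 8 * 2" using inverse_sh_diff(2)[OF z] by linarith
      then have "(1 / z - 1 / sh z) * (1 / z + 1 / sh z) \<le> (z / 8 * 2) * (1 / z + 1 / z)"
        using s z i si by (intro mult_mono) auto
      then show ?thesis unfolding eq using z by simp
    next
      case False
      have "(1 / z - 1 / sh z) * (1 / z + 1 / sh z) \<le> 1 / z\<^sup>2" unfolding sq[symmetric] by simp
      also have "\<dots> \<le> 1" using False by (simp add: field_simps)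
      finally show ?thesis unfolding eq .
    qed
  qed
  have "norm (beta a - beta b) \<le> 1 * norm (a - b)"
  proof (rule field_differentiable_bound[where S = "{0<..}" and f' = "\<lambda>z. 1 / (sh z)\<^sup>2 - 1 / z\<^sup>2"])
    show "(beta has_field_derivative 1 / (sh z)\<^sup>2 - 1 / z\<^sup>2) (at z within {0<..})" if "z \<in> {0<..}" for z
      using beta_deriv[of z] that has_field_derivative_at_within by auto
  qed (use assms d in auto)
  then show ?thesis by simp
qed

context offdiag begin

definition "M = integral {0<..} (\<lambda>l. sh l powr (\<alpha> - 1) * Gs (y l) * c l)"

lemma c_continuous: "continuous_on S c" unfolding c_def gauss_cos_def by (intro continuous_intros) auto

text \<open>Replacing the power of \<open>ch\<close> by its value at l = 0 costs O(l^2), that is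
  O(H^{-3}) after integration. What is left is the Fourier transform of a Gaussian at t0,
  exponentially small in (t0/H)^2.\<close>

lemma ch_part:
  shows "(\<lambda>l. ch l powr (\<alpha> - 1) * c l) absolutely_integrable_on {0<..}" (is ?A)
    and "\<bar>integral {0<..} (\<lambda>l. ch l powr (\<alpha> - 1) * c l)\<bar> \<le> gauss_K / H ^ 3 + 2 / H * exp (- (t0\<^sup>2 / H\<^sup>2) / 2)" (is ?B)
proof -
  let ?D = "\<lambda>l. (ch l powr (\<alpha> - 1) - 2 powr (\<alpha> - 1)) * c l"
  have D: "\<bar>ch l powr (\<alpha> - 1) - 2 powr (\<alpha> - 1)\<bar> \<le> l\<^sup>2" if l: "l > 0" for l
  proof -
    have c2: "ch l \<ge> 2" by (rule ch_ge_2)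
    have u: "0 < 2 / ch l" "2 / ch l \<le> 1" using c2 by auto
    have "(2 / ch l) powr (1 - \<alpha>) \<ge> (2 / ch l) powr 1" using u \<alpha> by (intro powr_mono') auto
    then have 1: "(2 / ch l) powr (1 - \<alpha>) \<ge> 2 / ch l" using u by simp
    have "ch l powr (\<alpha> - 1) = 2 powr (\<alpha> - 1) * (2 / ch l) powr (1 - \<alpha>)"
      using c2 by (simp add: powr_divide powr_diff field_simps flip: powr_add)
    then have eq: "2 powr (\<alpha> - 1) - ch l powr (\<alpha> - 1) = 2 powr (\<alpha> - 1) * (1 - (2 / ch l) powr (1 - \<alpha>))"
      by (simp add: algebra_simps)
    have "(2 / ch l) powr (1 - \<alpha>) \<le> 1" using u \<alpha> by (intro powr_le1) auto
    then have ge0: "0 \<le> 2 powr (\<alpha> - 1) * (1 - (2 / ch l) powr (1 - \<alpha>))" by simp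
    have "2 powr (\<alpha> - 1) \<le> (2::real) powr 0" using \<alpha> by (intro powr_mono) auto
    then have "2 powr (\<alpha> - 1) * (1 - (2 / ch l) powr (1 - \<alpha>)) \<le> 1 * (1 - 2 / ch l)"
      using 1 u \<open>(2 / ch l) powr (1 - \<alpha>) \<le> 1\<close> by (intro mult_mono) auto
    also have "\<dots> = (ch l - 2) / ch l" using c2 by (simp add: field_simps)
    also have "\<dots> \<le> (l\<^sup>2 / 4 * exp (l / 2)) / exp (l / 2)"
      using ch_minus_2[of l] ch_ge_exp[of l] l c2 by (intro frac_le) auto
    finally have "2 powr (\<alpha> - 1) * (1 - (2 / ch l) powr (1 - \<alpha>)) \<le> l\<^sup>2 / 4" by simp
    then show ?thesis using eq ge0 zero_le_power2[of l] by linarith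
  qed
  have chc: "continuous_on {0<..} ch" unfolding ch_def by (intro continuous_intros; simp)
  have ch0: "ch l \<noteq> 0" for l using ch_pos[of l] by simp
  have cont: "continuous_on {0<..} ?D" using ch0 by (intro continuous_intros c_continuous chc) auto
  have bd: "\<bar>?D l\<bar> \<le> gauss_K / H\<^sup>2 * exp (- H * l)" if l: "l > 0" for l
  proof -
    have "\<bar>?D l\<bar> \<le> l\<^sup>2 * exp (- (H\<^sup>2 * l\<^sup>2) / 2)"
      unfolding abs_mult using D[OF l] abs_c[of l] by (intro mult_mono) auto
    also have "\<dots> \<le> gauss_K / H\<^sup>2 * exp (- H * l)" using gauss_poly(1) H l by simp
    finally show ?thesis .
  qed
  have DI: "?D absolutely_integrable_on {0<..}" "\<bar>integral {0<..} ?D\<bar> \<le> gauss_K / H\<^sup>2 / H"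
    using exp_dominated_integral[OF cont bd] H by auto
  have cI: "c absolutely_integrable_on {0<..}"
  proof (rule exp_dominated_integral(1)[OF c_continuous])
    show "\<bar>c l\<bar> \<le> 2 * exp (- H * l)" for l using abs_c[of l] gauss_le_exp[of H l] by linarith
  qed (use H in auto)
  have eq: "(\<lambda>l. ch l powr (\<alpha> - 1) * c l) = (\<lambda>l. ?D l + 2 powr (\<alpha> - 1) * c l)" by (simp add: algebra_simps)
  have cI2: "(\<lambda>l. 2 powr (\<alpha> - 1) * c l) absolutely_integrable_on {0<..}" by (rule set_integrable_mult_right[OF cI])
  show ?A unfolding eq by (rule set_integral_add(1)[OF DI(1) cI2])
  have "integral {0<..} (\<lambda>l. ch l powr (\<alpha> - 1) * c l) = integral {0<..} ?D + 2 powr (\<alpha> - 1) * integral {0<..} c"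
    unfolding eq using set_lebesgue_integral_eq_integral(1)[OF DI(1)] set_lebesgue_integral_eq_integral(1)[OF cI2]
    by (subst Henstock_Kurzweil_Integration.integral_add) auto
  moreover have "\<bar>2 powr (\<alpha> - 1) * integral {0<..} c\<bar> \<le> 2 / H * exp (- (t0\<^sup>2 / H\<^sup>2) / 2)"
  proof -
    have "2 powr (\<alpha> - 1) \<le> (2::real) powr 0" using \<alpha> by (intro powr_mono) auto
    then have "2 powr (\<alpha> - 1) * sqrt (pi / 2) \<le> 1 * 2"
      using pi_less_4 by (intro mult_mono real_le_lsqrt) auto
    then have "2 powr (\<alpha> - 1) * sqrt (pi / 2) * (exp (- (t0\<^sup>2 / H\<^sup>2) / 2) / H) \<le> 1 * 2 * (exp (- (t0\<^sup>2 / H\<^sup>2) / 2) / H)"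
      using H by (intro mult_right_mono) auto
    moreover have "integral {0<..} c = sqrt (pi / 2) / H * exp (- (t0\<^sup>2 / H\<^sup>2) / 2)"
      using integral_gauss_cos[of H t0] H unfolding c_def by simp
    ultimately show ?thesis using H by (simp add: abs_mult mult_ac)
  qed
  ultimately show ?B using DI(2) H by (simp add: power2_eq_square power3_eq_cube)
qed

section \<open>Removing the singular part of the polylogarithm\<close>

lemma y_pos: "l > 0 \<Longrightarrow> y l > 0"
  unfolding y_def using sh_pos[of l] ch_pos[of l] X by simp

lemma sh_ch_y: "l > 0 \<Longrightarrow> sh l powr (\<alpha> - 1) * y l powr (\<alpha> - 1) = X powr (1 - \<alpha>) * ch l powr (\<alpha> - 1)"
proof -
  assume l: "l > 0"
  have "sh l * y l = ch l / X" unfolding y_def using sh_pos[OF l] X by simp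
  then have "(sh l * y l) powr (\<alpha> - 1) = (ch l / X) powr (\<alpha> - 1)" by simp
  moreover have "X powr (\<alpha> - 1) = 1 / X powr (1 - \<alpha>)" using powr_minus_divide[of X "1 - \<alpha>"] by simp
  ultimately show ?thesis
    using sh_pos[OF l] y_pos[OF l] ch_pos[of l] X by (simp add: powr_mult powr_divide)
qed

lemma continuous_sh_ch_y: "continuous_on {0<..} sh" "continuous_on {0<..} ch" "continuous_on {0<..} y"
proof -
  show 1: "continuous_on {0<..} sh" "continuous_on {0<..} ch" unfolding sh_def ch_def by (intro continuous_intros; simp)+
  have "sh l \<noteq> 0" if "l \<in> {0<..}" for l using sh_pos[of l] that by auto
  then show "continuous_on {0<..} y" unfolding y_def using X by (intro continuous_intros 1) auto
qed

text \<open>Near z = 0 the polylogarithm behaves like C z^{\<alpha> - 1}. As sh l times y l is ch l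
  / X, this singular part becomes a smooth function of l, to which \<open>ch_part\<close> applies;
  \<open>R\<close> stands for the rest, which will be bounded.\<close>

lemma M_split:
  assumes R: "\<And>l. l > 0 \<Longrightarrow> Gs (y l) = C * y l powr (\<alpha> - 1) - R (y l)"
  shows "(\<lambda>l. sh l powr (\<alpha> - 1) * R (y l) * c l) absolutely_integrable_on {0<..}"
    and "M = C * X powr (1 - \<alpha>) * integral {0<..} (\<lambda>l. ch l powr (\<alpha> - 1) * c l)
            - integral {0<..} (\<lambda>l. sh l powr (\<alpha> - 1) * R (y l) * c l)"
proof -
  let ?P = "\<lambda>l. C * X powr (1 - \<alpha>) * (ch l powr (\<alpha> - 1) * c l)"
  let ?G = "\<lambda>l. sh l powr (\<alpha> - 1) * Gs (y l) * c l"
  let ?R = "\<lambda>l. sh l powr (\<alpha> - 1) * R (y l) * c l"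
  have eq: "?P l - ?G l = ?R l" if "l \<in> {0<..}" for l
  proof -
    have "sh l powr (\<alpha> - 1) * R (y l) = C * (sh l powr (\<alpha> - 1) * y l powr (\<alpha> - 1)) - sh l powr (\<alpha> - 1) * Gs (y l)"
    proof -
      have "R (y l) = C * y l powr (\<alpha> - 1) - Gs (y l)" using R[of l] that by simp
      then have "sh l powr (\<alpha> - 1) * R (y l) = sh l powr (\<alpha> - 1) * (C * y l powr (\<alpha> - 1) - Gs (y l))" by simp
      then show ?thesis by (simp only: right_diff_distrib mult.left_commute)
    qed
    then have "sh l powr (\<alpha> - 1) * R (y l) = C * (X powr (1 - \<alpha>) * ch l powr (\<alpha> - 1)) - sh l powr (\<alpha> - 1) * Gs (y l)"
      using sh_ch_y[of l] that by simp
    then show ?thesis by (simp only: left_diff_distrib mult.assoc)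
  qed
  have P: "?P absolutely_integrable_on {0<..}" by (rule set_integrable_mult_right[OF ch_part(1)])
  note G = p_integral_sums(1)
  have "(\<lambda>l. ?P l - ?G l) absolutely_integrable_on {0<..}" by (rule set_integral_diff(1)[OF P G])
  then show "?R absolutely_integrable_on {0<..}"
    by (rule set_integrable_cong[THEN iffD1, rotated -1]) (simp_all only: eq)
  have "integral {0<..} ?R = integral {0<..} (\<lambda>l. ?P l - ?G l)" by (rule integral_cong) (simp only: eq)
  also have "\<dots> = integral {0<..} ?P - integral {0<..} ?G"
    using set_lebesgue_integral_eq_integral(1)[OF P] set_lebesgue_integral_eq_integral(1)[OF G]
    by (rule Henstock_Kurzweil_Integration.integral_diff)
  finally show "M = C * X powr (1 - \<alpha>) * integral {0<..} (\<lambda>l. ch l powr (\<alpha> - 1) * c l)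
            - integral {0<..} (\<lambda>l. sh l powr (\<alpha> - 1) * R (y l) * c l)" by (simp add: M_def)
qed

text \<open>Sum against integral for a decreasing function: the sum is at most the integral, and at
  least the integral without [0, 1], where the integrand is below x^{-\<alpha>}.\<close>

lemma Gs_bounds:
  assumes z: "z > 0"
  shows "Gs z \<le> Gamma (1 - \<alpha>) * z powr (\<alpha> - 1)" "Gamma (1 - \<alpha>) * z powr (\<alpha> - 1) - Gs z \<le> 1 / (1 - \<alpha>)"
proof -
  define f where "f x = x powr (- \<alpha>) * exp (- x * z)" for x
  have I: "f absolutely_integrable_on {0<..}" "integral {0<..} f = Gamma (1 - \<alpha>) * z powr (\<alpha> - 1)"
    using gamma_integral_scaled_real[of \<alpha> "1 / z"] z \<alpha> powr_minus_divide[of z "1 - \<alpha>"]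
    by (simp_all add: f_def[abs_def] powr_divide)
  have anti: "f b \<le> f a" if "0 < a" "a \<le> b" for a b
    unfolding f_def using that z \<alpha> by (intro mult_mono powr_mono2') auto
  have intN: "f integrable_on {real a..real b}" for a b
    by (rule integrable_on_subinterval[OF integral_to_infinity(1)[OF I(1), of b]]) auto
  have comb: "integral {0..real N} f + integral {real N..real (Suc N)} f = integral {0..real (Suc N)} f" for N
    by (rule Henstock_Kurzweil_Integration.integral_combine) (use intN[of 0 "Suc N"] in auto)
  have low: "f (real (Suc N)) \<le> integral {real N..real (Suc N)} f" for N
  proof -
    \<comment> \<open>At 0 the convention \<open>0 powr a = 0\<close> violates monotonicity, hence
      the exceptional point.\<close>
    have "integral {real N..real (Suc N)} (\<lambda>_. f (real (Suc N))) = integral {real N..real (Suc N)} (\<lambda>x. if x = 0 then 0 else f (real (Suc N)))"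
      by (rule integral_spike[where S = "{0}"]) auto
    then have "f (real (Suc N)) = integral {real N..real (Suc N)} (\<lambda>x. if x = 0 then 0 else f (real (Suc N)))"
      by simp
    also have "\<dots> \<le> integral {real N..real (Suc N)} f"
    proof (rule integral_le)
      show "(\<lambda>x. if x = 0 then 0 else f (real (Suc N))) integrable_on {real N..real (Suc N)}"
        by (rule integrable_spike[where S = "{0}" and f = "\<lambda>_. f (real (Suc N))"]) auto
      show "f integrable_on {real N..real (Suc N)}" by (rule intN)
      fix x assume x: "x \<in> {real N..real (Suc N)}"
      show "(if x = 0 then 0 else f (real (Suc N))) \<le> f x"
        using anti[of x "real (Suc N)"] x by (auto simp: f_def)
    qed
    finally show ?thesis .
  qed
  have up: "integral {real (Suc N)..real (Suc (Suc N))} f \<le> f (real (Suc N))" for N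
  proof -
    have "integral {real (Suc N)..real (Suc (Suc N))} f \<le> integral {real (Suc N)..real (Suc (Suc N))} (\<lambda>_. f (real (Suc N)))"
      by (rule integral_le) (use intN[of "Suc N" "Suc (Suc N)"] anti in auto)
    then show ?thesis by simp
  qed
  have L: "(\<Sum>n<N. f (real (Suc n))) \<le> integral {0..real N} f" for N
  proof (induction N)
    case (Suc N)
    then show ?case using low[of N] comb[of N] by simp
  qed simp
  have U: "integral {0..real (Suc N)} f - integral {0..1} f \<le> (\<Sum>n<N. f (real (Suc n)))" for N
  proof (induction N)
    case (Suc N)
    then show ?case using up[of N] comb[of "Suc N"] by simp
  qed simp
  have G: "(\<lambda>N. \<Sum>n<N. f (real (Suc n))) \<longlonglongrightarrow> Gs z"
    using summable_LIMSEQ[OF summable_Gs[OF z]] unfolding Gs_def f_def by simp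
  note T = integral_to_infinity(2)[OF I(1)]
  show "Gs z \<le> Gamma (1 - \<alpha>) * z powr (\<alpha> - 1)"
    unfolding I(2)[symmetric] by (rule LIMSEQ_le[OF G T]) (use L in blast)
  have "integral {0<..} f - integral {0..1} f \<le> Gs z"
    by (rule LIMSEQ_le[OF tendsto_diff[OF LIMSEQ_Suc[OF T] tendsto_const] G]) (use U in blast)
  moreover have "integral {0..1} f \<le> 1 / (1 - \<alpha>)"
  proof -
    have h: "((\<lambda>x. x powr (- \<alpha>)) has_integral 1 powr (- \<alpha> + 1) / (- \<alpha> + 1)) {0..1}"
      by (rule has_integral_powr_from_0) (use \<alpha> in auto)
    have "integral {0..1} f \<le> integral {0..1} (\<lambda>x. x powr (- \<alpha>))"
    proof (rule integral_le)
      show "f integrable_on {0..1}" using intN[of 0 1] by simp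
      show "(\<lambda>x. x powr (- \<alpha>)) integrable_on {0..1}" using h by blast
      show "f x \<le> x powr (- \<alpha>)" if "x \<in> {0..1}" for x
        unfolding f_def using that z by (intro mult_right_le_one_le) auto
    qed
    also have "\<dots> = 1 / (1 - \<alpha>)" using integral_unique[OF h] by simp
    finally show ?thesis .
  qed
  ultimately show "Gamma (1 - \<alpha>) * z powr (\<alpha> - 1) - Gs z \<le> 1 / (1 - \<alpha>)"
    unfolding I(2) by linarith
qed

text \<open>For \<alpha> > 0 the singularity l^{\<alpha> - 1} is integrable, and against a Gaussian
  of width 1/H it leaves H^{-\<alpha>}. So to the right of the critical line the whole off-diagonal
  part will vanish in the limit.\<close>

lemma M_bound_pos:
  assumes "\<alpha> > 0"
  shows "\<bar>M\<bar> \<le> Gamma (1 - \<alpha>) * X * (gauss_K / H ^ 3 + 2 / H * exp (- (t0\<^sup>2 / H\<^sup>2) / 2))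
           + 2 / (1 - \<alpha>) * Gamma \<alpha> * H powr (- \<alpha>)"
proof -
  define R where "R z = Gamma (1 - \<alpha>) * z powr (\<alpha> - 1) - Gs z" for z
  have R: "0 \<le> R (y l)" "R (y l) \<le> 1 / (1 - \<alpha>)" if "l > 0" for l
    using Gs_bounds[OF y_pos[OF that]] by (auto simp: R_def)
  have split: "(\<lambda>l. sh l powr (\<alpha> - 1) * R (y l) * c l) absolutely_integrable_on {0<..}"
    "M = Gamma (1 - \<alpha>) * X powr (1 - \<alpha>) * integral {0<..} (\<lambda>l. ch l powr (\<alpha> - 1) * c l)
            - integral {0<..} (\<lambda>l. sh l powr (\<alpha> - 1) * R (y l) * c l)"
    by (rule M_split[where C = "Gamma (1 - \<alpha>)" and R = R]; simp add: R_def)+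
  have gI: "(\<lambda>l. l powr (- (1 - \<alpha>)) * exp (- l / (1 / H))) absolutely_integrable_on {0<..}"
      "integral {0<..} (\<lambda>l. l powr (- (1 - \<alpha>)) * exp (- l / (1 / H))) = Gamma (1 - (1 - \<alpha>)) * (1 / H) powr (1 - (1 - \<alpha>))"
    by (rule gamma_integral_scaled_real; use assms H in simp)+
  have "norm (integral {0<..} (\<lambda>l. sh l powr (\<alpha> - 1) * R (y l) * c l))
     \<le> integral {0<..} (\<lambda>l. 2 / (1 - \<alpha>) * (l powr (- (1 - \<alpha>)) * exp (- l / (1 / H))))"
  proof (rule integral_norm_bound_integral)
    show "(\<lambda>l. 2 / (1 - \<alpha>) * (l powr (- (1 - \<alpha>)) * exp (- l / (1 / H)))) integrable_on {0<..}"
      using set_lebesgue_integral_eq_integral(1)[OF gI(1)] by (rule integrable_on_mult_right)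
    fix l :: real assume "l \<in> {0<..}"
    then have l: "l > 0" by simp
    have "\<bar>sh l powr (\<alpha> - 1) * R (y l) * c l\<bar> = sh l powr (\<alpha> - 1) * R (y l) * \<bar>c l\<bar>"
      using R[OF l] by (simp add: abs_mult)
    also have "\<dots> \<le> l powr (\<alpha> - 1) * (1 / (1 - \<alpha>)) * (2 * exp (- H * l))"
      using R[OF l] abs_c[of l] gauss_le_exp[of H l] sh_ge[of l] sh_pos[OF l] l \<alpha>
      by (intro mult_mono powr_mono2') auto
    finally show "norm (sh l powr (\<alpha> - 1) * R (y l) * c l) \<le> 2 / (1 - \<alpha>) * (l powr (- (1 - \<alpha>)) * exp (- l / (1 / H)))"
      by (simp add: mult_ac)
  qed (use set_lebesgue_integral_eq_integral(1)[OF split(1)] in auto)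
  also have "\<dots> = 2 / (1 - \<alpha>) * (Gamma \<alpha> * (1 / H) powr \<alpha>)" using gI(2) by simp
  also have "(1 / H) powr \<alpha> = H powr (- \<alpha>)" using H by (simp add: powr_divide powr_minus_divide)
  finally have 2: "\<bar>integral {0<..} (\<lambda>l. sh l powr (\<alpha> - 1) * R (y l) * c l)\<bar> \<le> 2 / (1 - \<alpha>) * (Gamma \<alpha> * H powr (- \<alpha>))" by simp
  have G0: "Gamma (1 - \<alpha>) > 0" using \<alpha> by (intro Gamma_real_pos) simp
  have "X powr (1 - \<alpha>) \<le> X powr 1" using X \<alpha> by (intro powr_mono) auto
  then have "\<bar>Gamma (1 - \<alpha>) * X powr (1 - \<alpha>) * integral {0<..} (\<lambda>l. ch l powr (\<alpha> - 1) * c l)\<bar>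
      \<le> Gamma (1 - \<alpha>) * X * (gauss_K / H ^ 3 + 2 / H * exp (- (t0\<^sup>2 / H\<^sup>2) / 2))"
    unfolding abs_mult using ch_part(2) G0 X by (intro mult_mono) auto
  then show ?thesis using 2 unfolding split(2) by (simp add: mult.assoc)
qed

text \<open>Up to sign the off-diagonal part on the critical line, with \<open>sh l\<close> and
  \<open>y l\<close> replaced by their leading terms l and 2 / (X l) at l = 0.\<close>

definition "M_beta = integral {0<..} (\<lambda>l. beta (2 / (X * l)) / l * c l)"

text \<open>For \<alpha> = 0 the series is geometric and the rest is \<open>beta (y l)\<close>. It
  becomes small only for l below 1/X, so dividing by l gives a logarithm that cannot be estimated
  away. Here only the kernel is simplified; \<open>beta_lipschitz\<close> and
  \<open>inverse_sh_diff\<close> control the two replacements.\<close>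

lemma M_bound_zero:
  assumes "\<alpha> = 0"
  shows "(\<lambda>l. beta (2 / (X * l)) / l * c l) absolutely_integrable_on {0<..}"
    and "\<bar>M + M_beta\<bar> \<le> X * (gauss_K / H ^ 3 + 2 / H * exp (- (t0\<^sup>2 / H\<^sup>2) / 2)) + gauss_K / H\<^sup>2 + gauss_K / (X * H)"
proof -
  have Gs: "Gs z = 1 / z - beta z" if z: "z > 0" for z
  proof -
    have "Gs z = (\<Sum>n. exp (- z) ^ Suc n)" unfolding Gs_def
    proof (rule suminf_cong)
      fix n show "real (Suc n) powr (- \<alpha>) * exp (- real (Suc n) * z) = exp (- z) ^ Suc n"
        using exp_of_nat_mult[of "Suc n" "- z"] assms by (simp add: algebra_simps)
    qed
    also have "\<dots> = exp (- z) * (\<Sum>n. exp (- z) ^ n)" using z by (simp add: suminf_mult)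
    also have "\<dots> = exp (- z) / (1 - exp (- z))" using z by (subst suminf_geometric) auto
    also have "\<dots> = 1 / (exp z - 1)" using z by (simp add: exp_minus field_simps)
    finally show ?thesis by (simp add: beta_def)
  qed
  have split: "(\<lambda>l. sh l powr (\<alpha> - 1) * beta (y l) * c l) absolutely_integrable_on {0<..}"
    "M = 1 * X powr (1 - \<alpha>) * integral {0<..} (\<lambda>l. ch l powr (\<alpha> - 1) * c l)
            - integral {0<..} (\<lambda>l. sh l powr (\<alpha> - 1) * beta (y l) * c l)"
  proof (rule_tac[!] M_split)
    have "Gs (y l) = 1 * y l powr (\<alpha> - 1) - beta (y l)" if "l > 0" for l
      using Gs[OF y_pos[OF that]] y_pos[OF that] assms by (simp add: powr_minus_divide)
    then show "l > 0 \<Longrightarrow> Gs (y l) = 1 * y l powr (\<alpha> - 1) - beta (y l)"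
      "l > 0 \<Longrightarrow> Gs (y l) = 1 * y l powr (\<alpha> - 1) - beta (y l)" for l by blast+
  qed
  let ?R = "\<lambda>l. sh l powr (\<alpha> - 1) * beta (y l) * c l"
  let ?Q = "\<lambda>l. beta (2 / (X * l)) / l * c l"
  let ?D = "\<lambda>l. (beta (2 / (X * l)) / l - beta (y l) / sh l) * c l"
  have bc: "continuous_on {0<..} beta" by (rule DERIV_continuous_on[OF has_field_derivative_at_within[OF beta_deriv]]) auto
  have b1: "continuous_on {0<..} (\<lambda>l. beta (y l))"
    by (rule continuous_on_compose2[OF bc continuous_sh_ch_y(3)]) (use y_pos in auto)
  have b2: "continuous_on {0<..} (\<lambda>l. beta (2 / (X * l)))"
    by (rule continuous_on_compose2[OF bc]) (use X in \<open>auto intro!: continuous_intros\<close>)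
  have s0: "sh l \<noteq> 0" if "l \<in> {0<..}" for l using sh_pos[of l] that by auto
  have cont: "continuous_on {0<..} ?D"
    using s0 by (intro continuous_intros b1 b2 c_continuous continuous_sh_ch_y) auto
  have bd: "\<bar>?D l\<bar> \<le> (gauss_K / H + gauss_K / X) * exp (- H * l)" if l: "l > 0" for l
  proof -
    let ?x = "2 / (X * l)"
    have x: "?x > 0" using X l by simp
    have yx: "y l - ?x = (ch l / sh l - 2 / l) / X" unfolding y_def using sh_pos[OF l] X l by (simp add: field_simps)
    have "\<bar>beta ?x - beta (y l)\<bar> \<le> \<bar>y l - ?x\<bar>" using beta_lipschitz[OF x y_pos[OF l]] by (simp add: abs_minus_commute)
    also have "\<dots> = (ch l / sh l - 2 / l) / X" unfolding yx using coth_diff(1)[OF l] X by simp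
    also have "\<dots> \<le> (l / 4 * exp (l / 2)) / X" by (rule divide_right_mono[OF coth_diff(2)[OF l]]) (use X in simp)
    finally have "\<bar>beta ?x - beta (y l)\<bar> / l \<le> (l / 4 * exp (l / 2)) / X / l" using l by (intro divide_right_mono) auto
    also have "\<dots> = exp (l / 2) / X / 4" using l by simp
    also have "\<dots> \<le> exp (l / 2) / X"
    proof -
      have "0 \<le> exp (l / 2) / X" using X by simp
      moreover have "a / 4 \<le> a" if "0 \<le> a" for a :: real using that by simp
      ultimately show ?thesis by blast
    qed
    finally have 1: "\<bar>beta ?x - beta (y l)\<bar> / l \<le> exp (l / 2) / X" .
    have 2: "beta (y l) * (1 / l - 1 / sh l) \<le> 1 / 2 * (l / 8 * exp (l / 2))"
      using beta_bounds(1,2)[OF y_pos[OF l]] inverse_sh_diff[OF l] by (intro mult_mono) auto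
    have 3: "0 \<le> beta (y l) * (1 / l - 1 / sh l)"
      using beta_bounds(1)[OF y_pos[OF l]] inverse_sh_diff[OF l] by simp
    have "beta ?x / l - beta (y l) / sh l = (beta ?x - beta (y l)) / l + beta (y l) * (1 / l - 1 / sh l)"
      by (simp add: diff_divide_distrib algebra_simps)
    moreover have "\<bar>(beta ?x - beta (y l)) / l\<bar> = \<bar>beta ?x - beta (y l)\<bar> / l" using l by simp
    moreover have "0 \<le> l * exp (l / 2)" using l by simp
    ultimately have "\<bar>beta ?x / l - beta (y l) / sh l\<bar> \<le> exp (l / 2) / X + l * exp (l / 2)"
      using 1 2 3 by linarith
    then have "\<bar>?D l\<bar> \<le> (exp (l / 2) / X + l * exp (l / 2)) * exp (- (H\<^sup>2 * l\<^sup>2) / 2)"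
      unfolding abs_mult using abs_c[of l] l X by (intro mult_mono) auto
    also have "\<dots> = exp (l / 2) * exp (- (H\<^sup>2 * l\<^sup>2) / 2) / X + l * exp (l / 2) * exp (- (H\<^sup>2 * l\<^sup>2) / 2)"
      by (simp add: algebra_simps)
    also have "\<dots> \<le> gauss_K * exp (- H * l) / X + gauss_K / H * exp (- H * l)"
      using gauss_poly(2,3)[of H l] H l X by (intro add_mono divide_right_mono) auto
    finally show ?thesis by (simp add: algebra_simps)
  qed
  have D: "?D absolutely_integrable_on {0<..}" "\<bar>integral {0<..} ?D\<bar> \<le> (gauss_K / H + gauss_K / X) / H"
    using exp_dominated_integral[OF cont bd] H by auto
  have eq: "?D l + ?R l = ?Q l" if "l \<in> {0<..}" for l
    using assms sh_pos[of l] that by (simp add: powr_minus_divide algebra_simps)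
  have "(\<lambda>l. ?D l + ?R l) absolutely_integrable_on {0<..}" by (rule set_integral_add(1)[OF D(1) split(1)])
  then show "?Q absolutely_integrable_on {0<..}"
    by (rule set_integrable_cong[THEN iffD1, rotated -1]) (simp_all only: eq)
  have "M_beta = integral {0<..} (\<lambda>l. ?D l + ?R l)" unfolding M_beta_def by (rule integral_cong) (simp only: eq)
  also have "\<dots> = integral {0<..} ?D + integral {0<..} ?R"
    using set_lebesgue_integral_eq_integral(1)[OF D(1)] set_lebesgue_integral_eq_integral(1)[OF split(1)]
    by (rule Henstock_Kurzweil_Integration.integral_add)
  finally have "M + M_beta = X * integral {0<..} (\<lambda>l. ch l powr (\<alpha> - 1) * c l) + integral {0<..} ?D"
    using split(2) X assms by simp
  moreover have "\<bar>X * integral {0<..} (\<lambda>l. ch l powr (\<alpha> - 1) * c l)\<bar> \<le> X * (gauss_K / H ^ 3 + 2 / H * exp (- (t0\<^sup>2 / H\<^sup>2) / 2))"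
    unfolding abs_mult using ch_part(2) X by (intro mult_mono) auto
  moreover have "(gauss_K / H + gauss_K / X) / H = gauss_K / H\<^sup>2 + gauss_K / (X * H)"
    by (simp add: add_divide_distrib power2_eq_square)
  ultimately show "\<bar>M + M_beta\<bar> \<le> X * (gauss_K / H ^ 3 + 2 / H * exp (- (t0\<^sup>2 / H\<^sup>2) / 2)) + gauss_K / H\<^sup>2 + gauss_K / (X * H)"
    using D(2) by linarith
qed

end

subsection \<open>The oscillating integral on the critical line\<close>

lemma dominated_continuous:
  fixes f :: "nat \<Rightarrow> real \<Rightarrow> real"
  assumes S: "S \<in> sets lebesgue" and f: "\<And>k. continuous_on S (f k)"
    and b: "\<And>k x. x \<in> S \<Longrightarrow> \<bar>f k x\<bar> \<le> h x" and h: "h integrable_on S"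
    and lim: "\<And>x. x \<in> S \<Longrightarrow> (\<lambda>k. f k x) \<longlonglongrightarrow> g x"
  shows "(\<lambda>k. integral S (f k)) \<longlonglongrightarrow> integral S g"
proof (rule dominated_convergence(2)[where h = h])
  show "f k integrable_on S" for k
    by (rule measurable_bounded_by_integrable_imp_integrable[OF continuous_imp_measurable_on_sets_lebesgue[OF f S] h _ S])
       (use b in auto)
qed (use assms in auto)

lemma integral_atLeast_limit:
  fixes f :: "real \<Rightarrow> real"
  assumes "continuous_on {a..} f" "f absolutely_integrable_on {a..}"
  shows "(\<lambda>N. integral {a..a + real N} f) \<longlonglongrightarrow> integral {a..} f"
proof -
  have int: "f integrable_on {a..a + real N}" for N
    by (rule integrable_on_subinterval[OF set_lebesgue_integral_eq_integral(1)[OF assms(2)]]) auto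
  have "(\<lambda>N. integral {a..} (\<lambda>x. if x \<in> {a..a + real N} then f x else 0)) \<longlonglongrightarrow> integral {a..} f"
  proof (rule dominated_convergence(2)[where h = "\<lambda>x. norm (f x)"])
    show "(\<lambda>x. if x \<in> {a..a + real N} then f x else 0) integrable_on {a..}" for N
      by (subst integrable_restrict_Int) (use int[of N] in \<open>simp add: Int_absorb2\<close>)
    show "(\<lambda>x. norm (f x)) integrable_on {a..}"
      using assms(2) absolutely_integrable_on_def by blast
    show "(\<lambda>N. if x \<in> {a..a + real N} then f x else 0) \<longlonglongrightarrow> f x" if "x \<in> {a..}" for x
    proof (rule tendsto_eventually)
      show "\<forall>\<^sub>F N in sequentially. (if x \<in> {a..a + real N} then f x else 0) = f x"
        by (rule eventually_mono[OF eventually_ge_at_top[of "nat \<lceil>x - a\<rceil>"]]) (use that in \<open>auto simp: nat_le_iff ceiling_le_iff algebra_simps\<close>)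
    qed
  qed auto
  moreover have "integral {a..} (\<lambda>x. if x \<in> {a..a + real N} then f x else 0) = integral {a..a + real N} f" for N
    by (subst integral_restrict_Int) (simp add: Int_absorb2)
  ultimately show ?thesis by simp
qed

lemma one_minus_cos_le: "\<bar>cos w - 1\<bar> \<le> w\<^sup>2 / 2" for w :: real
proof -
  have "1 - cos w = 2 * (sin (w / 2))\<^sup>2" using cos_double_sin[of "w / 2"] by simp
  moreover have "(sin (w / 2))\<^sup>2 \<le> (w / 2)\<^sup>2" by (rule abs_le_square_iff[THEN iffD1, OF abs_sin_x_le_abs_x])
  ultimately have "\<bar>1 - cos w\<bar> \<le> 2 * (w / 2)\<^sup>2" by simp
  then show ?thesis by (simp add: abs_minus_commute power_divide)
qed

lemma gauss_cos_diff: "\<bar>gauss_cos a H w - 1\<bar> \<le> (a\<^sup>2 + H\<^sup>2) * w\<^sup>2 / 2"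
proof -
  let ?e = "exp (- (H\<^sup>2 * w\<^sup>2) / 2)"
  have e: "0 \<le> 1 - ?e" "1 - ?e \<le> H\<^sup>2 * w\<^sup>2 / 2" "0 \<le> ?e" "?e \<le> 1"
    using exp_ge_add_one_self[of "- (H\<^sup>2 * w\<^sup>2) / 2"] by auto
  have eq: "gauss_cos a H w - 1 = (cos (a * w) - 1) * ?e - (1 - ?e)" by (simp add: gauss_cos_def algebra_simps)
  have "\<bar>(cos (a * w) - 1) * ?e\<bar> \<le> (a * w)\<^sup>2 / 2 * 1"
    unfolding abs_mult by (intro mult_mono one_minus_cos_le) (use e in auto)
  then have "\<bar>gauss_cos a H w - 1\<bar> \<le> (a * w)\<^sup>2 / 2 + H\<^sup>2 * w\<^sup>2 / 2" unfolding eq using e by linarith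
  then show ?thesis by (simp add: power_mult_distrib add_divide_distrib distrib_right)
qed

lemma abs_gauss_cos_le_1: "\<bar>gauss_cos a H w\<bar> \<le> 1"
  by (rule order_trans[OF abs_gauss_cos_le]) simp

lemma continuous_gauss_cos: "continuous_on S (gauss_cos a H)"
  unfolding gauss_cos_def by (intro continuous_intros) auto

lemma inverse_square_integrable: "(\<lambda>x::real. C / x\<^sup>2) integrable_on {1..}"
proof -
  have "((\<lambda>x. x powr (- 2)) has_integral - (1 powr (- 2 + 1)) / (- 2 + 1)) {1::real..}"
    by (rule has_integral_powr_to_inf) auto
  then have "(\<lambda>x::real. x powr (- 2)) integrable_on {1..}" by blast
  then have "(\<lambda>x::real. C * x powr (- 2)) integrable_on {1..}" by (rule integrable_on_mult_right)
  then show ?thesis by (rule integrable_eq) (simp add: powr_minus divide_simps)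
qed

lemma gauss_cos_tendsto:
  assumes "a \<longlonglongrightarrow> a0" "h \<longlonglongrightarrow> 0"
  shows "(\<lambda>k. gauss_cos (a k) (h k) x) \<longlonglongrightarrow> cos (a0 * x)"
proof -
  have "(\<lambda>k. cos (a k * x) * exp (- ((h k)\<^sup>2 * x\<^sup>2) / 2)) \<longlonglongrightarrow> cos (a0 * x) * exp (- (0\<^sup>2 * x\<^sup>2) / 2)"
    by (intro tendsto_intros assms) auto
  then show ?thesis by (simp add: gauss_cos_def)
qed

text \<open>Without the Gaussian factor the integral of cos w / w converges only conditionally. One
  integration by parts gives an absolutely convergent integral with a majorant independent of
  \<epsilon>, and an extra term from the Gaussian that is O(\<epsilon>).\<close>

lemma oscillating_by_parts:
  assumes \<epsilon>: "\<epsilon> > 0"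
  shows "(\<lambda>w. gauss_cos 1 \<epsilon> w / w) absolutely_integrable_on {1..}"
    and "integral {1..} (\<lambda>w. gauss_cos 1 \<epsilon> w / w) = - sin 1 * exp (- \<epsilon>\<^sup>2 / 2)
           + integral {1..} (\<lambda>w. sin w * exp (- (\<epsilon>\<^sup>2 * w\<^sup>2) / 2) / w\<^sup>2)
           + integral {1..} (\<lambda>w. \<epsilon>\<^sup>2 * sin w * exp (- (\<epsilon>\<^sup>2 * w\<^sup>2) / 2))" (is "_ = ?R")
    and "\<bar>integral {1..} (\<lambda>w. \<epsilon>\<^sup>2 * sin w * exp (- (\<epsilon>\<^sup>2 * w\<^sup>2) / 2))\<bar> \<le> 2 * \<epsilon>"
proof -
  let ?E = "\<lambda>w::real. exp (- (\<epsilon>\<^sup>2 * w\<^sup>2) / 2)"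
  have hI: "((\<lambda>w::real. exp (- \<epsilon> * w)) has_integral exp (- \<epsilon> * 1) / \<epsilon>) {1..}"
    by (rule has_integral_exp_minus_to_infinity) fact
  have hC: "(\<lambda>w::real. C * exp (- \<epsilon> * w)) integrable_on {1..}" for C
    by (intro integrable_on_mult_right has_integral_integrable[OF hI])
  have meas: "f \<in> borel_measurable (lebesgue_on {1..})" if "continuous_on {1..} f" for f :: "real \<Rightarrow> real"
    by (rule continuous_imp_measurable_on_sets_lebesgue[OF that]) simp
  have E: "?E w \<le> 2 * exp (- \<epsilon> * w)" for w using gauss_le_exp[of \<epsilon> w] .
  show A: "(\<lambda>w. gauss_cos 1 \<epsilon> w / w) absolutely_integrable_on {1..}"
  proof (rule measurable_bounded_by_integrable_imp_absolutely_integrable[OF meas _ hC[of 2]])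
    show "norm (gauss_cos 1 \<epsilon> w / w) \<le> 2 * exp (- \<epsilon> * w)" if "w \<in> {1..}" for w
    proof -
      have "\<bar>gauss_cos 1 \<epsilon> w\<bar> / w \<le> ?E w / 1" using abs_gauss_cos_le[of 1 \<epsilon> w] that by (intro frac_le) auto
      then show ?thesis using E[of w] that by simp
    qed
  qed (auto intro!: continuous_intros continuous_gauss_cos)
  have B: "(\<lambda>w. sin w * ?E w / w\<^sup>2) absolutely_integrable_on {1..}"
  proof (rule measurable_bounded_by_integrable_imp_absolutely_integrable[OF meas _ hC[of 2]])
    show "norm (sin w * ?E w / w\<^sup>2) \<le> 2 * exp (- \<epsilon> * w)" if "w \<in> {1..}" for w
    proof -
      have "\<bar>sin w\<bar> * ?E w / w\<^sup>2 \<le> 1 * ?E w / 1" using that by (intro frac_le mult_mono) auto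
      then show ?thesis using E[of w] by (simp add: abs_mult)
    qed
  qed (auto intro!: continuous_intros)
  have C_bd: "norm (\<epsilon>\<^sup>2 * sin w * ?E w) \<le> 2 * \<epsilon>\<^sup>2 * exp (- \<epsilon> * w)" for w
  proof -
    have "\<bar>sin w\<bar> * ?E w \<le> 1 * (2 * exp (- \<epsilon> * w))" using E[of w] by (intro mult_mono) auto
    then have "\<epsilon>\<^sup>2 * (\<bar>sin w\<bar> * ?E w) \<le> \<epsilon>\<^sup>2 * (1 * (2 * exp (- \<epsilon> * w)))" by (rule mult_left_mono) simp
    then show ?thesis by (simp add: abs_mult mult_ac)
  qed
  have C: "(\<lambda>w. \<epsilon>\<^sup>2 * sin w * ?E w) absolutely_integrable_on {1..}"
    by (rule measurable_bounded_by_integrable_imp_absolutely_integrable[OF meas _ hC[of "2 * \<epsilon>\<^sup>2"]])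
       (use C_bd in \<open>auto intro!: continuous_intros\<close>)
  have "norm (integral {1..} (\<lambda>w. \<epsilon>\<^sup>2 * sin w * ?E w)) \<le> integral {1..} (\<lambda>w. 2 * \<epsilon>\<^sup>2 * exp (- \<epsilon> * w))"
    by (rule integral_norm_bound_integral[OF set_lebesgue_integral_eq_integral(1)[OF C] hC]) (use C_bd in auto)
  also have "\<dots> = 2 * \<epsilon>\<^sup>2 * (exp (- \<epsilon> * 1) / \<epsilon>)" using integral_unique[OF has_integral_mult_right[OF hI]] .
  also have "\<dots> \<le> 2 * \<epsilon>\<^sup>2 * (1 / \<epsilon>)" using \<epsilon> by (intro mult_left_mono divide_right_mono) auto
  finally show "\<bar>integral {1..} (\<lambda>w. \<epsilon>\<^sup>2 * sin w * ?E w)\<bar> \<le> 2 * \<epsilon>"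
    using \<epsilon> by (simp add: power2_eq_square)
  let ?F = "\<lambda>w. sin w * ?E w / w"
  let ?f = "\<lambda>w. gauss_cos 1 \<epsilon> w / w - (sin w * ?E w / w\<^sup>2 + \<epsilon>\<^sup>2 * sin w * ?E w)"
  have "(?f has_integral (?F (1 + real N) - ?F 1)) {1..1 + real N}" for N
  proof (rule fundamental_theorem_of_calculus)
    fix w :: real assume w: "w \<in> {1..1 + real N}"
    have "(?F has_real_derivative ((cos w * ?E w + sin w * (?E w * (- (\<epsilon>\<^sup>2 * (2 * w)) / 2))) * w - sin w * ?E w * 1) / (w * w)) (at w within {1..1 + real N})"
      using w by (auto intro!: derivative_eq_intros)
    also have "((cos w * ?E w + sin w * (?E w * (- (\<epsilon>\<^sup>2 * (2 * w)) / 2))) * w - sin w * ?E w * 1) / (w * w) = ?f w"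
      using w by (simp add: gauss_cos_def power2_eq_square field_simps)
    finally show "(?F has_vector_derivative ?f w) (at w within {1..1 + real N})"
      by (simp add: has_real_derivative_iff_has_vector_derivative)
  qed simp
  then have "integral {1..1 + real N} ?f = ?F (1 + real N) - ?F 1" for N by (simp add: integral_unique)
  moreover have "(\<lambda>N. integral {1..1 + real N} ?f) \<longlonglongrightarrow> integral {1..} ?f"
  proof (rule integral_atLeast_limit)
    show "continuous_on {1..} ?f" by (intro continuous_intros continuous_gauss_cos) auto
    show "?f absolutely_integrable_on {1..}" by (intro set_integral_diff(1) set_integral_add(1) A B C)
  qed
  moreover have "(\<lambda>N. ?F (1 + real N) - ?F 1) \<longlonglongrightarrow> 0 - ?F 1"
  proof (intro tendsto_diff tendsto_const)
    show "(\<lambda>N. ?F (1 + real N)) \<longlonglongrightarrow> 0"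
    proof (rule Lim_null_comparison)
      have "\<bar>sin w\<bar> * ?E w \<le> 1 * 1" for w by (intro mult_mono) auto
      then show "\<forall>\<^sub>F N in sequentially. norm (?F (1 + real N)) \<le> 1 / (1 + real N)"
        by (intro always_eventually allI) (simp add: abs_mult divide_right_mono)
    qed real_asymp
  qed
  ultimately have "integral {1..} ?f = 0 - ?F 1" by (simp add: LIMSEQ_unique)
  moreover have "integral {1..} ?f = integral {1..} (\<lambda>w. gauss_cos 1 \<epsilon> w / w) -
      (integral {1..} (\<lambda>w. sin w * ?E w / w\<^sup>2) + integral {1..} (\<lambda>w. \<epsilon>\<^sup>2 * sin w * ?E w))"
    using A B C by (simp add: set_lebesgue_integral_eq_integral(1) Henstock_Kurzweil_Integration.integral_diff Henstock_Kurzweil_Integration.integral_add integrable_add)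
  ultimately show "integral {1..} (\<lambda>w. gauss_cos 1 \<epsilon> w / w) = ?R" by simp
qed

text \<open>The integral of cos w / w over [1, infinity) after integration by parts, that is
  -Ci(1).\<close>

definition "osc_const = - sin 1 + integral {1..} (\<lambda>w::real. sin w / w\<^sup>2)"

lemma oscillating_limit:
  assumes \<epsilon>: "\<And>k. \<epsilon> k > 0" "\<epsilon> \<longlonglongrightarrow> 0"
  shows "(\<lambda>k. integral {1..} (\<lambda>w. gauss_cos 1 (\<epsilon> k) w / w)) \<longlonglongrightarrow> osc_const"
proof -
  have 1: "(\<lambda>k. - sin 1 * exp (- (\<epsilon> k)\<^sup>2 / 2)) \<longlonglongrightarrow> - sin 1 * exp (- 0\<^sup>2 / 2)"
    by (intro tendsto_intros \<epsilon>) auto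
  have 2: "(\<lambda>k. integral {1..} (\<lambda>w. sin w * exp (- ((\<epsilon> k)\<^sup>2 * w\<^sup>2) / 2) / w\<^sup>2)) \<longlonglongrightarrow> integral {1..} (\<lambda>w::real. sin w / w\<^sup>2)"
  proof (rule dominated_continuous[where h = "\<lambda>w. 1 / w\<^sup>2"])
    show "continuous_on {1..} (\<lambda>w. sin w * exp (- ((\<epsilon> k)\<^sup>2 * w\<^sup>2) / 2) / w\<^sup>2)" for k
      by (intro continuous_intros) auto
    show "\<bar>sin w * exp (- ((\<epsilon> k)\<^sup>2 * w\<^sup>2) / 2) / w\<^sup>2\<bar> \<le> 1 / w\<^sup>2" for k w
    proof -
      have "\<bar>sin w\<bar> * exp (- ((\<epsilon> k)\<^sup>2 * w\<^sup>2) / 2) \<le> 1 * 1" by (intro mult_mono) auto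
      then show ?thesis by (simp add: abs_mult divide_right_mono)
    qed
    show "(\<lambda>k. sin w * exp (- ((\<epsilon> k)\<^sup>2 * w\<^sup>2) / 2) / w\<^sup>2) \<longlonglongrightarrow> sin w / w\<^sup>2" if "w \<in> {1..}" for w
    proof -
      have "(\<lambda>k. sin w * exp (- ((\<epsilon> k)\<^sup>2 * w\<^sup>2) / 2) / w\<^sup>2) \<longlonglongrightarrow> sin w * exp (- (0\<^sup>2 * w\<^sup>2) / 2) / w\<^sup>2"
        by (intro tendsto_intros \<epsilon>) (use that in auto)
      then show ?thesis by simp
    qed
  qed (auto intro: inverse_square_integrable)
  have 3: "(\<lambda>k. integral {1..} (\<lambda>w. (\<epsilon> k)\<^sup>2 * sin w * exp (- ((\<epsilon> k)\<^sup>2 * w\<^sup>2) / 2))) \<longlonglongrightarrow> 0"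
  proof (rule Lim_null_comparison)
    show "\<forall>\<^sub>F k in sequentially. norm (integral {1..} (\<lambda>w. (\<epsilon> k)\<^sup>2 * sin w * exp (- ((\<epsilon> k)\<^sup>2 * w\<^sup>2) / 2))) \<le> 2 * \<epsilon> k"
      using oscillating_by_parts(3)[OF \<epsilon>(1)] by simp
    show "(\<lambda>k. 2 * \<epsilon> k) \<longlonglongrightarrow> 0" using tendsto_mult_right_zero[OF \<epsilon>(2)] .
  qed
  show ?thesis unfolding oscillating_by_parts(2)[OF \<epsilon>(1)] osc_const_def
    using tendsto_add[OF tendsto_add[OF 1 2] 3] by simp
qed

text \<open>Below w = 1 the part 1/w integrates to -ln \<kappa> and what remains of the integrand is
  bounded; above w = 1 \<open>oscillating_limit\<close> applies. The limit is minus Euler's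
  constant.\<close>

lemma log_oscillating_limit:
  assumes \<kappa>: "\<And>k. 0 < \<kappa> k" "\<And>k. \<kappa> k \<le> 1" "\<kappa> \<longlonglongrightarrow> 0"
    and \<epsilon>: "\<And>k. 0 < \<epsilon> k" "\<And>k. \<epsilon> k \<le> 1" "\<epsilon> \<longlonglongrightarrow> 0"
  shows "(\<lambda>k. integral {\<kappa> k..} (\<lambda>w. gauss_cos 1 (\<epsilon> k) w / w) + ln (\<kappa> k)) \<longlonglongrightarrow>
            integral {0<..1} (\<lambda>w. (cos w - 1) / w) + osc_const"
proof -
  let ?g = "\<lambda>k w. gauss_cos 1 (\<epsilon> k) w / w"
  let ?d = "\<lambda>k w. (gauss_cos 1 (\<epsilon> k) w - 1) / w"
  have dbd: "\<bar>?d k w\<bar> \<le> 1" if "w \<in> {0<..1}" for k w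
  proof -
    have "\<bar>gauss_cos 1 (\<epsilon> k) w - 1\<bar> \<le> (1\<^sup>2 + (\<epsilon> k)\<^sup>2) * w\<^sup>2 / 2" by (rule gauss_cos_diff)
    also have "\<dots> \<le> (1\<^sup>2 + 1) * (1 * w) / 2"
      using that \<epsilon>(1,2)[of k] unfolding power2_eq_square[of w]
      by (intro divide_right_mono mult_mono add_mono) (auto simp: power_le_one)
    finally show ?thesis using that by (simp add: divide_le_eq)
  qed
  have dI: "(\<lambda>k. integral {0<..1} (\<lambda>w. if w \<in> {\<kappa> k..} then ?d k w else 0)) \<longlonglongrightarrow> integral {0<..1} (\<lambda>w. (cos w - 1) / w)"
  proof (rule dominated_convergence(2)[where h = "\<lambda>_. 1"])
    show "(\<lambda>w. if w \<in> {\<kappa> k..} then ?d k w else 0) integrable_on {0<..1}" for k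
    proof -
      have "{0<..1} \<inter> {\<kappa> k..} = {\<kappa> k..1}" using \<kappa>(1)[of k] by auto
      moreover have "?d k integrable_on {\<kappa> k..1}"
        using \<kappa>(1)[of k] by (intro integrable_continuous_interval continuous_intros continuous_gauss_cos) auto
      ultimately show ?thesis by (subst integrable_restrict_Int) (simp add: Int_commute)
    qed
    show "(\<lambda>_. 1::real) integrable_on {0<..1::real}"
      using integrable_on_const[of "{0<..1::real}" "1::real"] by (simp add: fmeasurable_def)
    show "norm (if w \<in> {\<kappa> k..} then ?d k w else 0) \<le> 1" if "w \<in> {0<..1}" for k w
      using dbd[OF that] by auto
    show "(\<lambda>k. if w \<in> {\<kappa> k..} then ?d k w else 0) \<longlonglongrightarrow> (cos w - 1) / w" if "w \<in> {0<..1}" for w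
    proof -
      have "(\<lambda>k. gauss_cos 1 (\<epsilon> k) w) \<longlonglongrightarrow> cos (1 * w)" by (rule gauss_cos_tendsto) (use \<epsilon> in auto)
      then have "(\<lambda>k. ?d k w) \<longlonglongrightarrow> (cos (1 * w) - 1) / w" using that by (intro tendsto_intros) auto
      then have L: "(\<lambda>k. ?d k w) \<longlonglongrightarrow> (cos w - 1) / w" by simp
      have "\<forall>\<^sub>F k in sequentially. \<kappa> k < w" using order_tendstoD(2)[OF \<kappa>(3)] that by auto
      then have "\<forall>\<^sub>F k in sequentially. ?d k w = (if w \<in> {\<kappa> k..} then ?d k w else 0)"
        by (rule eventually_mono) simp
      then show ?thesis by (rule Lim_transform_eventually[OF L])
    qed
  qed
  have eq: "integral {\<kappa> k..} (?g k) + ln (\<kappa> k) =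
      integral {0<..1} (\<lambda>w. if w \<in> {\<kappa> k..} then ?d k w else 0) + integral {1..} (?g k)" for k
  proof -
    have k: "0 < \<kappa> k" "\<kappa> k \<le> 1" using \<kappa> by auto
    have i1: "?g k integrable_on {\<kappa> k..1}"
      using k by (intro integrable_continuous_interval continuous_intros continuous_gauss_cos) auto
    have i2: "?g k integrable_on {1..}"
      using set_lebesgue_integral_eq_integral(1)[OF oscillating_by_parts(1)[OF \<epsilon>(1)]] .
    have "{\<kappa> k..1} \<inter> {1..} = {1}" using k by auto
    moreover have "{\<kappa> k..1} \<union> {1..} = {\<kappa> k..}" using k by auto
    ultimately have 1: "integral {\<kappa> k..} (?g k) = integral {\<kappa> k..1} (?g k) + integral {1..} (?g k)"
      using Henstock_Kurzweil_Integration.integral_Un[OF i1 i2] by simp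
    have l: "((\<lambda>w. 1 / w) has_integral (ln 1 - ln (\<kappa> k))) {\<kappa> k..1}"
      by (rule fundamental_theorem_of_calculus)
         (use k in \<open>auto intro!: derivative_eq_intros simp flip: has_real_derivative_iff_has_vector_derivative\<close>)
    have "integral {\<kappa> k..1} (?d k) = integral {\<kappa> k..1} (\<lambda>w. ?g k w - 1 / w)"
      by (rule integral_cong) (simp add: diff_divide_distrib)
    also have "\<dots> = integral {\<kappa> k..1} (?g k) - integral {\<kappa> k..1} (\<lambda>w. 1 / w)"
      by (rule Henstock_Kurzweil_Integration.integral_diff[OF i1 has_integral_integrable[OF l]])
    also have "integral {\<kappa> k..1} (\<lambda>w. 1 / w) = - ln (\<kappa> k)" using integral_unique[OF l] by simp
    finally have 2: "integral {\<kappa> k..1} (?d k) = integral {\<kappa> k..1} (?g k) + ln (\<kappa> k)" by simp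
    have "{\<kappa> k..} \<inter> {0<..1} = {\<kappa> k..1}" using k by auto
    then have "integral {0<..1} (\<lambda>w. if w \<in> {\<kappa> k..} then ?d k w else 0) = integral {\<kappa> k..1} (?d k)"
      by (subst integral_restrict_Int) (simp add: Int_commute)
    then show ?thesis using 1 2 by simp
  qed
  show ?thesis unfolding eq by (intro tendsto_add dI oscillating_limit \<epsilon>)
qed

text \<open>The kernel of \<open>2 * M_beta\<close> in the variable x = X l. It is bounded near 0
  and equals 1/x + O(1/x^2) at infinity, so its integral up to the first oscillation is
  logarithmic.\<close>

definition beta_kernel :: "real \<Rightarrow> real" where "beta_kernel x = 2 * beta (2 / x) / x"

lemma beta_kernel_bounds: "x > 0 \<Longrightarrow> 0 \<le> beta_kernel x" "x > 0 \<Longrightarrow> beta_kernel x \<le> 1" "x \<ge> 1 \<Longrightarrow> \<bar>beta_kernel x - 1 / x\<bar> \<le> 2 / x\<^sup>2"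
proof -
  show "0 \<le> beta_kernel x" "beta_kernel x \<le> 1" if "x > 0" using beta_bounds(1,3)[of "2 / x"] that by (auto simp: beta_kernel_def field_simps)
  assume x: "x \<ge> 1"
  have "beta_kernel x - 1 / x = - ((1 - 2 * beta (2 / x)) / x)" by (simp add: beta_kernel_def diff_divide_distrib)
  moreover have "0 \<le> 1 - 2 * beta (2 / x)" using beta_bounds(2)[of "2 / x"] x by simp
  ultimately have "\<bar>beta_kernel x - 1 / x\<bar> = (1 - 2 * beta (2 / x)) / x" using x by simp
  also have "\<dots> \<le> (2 / x / 4 * exp (2 / x / 2)) / x" using beta_bounds(4)[of "2 / x"] x by (intro divide_right_mono) auto
  also have "\<dots> = exp (1 / x) / (2 * x\<^sup>2)" by (simp add: power2_eq_square)
  also have "\<dots> \<le> 4 / (2 * x\<^sup>2)"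
  proof (rule divide_right_mono)
    have "exp (1 / x) \<le> exp 1" using x by simp
    also have "\<dots> \<le> 4" using exp_le by simp
    finally show "exp (1 / x) \<le> 4" .
  qed simp
  finally show "\<bar>beta_kernel x - 1 / x\<bar> \<le> 2 / x\<^sup>2" by simp
qed

lemma beta_kernel_continuous: "continuous_on {0<..} beta_kernel"
proof -
  have "continuous_on {0<..} beta" by (rule DERIV_continuous_on[OF has_field_derivative_at_within[OF beta_deriv]]) auto
  then have "continuous_on {0<..} (\<lambda>x. beta (2 / x))" by (rule continuous_on_compose2) (auto intro!: continuous_intros)
  then show ?thesis unfolding beta_kernel_def by (intro continuous_intros) auto
qed

definition "beta_kernel_const = integral {0<..1} beta_kernel + integral {1..} (\<lambda>x. beta_kernel x - 1 / x)
     + integral {0<..1} (\<lambda>w. (cos w - 1) / w) + osc_const"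

text \<open>In the application \<kappa> = t / X is the frequency and \<epsilon> = H / t the Gaussian
  width relative to the centre. The part 1/x of the kernel on [1, infinity) becomes the integral of
  \<open>log_oscillating_limit\<close> under w = \<kappa> x; the rest converges without
  oscillation.\<close>

lemma beta_kernel_limit:
  assumes \<kappa>: "\<And>k. 0 < \<kappa> k" "\<And>k. \<kappa> k \<le> 1" "\<kappa> \<longlonglongrightarrow> 0"
    and \<epsilon>: "\<And>k. 0 < \<epsilon> k" "\<And>k. \<epsilon> k \<le> 1" "\<epsilon> \<longlonglongrightarrow> 0"
  shows "(\<lambda>k. integral {0<..} (\<lambda>x. beta_kernel x * gauss_cos (\<kappa> k) (\<epsilon> k * \<kappa> k) x) + ln (\<kappa> k)) \<longlonglongrightarrow> beta_kernel_const"
proof -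
  let ?C = "\<lambda>k. gauss_cos (\<kappa> k) (\<epsilon> k * \<kappa> k)"
  have \<epsilon>\<kappa>: "(\<lambda>k. \<epsilon> k * \<kappa> k) \<longlonglongrightarrow> 0" using tendsto_mult[OF \<epsilon>(3) \<kappa>(3)] by simp
  have Clim: "(\<lambda>k. ?C k x) \<longlonglongrightarrow> 1" for x using gauss_cos_tendsto[OF \<kappa>(3) \<epsilon>\<kappa>, of x] by simp
  have S1: "{0<..1::real} \<in> sets lebesgue" by simp
  have c1: "(\<lambda>_. 1::real) integrable_on {0<..1::real}"
      using integrable_on_const[of "{0<..1::real}" "1::real"] by (simp add: fmeasurable_def)
  have cA: "continuous_on {0<..1} (\<lambda>x. beta_kernel x * ?C k x)" for k
    by (intro continuous_intros continuous_gauss_cos continuous_on_subset[OF beta_kernel_continuous]) auto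
  have bA: "\<bar>beta_kernel x * ?C k x\<bar> \<le> 1" if "x \<in> {0<..1}" for x k
    using mult_mono[of "\<bar>beta_kernel x\<bar>" 1 "\<bar>?C k x\<bar>" 1] beta_kernel_bounds(1,2)[of x] that abs_gauss_cos_le_1[of "\<kappa> k" "\<epsilon> k * \<kappa> k" x]
    by (simp add: abs_mult)
  have A: "(\<lambda>k. integral {0<..1} (\<lambda>x. beta_kernel x * ?C k x)) \<longlonglongrightarrow> integral {0<..1} beta_kernel"
    by (rule dominated_continuous[OF S1 cA bA c1]) (use tendsto_mult[OF tendsto_const Clim] in auto)
  have cB: "continuous_on {1..} (\<lambda>x. (beta_kernel x - 1 / x) * ?C k x)" for k
    by (intro continuous_intros continuous_gauss_cos continuous_on_subset[OF beta_kernel_continuous]) auto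
  have bB: "\<bar>(beta_kernel x - 1 / x) * ?C k x\<bar> \<le> 2 / x\<^sup>2" if "x \<in> {1..}" for x k
    using mult_mono[of "\<bar>beta_kernel x - 1 / x\<bar>" "2 / x\<^sup>2" "\<bar>?C k x\<bar>" 1] beta_kernel_bounds(3)[of x] that abs_gauss_cos_le_1[of "\<kappa> k" "\<epsilon> k * \<kappa> k" x]
    by (simp add: abs_mult)
  have B: "(\<lambda>k. integral {1..} (\<lambda>x. (beta_kernel x - 1 / x) * ?C k x)) \<longlonglongrightarrow> integral {1..} (\<lambda>x. beta_kernel x - 1 / x)"
    by (rule dominated_continuous[OF _ cB bB inverse_square_integrable]) (use tendsto_mult[OF tendsto_const Clim] in auto)
  have eq: "integral {0<..} (\<lambda>x. beta_kernel x * ?C k x) = integral {0<..1} (\<lambda>x. beta_kernel x * ?C k x)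
     + integral {1..} (\<lambda>x. (beta_kernel x - 1 / x) * ?C k x) + integral {\<kappa> k..} (\<lambda>w. gauss_cos 1 (\<epsilon> k) w / w)" for k
  proof -
    have k: "0 < \<kappa> k" "\<kappa> k \<le> 1" using \<kappa> by auto
    have iA: "(\<lambda>x. beta_kernel x * ?C k x) integrable_on {0<..1}"
      by (rule measurable_bounded_by_integrable_imp_integrable[OF continuous_imp_measurable_on_sets_lebesgue[OF cA S1] c1 _ S1]) (use bA in auto)
    have iB: "(\<lambda>x. (beta_kernel x - 1 / x) * ?C k x) integrable_on {1..}"
      by (rule measurable_bounded_by_integrable_imp_integrable[OF continuous_imp_measurable_on_sets_lebesgue[OF cB] inverse_square_integrable]) (use bB in auto)
    let ?g = "\<lambda>w. gauss_cos 1 (\<epsilon> k) w / w"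
    have gI: "?g absolutely_integrable_on {\<kappa> k..}"
    proof -
      have "?g absolutely_integrable_on {\<kappa> k..1}"
        by (rule absolutely_integrable_continuous_real) (use k in \<open>intro continuous_intros continuous_gauss_cos; auto\<close>)
      then have "?g absolutely_integrable_on ({\<kappa> k..1} \<union> {1..})"
        by (rule absolutely_integrable_Un[OF _ oscillating_by_parts(1)[OF \<epsilon>(1)]])
      moreover have "{\<kappa> k..1} \<union> {1..} = {\<kappa> k..}" using k by auto
      ultimately show ?thesis by simp
    qed
    have img: "(\<lambda>x. \<kappa> k * x) ` {1..} = {\<kappa> k..}"
      using k by (auto simp: image_iff field_simps intro!: bexI[of _ "x / \<kappa> k" for x])
    have "(\<lambda>x. \<bar>\<kappa> k\<bar> *\<^sub>R ?g (\<kappa> k * x)) absolutely_integrable_on {1..} \<and> integral {1..} (\<lambda>x. \<bar>\<kappa> k\<bar> *\<^sub>R ?g (\<kappa> k * x)) = integral {\<kappa> k..} ?g"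
      by (subst has_absolute_integral_change_of_variables_real[where g = "\<lambda>x. \<kappa> k * x" and h = "\<lambda>_. \<kappa> k"])
         (use k gI img in \<open>auto intro!: derivative_eq_intros inj_onI\<close>)
    moreover have sub: "\<bar>\<kappa> k\<bar> *\<^sub>R ?g (\<kappa> k * x) = ?C k x / x" for x
      using k by (simp add: gauss_cos_def power_mult_distrib mult_ac)
    ultimately have iC: "(\<lambda>x. ?C k x / x) integrable_on {1..}" "integral {1..} (\<lambda>x. ?C k x / x) = integral {\<kappa> k..} ?g"
      by (auto simp: set_lebesgue_integral_eq_integral(1))
    have split: "(\<lambda>x. beta_kernel x * ?C k x) = (\<lambda>x. (beta_kernel x - 1 / x) * ?C k x + ?C k x / x)" by (simp add: algebra_simps)
    have iBC: "(\<lambda>x. beta_kernel x * ?C k x) integrable_on {1..}" unfolding split by (rule integrable_add[OF iB iC(1)])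
    have "{0<..1} \<inter> {1..} = {1::real}" "{0<..1} \<union> {1..} = {0::real<..}" by auto
    then have "integral {0<..} (\<lambda>x. beta_kernel x * ?C k x) = integral {0<..1} (\<lambda>x. beta_kernel x * ?C k x) + integral {1..} (\<lambda>x. beta_kernel x * ?C k x)"
      using Henstock_Kurzweil_Integration.integral_Un[OF iA iBC] by simp
    also have "integral {1..} (\<lambda>x. beta_kernel x * ?C k x) = integral {1..} (\<lambda>x. (beta_kernel x - 1 / x) * ?C k x) + integral {1..} (\<lambda>x. ?C k x / x)"
      unfolding split by (rule Henstock_Kurzweil_Integration.integral_add[OF iB iC(1)])
    finally show ?thesis using iC(2) by simp
  qed
  have "(\<lambda>k. integral {0<..1} (\<lambda>x. beta_kernel x * ?C k x) + integral {1..} (\<lambda>x. (beta_kernel x - 1 / x) * ?C k x)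
        + (integral {\<kappa> k..} (\<lambda>w. gauss_cos 1 (\<epsilon> k) w / w) + ln (\<kappa> k))) \<longlonglongrightarrow> beta_kernel_const"
    unfolding beta_kernel_const_def add.assoc[of _ "integral {0<..1} (\<lambda>w. (cos w - 1) / w)"]
    by (intro tendsto_add A B log_oscillating_limit assms)
  then show ?thesis unfolding eq by (simp add: add.assoc)
qed

lemma (in offdiag) M_beta_kernel:
  assumes "\<alpha> = 0"
  shows "2 * M_beta = integral {0<..} (\<lambda>x. beta_kernel x * gauss_cos (t0 / X) (H / X) x)"
proof -
  let ?f = "\<lambda>l. beta (2 / (X * l)) / l * c l"
  let ?g = "\<lambda>x. beta_kernel x / 2 * gauss_cos (t0 / X) (H / X) x"
  have X0: "X > 0" using X by simp
  have img: "(\<lambda>x. X * x) ` {0<..} = {0<..}"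
    using X0 by (auto simp: image_iff intro!: bexI[of _ "x / X" for x])
  have sub: "\<bar>X\<bar> *\<^sub>R ?g (X * l) = ?f l" for l
    using X0 by (simp add: beta_kernel_def c_def gauss_cos_def power_mult_distrib power_divide)
  have "(\<lambda>l. \<bar>X\<bar> *\<^sub>R ?g (X * l)) absolutely_integrable_on {0<..} \<and> integral {0<..} (\<lambda>l. \<bar>X\<bar> *\<^sub>R ?g (X * l)) = M_beta \<longleftrightarrow>
      ?g absolutely_integrable_on ((\<lambda>x. X * x) ` {0<..}) \<and> integral ((\<lambda>x. X * x) ` {0<..}) ?g = M_beta"
    by (rule has_absolute_integral_change_of_variables_real) (use X0 in \<open>auto intro!: derivative_eq_intros inj_onI\<close>)
  then have "integral {0<..} ?g = M_beta" unfolding sub img using M_bound_zero(1)[OF assms] by (simp add: M_beta_def)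
  moreover have "integral {0<..} (\<lambda>x. 2 * ?g x) = 2 * integral {0<..} ?g" by (rule integral_mult_right)
  ultimately show ?thesis by simp
qed

subsection \<open>The Gaussian mean square of the zeta function\<close>

text \<open>Half of the exponent gives the small factor; the other half remains as a Gaussian of
  deviation \<open>sqrt 2 * H\<close>, so that tails of unbounded functions are controlled by means
  of the same kind.\<close>

lemma gauss_tail:
  assumes H: "H > 0" and d: "\<bar>t - t0\<bar> \<ge> d" "d \<ge> 0"
  shows "normal_density t0 H t \<le> sqrt 2 * exp (- d\<^sup>2 / (4 * H\<^sup>2)) * normal_density t0 (sqrt 2 * H) t"
proof -
  have "d\<^sup>2 \<le> (t - t0)\<^sup>2" using d by (metis abs_of_nonneg abs_le_square_iff)
  then have "d\<^sup>2 / (4 * H\<^sup>2) \<le> (t - t0)\<^sup>2 / (4 * H\<^sup>2)" by (intro divide_right_mono) auto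
  then have "exp (- (t - t0)\<^sup>2 / (4 * H\<^sup>2) + - (t - t0)\<^sup>2 / (4 * H\<^sup>2)) \<le> exp (- d\<^sup>2 / (4 * H\<^sup>2) + - (t - t0)\<^sup>2 / (4 * H\<^sup>2))"
    by simp
  then have "exp (- (t - t0)\<^sup>2 / (2 * H\<^sup>2)) / sqrt (2 * pi * H\<^sup>2) \<le> exp (- d\<^sup>2 / (4 * H\<^sup>2)) * exp (- (t - t0)\<^sup>2 / (4 * H\<^sup>2)) / sqrt (2 * pi * H\<^sup>2)"
    by (intro divide_right_mono) (auto simp flip: exp_add)
  also have "sqrt (2 * pi * (sqrt 2 * H)\<^sup>2) = sqrt 2 * sqrt (2 * pi * H\<^sup>2)"
    by (simp add: power_mult_distrib real_sqrt_mult)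
  then have "exp (- d\<^sup>2 / (4 * H\<^sup>2)) * exp (- (t - t0)\<^sup>2 / (4 * H\<^sup>2)) / sqrt (2 * pi * H\<^sup>2) =
     sqrt 2 * exp (- d\<^sup>2 / (4 * H\<^sup>2)) * normal_density t0 (sqrt 2 * H) t"
    by (simp add: normal_density_def power_mult_distrib)
  finally show ?thesis by (simp add: normal_density_def)
qed

lemma norm_Gamma_le:
  assumes "Re z > 0" shows "norm (Gamma z) \<le> Gamma (Re z)"
proof -
  have 1: "((\<lambda>t. of_real t powr (z - 1) / of_real (exp t)) has_integral Gamma z) {0..}"
    by (rule Gamma_integral_complex[OF assms])
  have 2: "((\<lambda>t. t powr (Re z - 1) / exp t) has_integral Gamma (Re z)) {0..}"
    by (rule Gamma_integral_real[OF assms])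
  have "norm (integral {0..} (\<lambda>t. of_real t powr (z - 1) / of_real (exp t))) \<le> integral {0..} (\<lambda>t. t powr (Re z - 1) / exp t)"
  proof (rule integral_norm_bound_integral)
    fix t :: real assume "t \<in> {0..}"
    then show "norm (of_real t powr (z - 1) / of_real (exp t) :: complex) \<le> t powr (Re z - 1) / exp t"
      by (cases "t = 0") (auto simp: norm_divide norm_powr_real_powr)
  qed (use 1 2 in auto)
  then show ?thesis using 1 2 by (simp add: has_integral_iff)
qed

text \<open>Gamma(z) = Gamma(z + 2) / (z (z + 1)). Two shifts are taken because the square of the
  Gamma term is multiplied by up to X = T^{5/2}: decay t^{-2} of the norm suffices, decay t^{-1}
  would not.\<close>

lemma norm_Gamma_decay:
  assumes a: "0 < a" "a \<le> 1"
  shows "norm (Gamma (Complex a t)) \<le> Gamma (a + 2) / a / (1 + t\<^sup>2)"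
proof -
  let ?z = "Complex a t"
  have z: "?z \<noteq> 0" "?z + 1 \<noteq> 0" using a by (auto simp: complex_eq_iff)
  have "Gamma (?z + 1 + 1) = (?z + 1) * (?z * Gamma ?z)"
  proof -
    have "?z \<notin> \<int>\<^sub>\<le>\<^sub>0" "?z + 1 \<notin> \<int>\<^sub>\<le>\<^sub>0" using a by (auto elim!: nonpos_Ints_cases simp: complex_eq_iff)
    then show ?thesis using Gamma_plus1[of ?z] Gamma_plus1[of "?z + 1"] by metis
  qed
  then have "norm (Gamma (?z + 2)) = norm (?z + 1) * (norm ?z * norm (Gamma ?z))" by (simp add: norm_mult add.assoc)
  moreover have "norm (Gamma (?z + 2)) \<le> Gamma (a + 2)" using norm_Gamma_le[of "?z + 2"] a by simp
  moreover have "norm (?z + 1) * norm ?z \<ge> a * (1 + t\<^sup>2)"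
  proof -
    have "(norm (?z + 1))\<^sup>2 \<ge> 1 + t\<^sup>2" unfolding cmod_power2 using a by (simp add: one_le_power)
    then have 1: "norm (?z + 1) \<ge> sqrt (1 + t\<^sup>2)" by (simp add: real_le_lsqrt)
    have "a * a \<le> 1" using a by (simp add: mult_le_one)
    then have "(norm ?z)\<^sup>2 \<ge> (a * sqrt (1 + t\<^sup>2))\<^sup>2"
      using mult_right_mono[OF \<open>a * a \<le> 1\<close>, of "t\<^sup>2"]
      by (simp add: cmod_power2 power_mult_distrib algebra_simps power2_eq_square[of a])
    then have 2: "norm ?z \<ge> a * sqrt (1 + t\<^sup>2)" using power2_le_imp_le norm_ge_zero by blast
    have "sqrt (1 + t\<^sup>2) * (a * sqrt (1 + t\<^sup>2)) \<le> norm (?z + 1) * norm ?z"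
      using 1 2 a by (intro mult_mono) auto
    then show ?thesis by (simp add: algebra_simps)
  qed
  then have "a * (1 + t\<^sup>2) * norm (Gamma ?z) \<le> norm (?z + 1) * norm ?z * norm (Gamma ?z)" by (rule mult_right_mono) simp
  ultimately have "a * (1 + t\<^sup>2) * norm (Gamma ?z) \<le> Gamma (a + 2)" by (simp add: mult_ac)
  moreover have "1 + t\<^sup>2 > 0" by (simp add: add_pos_nonneg)
  ultimately have "norm (Gamma ?z) \<le> Gamma (a + 2) / (a * (1 + t\<^sup>2))"
    using a by (subst pos_le_divide_eq) (simp_all add: mult.commute)
  then show ?thesis by (simp only: divide_divide_eq_left)
qed

section \<open>Mean-square error of the smoothed series\<close>

definition zeta_line :: "real \<Rightarrow> real \<Rightarrow> complex" where
  "zeta_line \<sigma> t = zeta (of_real \<sigma> + \<i> * of_real t)"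

definition dir_coeff :: "real \<Rightarrow> real \<Rightarrow> nat \<Rightarrow> real" where
  "dir_coeff \<sigma> X n = real (Suc n) powr (- \<sigma>) * exp (- real (Suc n) / X)"

definition dir_series :: "real \<Rightarrow> real \<Rightarrow> real \<Rightarrow> complex" where
  "dir_series \<sigma> X t = (\<Sum>n. of_real (dir_coeff \<sigma> X n) * cis (- t * ln (real (Suc n))))"

lemma dir_coeff_nonneg: "dir_coeff \<sigma> X n \<ge> 0" by (simp add: dir_coeff_def)

lemma summable_dir_coeff:
  assumes "\<sigma> \<ge> 0" "X > 0" shows "summable (dir_coeff \<sigma> X)"
proof (rule summable_comparison_test')
  have "exp (- 1 / X) < 1" using assms by simp
  then show "summable (\<lambda>n. exp (- 1 / X) ^ n)" by (intro summable_geometric) auto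
  fix n
  have "dir_coeff \<sigma> X n \<le> 1 * exp (- real n / X)" unfolding dir_coeff_def
    using assms by (intro mult_mono) (auto simp: powr_minus inverse_le_1_iff ge_one_powr_ge_zero field_simps)
  then show "norm (dir_coeff \<sigma> X n) \<le> exp (- 1 / X) ^ n"
    using dir_coeff_nonneg[of \<sigma> X n] by (simp add: exp_of_nat_mult[symmetric])
qed

lemma powr_line:
  "complex_of_real (real (Suc n)) powr (- (of_real \<sigma> + \<i> * of_real t)) =
     of_real (real (Suc n) powr (- \<sigma>)) * cis (- t * ln (real (Suc n)))"
proof -
  have "complex_of_real (real (Suc n)) powr (- (of_real \<sigma> + \<i> * of_real t)) = exp (- (of_real \<sigma> + \<i> * of_real t) * of_real (ln (real (Suc n))))"
    using Ln_of_real[of "real (Suc n)"] by (simp add: powr_def del: of_nat_Suc)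
  also have "\<dots> = of_real (exp (- \<sigma> * ln (real (Suc n)))) * cis (- t * ln (real (Suc n)))"
    by (simp add: cis_conv_exp exp_of_real[symmetric] algebra_simps flip: exp_add)
  also have "exp (- \<sigma> * ln (real (Suc n))) = real (Suc n) powr (- \<sigma>)" by (simp add: powr_def)
  finally show ?thesis .
qed

lemma zeta_dir_series:
  assumes \<sigma>: "0 < \<sigma>" "\<sigma> < 1" and X: "X > 0"
  shows "norm (zeta_line \<sigma> t - dir_series \<sigma> X t) \<le>
     Gamma (3 - \<sigma>) / (1 - \<sigma>) / (1 + t\<^sup>2) * X powr (1 - \<sigma>) + (2 + \<bar>t\<bar> / \<sigma>) * (Gamma (1 - \<sigma>) * X powr (- \<sigma>))"
proof -
  let ?s = "of_real \<sigma> + \<i> * of_real t"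
  interpret E: exp_smoothing ?s X by standard (use assms in auto)
  have E: "E.E (real (Suc n)) = of_real (dir_coeff \<sigma> X n) * cis (- t * ln (real (Suc n)))" for n
    unfolding E.E_def powr_line dir_coeff_def by simp
  have 1: "norm (zeta_line \<sigma> t - (dir_series \<sigma> X t - Gamma (1 - ?s) * of_real X powr (1 - ?s)))
      \<le> (norm ?s / \<sigma> + 1) * (Gamma (1 - \<sigma>) * X powr (- \<sigma>))"
    using E.zeta_smooth_approx unfolding E dir_series_def zeta_line_def by simp
  have G: "Gamma (1 - \<sigma>) > 0" using \<sigma> by (intro Gamma_real_pos) simp
  have "norm ?s \<le> \<sigma> + \<bar>t\<bar>" using norm_triangle_ineq[of "of_real \<sigma>" "\<i> * of_real t"] \<sigma> by (simp add: norm_mult)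
  then have "norm ?s / \<sigma> \<le> (\<sigma> + \<bar>t\<bar>) / \<sigma>" using \<sigma> by (intro divide_right_mono) auto
  then have "norm ?s / \<sigma> + 1 \<le> 2 + \<bar>t\<bar> / \<sigma>" using \<sigma> by (simp add: add_divide_distrib)
  then have 2: "(norm ?s / \<sigma> + 1) * (Gamma (1 - \<sigma>) * X powr (- \<sigma>)) \<le> (2 + \<bar>t\<bar> / \<sigma>) * (Gamma (1 - \<sigma>) * X powr (- \<sigma>))"
    using G by (intro mult_right_mono) auto
  have s_eq: "1 - ?s = Complex (1 - \<sigma>) (- t)" by (simp add: complex_eq_iff)
  have Gd: "norm (Gamma (1 - ?s)) \<le> Gamma (3 - \<sigma>) / (1 - \<sigma>) / (1 + t\<^sup>2)"
    unfolding s_eq using norm_Gamma_decay[of "1 - \<sigma>" "- t"] \<sigma> by simp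
  have Xp: "norm (of_real X powr (1 - ?s)) = X powr (1 - \<sigma>)" using X by (subst norm_powr_real_powr) auto
  have 3: "norm (Gamma (1 - ?s) * of_real X powr (1 - ?s)) \<le> Gamma (3 - \<sigma>) / (1 - \<sigma>) / (1 + t\<^sup>2) * X powr (1 - \<sigma>)"
    unfolding norm_mult Xp by (rule mult_right_mono[OF Gd]) simp
  have "zeta_line \<sigma> t - dir_series \<sigma> X t = (zeta_line \<sigma> t - (dir_series \<sigma> X t - Gamma (1 - ?s) * of_real X powr (1 - ?s))) - Gamma (1 - ?s) * of_real X powr (1 - ?s)"
    by simp
  then have "norm (zeta_line \<sigma> t - dir_series \<sigma> X t) \<le> norm (zeta_line \<sigma> t - (dir_series \<sigma> X t - Gamma (1 - ?s) * of_real X powr (1 - ?s))) + norm (Gamma (1 - ?s) * of_real X powr (1 - ?s))"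
    by (metis norm_triangle_ineq4)
  then show ?thesis using 1 2 3 by linarith
qed

lemma second_moment:
  assumes "H > 0"
  shows "integrable lborel (\<lambda>t. normal_density t0 H t * (1 + t\<^sup>2))"
    and "(LINT t|lborel. normal_density t0 H t * (1 + t\<^sup>2)) \<le> 1 + 2 * t0\<^sup>2 + 2 * H\<^sup>2"
proof -
  have m: "has_bochner_integral lborel (\<lambda>t. normal_density t0 H t * (t - t0)\<^sup>2) (H\<^sup>2)"
    using normal_moment_even[of H t0 1] assms by (simp add: fact_2)
  have n: "has_bochner_integral lborel (normal_density t0 H) 1"
    using assms by (simp add: has_bochner_integral_iff)
  have B: "has_bochner_integral lborel (\<lambda>t. (1 + 2 * t0\<^sup>2) * normal_density t0 H t + 2 * (normal_density t0 H t * (t - t0)\<^sup>2)) ((1 + 2 * t0\<^sup>2) * 1 + 2 * H\<^sup>2)"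
    by (intro has_bochner_integral_add has_bochner_integral_mult_right m n)
  have le: "normal_density t0 H t * (1 + t\<^sup>2) \<le> (1 + 2 * t0\<^sup>2) * normal_density t0 H t + 2 * (normal_density t0 H t * (t - t0)\<^sup>2)" for t
  proof -
    have "(t - 2 * t0)\<^sup>2 \<ge> 0" by simp
    then have "1 + t\<^sup>2 \<le> 1 + 2 * t0\<^sup>2 + 2 * (t - t0)\<^sup>2" by (simp add: power2_eq_square algebra_simps)
    from mult_left_mono[OF this, of "normal_density t0 H t"] show ?thesis by (simp add: algebra_simps)
  qed
  show I: "integrable lborel (\<lambda>t. normal_density t0 H t * (1 + t\<^sup>2))"
    by (rule Bochner_Integration.integrable_bound[OF conjunct1[OF B[unfolded has_bochner_integral_iff]]])
       (use le in \<open>auto simp: abs_mult intro!: AE_I2 order_trans[OF _ abs_ge_self]\<close>)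
  have "(LINT t|lborel. normal_density t0 H t * (1 + t\<^sup>2)) \<le> (LINT t|lborel. (1 + 2 * t0\<^sup>2) * normal_density t0 H t + 2 * (normal_density t0 H t * (t - t0)\<^sup>2))"
    by (rule integral_mono[OF I conjunct1[OF B[unfolded has_bochner_integral_iff]] le])
  then show "(LINT t|lborel. normal_density t0 H t * (1 + t\<^sup>2)) \<le> 1 + 2 * t0\<^sup>2 + 2 * H\<^sup>2"
    using has_bochner_integral_integral_eq[OF B] by simp
qed

text \<open>Within t0/2 of the centre the factor is at most 16 / t0^4; farther out it is at most 1
  and \<open>gauss_tail\<close> applies with d = t0/2.\<close>

lemma decay_moment:
  assumes H: "H > 0" and t0: "t0 > 0"
  shows "integrable lborel (\<lambda>t. normal_density t0 H t * (1 / (1 + t\<^sup>2)\<^sup>2))"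
    and "(LINT t|lborel. normal_density t0 H t * (1 / (1 + t\<^sup>2)\<^sup>2)) \<le> 16 / t0 ^ 4 + 2 * exp (- t0\<^sup>2 / (16 * H\<^sup>2))"
proof -
  let ?f = "\<lambda>t. normal_density t0 H t * (1 / (1 + t\<^sup>2)\<^sup>2)"
  let ?e = "exp (- (t0 / 2)\<^sup>2 / (4 * H\<^sup>2))"
  let ?g = "\<lambda>t. 16 / t0 ^ 4 * normal_density t0 H t + sqrt 2 * ?e * normal_density t0 (sqrt 2 * H) t"
  have one: "1 / (1 + t\<^sup>2)\<^sup>2 \<le> 1" for t :: real
    by (simp add: divide_le_eq_1 add_nonneg_eq_0_iff one_le_power)
  have le: "?f t \<le> ?g t" for t
  proof (cases "\<bar>t - t0\<bar> \<ge> t0 / 2")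
    case True
    have "?f t \<le> normal_density t0 H t * 1" by (intro mult_left_mono one) simp
    also have "\<dots> \<le> sqrt 2 * ?e * normal_density t0 (sqrt 2 * H) t" using gauss_tail[OF H True] t0 by simp
    also have "\<dots> \<le> ?g t" using t0 by simp
    finally show ?thesis .
  next
    case False
    then have "t \<ge> t0 / 2" by (auto simp: abs_if split: if_splits)
    then have "(t0 / 2)\<^sup>2 \<le> t\<^sup>2" using t0 by (intro power_mono) auto
    then have "(t0 / 2)\<^sup>2 \<le> 1 + t\<^sup>2" by (rule order_trans) simp
    then have "((t0 / 2)\<^sup>2)\<^sup>2 \<le> (1 + t\<^sup>2)\<^sup>2" by (rule power_mono) simp
    then have "t0 ^ 4 / 16 \<le> (1 + t\<^sup>2)\<^sup>2" by (simp add: power_divide)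
    then have "1 / (1 + t\<^sup>2)\<^sup>2 \<le> 1 / (t0 ^ 4 / 16)" using t0 by (intro divide_left_mono) (auto simp: add_nonneg_eq_0_iff intro!: mult_pos_pos zero_less_power add_pos_nonneg)
    then have "?f t \<le> normal_density t0 H t * (16 / t0 ^ 4)" by (intro mult_left_mono) auto
    also have "\<dots> \<le> ?g t" by (simp add: mult.commute)
    finally show ?thesis .
  qed
  have G: "has_bochner_integral lborel ?g (16 / t0 ^ 4 * 1 + sqrt 2 * ?e * 1)"
    by (intro has_bochner_integral_add has_bochner_integral_mult_right) (use H in \<open>simp_all add: has_bochner_integral_iff\<close>)
  show I: "integrable lborel ?f"
    by (rule Bochner_Integration.integrable_bound[OF conjunct1[OF G[unfolded has_bochner_integral_iff]]])
       (use le in \<open>auto simp: abs_mult intro!: AE_I2 order_trans[OF _ abs_ge_self]\<close>)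
  have "(LINT t|lborel. ?f t) \<le> (LINT t|lborel. ?g t)"
    by (rule integral_mono[OF I conjunct1[OF G[unfolded has_bochner_integral_iff]] le])
  also have "\<dots> = 16 / t0 ^ 4 + sqrt 2 * ?e" using has_bochner_integral_integral_eq[OF G] by simp
  also have "\<dots> \<le> 16 / t0 ^ 4 + 2 * ?e" using sqrt2_less_2 by (intro add_mono mult_right_mono) auto
  finally show "(LINT t|lborel. ?f t) \<le> 16 / t0 ^ 4 + 2 * exp (- t0\<^sup>2 / (16 * H\<^sup>2))" by (simp add: power_divide)
qed

lemma zeta_line_continuous:
  assumes "\<sigma> \<noteq> 1 \<or> 0 \<notin> S" shows "continuous_on S (zeta_line \<sigma>)"
proof -
  have "continuous_on (- {1}) zeta" using zeta_holomorphic by (rule holomorphic_on_imp_continuous_on)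
  then show ?thesis unfolding zeta_line_def
    by (rule continuous_on_compose2) (use assms in \<open>auto intro!: continuous_intros simp: complex_eq_iff\<close>)
qed

text \<open>The two errors of \<open>zeta_dir_series\<close> depend on X in opposite ways. For
  \<sigma> \<ge> 1/2 their squares carry at most X and 1/X, so one bound, governed by the critical
  line, serves all these lines.\<close>

lemma zeta_error_moment:
  assumes \<sigma>: "1/2 \<le> \<sigma>" "\<sigma> < 1"
  obtains C where "C > 0" "\<And>X H t0. X \<ge> 1 \<Longrightarrow> H > 0 \<Longrightarrow> t0 > 0 \<Longrightarrow>
     integrable lborel (\<lambda>t. normal_density t0 H t * (norm (zeta_line \<sigma> t - dir_series \<sigma> X t))\<^sup>2) \<and>
     (LINT t|lborel. normal_density t0 H t * (norm (zeta_line \<sigma> t - dir_series \<sigma> X t))\<^sup>2)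
       \<le> C * (X * (16 / t0 ^ 4 + 2 * exp (- t0\<^sup>2 / (16 * H\<^sup>2))) + (1 + 2 * t0\<^sup>2 + 2 * H\<^sup>2) / X)"
proof -
  define A where "A = Gamma (3 - \<sigma>) / (1 - \<sigma>)"
  define B where "B = 2 * Gamma (1 - \<sigma>)"
  define C where "C = 2 * A\<^sup>2 + 4 * B\<^sup>2 + 1"
  have G: "Gamma (1 - \<sigma>) > 0" "Gamma (3 - \<sigma>) > 0" using \<sigma> by (auto intro!: Gamma_real_pos)
  have A: "A \<ge> 0" "B \<ge> 0" "C > 0" using \<sigma> G by (auto simp: A_def B_def C_def intro!: add_nonneg_pos)
  show ?thesis
  proof (rule that[OF A(3)])
    fix X H t0 :: real assume X: "X \<ge> 1" and H: "H > 0" and t0: "t0 > 0"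
    let ?e = "\<lambda>t. norm (zeta_line \<sigma> t - dir_series \<sigma> X t)"
    have XX: "(X powr (1 - \<sigma>))\<^sup>2 \<le> X" "(X powr (- \<sigma>))\<^sup>2 \<le> 1 / X"
    proof -
      have "(X powr (1 - \<sigma>))\<^sup>2 = X powr (2 * (1 - \<sigma>))" using X by (simp add: powr_power)
      also have "\<dots> \<le> X powr 1" using X \<sigma> by (intro powr_mono) auto
      finally show "(X powr (1 - \<sigma>))\<^sup>2 \<le> X" using X by simp
      have "(X powr (- \<sigma>))\<^sup>2 = X powr (2 * (- \<sigma>))" using X by (simp add: powr_power)
      also have "\<dots> \<le> X powr (- 1)" using X \<sigma> by (intro powr_mono) auto
      finally show "(X powr (- \<sigma>))\<^sup>2 \<le> 1 / X" using X by (simp add: powr_minus_divide)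
    qed
    have pt: "(?e t)\<^sup>2 \<le> C * (X * (1 / (1 + t\<^sup>2)\<^sup>2) + 1 / X * (1 + t\<^sup>2))" for t
    proof -
      have t2: "1 + t\<^sup>2 > 0" by (simp add: add_pos_nonneg)
      have "(2 + \<bar>t\<bar> / \<sigma>) * Gamma (1 - \<sigma>) \<le> (2 + \<bar>t\<bar> * 2) * Gamma (1 - \<sigma>)"
        using G \<sigma> by (intro mult_right_mono add_left_mono) (auto simp: divide_le_eq mult_le_cancel_left1 mult.assoc)
      then have "?e t \<le> A / (1 + t\<^sup>2) * X powr (1 - \<sigma>) + (1 + \<bar>t\<bar>) * B * X powr (- \<sigma>)"
        using zeta_dir_series[of \<sigma> X t] \<sigma> X mult_right_mono[of "(2 + \<bar>t\<bar> / \<sigma>) * Gamma (1 - \<sigma>)" "(2 + \<bar>t\<bar> * 2) * Gamma (1 - \<sigma>)" "X powr (- \<sigma>)"]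
        unfolding A_def B_def by (simp add: algebra_simps)
      then have "(?e t)\<^sup>2 \<le> (A / (1 + t\<^sup>2) * X powr (1 - \<sigma>) + (1 + \<bar>t\<bar>) * B * X powr (- \<sigma>))\<^sup>2"
        by (rule power_mono) simp
      also have "\<dots> \<le> 2 * (A / (1 + t\<^sup>2) * X powr (1 - \<sigma>))\<^sup>2 + 2 * ((1 + \<bar>t\<bar>) * B * X powr (- \<sigma>))\<^sup>2"
        using sum_squares_bound[of "A / (1 + t\<^sup>2) * X powr (1 - \<sigma>)" "(1 + \<bar>t\<bar>) * B * X powr (- \<sigma>)"] by (simp add: power2_sum)
      also have "(A / (1 + t\<^sup>2) * X powr (1 - \<sigma>))\<^sup>2 \<le> A\<^sup>2 * (1 / (1 + t\<^sup>2)\<^sup>2) * X"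
        unfolding power_mult_distrib power_divide using XX by (simp add: mult_left_mono divide_right_mono)
      also have "((1 + \<bar>t\<bar>) * B * X powr (- \<sigma>))\<^sup>2 \<le> (2 * (1 + t\<^sup>2)) * B\<^sup>2 * (1 / X)"
        unfolding power_mult_distrib
      proof (intro mult_mono XX order_refl)
        have "2 * \<bar>t\<bar> \<le> 1 + t\<^sup>2" using sum_squares_bound[of 1 "\<bar>t\<bar>"] by simp
        then show "(1 + \<bar>t\<bar>)\<^sup>2 \<le> 2 * (1 + t\<^sup>2)" by (simp add: power2_sum)
      qed auto
      finally have "(?e t)\<^sup>2 \<le> 2 * A\<^sup>2 * (X * (1 / (1 + t\<^sup>2)\<^sup>2)) + 4 * B\<^sup>2 * (1 / X * (1 + t\<^sup>2))"
        by (simp add: algebra_simps)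
      also have "\<dots> \<le> C * (X * (1 / (1 + t\<^sup>2)\<^sup>2)) + C * (1 / X * (1 + t\<^sup>2))"
        unfolding C_def using X t2 by (intro add_mono mult_right_mono) auto
      finally show ?thesis by (simp add: distrib_left)
    qed
    let ?g = "\<lambda>t. C * X * (normal_density t0 H t * (1 / (1 + t\<^sup>2)\<^sup>2)) + C / X * (normal_density t0 H t * (1 + t\<^sup>2))"
    have le: "normal_density t0 H t * (?e t)\<^sup>2 \<le> ?g t" for t
      using mult_left_mono[OF pt[of t], of "normal_density t0 H t"] by (simp add: algebra_simps)
    have gI: "integrable lborel ?g"
      by (intro Bochner_Integration.integrable_add integrable_mult_right decay_moment(1)[OF H t0] second_moment(1)[OF H])
    have [measurable]: "zeta_line \<sigma> \<in> borel_measurable borel"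
      using zeta_line_continuous[of \<sigma> UNIV] \<sigma> by (intro borel_measurable_continuous_onI) auto
    have [measurable]: "dir_series \<sigma> X \<in> borel_measurable borel"
      unfolding dir_series_def
    proof (rule borel_measurable_LIMSEQ_metric)
      show "(\<lambda>t. \<Sum>n<N. of_real (dir_coeff \<sigma> X n) * cis (- t * ln (real (Suc n)))) \<in> borel_measurable borel" for N
        by (intro borel_measurable_continuous_onI continuous_intros)
      show "(\<lambda>N. \<Sum>n<N. of_real (dir_coeff \<sigma> X n) * cis (- t * ln (real (Suc n)))) \<longlonglongrightarrow> (\<Sum>n. of_real (dir_coeff \<sigma> X n) * cis (- t * ln (real (Suc n))))" for t
      proof (rule summable_LIMSEQ, rule summable_comparison_test')
        show "summable (dir_coeff \<sigma> X)" using \<sigma> X by (intro summable_dir_coeff) auto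
      qed (simp add: norm_mult dir_coeff_nonneg)
    qed
    have I: "integrable lborel (\<lambda>t. normal_density t0 H t * (?e t)\<^sup>2)"
      by (rule Bochner_Integration.integrable_bound[OF gI])
         (use le in \<open>auto simp: abs_mult intro!: AE_I2 order_trans[OF _ abs_ge_self]\<close>)
    have "(LINT t|lborel. normal_density t0 H t * (?e t)\<^sup>2) \<le> (LINT t|lborel. ?g t)" by (rule integral_mono[OF I gI le])
    also have "\<dots> = C * X * (LINT t|lborel. normal_density t0 H t * (1 / (1 + t\<^sup>2)\<^sup>2)) + C / X * (LINT t|lborel. normal_density t0 H t * (1 + t\<^sup>2))"
      by (subst Bochner_Integration.integral_add)
         ((intro integrable_mult_right decay_moment(1)[OF H t0] second_moment(1)[OF H])+, simp only: integral_mult_right_zero)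
    also have "\<dots> \<le> C * X * (16 / t0 ^ 4 + 2 * exp (- t0\<^sup>2 / (16 * H\<^sup>2))) + C / X * (1 + 2 * t0\<^sup>2 + 2 * H\<^sup>2)"
      using A X by (intro add_mono mult_left_mono decay_moment(2)[OF H t0] second_moment(2)[OF H]) auto
    also have "\<dots> = C * (X * (16 / t0 ^ 4 + 2 * exp (- t0\<^sup>2 / (16 * H\<^sup>2))) + (1 + 2 * t0\<^sup>2 + 2 * H\<^sup>2) / X)"
      by (simp only: distrib_left mult.assoc times_divide_eq_left times_divide_eq_right add_divide_distrib)
    finally show "integrable lborel (\<lambda>t. normal_density t0 H t * (?e t)\<^sup>2) \<and> (LINT t|lborel. normal_density t0 H t * (?e t)\<^sup>2)
       \<le> C * (X * (16 / t0 ^ 4 + 2 * exp (- t0\<^sup>2 / (16 * H\<^sup>2))) + (1 + 2 * t0\<^sup>2 + 2 * H\<^sup>2) / X)"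
      using I by blast
  qed
qed

lemma (in offdiag) q_eq_symmetric:
  assumes h: "h > 0" and x: "x > 0"
  shows "q h x = x powr (- ((1 + \<alpha>) / 2)) * exp (- x / X) * ((x + h) powr (- ((1 + \<alpha>) / 2)) * exp (- (x + h) / X)) *
            gauss_cos t0 H (ln (x + h) - ln x)"
proof -
  define l where "l = ln (1 + h / x)"
  have e: "exp l = (x + h) / x" unfolding l_def using h x by (simp add: field_simps add_pos_pos)
  have l_eq: "l = ln (x + h) - ln x"
  proof -
    have "1 + h / x = (x + h) / x" using x by (simp add: field_simps)
    then show ?thesis unfolding l_def using h x by (simp add: ln_div)
  qed
  have l0: "l > 0" unfolding l_eq using h x by simp
  have S: "sh l > 0" by (rule sh_pos[OF l0])
  have "exp l - 1 = exp (l / 2) * sh l" by (simp add: sh_def algebra_simps flip: exp_add)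
  moreover have "exp l + 1 = exp (l / 2) * ch l" by (simp add: ch_def algebra_simps flip: exp_add)
  ultimately have "ch l / sh l = (exp l + 1) / (exp l - 1)" by simp
  also have "\<dots> = (2 * x + h) / h" unfolding e using h x by (simp add: field_simps)
  finally have "y l = (2 * x + h) / h / X" unfolding y_def by (metis divide_divide_eq_left mult.commute)
  then have "h * y l = (2 * x + h) / X" using h by simp
  then have "- h * y l = - x / X + - (x + h) / X" using X by (simp add: field_simps)
  then have 1: "exp (- h * y l) = exp (- x / X) * exp (- (x + h) / X)"
    by (simp only: exp_add)
  have "(exp l - 1)\<^sup>2 = exp l * (sh l)\<^sup>2" using \<open>exp l - 1 = exp (l / 2) * sh l\<close>
    by (simp add: power_mult_distrib flip: exp_double)
  then have "(sh l)\<^sup>2 = (exp l - 1)\<^sup>2 / exp l" by simp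
  also have "\<dots> = h\<^sup>2 / (x * (x + h))" unfolding e using h x by (simp add: field_simps power2_eq_square)
  finally have "(sh l / h)\<^sup>2 = 1 / (x * (x + h))" using h by (simp add: power_divide)
  moreover have "(sh l / h) powr (1 + \<alpha>) = ((sh l / h)\<^sup>2) powr ((1 + \<alpha>) / 2)"
    using S h by (simp add: powr_powr add_divide_distrib flip: powr_numeral)
  ultimately have "(sh l / h) powr (1 + \<alpha>) = (1 / (x * (x + h))) powr ((1 + \<alpha>) / 2)" by simp
  also have "\<dots> = x powr (- ((1 + \<alpha>) / 2)) * (x + h) powr (- ((1 + \<alpha>) / 2))"
    using h x by (simp add: powr_divide powr_mult powr_minus_divide)
  finally show ?thesis using 1 unfolding q_def r_def c_def l_def[symmetric] l_eq[symmetric] by simp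
qed

lemma dir_series_mean:
  assumes \<sigma>: "1/2 \<le> \<sigma>" "\<sigma> < 1" and X: "X \<ge> 1" and H: "H \<ge> 1" and t0: "t0 \<ge> 0"
  shows "integrable lborel (\<lambda>t. normal_density t0 H t * (norm (dir_series \<sigma> X t))\<^sup>2)"
    and "\<bar>(LINT t|lborel. normal_density t0 H t * (norm (dir_series \<sigma> X t))\<^sup>2)
           - ((\<Sum>n. (dir_coeff \<sigma> X n)\<^sup>2) + 2 * offdiag.M (2 * \<sigma> - 1) X H t0)\<bar>
         \<le> 2 * gauss_K * (1 + t0 / H) / H * ln (4 * X)"
proof -
  interpret O: offdiag "2 * \<sigma> - 1" X H t0 by standard (use assms in auto)
  let ?a = "dir_coeff \<sigma> X"
  let ?w = "\<lambda>n. ln (real (Suc n))"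
  let ?S = "LINT t|lborel. normal_density t0 H t * (norm (dir_series \<sigma> X t))\<^sup>2"
  let ?f = "\<lambda>(m, n). ?a m * ?a n * gauss_cos t0 H (?w n - ?w m)"
  have D: "dir_series \<sigma> X = (\<lambda>t. \<Sum>n. of_real (?a n) * cis (- t * ?w n))" by (simp add: dir_series_def fun_eq_iff)
  have sa: "summable ?a" by (rule summable_dir_coeff) (use \<sigma> X in auto)
  have H0: "H > 0" using H by simp
  show "integrable lborel (\<lambda>t. normal_density t0 H t * (norm (dir_series \<sigma> X t))\<^sup>2)"
    unfolding D by (rule dirichlet_gaussian_mean(1)[OF dir_coeff_nonneg sa H0])
  have sum: "(?f has_sum ?S) UNIV"
    unfolding D by (rule dirichlet_gaussian_mean(2)[OF dir_coeff_nonneg sa H0])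
  have "?f (m, n) = ?f (n, m)" for m n
    using gauss_cos_minus[of t0 H "?w n - ?w m"] by (simp add: mult.commute)
  from has_sum_symmetric_split[OF this sum] obtain T where
    T: "((\<lambda>(h, m). ?f (m, m + Suc h)) has_sum T) UNIV" and d: "(\<lambda>n. ?f (n, n)) sums (?S - 2 * T)" by blast
  have "(\<lambda>n. ?f (n, n)) = (\<lambda>n. (?a n)\<^sup>2)" by (simp add: fun_eq_iff gauss_cos_def power2_eq_square)
  with d have S: "?S = (\<Sum>n. (?a n)\<^sup>2) + 2 * T" by (simp add: sums_iff)
  have "?f (m, m + Suc h) = O.q (real (Suc h)) (real (Suc m))" for h m
  proof -
    have "real (Suc m) + real (Suc h) = real (Suc (m + Suc h))" by simp
    then show ?thesis using O.q_eq_symmetric[of "real (Suc h)" "real (Suc m)"] by (simp add: dir_coeff_def)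
  qed
  then have "((\<lambda>(h, m). O.q (real (Suc h)) (real (Suc m))) has_sum T) UNIV" using T by (simp only:)
  from O.offdiag_main[OF this] have "\<bar>T - O.M\<bar> \<le> gauss_K * (1 + t0 / H) / H * ln (4 * X)"
    by (simp add: O.M_def gauss_K_def)
  then show "\<bar>?S - ((\<Sum>n. (?a n)\<^sup>2) + 2 * O.M)\<bar> \<le> 2 * gauss_K * (1 + t0 / H) / H * ln (4 * X)"
    unfolding S by (simp add: abs_le_iff)
qed

text \<open>The exponents are such that \<open>X\<close> exceeds \<open>T^2\<close>, the size of the mean square of \<open>\<bar>s\<bar>\<close> in the smoothing error, while
  \<open>X / H^3\<close>, the contribution of the removed pole, still tends to zero.\<close>

definition "smooth_H T = T powr (9/10)" for T :: real
definition "smooth_X T = T powr (5/2)" for T :: real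

definition "zeta_gauss_mean \<sigma> t0 H = (LINT t|lborel. normal_density t0 H t * (norm (zeta_line \<sigma> t))\<^sup>2)"
definition "dir_gauss_mean \<sigma> X t0 H = (LINT t|lborel. normal_density t0 H t * (norm (dir_series \<sigma> X t))\<^sup>2)"

text \<open>The mean of |zeta|^2 near height t is \<open>log_coeff\<close> times ln t plus
  \<open>mean_const\<close>. This common form lets the critical line and the lines to its right
  share the removal of the Gaussian.\<close>

definition "log_coeff \<sigma> = (if \<sigma> = 1/2 then 1 else 0 :: real)"
definition "mean_const \<sigma> = (if \<sigma> = 1/2 then - ln 2 - beta_kernel_const else zeta_real (2 * \<sigma>))"

lemma zeta_real_sums: "c > 1 \<Longrightarrow> (\<lambda>n. real (Suc n) powr (- c)) sums zeta_real c"
proof -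
  assume c: "c > 1"
  have "of_real (real (Suc n)) powr (- complex_of_real c) = of_real (real (Suc n) powr (- c))" for n
    using powr_of_real[of "real (Suc n)" "- c"] by simp
  then have "(\<lambda>n. complex_of_real (real (Suc n) powr (- c))) sums zeta (of_real c)"
    using zeta_sums[of "of_real c"] c by simp
  from sums_Re[OF this] show ?thesis by (simp add: zeta_real_def)
qed

lemma zeta_real_pos: "c > 1 \<Longrightarrow> zeta_real c > 0"
  using zeta_real_sums[of c] suminf_pos[of "\<lambda>n. real (Suc n) powr (- c)"] by (simp add: sums_iff)

lemma diagonal_sum_half:
  assumes X: "filterlim X at_top sequentially" "\<And>k. X k \<ge> 1"
  shows "(\<lambda>k. (\<Sum>n. (dir_coeff (1/2) (X k) n)\<^sup>2) - ln (X k)) \<longlonglongrightarrow> - ln 2"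
proof -
  have "(\<Sum>n. (dir_coeff (1/2) x n)\<^sup>2) = - ln (1 - exp (- (2 / x)))" if "x \<ge> 1" for x
  proof -
    have "(dir_coeff (1/2) x n)\<^sup>2 = exp (- real (Suc n) * (2 / x)) / real (Suc n)" for n
    proof -
      have "(real (Suc n) powr (- (1/2)))\<^sup>2 = 1 / real (Suc n)"
        by (subst powr_power) (auto simp: powr_minus_divide)
      moreover have "(exp (- real (Suc n) / x))\<^sup>2 = exp (- real (Suc n) * (2 / x))"
        by (simp flip: exp_double)
      ultimately show ?thesis unfolding dir_coeff_def power_mult_distrib by simp
    qed
    then show ?thesis using harmonic_exp_sums[of "2 / x"] that by (simp add: sums_iff)
  qed
  then have "(\<lambda>k. (\<Sum>n. (dir_coeff (1/2) (X k) n)\<^sup>2) - ln (X k)) = (\<lambda>k. - ln (1 - exp (- (2 / X k))) - ln (X k))"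
    using X(2) by simp
  moreover have "((\<lambda>x::real. - ln (1 - exp (- (2 / x))) - ln x) \<longlongrightarrow> - ln 2) at_top" by real_asymp
  ultimately show ?thesis using filterlim_compose X(1) by fastforce
qed

lemma diagonal_sum_gt_half:
  assumes \<sigma>: "\<sigma> > 1/2" and X: "filterlim X at_top sequentially" "\<And>k. X k \<ge> 1"
  shows "(\<lambda>k. (\<Sum>n. (dir_coeff \<sigma> (X k) n)\<^sup>2)) \<longlonglongrightarrow> zeta_real (2 * \<sigma>)"
proof -
  have Z: "(\<lambda>n. real (Suc n) powr (- (2 * \<sigma>))) sums zeta_real (2 * \<sigma>)" using \<sigma> by (intro zeta_real_sums) auto
  have eq: "(dir_coeff \<sigma> x n)\<^sup>2 = real (Suc n) powr (- (2 * \<sigma>)) * (exp (- real (Suc n) / x))\<^sup>2" for x n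
    unfolding dir_coeff_def power_mult_distrib by (simp add: powr_power)
  have "(\<lambda>k. suminf (\<lambda>n. (dir_coeff \<sigma> (X k) n)\<^sup>2)) \<longlonglongrightarrow> suminf (\<lambda>n. real (Suc n) powr (- (2 * \<sigma>)))"
  proof (rule conjunct2[OF conjunct2[OF tannerys_theorem[where M = "\<lambda>n. real (Suc n) powr (- (2 * \<sigma>))"]]])
    fix n
    have "((\<lambda>x::real. (exp (- real (Suc n) / x))\<^sup>2) \<longlongrightarrow> 1) at_top" by real_asymp
    then have "(\<lambda>k. (exp (- real (Suc n) / X k))\<^sup>2) \<longlonglongrightarrow> 1" using filterlim_compose X(1) by blast
    then have "(\<lambda>k. real (Suc n) powr (- (2 * \<sigma>)) * (exp (- real (Suc n) / X k))\<^sup>2) \<longlonglongrightarrow> real (Suc n) powr (- (2 * \<sigma>)) * 1"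
      by (intro tendsto_intros)
    then show "(\<lambda>k. (dir_coeff \<sigma> (X k) n)\<^sup>2) \<longlonglongrightarrow> real (Suc n) powr (- (2 * \<sigma>))" unfolding eq by simp
  next
    have "norm ((dir_coeff \<sigma> (X k) n)\<^sup>2) \<le> real (Suc n) powr (- (2 * \<sigma>))" for n k
    proof -
      have "- real (Suc n) / X k \<le> 0" using X(2)[of k] by (intro divide_nonpos_pos) auto
      then have "(exp (- real (Suc n) / X k))\<^sup>2 \<le> 1" by (intro power_le_one) (simp_all del: of_nat_Suc)
      then have "real (Suc n) powr (- (2 * \<sigma>)) * (exp (- real (Suc n) / X k))\<^sup>2 \<le> real (Suc n) powr (- (2 * \<sigma>)) * 1"
        by (intro mult_left_mono) auto
      then show ?thesis by (simp add: eq)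
    qed
    then show "\<forall>\<^sub>F (n, k) in sequentially \<times>\<^sub>F sequentially. norm ((dir_coeff \<sigma> (X k) n)\<^sup>2) \<le> real (Suc n) powr (- (2 * \<sigma>))"
      by (intro always_eventually) auto
  qed (use Z in \<open>auto simp: sums_iff\<close>)
  then show ?thesis using Z by (simp add: sums_iff)
qed

text \<open>Uniformity in t is needed, but the limits above come from convergence theorems for
  sequences. So an arbitrary sequence of admissible pairs is followed, and
  \<open>zeta_gauss_mean_uniform\<close> argues by contradiction. The bound 1024 = 2^10 gives
  T^{1/10} \<ge> 2, hence H \<le> T/2 \<le> t.\<close>

locale scale_sequence =
  fixes T t :: "nat \<Rightarrow> real"
  assumes T: "filterlim T at_top sequentially" "\<And>k. T k \<ge> 1024"
    and t: "\<And>k. T k / 2 \<le> t k" "\<And>k. t k \<le> 4 * T k"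
begin

definition "H k = smooth_H (T k)"
definition "X k = smooth_X (T k)"

lemma compose: "(f \<longlongrightarrow> l) at_top \<Longrightarrow> (\<lambda>k. f (T k)) \<longlonglongrightarrow> l" for f :: "real \<Rightarrow> real"
  using filterlim_compose T(1) by blast

lemma H_ge: "H k \<ge> 1" and X_ge: "X k \<ge> 1" and t_pos: "t k > 0"
  unfolding H_def X_def smooth_H_def smooth_X_def using T(2)[of k] t(1)[of k] by (auto intro!: ge_one_powr_ge_zero)

lemma X_lim: "filterlim X at_top sequentially"
proof -
  have "filterlim smooth_X at_top at_top" unfolding smooth_X_def by real_asymp
  then show ?thesis unfolding X_def using filterlim_compose T(1) by blast
qed

lemma exp_t_le: "c > 0 \<Longrightarrow> exp (- ((t k)\<^sup>2 / (H k)\<^sup>2) / c) \<le> exp (- ((T k)\<^sup>2 / 4 / (H k)\<^sup>2) / c)"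
proof -
  assume c: "c > 0"
  have "(T k / 2)\<^sup>2 \<le> (t k)\<^sup>2" by (rule power_mono) (use t(1)[of k] T(2)[of k] in auto)
  then have "(T k)\<^sup>2 / 4 / (H k)\<^sup>2 / c \<le> (t k)\<^sup>2 / (H k)\<^sup>2 / c"
    using c by (intro divide_right_mono) (auto simp: power_divide)
  then show ?thesis by simp
qed

lemma small_ratio: "(\<lambda>k. t k / X k) \<longlonglongrightarrow> 0" "(\<lambda>k. H k / t k) \<longlonglongrightarrow> 0"
  "\<And>k. t k / X k \<le> 1" "\<And>k. H k / t k \<le> 1"
proof -
  have T0: "T k > 0" for k using T(2)[of k] by simp
  have 1: "t k / X k \<le> 4 * T k / smooth_X (T k)" for k
    unfolding X_def[symmetric] using t(2)[of k] X_ge[of k] by (intro divide_right_mono) auto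
  have 2: "H k / t k \<le> smooth_H (T k) / (T k / 2)" for k
    unfolding H_def[symmetric] using t(1)[of k] H_ge[of k] T0[of k] by (intro divide_left_mono mult_pos_pos) auto
  show "(\<lambda>k. t k / X k) \<longlonglongrightarrow> 0"
  proof (rule Lim_null_comparison)
    show "\<forall>\<^sub>F k in sequentially. norm (t k / X k) \<le> 4 * T k / smooth_X (T k)"
      using 1 t_pos X_ge by (intro always_eventually allI) (simp add: less_imp_le order_trans[OF zero_le_one])
    show "(\<lambda>k. 4 * T k / smooth_X (T k)) \<longlonglongrightarrow> 0" unfolding smooth_X_def by (rule compose) real_asymp
  qed
  show "(\<lambda>k. H k / t k) \<longlonglongrightarrow> 0"
  proof (rule Lim_null_comparison)
    show "\<forall>\<^sub>F k in sequentially. norm (H k / t k) \<le> smooth_H (T k) / (T k / 2)"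
      using 2 t_pos H_ge by (intro always_eventually allI) (simp add: less_imp_le order_trans[OF zero_le_one])
    show "(\<lambda>k. smooth_H (T k) / (T k / 2)) \<longlonglongrightarrow> 0" unfolding smooth_H_def by (rule compose) real_asymp
  qed
  show "t k / X k \<le> 1" for k
  proof -
    have "4 * T k \<le> T k powr (3/2) * T k powr 1"
    proof (rule mult_mono)
      have "(4::real) = 4 powr 1" by simp
      also have "\<dots> \<le> 4 powr (3/2)" by (rule powr_mono) auto
      also have "\<dots> \<le> T k powr (3/2)" using T(2)[of k] by (intro powr_mono2) auto
      finally show "4 \<le> T k powr (3/2)" .
    qed (use T0[of k] in auto)
    also have "\<dots> = smooth_X (T k)" unfolding smooth_X_def by (subst powr_add[symmetric]) simp
    finally have "4 * T k \<le> smooth_X (T k)" .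
    then have "t k \<le> X k" using t(2)[of k] unfolding X_def by linarith
    then show ?thesis using X_ge[of k] by simp
  qed
  show "H k / t k \<le> 1" for k
  proof -
    have "2 = (1024 :: real) powr (1/10)"
      using powr_powr[of 2 10 "1/10"] by simp
    also have "\<dots> \<le> T k powr (1/10)" using T(2)[of k] by (intro powr_mono2) auto
    finally have "2 * H k \<le> T k powr (1/10) * smooth_H (T k)"
      unfolding H_def by (rule mult_right_mono) (simp add: smooth_H_def)
    also have "\<dots> = T k" unfolding smooth_H_def using T0[of k] by (simp flip: powr_add)
    finally show ?thesis using t(1)[of k] t_pos[of k] by simp
  qed
qed

lemma offdiag_locale: "1/2 \<le> \<sigma> \<Longrightarrow> \<sigma> < 1 \<Longrightarrow> offdiag (2 * \<sigma> - 1) (X k) (H k) (t k)"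
  by standard (use X_ge[of k] H_ge[of k] t_pos[of k] in auto)

lemma ch_error: "(\<lambda>k. X k * (gauss_K / H k ^ 3 + 2 / H k * exp (- ((t k)\<^sup>2 / (H k)\<^sup>2) / 2))) \<longlonglongrightarrow> 0"
proof (rule Lim_null_comparison)
  let ?b = "\<lambda>T. smooth_X T * (gauss_K / smooth_H T ^ 3 + 2 / smooth_H T * exp (- (T\<^sup>2 / 4 / (smooth_H T)\<^sup>2) / 2))"
  show "\<forall>\<^sub>F k in sequentially. norm (X k * (gauss_K / H k ^ 3 + 2 / H k * exp (- ((t k)\<^sup>2 / (H k)\<^sup>2) / 2))) \<le> ?b (T k)"
  proof (intro always_eventually allI)
    fix k
    have "0 \<le> gauss_K / H k ^ 3 + 2 / H k * exp (- ((t k)\<^sup>2 / (H k)\<^sup>2) / 2)"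
      using gauss_K_pos H_ge[of k] by (intro add_nonneg_nonneg) auto
    then have "norm (X k * (gauss_K / H k ^ 3 + 2 / H k * exp (- ((t k)\<^sup>2 / (H k)\<^sup>2) / 2))) = X k * (gauss_K / H k ^ 3 + 2 / H k * exp (- ((t k)\<^sup>2 / (H k)\<^sup>2) / 2))"
      using X_ge[of k] by (simp add: abs_mult)
    also have "\<dots> \<le> X k * (gauss_K / H k ^ 3 + 2 / H k * exp (- ((T k)\<^sup>2 / 4 / (H k)\<^sup>2) / 2))"
      using exp_t_le[of 2 k] X_ge[of k] H_ge[of k] by (intro mult_left_mono add_left_mono) auto
    finally show "norm (X k * (gauss_K / H k ^ 3 + 2 / H k * exp (- ((t k)\<^sup>2 / (H k)\<^sup>2) / 2))) \<le> ?b (T k)"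
      by (simp only: X_def H_def)
  qed
  show "(\<lambda>k. ?b (T k)) \<longlonglongrightarrow> 0" unfolding smooth_X_def smooth_H_def by (rule compose) real_asymp
qed

text \<open>On the critical line the diagonal is ln X - ln 2 + o(1) and twice the off-diagonal
  integral is ln (t/X) up to a constant, so the auxiliary X drops out and ln t remains. For \<sigma>
  > 1/2 the diagonal alone tends to zeta(2 \<sigma>).\<close>

lemma dir_gauss_mean_limit:
  assumes \<sigma>: "1/2 \<le> \<sigma>" "\<sigma> < 1"
  shows "(\<lambda>k. dir_gauss_mean \<sigma> (X k) (t k) (H k) - (log_coeff \<sigma> * ln (t k) + mean_const \<sigma>)) \<longlonglongrightarrow> 0"
proof -
  let ?M = "\<lambda>k. offdiag.M (2 * \<sigma> - 1) (X k) (H k) (t k)"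
  let ?D = "\<lambda>k. \<Sum>n. (dir_coeff \<sigma> (X k) n)\<^sup>2"
  have E: "(\<lambda>k. dir_gauss_mean \<sigma> (X k) (t k) (H k) - (?D k + 2 * ?M k)) \<longlonglongrightarrow> 0"
  proof (rule Lim_null_comparison)
    let ?b = "\<lambda>T. 2 * gauss_K * (1 + 4 * T / smooth_H T) / smooth_H T * ln (4 * smooth_X T)"
    show "\<forall>\<^sub>F k in sequentially. norm (dir_gauss_mean \<sigma> (X k) (t k) (H k) - (?D k + 2 * ?M k)) \<le> ?b (T k)"
    proof (intro always_eventually allI)
      fix k
      have "norm (dir_gauss_mean \<sigma> (X k) (t k) (H k) - (?D k + 2 * ?M k)) \<le> 2 * gauss_K * (1 + t k / H k) / H k * ln (4 * X k)"
        using dir_series_mean(2)[OF \<sigma> X_ge H_ge, of "t k" k k] t_pos[of k] by (simp add: dir_gauss_mean_def)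
      also have "\<dots> \<le> 2 * gauss_K * (1 + 4 * T k / H k) / H k * ln (4 * X k)"
        using t(2)[of k] H_ge[of k] X_ge[of k] gauss_K_pos
        by (intro mult_right_mono divide_right_mono mult_left_mono add_left_mono) auto
      finally show "norm (dir_gauss_mean \<sigma> (X k) (t k) (H k) - (?D k + 2 * ?M k)) \<le> ?b (T k)" by (simp add: X_def H_def)
    qed
    show "(\<lambda>k. ?b (T k)) \<longlonglongrightarrow> 0" unfolding smooth_X_def smooth_H_def by (rule compose) real_asymp
  qed
  show ?thesis
  proof (cases "\<sigma> = 1/2")
    case True
    have loc: "offdiag 0 (X k) (H k) (t k)" for k using offdiag_locale[OF \<sigma>, of k] True by simp
    have a0: "2 * \<sigma> - 1 = 0" using True by simp
    let ?M_beta = "\<lambda>k. offdiag.M_beta (X k) (H k) (t k)"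
    have M0: "(\<lambda>k. ?M k + ?M_beta k) \<longlonglongrightarrow> 0"
    proof (rule Lim_null_comparison)
      show "\<forall>\<^sub>F k in sequentially. norm (?M k + ?M_beta k) \<le> X k * (gauss_K / H k ^ 3 + 2 / H k * exp (- ((t k)\<^sup>2 / (H k)\<^sup>2) / 2)) + (gauss_K / (smooth_H (T k))\<^sup>2 + gauss_K / (smooth_X (T k) * smooth_H (T k)))"
        unfolding a0 using offdiag.M_bound_zero(2)[OF loc refl] by (simp add: X_def H_def add.assoc)
      have "(\<lambda>k. gauss_K / (smooth_H (T k))\<^sup>2 + gauss_K / (smooth_X (T k) * smooth_H (T k))) \<longlonglongrightarrow> 0"
        unfolding smooth_X_def smooth_H_def by (rule compose) real_asymp
      from tendsto_add[OF ch_error this]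
      show "(\<lambda>k. X k * (gauss_K / H k ^ 3 + 2 / H k * exp (- ((t k)\<^sup>2 / (H k)\<^sup>2) / 2)) + (gauss_K / (smooth_H (T k))\<^sup>2 + gauss_K / (smooth_X (T k) * smooth_H (T k)))) \<longlonglongrightarrow> 0" by simp
    qed
    have lim: "(\<lambda>k. integral {0<..} (\<lambda>x. beta_kernel x * gauss_cos (t k / X k) (H k / t k * (t k / X k)) x) + ln (t k / X k)) \<longlonglongrightarrow> beta_kernel_const"
    proof (intro beta_kernel_limit small_ratio)
      fix k
      have "X k > 0" "H k > 0" using X_ge[of k] H_ge[of k] by auto
      then show "t k / X k > 0" "H k / t k > 0" using t_pos[of k] by auto
    qed
    have Heq: "H k / t k * (t k / X k) = H k / X k" for k using t_pos[of k] by simp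
    have B: "(\<lambda>k. 2 * ?M_beta k + ln (t k / X k)) \<longlonglongrightarrow> beta_kernel_const"
      using lim unfolding Heq offdiag.M_beta_kernel[OF loc refl] .
    note D = diagonal_sum_half[OF X_lim X_ge]
    have "(\<lambda>k. (dir_gauss_mean \<sigma> (X k) (t k) (H k) - (?D k + 2 * ?M k)) + ((\<Sum>n. (dir_coeff (1/2) (X k) n)\<^sup>2) - ln (X k))
        + 2 * (?M k + ?M_beta k) - (2 * ?M_beta k + ln (t k / X k)) - (- ln 2 - beta_kernel_const)) \<longlonglongrightarrow> 0 + - ln 2 + 2 * 0 - beta_kernel_const - (- ln 2 - beta_kernel_const)"
      by (intro tendsto_intros E D M0 B)
    moreover have "ln (t k / X k) = ln (t k) - ln (X k)" for k using t_pos[of k] X_ge[of k] by (simp add: ln_div)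
    ultimately show ?thesis unfolding True by (simp add: log_coeff_def mean_const_def algebra_simps)
  next
    case False
    then have s: "\<sigma> > 1/2" using \<sigma> by simp
    let ?a = "2 * \<sigma> - 1"
    have M0: "?M \<longlonglongrightarrow> 0"
    proof (rule Lim_null_comparison)
      show "\<forall>\<^sub>F k in sequentially. norm (?M k) \<le> Gamma (1 - ?a) * (X k * (gauss_K / H k ^ 3 + 2 / H k * exp (- ((t k)\<^sup>2 / (H k)\<^sup>2) / 2)))
           + 2 / (1 - ?a) * Gamma ?a * smooth_H (T k) powr (- ?a)"
        using offdiag.M_bound_pos[OF offdiag_locale[OF \<sigma>]] s by (simp add: H_def mult.assoc)
      have "(\<lambda>k. smooth_H (T k) powr (- ?a)) \<longlonglongrightarrow> 0"
        unfolding smooth_H_def using s by (intro compose) real_asymp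
      then have "(\<lambda>k. Gamma (1 - ?a) * (X k * (gauss_K / H k ^ 3 + 2 / H k * exp (- ((t k)\<^sup>2 / (H k)\<^sup>2) / 2)))
           + 2 / (1 - ?a) * Gamma ?a * smooth_H (T k) powr (- ?a)) \<longlonglongrightarrow> Gamma (1 - ?a) * 0 + 2 / (1 - ?a) * Gamma ?a * 0"
        by (intro tendsto_add tendsto_mult tendsto_const ch_error)
      then show "(\<lambda>k. Gamma (1 - ?a) * (X k * (gauss_K / H k ^ 3 + 2 / H k * exp (- ((t k)\<^sup>2 / (H k)\<^sup>2) / 2)))
           + 2 / (1 - ?a) * Gamma ?a * smooth_H (T k) powr (- ?a)) \<longlonglongrightarrow> 0" by simp
    qed
    have "(\<lambda>k. (dir_gauss_mean \<sigma> (X k) (t k) (H k) - (?D k + 2 * ?M k)) + ?D k + 2 * ?M k - zeta_real (2 * \<sigma>)) \<longlonglongrightarrow> 0 + zeta_real (2 * \<sigma>) + 2 * 0 - zeta_real (2 * \<sigma>)"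
      by (intro tendsto_intros E M0 diagonal_sum_gt_half[OF s X_lim X_ge])
    then show ?thesis using False by (simp add: log_coeff_def mean_const_def)
  qed
qed

text \<open>The squared norms differ by the error times norms whose mean square is of order ln T.
  The inequality 2 b e \<le> \<eta> b^2 + e^2 / \<eta> separates the two factors; \<eta> = T^{-1/10}
  beats the logarithm, while the mean square error divided by \<eta> still vanishes.\<close>

lemma zeta_gauss_mean_limit:
  assumes \<sigma>: "1/2 \<le> \<sigma>" "\<sigma> < 1"
  shows "(\<lambda>k. zeta_gauss_mean \<sigma> (t k) (H k) - (log_coeff \<sigma> * ln (t k) + mean_const \<sigma>)) \<longlonglongrightarrow> 0"
proof -
  obtain C where C: "C > 0" "\<And>X H t0. X \<ge> 1 \<Longrightarrow> H > 0 \<Longrightarrow> t0 > 0 \<Longrightarrow>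
     integrable lborel (\<lambda>t. normal_density t0 H t * (norm (zeta_line \<sigma> t - dir_series \<sigma> X t))\<^sup>2) \<and>
     (LINT t|lborel. normal_density t0 H t * (norm (zeta_line \<sigma> t - dir_series \<sigma> X t))\<^sup>2)
       \<le> C * (X * (16 / t0 ^ 4 + 2 * exp (- t0\<^sup>2 / (16 * H\<^sup>2))) + (1 + 2 * t0\<^sup>2 + 2 * H\<^sup>2) / X)"
    by (rule zeta_error_moment[OF \<sigma>]) blast
  let ?Err = "\<lambda>k. LINT s|lborel. normal_density (t k) (H k) s * (norm (zeta_line \<sigma> s - dir_series \<sigma> (X k) s))\<^sup>2"
  let ?S = "\<lambda>k. dir_gauss_mean \<sigma> (X k) (t k) (H k)"
  define \<eta> where "\<eta> k = T k powr (- (1/10))" for k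
  have \<eta>: "\<eta> k > 0" for k unfolding \<eta>_def using T(2)[of k] by simp
  have H0: "H k > 0" for k using H_ge[of k] by simp
  have diff: "\<bar>zeta_gauss_mean \<sigma> (t k) (H k) - ?S k\<bar> \<le> \<eta> k * ?S k + (1 + 1 / \<eta> k) * ?Err k" for k
  proof -
    let ?W = "normal_density (t k) (H k)"
    let ?z = "\<lambda>s. zeta_line \<sigma> s" and ?d = "\<lambda>s. dir_series \<sigma> (X k) s"
    have iE: "integrable lborel (\<lambda>s. ?W s * (norm (?z s - ?d s))\<^sup>2)" using C(2)[OF X_ge H0 t_pos] by blast
    have iD: "integrable lborel (\<lambda>s. ?W s * (norm (?d s))\<^sup>2)" using dir_series_mean(1)[OF \<sigma> X_ge H_ge] t_pos by (simp add: less_imp_le)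
    have pt: "\<bar>(norm (?z s))\<^sup>2 - (norm (?d s))\<^sup>2\<bar> \<le> \<eta> k * (norm (?d s))\<^sup>2 + (1 + 1 / \<eta> k) * (norm (?z s - ?d s))\<^sup>2" for s
    proof -
      let ?a = "norm (?z s)" and ?b = "norm (?d s)" and ?e = "norm (?z s - ?d s)"
      have ab: "\<bar>?a - ?b\<bar> \<le> ?e" by (rule norm_triangle_ineq3)
      have "\<bar>?a\<^sup>2 - ?b\<^sup>2\<bar> = \<bar>?a - ?b\<bar> * (?a + ?b)" by (simp add: power2_eq_square square_diff_square_factored abs_mult)
      also have "\<dots> \<le> ?e * (2 * ?b + ?e)" using ab by (intro mult_mono) auto
      also have "\<dots> = 2 * ?b * ?e + ?e\<^sup>2" by (simp add: power2_eq_square algebra_simps)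
      also have "2 * ?b * ?e \<le> \<eta> k * ?b\<^sup>2 + ?e\<^sup>2 / \<eta> k"
      proof -
        have "0 \<le> (\<eta> k * ?b - ?e)\<^sup>2 / \<eta> k" using \<eta>[of k] by simp
        also have "\<dots> = \<eta> k * ?b\<^sup>2 + ?e\<^sup>2 / \<eta> k - 2 * ?b * ?e" using \<eta>[of k] by (simp add: power2_eq_square field_simps)
        finally show ?thesis by simp
      qed
      finally show ?thesis by (simp add: algebra_simps)
    qed
    have [measurable]: "?z \<in> borel_measurable borel"
      using zeta_line_continuous[of \<sigma> UNIV] \<sigma> by (intro borel_measurable_continuous_onI) auto
    have iR: "integrable lborel (\<lambda>s. \<eta> k * (?W s * (norm (?d s))\<^sup>2) + (1 + 1 / \<eta> k) * (?W s * (norm (?z s - ?d s))\<^sup>2))"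
      using iD iE by (intro Bochner_Integration.integrable_add integrable_mult_right)
    have iS: "integrable lborel (\<lambda>s. ?W s * (norm (?z s))\<^sup>2 - ?W s * (norm (?d s))\<^sup>2)"
      and leS: "\<bar>?W s * (norm (?z s))\<^sup>2 - ?W s * (norm (?d s))\<^sup>2\<bar> \<le> \<eta> k * (?W s * (norm (?d s))\<^sup>2) + (1 + 1 / \<eta> k) * (?W s * (norm (?z s - ?d s))\<^sup>2)" for s
    proof -
      show le: "\<bar>?W s * (norm (?z s))\<^sup>2 - ?W s * (norm (?d s))\<^sup>2\<bar> \<le> \<eta> k * (?W s * (norm (?d s))\<^sup>2) + (1 + 1 / \<eta> k) * (?W s * (norm (?z s - ?d s))\<^sup>2)" for s
        using mult_left_mono[OF pt[of s], of "?W s"] by (simp add: right_diff_distrib[symmetric] abs_mult distrib_left mult.left_commute)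
      have m: "(\<lambda>s. ?W s * (norm (?z s))\<^sup>2 - ?W s * (norm (?d s))\<^sup>2) \<in> borel_measurable lborel"
        using borel_measurable_integrable[OF iD] by measurable
      show "integrable lborel (\<lambda>s. ?W s * (norm (?z s))\<^sup>2 - ?W s * (norm (?d s))\<^sup>2)"
        by (rule Bochner_Integration.integrable_bound[OF iR m]) (use le in \<open>auto intro!: AE_I2 order_trans[OF _ abs_ge_self]\<close>)
    qed
    have iZ: "integrable lborel (\<lambda>s. ?W s * (norm (?z s))\<^sup>2)"
      using Bochner_Integration.integrable_add[OF iS iD] by simp
    have "\<bar>zeta_gauss_mean \<sigma> (t k) (H k) - ?S k\<bar> = \<bar>LINT s|lborel. ?W s * (norm (?z s))\<^sup>2 - ?W s * (norm (?d s))\<^sup>2\<bar>"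
      unfolding zeta_gauss_mean_def dir_gauss_mean_def using iZ iD by simp
    also have "\<dots> \<le> (LINT s|lborel. \<bar>?W s * (norm (?z s))\<^sup>2 - ?W s * (norm (?d s))\<^sup>2\<bar>)" by (rule integral_abs_bound)
    also have "\<dots> \<le> (LINT s|lborel. \<eta> k * (?W s * (norm (?d s))\<^sup>2) + (1 + 1 / \<eta> k) * (?W s * (norm (?z s - ?d s))\<^sup>2))"
      by (rule integral_mono[OF integrable_abs[OF iS] iR leS])
    also have "\<dots> = \<eta> k * ?S k + (1 + 1 / \<eta> k) * ?Err k"
      unfolding dir_gauss_mean_def using iD iE
      by (subst Bochner_Integration.integral_add) ((intro integrable_mult_right; assumption)+, simp only: integral_mult_right_zero)
    finally show ?thesis .
  qed
  have Err0: "?Err k \<ge> 0" for k by (rule Bochner_Integration.integral_nonneg) simp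
  have 1: "(\<lambda>k. (1 + 1 / \<eta> k) * ?Err k) \<longlonglongrightarrow> 0"
  proof (rule Lim_null_comparison)
    let ?b = "\<lambda>T. (1 + 1 / T powr (- (1/10))) * (C * (smooth_X T * (16 / (T / 2) ^ 4 + 2 * exp (- (T\<^sup>2 / 4 / (smooth_H T)\<^sup>2) / 16)) + (1 + 2 * (4 * T)\<^sup>2 + 2 * (smooth_H T)\<^sup>2) / smooth_X T))"
    show "\<forall>\<^sub>F k in sequentially. norm ((1 + 1 / \<eta> k) * ?Err k) \<le> ?b (T k)"
    proof (intro always_eventually allI)
      fix k
      have T0: "T k > 0" using T(2)[of k] by simp
      have "?Err k \<le> C * (X k * (16 / t k ^ 4 + 2 * exp (- (t k)\<^sup>2 / (16 * (H k)\<^sup>2))) + (1 + 2 * (t k)\<^sup>2 + 2 * (H k)\<^sup>2) / X k)"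
        using C(2)[OF X_ge H0 t_pos] by blast
      also have "\<dots> \<le> C * (X k * (16 / (T k / 2) ^ 4 + 2 * exp (- ((T k)\<^sup>2 / 4 / (H k)\<^sup>2) / 16)) + (1 + 2 * (4 * T k)\<^sup>2 + 2 * (H k)\<^sup>2) / X k)"
      proof (intro mult_left_mono add_mono divide_right_mono order_refl)
        show "16 / t k ^ 4 \<le> 16 / (T k / 2) ^ 4"
          using t(1)[of k] T0 t_pos[of k] by (intro divide_left_mono power_mono mult_pos_pos zero_less_power) auto
        show "exp (- (t k)\<^sup>2 / (16 * (H k)\<^sup>2)) \<le> exp (- ((T k)\<^sup>2 / 4 / (H k)\<^sup>2) / 16)"
          using exp_t_le[of 16 k] by (simp add: mult.commute)
        show "(t k)\<^sup>2 \<le> (4 * T k)\<^sup>2" using t(2)[of k] t_pos[of k] by (intro power_mono) auto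
      qed (use C(1) X_ge[of k] in auto)
      finally have "(1 + 1 / \<eta> k) * ?Err k \<le> (1 + 1 / \<eta> k) * \<dots>" using \<eta>[of k] by (intro mult_left_mono) auto
      moreover have "0 \<le> (1 + 1 / \<eta> k) * ?Err k" using \<eta>[of k] Err0[of k] by simp
      ultimately show "norm ((1 + 1 / \<eta> k) * ?Err k) \<le> ?b (T k)" by (simp only: real_norm_def abs_of_nonneg \<eta>_def X_def H_def)
    qed
    show "(\<lambda>k. ?b (T k)) \<longlonglongrightarrow> 0" unfolding smooth_X_def smooth_H_def by (rule compose) real_asymp
  qed
  note L = dir_gauss_mean_limit[OF \<sigma>]
  have 2: "(\<lambda>k. \<eta> k * ?S k) \<longlonglongrightarrow> 0"
  proof -
    have \<eta>0: "\<eta> \<longlonglongrightarrow> 0" unfolding \<eta>_def by (rule compose) real_asymp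
    have "(\<lambda>k. \<eta> k * ln (t k)) \<longlonglongrightarrow> 0"
    proof (rule Lim_null_comparison)
      show "\<forall>\<^sub>F k in sequentially. norm (\<eta> k * ln (t k)) \<le> T k powr (- (1/10)) * ln (4 * T k)"
      proof (intro always_eventually allI)
        fix k
        have "0 \<le> ln (t k)" "ln (t k) \<le> ln (4 * T k)" using t[of k] T(2)[of k] by auto
        then show "norm (\<eta> k * ln (t k)) \<le> T k powr (- (1/10)) * ln (4 * T k)"
          unfolding \<eta>_def by (simp add: abs_mult mult_left_mono)
      qed
      show "(\<lambda>k. T k powr (- (1/10)) * ln (4 * T k)) \<longlonglongrightarrow> 0" by (rule compose) real_asymp
    qed
    then have "(\<lambda>k. \<eta> k * (?S k - (log_coeff \<sigma> * ln (t k) + mean_const \<sigma>)) + (log_coeff \<sigma> * (\<eta> k * ln (t k)) + \<eta> k * mean_const \<sigma>)) \<longlonglongrightarrow> 0 * 0 + (log_coeff \<sigma> * 0 + 0 * mean_const \<sigma>)"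
      by (intro tendsto_intros \<eta>0 L)
    then show ?thesis by (simp add: algebra_simps)
  qed
  have "(\<lambda>k. zeta_gauss_mean \<sigma> (t k) (H k) - ?S k) \<longlonglongrightarrow> 0"
  proof (rule Lim_null_comparison)
    show "\<forall>\<^sub>F k in sequentially. norm (zeta_gauss_mean \<sigma> (t k) (H k) - ?S k) \<le> \<eta> k * ?S k + (1 + 1 / \<eta> k) * ?Err k"
      using diff by simp
    show "(\<lambda>k. \<eta> k * ?S k + (1 + 1 / \<eta> k) * ?Err k) \<longlonglongrightarrow> 0" using tendsto_add[OF 2 1] by simp
  qed
  from tendsto_add[OF this L] show ?thesis by (simp add: algebra_simps)
qed

end

lemma zeta_gauss_mean_uniform:
  assumes \<sigma>: "1/2 \<le> \<sigma>" "\<sigma> < 1" and e: "e > 0"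
  shows "\<exists>T0. \<forall>T\<ge>T0. \<forall>t. T / 2 \<le> t \<and> t \<le> 4 * T \<longrightarrow>
      \<bar>zeta_gauss_mean \<sigma> t (smooth_H T) - (log_coeff \<sigma> * ln t + mean_const \<sigma>)\<bar> < e"
proof (rule ccontr)
  assume "\<not> ?thesis"
  then have "\<forall>k::nat. \<exists>T t. T \<ge> max 1024 (real k) \<and> T / 2 \<le> t \<and> t \<le> 4 * T \<and>
      \<not> \<bar>zeta_gauss_mean \<sigma> t (smooth_H T) - (log_coeff \<sigma> * ln t + mean_const \<sigma>)\<bar> < e"
    by metis
  then obtain T t where Tt: "\<And>k::nat. T k \<ge> max 1024 (real k)" "\<And>k. T k / 2 \<le> t k" "\<And>k. t k \<le> 4 * T k"
     "\<And>k. \<not> \<bar>zeta_gauss_mean \<sigma> (t k) (smooth_H (T k)) - (log_coeff \<sigma> * ln (t k) + mean_const \<sigma>)\<bar> < e"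
    by metis
  have Tlim: "filterlim T at_top sequentially"
    by (rule filterlim_at_top_mono[OF filterlim_real_sequentially]) (use Tt(1) in \<open>auto intro!: always_eventually\<close>)
  interpret S: scale_sequence T t by standard (use Tlim Tt in auto)
  have "\<forall>\<^sub>F k in sequentially. dist (zeta_gauss_mean \<sigma> (t k) (S.H k) - (log_coeff \<sigma> * ln (t k) + mean_const \<sigma>)) 0 < e"
    using S.zeta_gauss_mean_limit[OF \<sigma>] e by (rule tendstoD)
  then obtain k where "dist (zeta_gauss_mean \<sigma> (t k) (S.H k) - (log_coeff \<sigma> * ln (t k) + mean_const \<sigma>)) 0 < e"
    using eventually_happens trivial_limit_sequentially by blast
  with Tt(4)[of k] show False by (simp add: S.H_def dist_norm)
qed

subsection \<open>Removing the Gaussian weight\<close>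

lemma norm_add_square_le: "(norm (x + y))\<^sup>2 \<le> 2 * (norm x)\<^sup>2 + 2 * (norm y)\<^sup>2" for x y :: complex
proof -
  have "(norm (x + y))\<^sup>2 \<le> (norm x + norm y)\<^sup>2" by (intro power_mono norm_triangle_ineq) simp
  also have "\<dots> \<le> 2 * (norm x)\<^sup>2 + 2 * (norm y)\<^sup>2"
    using sum_squares_bound[of "norm x" "norm y"] by (simp add: power2_sum)
  finally show ?thesis .
qed

text \<open>With X = 1 the Dirichlet series is bounded, and the smoothing error gives quadratic
  growth. The bound is crude but holds for every width, in particular for the wider Gaussian of
  \<open>gauss_tail\<close>, where an exponentially small factor multiplies it.\<close>

lemma zeta_gauss_mean_bound:
  assumes \<sigma>: "1/2 \<le> \<sigma>" "\<sigma> < 1"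
  obtains K where "K > 0" "\<And>H t0. H \<ge> 1 \<Longrightarrow> t0 \<ge> 1 \<Longrightarrow>
     integrable lborel (\<lambda>t. normal_density t0 H t * (norm (zeta_line \<sigma> t))\<^sup>2) \<and>
     zeta_gauss_mean \<sigma> t0 H \<le> K * (1 + t0\<^sup>2 + H\<^sup>2)"
proof -
  obtain C where C: "C > 0" "\<And>X H t0. X \<ge> 1 \<Longrightarrow> H > 0 \<Longrightarrow> t0 > 0 \<Longrightarrow>
     integrable lborel (\<lambda>t. normal_density t0 H t * (norm (zeta_line \<sigma> t - dir_series \<sigma> X t))\<^sup>2) \<and>
     (LINT t|lborel. normal_density t0 H t * (norm (zeta_line \<sigma> t - dir_series \<sigma> X t))\<^sup>2)
       \<le> C * (X * (16 / t0 ^ 4 + 2 * exp (- t0\<^sup>2 / (16 * H\<^sup>2))) + (1 + 2 * t0\<^sup>2 + 2 * H\<^sup>2) / X)"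
    by (rule zeta_error_moment[OF \<sigma>]) blast
  define A where "A = suminf (dir_coeff \<sigma> 1)"
  have sA: "summable (dir_coeff \<sigma> 1)" by (rule summable_dir_coeff) (use \<sigma> in auto)
  have D: "norm (dir_series \<sigma> 1 t) \<le> A" for t
    unfolding dir_series_def A_def by (rule norm_suminf_le[OF _ sA]) (simp add: norm_mult dir_coeff_nonneg)
  have A0: "A \<ge> 0" using D[of 0] norm_ge_zero order_trans by blast
  show ?thesis
  proof (rule that)
    show "2 * A\<^sup>2 + 38 * C > 0" using C by (intro add_nonneg_pos) auto
    fix H t0 :: real assume H: "H \<ge> 1" and t0: "t0 \<ge> 1"
    have H0: "H > 0" and t00: "t0 > 0" using H t0 by auto
    let ?W = "normal_density t0 H" and ?d = "dir_series \<sigma> 1" and ?z = "zeta_line \<sigma>"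
    note E = C(2)[OF order_refl H0 t00]
    have iE: "integrable lborel (\<lambda>t. ?W t * (norm (?z t - ?d t))\<^sup>2)" using E by blast
    let ?g = "\<lambda>t. 2 * A\<^sup>2 * ?W t + 2 * (?W t * (norm (?z t - ?d t))\<^sup>2)"
    have iG: "integrable lborel ?g" using iE H0 by (intro Bochner_Integration.integrable_add integrable_mult_right) auto
    have le: "?W t * (norm (?z t))\<^sup>2 \<le> ?g t" for t
    proof -
      have "(norm (?z t))\<^sup>2 \<le> 2 * (norm (?d t))\<^sup>2 + 2 * (norm (?z t - ?d t))\<^sup>2" using norm_add_square_le[of "?d t" "?z t - ?d t"] by simp
      also have "(norm (?d t))\<^sup>2 \<le> A\<^sup>2" using D by (intro power_mono) auto
      finally have "(norm (?z t))\<^sup>2 \<le> 2 * A\<^sup>2 + 2 * (norm (?z t - ?d t))\<^sup>2" by simp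
      from mult_left_mono[OF this, of "?W t"] show ?thesis by (simp add: algebra_simps)
    qed
    have [measurable]: "?z \<in> borel_measurable borel"
      using zeta_line_continuous[of \<sigma> UNIV] \<sigma> by (intro borel_measurable_continuous_onI) auto
    have iZ: "integrable lborel (\<lambda>t. ?W t * (norm (?z t))\<^sup>2)"
      by (rule Bochner_Integration.integrable_bound[OF iG])
         (use le in \<open>auto simp: abs_mult intro!: AE_I2 order_trans[OF _ abs_ge_self]\<close>)
    have "zeta_gauss_mean \<sigma> t0 H \<le> (LINT t|lborel. ?g t)" unfolding zeta_gauss_mean_def by (rule integral_mono[OF iZ iG le])
    also have "\<dots> = 2 * A\<^sup>2 * 1 + 2 * (LINT t|lborel. ?W t * (norm (?z t - ?d t))\<^sup>2)"
      using iE H0 by (subst Bochner_Integration.integral_add) (auto intro!: integrable_mult_right)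
    also have "\<dots> \<le> 2 * A\<^sup>2 * (1 + t0\<^sup>2 + H\<^sup>2) + 2 * (C * (19 * (1 + t0\<^sup>2 + H\<^sup>2)))"
    proof (intro add_mono mult_left_mono)
      have "16 / t0 ^ 4 \<le> 16 / 1" using t0 by (intro divide_left_mono) (auto intro: one_le_power)
      moreover have "exp (- t0\<^sup>2 / (16 * H\<^sup>2)) \<le> 1" by simp
      \<comment> \<open>The constant 19 is 16 + 2 + 1, and it also dominates the coefficients 2 of
        the squares.\<close>
      moreover have "x \<le> 16 / 1 \<Longrightarrow> y \<le> 1 \<Longrightarrow> 0 \<le> p \<Longrightarrow> 0 \<le> q \<Longrightarrow> 1 * (x + 2 * y) + (1 + 2 * p + 2 * q) / 1 \<le> 19 * (1 + p + q)"
        for x y p q :: real by simp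
      ultimately have "1 * (16 / t0 ^ 4 + 2 * exp (- t0\<^sup>2 / (16 * H\<^sup>2))) + (1 + 2 * t0\<^sup>2 + 2 * H\<^sup>2) / 1 \<le> 19 * (1 + t0\<^sup>2 + H\<^sup>2)" using zero_le_power2 by blast
      then have "C * (1 * (16 / t0 ^ 4 + 2 * exp (- t0\<^sup>2 / (16 * H\<^sup>2))) + (1 + 2 * t0\<^sup>2 + 2 * H\<^sup>2) / 1) \<le> C * (19 * (1 + t0\<^sup>2 + H\<^sup>2))"
        using C(1) by (intro mult_left_mono) auto
      then show "(LINT t|lborel. ?W t * (norm (?z t - ?d t))\<^sup>2) \<le> C * (19 * (1 + t0\<^sup>2 + H\<^sup>2))" using E by linarith
    qed auto
    finally show "integrable lborel (\<lambda>t. ?W t * (norm (?z t))\<^sup>2) \<and> zeta_gauss_mean \<sigma> t0 H \<le> (2 * A\<^sup>2 + 38 * C) * (1 + t0\<^sup>2 + H\<^sup>2)"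
      using iZ by (simp add: algebra_simps)
  qed
qed

lemma normal_density_swap: "normal_density a H b = normal_density b H a"
  by (simp add: normal_density_def power2_commute)

lemma continuous_normal_density [continuous_intros]:
  fixes f g :: "'a::topological_space \<Rightarrow> real"
  assumes "continuous_on S f" "continuous_on S g"
  shows "continuous_on S (\<lambda>x. normal_density (f x) H (g x))"
proof (cases "H = 0")
  case True
  then show ?thesis by (simp add: normal_density_def)
next
  case False
  then show ?thesis unfolding normal_density_def by (intro continuous_intros assms) auto
qed

lemma normal_density_interval:
  assumes "H > 0"
  shows "integral {a..b} (\<lambda>s. normal_density s H t) \<le> 1"
    and "\<lbrakk>d \<ge> 0; a \<le> t - d; t + d \<le> b\<rbrakk> \<Longrightarrow> integral {a..b} (\<lambda>s. normal_density s H t) \<ge> 1 - sqrt 2 * exp (- d\<^sup>2 / (4 * H\<^sup>2))"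
proof -
  let ?W = "normal_density t H"
  have i1: "integrable lborel ?W" "(LINT s|lborel. ?W s) = 1" using assms by auto
  have si: "set_integrable lborel {a..b} ?W" unfolding set_integrable_def
    by (rule integrable_mult_indicator[OF _ i1(1)]) simp
  have eq: "integral {a..b} (\<lambda>s. normal_density s H t) = (LINT s|lborel. indicator {a..b} s * ?W s)"
    using set_borel_integral_eq_integral(2)[OF si] normal_density_swap[of _ H t]
    by (simp add: set_lebesgue_integral_def)
  have ii: "integrable lborel (\<lambda>s. indicator {a..b} s * ?W s)" using si by (simp add: set_integrable_def)
  show "integral {a..b} (\<lambda>s. normal_density s H t) \<le> 1"
    unfolding eq i1(2)[symmetric] by (rule integral_mono[OF ii i1(1)]) (auto simp: indicator_def)
  assume d: "d \<ge> 0" "a \<le> t - d" "t + d \<le> b"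
  let ?c = "sqrt 2 * exp (- d\<^sup>2 / (4 * H\<^sup>2))"
  have i2: "integrable lborel (\<lambda>s. ?c * normal_density t (sqrt 2 * H) s)" "(LINT s|lborel. ?c * normal_density t (sqrt 2 * H) s) = ?c"
    using assms by auto
  have "1 = (LINT s|lborel. ?W s)" using i1 by simp
  also have "\<dots> \<le> (LINT s|lborel. indicator {a..b} s * ?W s + ?c * normal_density t (sqrt 2 * H) s)"
  proof (rule integral_mono[OF i1(1) Bochner_Integration.integrable_add[OF ii i2(1)]])
    fix s
    show "?W s \<le> indicator {a..b} s * ?W s + ?c * normal_density t (sqrt 2 * H) s"
    proof (cases "s \<in> {a..b}")
      case False
      then have "\<bar>s - t\<bar> \<ge> d" using d by auto
      then show ?thesis using gauss_tail[OF assms _ d(1), of s t] False by simp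
    qed simp
  qed
  also have "\<dots> = (LINT s|lborel. indicator {a..b} s * ?W s) + ?c"
    by (subst Bochner_Integration.integral_add[OF ii i2(1)]) (simp only: i2(2))
  finally show "integral {a..b} (\<lambda>s. normal_density s H t) \<ge> 1 - ?c" unfolding eq by simp
qed

definition "line_moment \<sigma> a b = integral {a..b} (\<lambda>t. (norm (zeta_line \<sigma> t))\<^sup>2)"

text \<open>By Fubini, integrating truncated means over their centres in [c, d] weights each t by
  the mass that a Gaussian centred at t gives to [c, d]. Where this weight is near 1, averages of
  means compare with the plain moment.\<close>

lemma window_swap:
  assumes \<sigma>: "\<sigma> < 1"
  defines "J \<equiv> \<lambda>a b H s. integral {a..b} (\<lambda>t. normal_density s H t * (norm (zeta_line \<sigma> t))\<^sup>2)"
  shows "J a b H integrable_on {c..d}"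
    and "integral {c..d} (J a b H) = integral {a..b} (\<lambda>t. (norm (zeta_line \<sigma> t))\<^sup>2 * integral {c..d} (\<lambda>s. normal_density s H t))"
    and "(\<lambda>t. (norm (zeta_line \<sigma> t))\<^sup>2 * integral {c..d} (\<lambda>s. normal_density s H t)) integrable_on {a..b}"
proof -
  have z: "continuous_on S (zeta_line \<sigma>)" for S using \<sigma> by (intro zeta_line_continuous) auto
  have cont: "continuous_on (cbox (c, a) (d, b)) (\<lambda>(s, t). normal_density s H t * (norm (zeta_line \<sigma> t))\<^sup>2)"
    unfolding case_prod_beta by (intro continuous_intros continuous_on_compose2[OF z[of UNIV]]) auto
  have cont2: "continuous_on (cbox a b \<times> cbox c d) (\<lambda>(t, s). normal_density s H t)"
    unfolding case_prod_beta by (intro continuous_intros)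
  have cont3: "continuous_on (cbox c d \<times> cbox a b) (\<lambda>(s, t). normal_density s H t * (norm (zeta_line \<sigma> t))\<^sup>2)"
    unfolding case_prod_beta by (intro continuous_intros continuous_on_compose2[OF z[of UNIV]]) auto
  have "continuous_on (cbox c d) (J a b H)"
    unfolding J_def using integral_continuous_on_param[OF cont3] by simp
  then show "J a b H integrable_on {c..d}" by (intro integrable_continuous_interval) simp
  have "continuous_on (cbox a b) (\<lambda>t. integral (cbox c d) (\<lambda>s. normal_density s H t))"
    by (rule integral_continuous_on_param[OF cont2])
  then show "(\<lambda>t. (norm (zeta_line \<sigma> t))\<^sup>2 * integral {c..d} (\<lambda>s. normal_density s H t)) integrable_on {a..b}"
    by (intro integrable_continuous_interval continuous_intros z) simp
  have "integral (cbox c d) (\<lambda>s. integral (cbox a b) (\<lambda>t. normal_density s H t * (norm (zeta_line \<sigma> t))\<^sup>2))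
      = integral (cbox a b) (\<lambda>t. integral (cbox c d) (\<lambda>s. normal_density s H t * (norm (zeta_line \<sigma> t))\<^sup>2))"
    by (rule integral_swap_continuous[OF cont])
  then show "integral {c..d} (J a b H) = integral {a..b} (\<lambda>t. (norm (zeta_line \<sigma> t))\<^sup>2 * integral {c..d} (\<lambda>s. normal_density s H t))"
    unfolding J_def by (simp add: mult.commute)
qed

text \<open>\<Delta> is a margin, to be taken wider than H, and \<open>tail\<close> bounds the
  Gaussian mass beyond it. The plain moment over [a, b] is enclosed between averages of Gaussian
  means with centres in [a + \<Delta>, b - \<Delta>] and in [a - \<Delta>, b + \<Delta>];
  \<open>m\<close> is the predicted mean and \<open>Pm\<close> its primitive.\<close>

locale window =
  fixes \<sigma> T a b e K H \<Delta> :: real and m Pm :: "real \<Rightarrow> real"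
  assumes \<sigma>: "1/2 \<le> \<sigma>" "\<sigma> < 1" and ab: "T \<le> a" "a \<le> b" "b \<le> 2 * T" and T: "T \<ge> 2"
    and H: "H \<ge> 1" and \<Delta>: "0 \<le> \<Delta>" "\<Delta> \<le> T / 2" and e: "e > 0" and K0: "K > 0"
    and near: "\<And>t. T / 2 \<le> t \<Longrightarrow> t \<le> 4 * T \<Longrightarrow> \<bar>zeta_gauss_mean \<sigma> t H - m t\<bar> < e"
    and K: "\<And>H t0. H \<ge> 1 \<Longrightarrow> t0 \<ge> 1 \<Longrightarrow>
     integrable lborel (\<lambda>t. normal_density t0 H t * (norm (zeta_line \<sigma> t))\<^sup>2) \<and>
     zeta_gauss_mean \<sigma> t0 H \<le> K * (1 + t0\<^sup>2 + H\<^sup>2)"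
    and Pm: "\<And>t. t > 0 \<Longrightarrow> (Pm has_real_derivative m t) (at t)"
begin

definition "F t = (norm (zeta_line \<sigma> t))\<^sup>2"
definition "J s = integral {a..b} (\<lambda>t. normal_density s H t * F t)"
definition "tail = sqrt 2 * exp (- \<Delta>\<^sup>2 / (4 * H\<^sup>2))"

lemma F_integrable: "F integrable_on {c..d}"
  unfolding F_def using \<sigma> by (intro integrable_continuous_interval continuous_intros zeta_line_continuous) auto

lemma J_eq: "J s = (LINT t|lborel. indicator {a..b} t * (normal_density s H t * F t))"
  and J_int: "integrable lborel (\<lambda>t. indicator {a..b} t * (normal_density s H t * F t))"
proof -
  have si: "set_integrable lborel {a..b} (\<lambda>t. normal_density s H t * F t)"
    unfolding F_def using \<sigma> by (intro borel_integrable_atLeastAtMost' continuous_intros zeta_line_continuous) auto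
  show "J s = (LINT t|lborel. indicator {a..b} t * (normal_density s H t * F t))"
    "integrable lborel (\<lambda>t. indicator {a..b} t * (normal_density s H t * F t))"
    using set_borel_integral_eq_integral(2)[OF si] si by (simp_all add: J_def set_integrable_def set_lebesgue_integral_def)
qed

lemma J_le: "s \<ge> 1 \<Longrightarrow> J s \<le> zeta_gauss_mean \<sigma> s H"
  unfolding J_eq zeta_gauss_mean_def
  by (rule integral_mono[OF J_int]) (use K[OF H] in \<open>auto simp: F_def indicator_def\<close>)

lemma J_ge:
  assumes s: "a + \<Delta> \<le> s" "s \<le> b - \<Delta>"
  shows "zeta_gauss_mean \<sigma> s H \<le> J s + tail * (K * (1 + (2 * T)\<^sup>2 + 2 * H\<^sup>2))"
proof -
  have s1: "s \<ge> 1" using s ab T \<Delta> by simp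
  have H2: "sqrt 2 * H \<ge> 1" using H mult_mono[of 1 "sqrt 2" 1 H] by simp
  have i: "integrable lborel (\<lambda>t. tail * (normal_density s (sqrt 2 * H) t * F t))"
    using K[OF H2 s1] by (simp add: F_def)
  have H0: "H > 0" using H by simp
  have "zeta_gauss_mean \<sigma> s H \<le> (LINT t|lborel. indicator {a..b} t * (normal_density s H t * F t) + tail * (normal_density s (sqrt 2 * H) t * F t))"
    unfolding zeta_gauss_mean_def
  proof (rule integral_mono[OF _ Bochner_Integration.integrable_add[OF J_int i]])
    show "integrable lborel (\<lambda>t. normal_density s H t * (norm (zeta_line \<sigma> t))\<^sup>2)" using K[OF H s1] by blast
    fix t
    show "normal_density s H t * (norm (zeta_line \<sigma> t))\<^sup>2 \<le> indicator {a..b} t * (normal_density s H t * F t) + tail * (normal_density s (sqrt 2 * H) t * F t)"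
    proof (cases "t \<in> {a..b}")
      case False
      then have "\<bar>t - s\<bar> \<ge> \<Delta>" using s by auto
      from gauss_tail[OF H0 this \<Delta>(1)] have "normal_density s H t * F t \<le> tail * normal_density s (sqrt 2 * H) t * F t"
        unfolding tail_def by (rule mult_right_mono) (simp add: F_def)
      then show ?thesis using False by (simp add: F_def mult.assoc)
    qed (simp add: F_def tail_def)
  qed
  also have "\<dots> = J s + tail * zeta_gauss_mean \<sigma> s (sqrt 2 * H)"
    unfolding J_eq zeta_gauss_mean_def F_def[symmetric]
    by (subst Bochner_Integration.integral_add[OF J_int i]) simp
  also have "\<dots> \<le> J s + tail * (K * (1 + (2 * T)\<^sup>2 + 2 * H\<^sup>2))"
  proof (intro add_left_mono mult_left_mono)
    have "zeta_gauss_mean \<sigma> s (sqrt 2 * H) \<le> K * (1 + s\<^sup>2 + (sqrt 2 * H)\<^sup>2)" using K[OF H2 s1] by blast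
    also have "\<dots> \<le> K * (1 + (2 * T)\<^sup>2 + 2 * H\<^sup>2)"
      using K0 s s1 ab \<Delta> by (intro mult_left_mono add_mono power_mono) (auto simp: power_mult_distrib)
    finally show "zeta_gauss_mean \<sigma> s (sqrt 2 * H) \<le> K * (1 + (2 * T)\<^sup>2 + 2 * H\<^sup>2)" .
  qed (simp add: tail_def)
  finally show ?thesis .
qed

lemma m_integral:
  assumes "0 < c" "c \<le> d" shows "((\<lambda>t. m t + u) has_integral (Pm d - Pm c + u * (d - c))) {c..d}"
proof -
  have "(m has_integral (Pm d - Pm c)) {c..d}"
    by (rule fundamental_theorem_of_calculus)
       (use assms Pm in \<open>auto simp flip: has_real_derivative_iff_has_vector_derivative intro: has_field_derivative_at_within\<close>)
  from has_integral_add[OF this has_integral_const_real[of u c d]] assms show ?thesis by (simp add: mult.commute)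
qed

lemma line_moment_eq: "line_moment \<sigma> a b = integral {a..b} F" by (simp add: line_moment_def F_def[abs_def])

text \<open>Centres at least \<Delta> inside [a, b] lose by truncation at most \<open>tail\<close>
  times a polynomial bound (\<open>J_ge\<close>), while the total weight of any t is at most
  1.\<close>

lemma lower:
  assumes "a + \<Delta> \<le> b - \<Delta>"
  shows "Pm (b - \<Delta>) - Pm (a + \<Delta>) - (e + tail * (K * (1 + (2 * T)\<^sup>2 + 2 * H\<^sup>2))) * (b - a) \<le> line_moment \<sigma> a b"
proof -
  let ?u = "e + tail * (K * (1 + (2 * T)\<^sup>2 + 2 * H\<^sup>2))"
  have u0: "?u \<ge> 0" using e K0 by (simp add: tail_def)
  have c: "0 < a + \<Delta>" using ab T \<Delta> by simp
  have "Pm (b - \<Delta>) - Pm (a + \<Delta>) + - ?u * ((b - \<Delta>) - (a + \<Delta>)) = integral {a + \<Delta>..b - \<Delta>} (\<lambda>t. m t + - ?u)"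
    using integral_unique[OF m_integral[OF c assms, of "- ?u"]] by simp
  also have "\<dots> \<le> integral {a + \<Delta>..b - \<Delta>} J"
  proof (rule integral_le)
    show "(\<lambda>t. m t + - ?u) integrable_on {a + \<Delta>..b - \<Delta>}" using m_integral[OF c assms] by blast
    show "J integrable_on {a + \<Delta>..b - \<Delta>}" unfolding J_def[abs_def] F_def using window_swap(1)[OF \<sigma>(2)] .
    fix s assume s: "s \<in> {a + \<Delta>..b - \<Delta>}"
    have "\<bar>zeta_gauss_mean \<sigma> s H - m s\<bar> < e" by (rule near) (use s ab T \<Delta> in auto)
    then show "m s + - ?u \<le> J s" using J_ge[of s] s by auto
  qed
  also have "\<dots> = integral {a..b} (\<lambda>t. F t * integral {a + \<Delta>..b - \<Delta>} (\<lambda>s. normal_density s H t))"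
    unfolding J_def[abs_def] F_def using window_swap(2)[OF \<sigma>(2)] .
  also have "\<dots> \<le> integral {a..b} F"
  proof (rule integral_le[OF _ F_integrable])
    show "(\<lambda>t. F t * integral {a + \<Delta>..b - \<Delta>} (\<lambda>s. normal_density s H t)) integrable_on {a..b}"
      unfolding F_def using window_swap(3)[OF \<sigma>(2)] .
    fix t
    have "F t * integral {a + \<Delta>..b - \<Delta>} (\<lambda>s. normal_density s H t) \<le> F t * 1"
      using normal_density_interval(1)[of H] H by (intro mult_left_mono) (auto simp: F_def)
    then show "F t * integral {a + \<Delta>..b - \<Delta>} (\<lambda>s. normal_density s H t) \<le> F t" by simp
  qed
  finally have "Pm (b - \<Delta>) - Pm (a + \<Delta>) + - ?u * ((b - \<Delta>) - (a + \<Delta>)) \<le> line_moment \<sigma> a b" by (simp only: line_moment_eq)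
  moreover have "?u * ((b - \<Delta>) - (a + \<Delta>)) \<le> ?u * (b - a)" using u0 \<Delta> by (intro mult_left_mono) auto
  moreover have "P + - u * c \<le> L \<Longrightarrow> u * c \<le> u * d \<Longrightarrow> P - u * d \<le> L" for P u c d L :: real by simp
  ultimately show ?thesis by blast
qed

text \<open>With centres up to \<Delta> outside, every t in [a, b] receives weight at least
  \<open>1 - tail\<close>, and truncation only decreases a mean.\<close>

lemma upper: "(1 - tail) * line_moment \<sigma> a b \<le> Pm (b + \<Delta>) - Pm (a - \<Delta>) + e * (b - a + 2 * \<Delta>)"
proof -
  have c: "0 < a - \<Delta>" "a - \<Delta> \<le> b + \<Delta>" using ab T \<Delta> by auto
  have "(1 - tail) * line_moment \<sigma> a b = integral {a..b} (\<lambda>t. (1 - tail) * F t)"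
    unfolding line_moment_eq by simp
  also have "\<dots> \<le> integral {a..b} (\<lambda>t. F t * integral {a - \<Delta>..b + \<Delta>} (\<lambda>s. normal_density s H t))"
  proof (rule integral_le)
    show "(\<lambda>t. (1 - tail) * F t) integrable_on {a..b}" by (intro integrable_on_mult_right F_integrable)
    show "(\<lambda>t. F t * integral {a - \<Delta>..b + \<Delta>} (\<lambda>s. normal_density s H t)) integrable_on {a..b}"
      unfolding F_def using window_swap(3)[OF \<sigma>(2)] .
    fix t assume t: "t \<in> {a..b}"
    have "1 - tail \<le> integral {a - \<Delta>..b + \<Delta>} (\<lambda>s. normal_density s H t)"
      unfolding tail_def by (rule normal_density_interval(2)) (use t H \<Delta> in auto)
    then have "F t * (1 - tail) \<le> F t * integral {a - \<Delta>..b + \<Delta>} (\<lambda>s. normal_density s H t)"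
      by (rule mult_left_mono) (simp add: F_def)
    then show "(1 - tail) * F t \<le> F t * integral {a - \<Delta>..b + \<Delta>} (\<lambda>s. normal_density s H t)" by (simp add: mult.commute)
  qed
  also have "\<dots> = integral {a - \<Delta>..b + \<Delta>} J"
    unfolding J_def[abs_def] F_def using window_swap(2)[OF \<sigma>(2)] by simp
  also have "\<dots> \<le> integral {a - \<Delta>..b + \<Delta>} (\<lambda>t. m t + e)"
  proof (rule integral_le)
    show "J integrable_on {a - \<Delta>..b + \<Delta>}" unfolding J_def[abs_def] F_def using window_swap(1)[OF \<sigma>(2)] .
    show "(\<lambda>t. m t + e) integrable_on {a - \<Delta>..b + \<Delta>}" using m_integral[OF c] by blast
    fix s assume s: "s \<in> {a - \<Delta>..b + \<Delta>}"
    have "\<bar>zeta_gauss_mean \<sigma> s H - m s\<bar> < e" by (rule near) (use s ab T \<Delta> in auto)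
    moreover have "s \<ge> 1" using s ab T \<Delta> by auto
    ultimately show "J s \<le> m s + e" using J_le[of s] by auto
  qed
  also have "\<dots> = Pm (b + \<Delta>) - Pm (a - \<Delta>) + e * ((b + \<Delta>) - (a - \<Delta>))"
    by (rule integral_unique[OF m_integral[OF c]])
  also have "(b + \<Delta>) - (a - \<Delta>) = b - a + 2 * \<Delta>" by simp
  finally show ?thesis .
qed

end

section \<open>Moments over short intervals for 1/2 \<le> \<sigma> < 1\<close>

definition "mean_density \<sigma> t = log_coeff \<sigma> * ln t + mean_const \<sigma>"
definition "mean_primitive \<sigma> t = log_coeff \<sigma> * (t * ln t - t) + mean_const \<sigma> * t"

lemma mean_primitive_deriv: "t > 0 \<Longrightarrow> (mean_primitive \<sigma> has_real_derivative mean_density \<sigma> t) (at t)"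
  unfolding mean_primitive_def mean_density_def by (auto intro!: derivative_eq_intros)

lemma mean_primitive_diff:
  assumes T: "T \<ge> 2" and x: "T / 2 \<le> x" "x \<le> 4 * T" and y: "T / 2 \<le> y" "y \<le> 4 * T"
  shows "\<bar>mean_primitive \<sigma> x - mean_primitive \<sigma> y\<bar> \<le> (ln (4 * T) + \<bar>mean_const \<sigma>\<bar>) * \<bar>x - y\<bar>"
proof -
  have "norm (mean_primitive \<sigma> x - mean_primitive \<sigma> y) \<le> (ln (4 * T) + \<bar>mean_const \<sigma>\<bar>) * norm (x - y)"
  proof (rule field_differentiable_bound[where S = "{T / 2..4 * T}" and f' = "mean_density \<sigma>"])
    fix z assume z: "z \<in> {T / 2..4 * T}"
    show "(mean_primitive \<sigma> has_field_derivative mean_density \<sigma> z) (at z within {T / 2..4 * T})"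
      by (rule has_field_derivative_at_within[OF mean_primitive_deriv]) (use z T in auto)
    have "0 \<le> ln z" "ln z \<le> ln (4 * T)" using z T by auto
    then have "\<bar>log_coeff \<sigma> * ln z\<bar> \<le> ln (4 * T)" by (auto simp: log_coeff_def)
    then show "norm (mean_density \<sigma> z) \<le> ln (4 * T) + \<bar>mean_const \<sigma>\<bar>" unfolding mean_density_def by simp
  qed (use x y in auto)
  then show ?thesis by simp
qed

lemma line_moment_nonneg: "line_moment \<sigma> a b \<ge> 0"
proof (cases "(\<lambda>t. (norm (zeta_line \<sigma> t))\<^sup>2) integrable_on {a..b}")
  case True
  then show ?thesis unfolding line_moment_def by (rule Henstock_Kurzweil_Integration.integral_nonneg) simp
qed (simp add: line_moment_def not_integrable_integral)

text \<open>The margin T^{19/20} exceeds the width T^{9/10} by a power, which makes the tail a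
  multiple of exp (-T^{1/10} / 4). The margin costs about T^{19/20} ln T, which T^{24/25}
  absorbs.\<close>

lemma line_moment_asymptotic_lt_1:
  assumes \<sigma>: "1/2 \<le> \<sigma>" "\<sigma> < 1" and e: "e > 0"
  shows "\<forall>\<^sub>F T in at_top. \<forall>a b. T \<le> a \<and> a \<le> b \<and> b \<le> 2 * T \<longrightarrow>
      \<bar>line_moment \<sigma> a b - (mean_primitive \<sigma> b - mean_primitive \<sigma> a)\<bar> \<le> e * (b - a) + T powr (24/25)"
proof -
  obtain K where K: "K > 0" "\<And>H t0. H \<ge> 1 \<Longrightarrow> t0 \<ge> 1 \<Longrightarrow>
     integrable lborel (\<lambda>t. normal_density t0 H t * (norm (zeta_line \<sigma> t))\<^sup>2) \<and>
     zeta_gauss_mean \<sigma> t0 H \<le> K * (1 + t0\<^sup>2 + H\<^sup>2)"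
    by (rule zeta_gauss_mean_bound[OF \<sigma>]) blast
  define e2 where "e2 = e / 2"
  have e2: "e2 > 0" using e by (simp add: e2_def)
  obtain T0 where T0: "\<And>T t. T \<ge> T0 \<Longrightarrow> T / 2 \<le> t \<Longrightarrow> t \<le> 4 * T \<Longrightarrow>
      \<bar>zeta_gauss_mean \<sigma> t (smooth_H T) - (log_coeff \<sigma> * ln t + mean_const \<sigma>)\<bar> < e2"
    using zeta_gauss_mean_uniform[OF \<sigma> e2] by blast
  define c where "c = \<bar>mean_const \<sigma>\<bar>"
  define \<Delta> where "\<Delta> T = T powr (19/20)" for T :: real
  define tl where "tl T = sqrt 2 * exp (- (\<Delta> T)\<^sup>2 / (4 * (smooth_H T)\<^sup>2))" for T
  define mm where "mm T = ln (4 * T) + c" for T :: real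
  have "\<forall>\<^sub>F T in at_top. \<Delta> T \<le> T / 2" unfolding \<Delta>_def by real_asymp
  moreover have "\<forall>\<^sub>F T in at_top. tl T * (K * (1 + (2 * T)\<^sup>2 + 2 * (smooth_H T)\<^sup>2)) \<le> e2"
  proof -
    have "((\<lambda>T. sqrt 2 * exp (- (T powr (19/20))\<^sup>2 / (4 * (T powr (9/10))\<^sup>2)) * (K * (1 + (2 * T)\<^sup>2 + 2 * (T powr (9/10))\<^sup>2))) \<longlongrightarrow> 0) at_top" by real_asymp
    then have "\<forall>\<^sub>F T in at_top. sqrt 2 * exp (- (T powr (19/20))\<^sup>2 / (4 * (T powr (9/10))\<^sup>2)) * (K * (1 + (2 * T)\<^sup>2 + 2 * (T powr (9/10))\<^sup>2)) < e2"
      using e2 order_tendstoD(2) by blast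
    then show ?thesis unfolding tl_def \<Delta>_def smooth_H_def by (rule eventually_mono) simp
  qed
  moreover have "\<forall>\<^sub>F T in at_top. tl T \<le> 1 / 2" unfolding tl_def \<Delta>_def smooth_H_def by real_asymp
  moreover have "\<forall>\<^sub>F T in at_top. 2 * tl T * (2 * T * mm T + e * T) \<le> 1"
  proof -
    have "((\<lambda>T. 2 * (sqrt 2 * exp (- (T powr (19/20))\<^sup>2 / (4 * (T powr (9/10))\<^sup>2))) * (2 * T * (ln (4 * T) + c) + e * T)) \<longlongrightarrow> 0) at_top" by real_asymp
    then have "\<forall>\<^sub>F T in at_top. 2 * (sqrt 2 * exp (- (T powr (19/20))\<^sup>2 / (4 * (T powr (9/10))\<^sup>2))) * (2 * T * (ln (4 * T) + c) + e * T) < 1"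
      using order_tendstoD(2) zero_less_one by blast
    then show ?thesis unfolding tl_def \<Delta>_def smooth_H_def mm_def by (rule eventually_mono) simp
  qed
  moreover have "\<forall>\<^sub>F T in at_top. 2 * \<Delta> T * mm T + e * \<Delta> T + 1 \<le> T powr (24/25)" unfolding \<Delta>_def mm_def using e by real_asymp
  ultimately show ?thesis using eventually_ge_at_top[of "max 2 T0"]
  proof eventually_elim
    case (elim T)
    have T: "T \<ge> 2" "T \<ge> T0" using elim by auto
    have mm0: "mm T \<ge> 0" using T by (simp add: mm_def c_def)
    have tl0: "tl T \<ge> 0" by (simp add: tl_def)
    have D0: "\<Delta> T \<ge> 0" by (simp add: \<Delta>_def)
    show ?case
    proof (intro allI impI)
      fix a b assume ab: "T \<le> a \<and> a \<le> b \<and> b \<le> 2 * T"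
      interpret W: window \<sigma> T a b e2 K "smooth_H T" "\<Delta> T" "mean_density \<sigma>" "mean_primitive \<sigma>"
      proof
        show "smooth_H T \<ge> 1" unfolding smooth_H_def using T by (intro ge_one_powr_ge_zero) auto
        show "\<bar>zeta_gauss_mean \<sigma> t (smooth_H T) - mean_density \<sigma> t\<bar> < e2" if "T / 2 \<le> t" "t \<le> 4 * T" for t
          using T0[OF T(2) that] by (simp add: mean_density_def)
        show "integrable lborel (\<lambda>t. normal_density t0 H t * (norm (zeta_line \<sigma> t))\<^sup>2) \<and>
            zeta_gauss_mean \<sigma> t0 H \<le> K * (1 + t0\<^sup>2 + H\<^sup>2)" if "H \<ge> 1" "t0 \<ge> 1" for H t0
          by (rule K(2)[OF that])
        show "(mean_primitive \<sigma> has_real_derivative mean_density \<sigma> t) (at t)" if "t > 0" for t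
          by (rule mean_primitive_deriv[OF that])
      qed (use \<sigma> ab T elim(1) D0 e2 K(1) in auto)
      let ?L = "line_moment \<sigma> a b" and ?P = "mean_primitive \<sigma>"
      have tail: "W.tail = tl T" by (simp add: W.tail_def tl_def)
      have P: "\<bar>?P x - ?P y\<bar> \<le> mm T * \<bar>x - y\<bar>" if "T / 2 \<le> x" "x \<le> 4 * T" "T / 2 \<le> y" "y \<le> 4 * T" for x y
        using mean_primitive_diff[OF T(1) that] by (simp add: mm_def c_def)
      have low: "?P b - ?P a - (e * (b - a) + 2 * \<Delta> T * mm T) \<le> ?L"
      proof (cases "a + \<Delta> T \<le> b - \<Delta> T")
        case True
        have "(e2 + tl T * (K * (1 + (2 * T)\<^sup>2 + 2 * (smooth_H T)\<^sup>2))) * (b - a) \<le> (e2 + e2) * (b - a)"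
          using elim(2) ab by (intro mult_right_mono) auto
        moreover have "\<bar>?P b - ?P (b - \<Delta> T)\<bar> \<le> mm T * \<bar>b - (b - \<Delta> T)\<bar>" "\<bar>?P (a + \<Delta> T) - ?P a\<bar> \<le> mm T * \<bar>a + \<Delta> T - a\<bar>"
          by (rule P; use ab T elim(1) D0 in auto)+
        ultimately show ?thesis using W.lower[OF True] D0 unfolding tail e2_def by (simp add: algebra_simps)
      next
        \<comment> \<open>The interval is shorter than two margins: the predicted value is itself
          within the error, and the moment is nonnegative.\<close>
        case False
        have "\<bar>?P b - ?P a\<bar> \<le> mm T * \<bar>b - a\<bar>" by (rule P) (use ab T in auto)
        also have "\<dots> \<le> mm T * (2 * \<Delta> T)" using False ab mm0 by (intro mult_left_mono) auto
        finally have "?P b - ?P a \<le> 2 * \<Delta> T * mm T" by (simp add: algebra_simps)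
        moreover have "0 \<le> e * (b - a)" using e ab by simp
        ultimately show ?thesis using line_moment_nonneg[of \<sigma> a b] by linarith
      qed
      define R where "R = ?P (b + \<Delta> T) - ?P (a - \<Delta> T) + e2 * (b - a + 2 * \<Delta> T)"
      have LR: "(1 - tl T) * ?L \<le> R" using W.upper unfolding tail R_def .
      \<comment> \<open>A preliminary bound: it gives a moment of order T ln T, so that
        \<open>tl T * ?L\<close> is at most 1 and the factor \<open>1 - tl T\<close> can be
        removed.\<close>
      have "R \<le> 2 * T * mm T + e * T"
      proof -
        have "\<bar>?P (b + \<Delta> T) - ?P (a - \<Delta> T)\<bar> \<le> mm T * \<bar>(b + \<Delta> T) - (a - \<Delta> T)\<bar>"
          by (rule P) (use ab T elim(1) D0 in auto)
        also have "\<dots> \<le> mm T * (2 * T)" using ab D0 elim(1) mm0 by (intro mult_left_mono) auto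
        finally have 1: "?P (b + \<Delta> T) - ?P (a - \<Delta> T) \<le> 2 * T * mm T" by (simp add: algebra_simps)
        have "e2 * (b - a + 2 * \<Delta> T) \<le> e2 * (2 * T)" using ab elim(1) e2 by (intro mult_left_mono) auto
        then show ?thesis using 1 unfolding R_def e2_def by simp
      qed
      moreover have "1 / 2 * ?L \<le> (1 - tl T) * ?L" using elim(3) line_moment_nonneg[of \<sigma> a b] by (intro mult_right_mono) auto
      ultimately have "1 / 2 * ?L \<le> 2 * T * mm T + e * T" using LR order_trans by blast
      then have "?L \<le> 2 * (2 * T * mm T + e * T)" by simp
      then have "tl T * ?L \<le> tl T * (2 * (2 * T * mm T + e * T))" using tl0 by (rule mult_left_mono)
      then have "tl T * ?L \<le> 1" using elim(4) by (simp add: algebra_simps)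
      then have k1: "?L \<le> R + 1" using LR by (simp add: algebra_simps)
      have "\<bar>?P (b + \<Delta> T) - ?P b\<bar> \<le> mm T * \<bar>b + \<Delta> T - b\<bar>" "\<bar>?P a - ?P (a - \<Delta> T)\<bar> \<le> mm T * \<bar>a - (a - \<Delta> T)\<bar>"
        by (rule P; use ab T elim(1) D0 in auto)+
      then have k2: "\<bar>?P (b + \<Delta> T) - ?P b\<bar> \<le> \<Delta> T * mm T" "\<bar>?P a - ?P (a - \<Delta> T)\<bar> \<le> \<Delta> T * mm T"
        using D0 by (simp_all add: mult.commute)
      have k3: "e2 * (b - a) \<le> e * (b - a)" using ab e by (intro mult_right_mono) (auto simp: e2_def)
      have k4: "e2 * (b - a + 2 * \<Delta> T) = e2 * (b - a) + e * \<Delta> T" by (simp add: e2_def field_simps)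
      have "L \<le> R + 1 \<Longrightarrow> R = p - q + x \<Longrightarrow> \<bar>p - p'\<bar> \<le> d \<Longrightarrow> \<bar>q' - q\<bar> \<le> d \<Longrightarrow> y \<le> w \<Longrightarrow> x = y + z
          \<Longrightarrow> L \<le> p' - q' + (w + (2 * d + z + 1))" for L R p q x p' q' d y w z :: real by linarith
      from this[OF k1 R_def k2 k3 k4]
      have up: "?L \<le> ?P b - ?P a + (e * (b - a) + (2 * \<Delta> T * mm T + e * \<Delta> T + 1))" by (simp only: mult.assoc)
      have "0 \<le> e * \<Delta> T" using e D0 by simp
      then show "\<bar>?L - (?P b - ?P a)\<bar> \<le> e * (b - a) + T powr (24/25)"
        using low up elim(5) by linarith
    qed
  qed
qed

subsection \<open>Lines to the right of the critical strip\<close>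

lemma harm_le_ln: "M \<ge> 1 \<Longrightarrow> (\<Sum>n<M. 1 / real (Suc n)) \<le> 1 + ln (real M)"
proof -
  assume "M \<ge> 1"
  then obtain k where k: "M = Suc k" by (cases M) auto
  have "harm (Suc k) - ln (real (Suc k)) \<le> harm (Suc 0) - ln (real (Suc 0))"
    using decseq_harm_diff_ln unfolding decseq_def by blast
  then show ?thesis by (simp add: k harm_altdef inverse_eq_divide)
qed

lemma sum_inverse_distance:
  "(\<Sum>n\<in>{..<M} - {m}. 1 / \<bar>real n - real m\<bar>) \<le> 2 * (\<Sum>k<M. 1 / real (Suc k))" if "m < M"
proof -
  have split: "{..<M} - {m} = {..<m} \<union> {Suc m..<M}" using that by auto
  have "(\<Sum>n\<in>{..<M} - {m}. 1 / \<bar>real n - real m\<bar>) = (\<Sum>n<m. 1 / \<bar>real n - real m\<bar>) + (\<Sum>n=Suc m..<M. 1 / \<bar>real n - real m\<bar>)"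
    unfolding split by (rule sum.union_disjoint) auto
  also have "(\<Sum>n<m. 1 / \<bar>real n - real m\<bar>) = (\<Sum>k<m. 1 / real (Suc k))"
    by (rule sum.reindex_bij_witness[of _ "\<lambda>k. m - Suc k" "\<lambda>n. m - Suc n"]) (auto simp: of_nat_diff)
  also have "\<dots> \<le> (\<Sum>k<M. 1 / real (Suc k))" using that by (intro sum_mono2) auto
  also have "(\<Sum>n=Suc m..<M. 1 / \<bar>real n - real m\<bar>) = (\<Sum>k<M - Suc m. 1 / real (Suc k))"
    by (rule sum.reindex_bij_witness[of _ "\<lambda>k. k + Suc m" "\<lambda>n. n - Suc m"]) (auto simp: of_nat_diff)
  also have "\<dots> \<le> (\<Sum>k<M. 1 / real (Suc k))" by (intro sum_mono2) auto
  finally show ?thesis by simp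
qed

lemma ln_gap:
  assumes "m < n" shows "ln (real (Suc n)) - ln (real (Suc m)) \<ge> (real n - real m) / real (Suc n)"
proof -
  have "ln (real (Suc m) / real (Suc n)) \<le> real (Suc m) / real (Suc n) - 1" by (rule ln_le_minus_one) simp
  then have "ln (real (Suc m)) - ln (real (Suc n)) \<le> real (Suc m) / real (Suc n) - 1" by (simp add: ln_div)
  also have "\<dots> = - ((real n - real m) / real (Suc n))" by (simp add: field_simps)
  finally show ?thesis by simp
qed

text \<open>For m < n the logarithms differ by at least (n - m) / (n + 1), and the factor n + 1 is
  absorbed by the coefficient because \<sigma> \<ge> 1. Both orders appear on the right, so that the
  bound is symmetric in m and n.\<close>

lemma coeff_gap:
  assumes \<sigma>: "\<sigma> \<ge> 1" and mn: "m \<noteq> n"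
  shows "real (Suc m) powr (- \<sigma>) * real (Suc n) powr (- \<sigma>) * (2 / \<bar>ln (real (Suc n)) - ln (real (Suc m))\<bar>)
      \<le> 2 / (real (Suc m) * \<bar>real n - real m\<bar>) + 2 / (real (Suc n) * \<bar>real n - real m\<bar>)"
proof -
  have main: "real (Suc m) powr (- \<sigma>) * real (Suc n) powr (- \<sigma>) * (2 / \<bar>ln (real (Suc n)) - ln (real (Suc m))\<bar>)
      \<le> 2 / (real (Suc m) * \<bar>real n - real m\<bar>)" if "m < n" for m n
  proof -
    have p: "real (Suc k) powr (- \<sigma>) \<le> 1 / real (Suc k)" for k
    proof -
      have "real (Suc k) powr (- \<sigma>) \<le> real (Suc k) powr (- 1)" using \<sigma> by (intro powr_mono) auto
      then show ?thesis by (simp add: powr_minus_divide)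
    qed
    have d: "real n - real m > 0" using that by simp
    have g: "(real n - real m) / real (Suc n) \<le> \<bar>ln (real (Suc n)) - ln (real (Suc m))\<bar>" using ln_gap[OF that] by linarith
    have gp: "(real n - real m) / real (Suc n) > 0" using d by simp
    have "real (Suc m) powr (- \<sigma>) * real (Suc n) powr (- \<sigma>) * (2 / \<bar>ln (real (Suc n)) - ln (real (Suc m))\<bar>)
        \<le> (1 / real (Suc m)) * (1 / real (Suc n)) * (2 / ((real n - real m) / real (Suc n)))"
      using p g gp by (intro mult_mono divide_left_mono mult_pos_pos mult_nonneg_nonneg) auto
    also have "\<dots> = 2 / (real (Suc m) * (real n - real m))" using d by (simp del: of_nat_Suc)
    finally show ?thesis using d by simp
  qed
  show ?thesis
  proof (cases "m < n")
    case True
    have "0 \<le> 2 / (real (Suc n) * \<bar>real n - real m\<bar>)" by simp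
    then show ?thesis using main[OF True] by linarith
  next
    case False
    then have "n < m" using mn by simp
    have "0 \<le> 2 / (real (Suc m) * \<bar>real n - real m\<bar>)" by simp
    then show ?thesis using main[OF \<open>n < m\<close>] by (simp only: mult.commute abs_minus_commute[of "ln (real (Suc n))"] abs_minus_commute[of "real n"])
  qed
qed

lemma integral_cos_bound:
  fixes c :: real
  assumes "a \<le> b" "c \<noteq> 0" shows "\<bar>integral {a..b} (\<lambda>t. cos (c * t))\<bar> \<le> 2 / \<bar>c\<bar>"
proof -
  have "((\<lambda>t. cos (c * t)) has_integral (sin (c * b) / c - sin (c * a) / c)) {a..b}"
    by (rule fundamental_theorem_of_calculus)
       (use assms in \<open>auto intro!: derivative_eq_intros simp flip: has_real_derivative_iff_has_vector_derivative\<close>)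
  then have "integral {a..b} (\<lambda>t. cos (c * t)) = (sin (c * b) - sin (c * a)) / c" by (simp add: integral_unique diff_divide_distrib)
  moreover have "\<bar>sin (c * b) - sin (c * a)\<bar> \<le> 2" using abs_sin_le_one[of "c * b"] abs_sin_le_one[of "c * a"] by linarith
  ultimately show ?thesis using assms by (simp add: divide_right_mono)
qed

text \<open>Each off-diagonal cosine has integral at most twice the inverse gap of logarithms. By
  \<open>coeff_gap\<close> the sum of these bounds is a product of two harmonic sums, so the error
  is only a squared logarithm.\<close>

lemma dirichlet_polynomial_mean:
  assumes \<sigma>: "\<sigma> \<ge> 1" and ab: "a \<le> b" and M: "M \<ge> 1"
  defines "D \<equiv> \<lambda>t. \<Sum>n<M. of_real (real (Suc n) powr (- \<sigma>)) * cis (- t * ln (real (Suc n)))"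
  shows "\<bar>integral {a..b} (\<lambda>t. (norm (D t))\<^sup>2) - (b - a) * (\<Sum>n<M. real (Suc n) powr (- (2 * \<sigma>)))\<bar> \<le> 8 * (1 + ln (real M))\<^sup>2"
proof -
  let ?a = "\<lambda>n. real (Suc n) powr (- \<sigma>)" and ?w = "\<lambda>n. ln (real (Suc n))"
  let ?I = "\<lambda>m n. integral {a..b} (\<lambda>t. cos ((?w n - ?w m) * t))"
  define h where "h = (\<Sum>k<M. 1 / real (Suc k))"
  have h: "0 \<le> h" "h \<le> 1 + ln (real M)" unfolding h_def using harm_le_ln[OF M] by (auto intro!: sum_nonneg)
  have "((\<lambda>t. \<Sum>m<M. \<Sum>n<M. ?a m * ?a n * cos ((?w n - ?w m) * t)) has_integral (\<Sum>m<M. \<Sum>n<M. ?a m * ?a n * ?I m n)) {a..b}"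
    by (intro has_integral_sum has_integral_mult_right integrable_integral integrable_continuous_interval continuous_intros) auto
  then have "integral {a..b} (\<lambda>t. (norm (D t))\<^sup>2) = (\<Sum>m<M. \<Sum>n<M. ?a m * ?a n * ?I m n)"
    unfolding D_def norm_square_sum_cos by (rule integral_unique)
  also have "\<dots> = (\<Sum>m<M. ?a m * ?a m * ?I m m + (\<Sum>n\<in>{..<M} - {m}. ?a m * ?a n * ?I m n))"
    by (intro sum.cong refl sum.remove) auto
  also have "\<dots> = (b - a) * (\<Sum>m<M. real (Suc m) powr (- (2 * \<sigma>))) + (\<Sum>m<M. \<Sum>n\<in>{..<M} - {m}. ?a m * ?a n * ?I m n)"
    using ab by (simp add: sum.distrib sum_distrib_left mult.commute powr_add[symmetric] del: of_nat_Suc)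
  finally have "\<bar>integral {a..b} (\<lambda>t. (norm (D t))\<^sup>2) - (b - a) * (\<Sum>n<M. real (Suc n) powr (- (2 * \<sigma>)))\<bar>
      = \<bar>\<Sum>m<M. \<Sum>n\<in>{..<M} - {m}. ?a m * ?a n * ?I m n\<bar>" by simp
  also have "\<dots> \<le> (\<Sum>m<M. \<Sum>n\<in>{..<M} - {m}. \<bar>?a m * ?a n * ?I m n\<bar>)"
    by (intro order_trans[OF sum_abs] sum_mono sum_abs)
  also have "\<dots> \<le> (\<Sum>m<M. \<Sum>n\<in>{..<M} - {m}. 2 / (real (Suc m) * \<bar>real n - real m\<bar>) + 2 / (real (Suc n) * \<bar>real n - real m\<bar>))"
  proof (intro sum_mono)
    fix m n assume "n \<in> {..<M} - {m}"
    then have mn: "m \<noteq> n" by auto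
    then have "?w n - ?w m \<noteq> 0" by (simp del: of_nat_Suc)
    then have I: "\<bar>?I m n\<bar> \<le> 2 / \<bar>?w n - ?w m\<bar>" by (intro integral_cos_bound ab)
    have nn: "0 \<le> ?a m * ?a n" by simp
    have "\<bar>?a m * ?a n * ?I m n\<bar> = ?a m * ?a n * \<bar>?I m n\<bar>" by (simp add: abs_mult)
    also note mult_left_mono[OF I nn]
    finally have "\<bar>?a m * ?a n * ?I m n\<bar> \<le> ?a m * ?a n * (2 / \<bar>?w n - ?w m\<bar>)" .
    then show "\<bar>?a m * ?a n * ?I m n\<bar> \<le> 2 / (real (Suc m) * \<bar>real n - real m\<bar>) + 2 / (real (Suc n) * \<bar>real n - real m\<bar>)"
      using coeff_gap[OF \<sigma> mn] by linarith
  qed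
  also have "\<dots> = (\<Sum>m<M. \<Sum>n\<in>{..<M} - {m}. 2 / (real (Suc m) * \<bar>real n - real m\<bar>)) + (\<Sum>m<M. \<Sum>n\<in>{..<M} - {m}. 2 / (real (Suc n) * \<bar>real n - real m\<bar>))"
    by (simp only: sum.distrib)
  also have "(\<Sum>m<M. \<Sum>n\<in>{..<M} - {m}. 2 / (real (Suc n) * \<bar>real n - real m\<bar>)) = (\<Sum>n<M. \<Sum>m\<in>{..<M} - {n}. 2 / (real (Suc n) * \<bar>real n - real m\<bar>))"
  proof -
    have "{y \<in> {..<M}. x \<noteq> y} = {..<M} - {x}" "{y \<in> {..<M}. y \<noteq> x} = {..<M} - {x}" for x by auto
    then show ?thesis
      using sum.swap_restrict[of "{..<M}" "{..<M}" "\<lambda>m n. 2 / (real (Suc n) * \<bar>real n - real m\<bar>)" "\<lambda>m n. m \<noteq> n"]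
      by (simp del: of_nat_Suc)
  qed
  also have "\<dots> = (\<Sum>m<M. \<Sum>n\<in>{..<M} - {m}. 2 / (real (Suc m) * \<bar>real n - real m\<bar>))"
    by (simp only: abs_minus_commute)
  also have "(\<Sum>m<M. \<Sum>n\<in>{..<M} - {m}. 2 / (real (Suc m) * \<bar>real n - real m\<bar>)) \<le> (\<Sum>m<M. 2 / real (Suc m) * (2 * h))"
  proof (rule sum_mono)
    fix m assume m: "m \<in> {..<M}"
    have "(\<Sum>n\<in>{..<M} - {m}. 2 / (real (Suc m) * \<bar>real n - real m\<bar>)) = 2 / real (Suc m) * (\<Sum>n\<in>{..<M} - {m}. 1 / \<bar>real n - real m\<bar>)"
      by (simp add: sum_distrib_left del: of_nat_Suc)
    also have "\<dots> \<le> 2 / real (Suc m) * (2 * h)"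
      unfolding h_def using m by (intro mult_left_mono sum_inverse_distance) auto
    finally show "(\<Sum>n\<in>{..<M} - {m}. 2 / (real (Suc m) * \<bar>real n - real m\<bar>)) \<le> 2 / real (Suc m) * (2 * h)" .
  qed
  also have "(\<Sum>m<M. 2 / real (Suc m) * (2 * h)) = 4 * h * h"
  proof -
    have "(\<Sum>m<M. 2 / real (Suc m) * (2 * h)) = (\<Sum>m<M. (4 * h) * (1 / real (Suc m)))" by (simp add: mult_ac del: of_nat_Suc)
    also have "\<dots> = 4 * h * h" by (simp only: sum_distrib_left[symmetric] h_def)
    finally show ?thesis .
  qed
  finally have "\<bar>integral {a..b} (\<lambda>t. (norm (D t))\<^sup>2) - (b - a) * (\<Sum>n<M. real (Suc n) powr (- (2 * \<sigma>)))\<bar> \<le> 8 * h\<^sup>2"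
    by (simp add: power2_eq_square)
  also have "\<dots> \<le> 8 * (1 + ln (real M))\<^sup>2" using h by (intro mult_left_mono power_mono) auto
  finally show ?thesis .
qed

text \<open>A Dirichlet polynomial of length about T^2 makes the truncation error at most 3/T, and
  the pole term is at most 1/T because |1 - s| \<ge> T. The polynomial is bounded by a logarithm, so
  the squares differ by O(ln T / T).\<close>

lemma line_moment_asymptotic_ge_1:
  assumes \<sigma>: "\<sigma> \<ge> 1" and e: "e > 0"
  shows "\<forall>\<^sub>F T in at_top. \<forall>a b. T \<le> a \<and> a \<le> b \<and> b \<le> 2 * T \<longrightarrow>
      \<bar>line_moment \<sigma> a b - zeta_real (2 * \<sigma>) * (b - a)\<bar> \<le> e * (b - a) + T powr (24/25)"
proof -
  define N where "N T = nat \<lceil>T\<^sup>2\<rceil>" for T :: real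
  define Z where "Z M = (\<Sum>n<M. real (Suc n) powr (- (2 * \<sigma>)))" for M
  have "Z \<longlonglongrightarrow> zeta_real (2 * \<sigma>)" using zeta_real_sums[of "2 * \<sigma>"] \<sigma> by (simp add: sums_def Z_def[abs_def])
  then have "\<forall>\<^sub>F M in sequentially. \<bar>Z M - zeta_real (2 * \<sigma>)\<bar> < e"
    using e by (auto dest!: tendstoD simp: dist_norm)
  then obtain M0 where M0: "\<And>M. M \<ge> M0 \<Longrightarrow> \<bar>Z M - zeta_real (2 * \<sigma>)\<bar> < e" by (auto simp: eventually_sequentially)
  have "\<forall>\<^sub>F T in at_top. 8 * (1 + ln (T\<^sup>2 + 2))\<^sup>2 + T * (4 / T * (2 * (1 + ln (T\<^sup>2 + 2)) + 4 / T)) \<le> (T::real) powr (24/25)" by real_asymp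
  moreover have "\<forall>\<^sub>F T in at_top. (T::real) \<ge> max 1 (real M0)" by (rule eventually_ge_at_top)
  ultimately show ?thesis
  proof eventually_elim
    case (elim T)
    have T: "T \<ge> 1" "T \<ge> real M0" using elim by auto
    let ?M = "Suc (N T)"
    have NT: "real (N T) \<ge> T\<^sup>2" "real (N T) \<le> T\<^sup>2 + 1" unfolding N_def by (auto simp: real_nat_ceiling_ge)
    have T2: "T\<^sup>2 \<ge> T" using T by (simp add: power2_eq_square)
    have MM: "?M \<ge> M0" using NT T T2 by (simp add: Suc_le_eq flip: of_nat_less_iff[where 'a = real])
    define l where "l = 1 + ln (T\<^sup>2 + 2)"
    have l: "1 + ln (real ?M) \<le> l" "l \<ge> 0" using NT unfolding l_def by auto
    define D where "D t = (\<Sum>n<?M. of_real (real (Suc n) powr (- \<sigma>)) * cis (- t * ln (real (Suc n))))" for t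
    have Dl: "norm (D t) \<le> l" for t
    proof -
      have "norm (D t) \<le> (\<Sum>n<?M. 1 / real (Suc n))" unfolding D_def
      proof (rule order_trans[OF norm_sum sum_mono])
        fix n
        have "real (Suc n) powr (- \<sigma>) \<le> real (Suc n) powr (- 1)" using \<sigma> by (intro powr_mono) auto
        then show "norm (of_real (real (Suc n) powr (- \<sigma>)) * cis (- t * ln (real (Suc n)))) \<le> 1 / real (Suc n)"
          by (simp add: norm_mult norm_divide powr_minus_divide)
      qed
      also have "\<dots> \<le> 1 + ln (real ?M)" by (rule harm_le_ln) simp
      finally show ?thesis using l by linarith
    qed
    have zD: "norm (zeta_line \<sigma> t - D t) \<le> 4 / T" if t: "T \<le> t" "t \<le> 2 * T" for t
    proof -
      let ?s = "of_real \<sigma> + \<i> * of_real t"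
      have s: "Re ?s > 0" "?s \<noteq> 1" "Re ?s = \<sigma>" using \<sigma> t T by (auto simp: complex_eq_iff)
      have "norm (zeta ?s - (D t - of_real (real ?M) powr (1 - ?s) / (1 - ?s))) \<le> norm ?s / \<sigma> * real ?M powr (- \<sigma>)"
        using zeta_approx[OF s(1,2), of "N T"] unfolding powr_line D_def s(3) .
      moreover have "norm ?s / \<sigma> * real ?M powr (- \<sigma>) \<le> 3 * T * (1 / T\<^sup>2)"
      proof (rule mult_mono)
        have "norm ?s \<le> \<sigma> + t" using norm_triangle_ineq[of "of_real \<sigma>" "\<i> * of_real t"] \<sigma> t T by (simp add: norm_mult)
        also have "\<dots> \<le> \<sigma> * (3 * T)"
        proof -
          have "\<sigma> * 1 \<le> \<sigma> * T" "1 * (2 * T) \<le> \<sigma> * (2 * T)" using \<sigma> T by (intro mult_left_mono mult_right_mono; simp)+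
          then show ?thesis using t by (simp add: algebra_simps)
        qed
        finally show "norm ?s / \<sigma> \<le> 3 * T" using \<sigma> by (simp add: divide_le_eq mult.commute)
        have "real ?M powr (- \<sigma>) \<le> real ?M powr (- 1)" using \<sigma> by (intro powr_mono) auto
        also have "\<dots> = 1 / real ?M" by (simp add: powr_minus_divide)
        also have "\<dots> \<le> 1 / T\<^sup>2" using NT T by (intro divide_left_mono) auto
        finally show "real ?M powr (- \<sigma>) \<le> 1 / T\<^sup>2" .
      qed (use T in auto)
      moreover have "norm (of_real (real ?M) powr (1 - ?s) / (1 - ?s)) \<le> 1 / T"
      proof -
        have "norm (of_real (real ?M) powr (1 - ?s)) = real ?M powr (1 - \<sigma>)" by (subst norm_powr_real_powr) auto
        also have "\<dots> \<le> real ?M powr 0" using \<sigma> by (intro powr_mono) auto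
        finally have 1: "norm (of_real (real ?M) powr (1 - ?s)) \<le> 1" by simp
        have "\<bar>Im (1 - ?s)\<bar> \<le> norm (1 - ?s)" by (rule abs_Im_le_cmod)
        then have 2: "T \<le> norm (1 - ?s)" using t T by simp
        show ?thesis unfolding norm_divide using 1 2 T by (intro frac_le) auto
      qed
      moreover have "norm (zeta ?s - D t) \<le> norm (zeta ?s - (D t - of_real (real ?M) powr (1 - ?s) / (1 - ?s))) + norm (of_real (real ?M) powr (1 - ?s) / (1 - ?s))"
        using norm_triangle_ineq4[of "zeta ?s - (D t - of_real (real ?M) powr (1 - ?s) / (1 - ?s))" "of_real (real ?M) powr (1 - ?s) / (1 - ?s)"] by simp
      moreover have "3 * T * (1 / T\<^sup>2) + 1 / T = 4 / T" using T by (simp add: power2_eq_square)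
      ultimately show ?thesis unfolding zeta_line_def by linarith
    qed
    show ?case
    proof (intro allI impI)
      fix a b assume ab: "T \<le> a \<and> a \<le> b \<and> b \<le> 2 * T"
      let ?L = "line_moment \<sigma> a b"
      have Di: "(\<lambda>t. (norm (D t))\<^sup>2) integrable_on {a..b}"
        unfolding D_def by (intro integrable_continuous_interval continuous_intros)
      have Zi: "(\<lambda>t. (norm (zeta_line \<sigma> t))\<^sup>2) integrable_on {a..b}"
        by (intro integrable_continuous_interval continuous_intros zeta_line_continuous) (use ab T in auto)
      have "norm (integral {a..b} (\<lambda>t. (norm (zeta_line \<sigma> t))\<^sup>2 - (norm (D t))\<^sup>2)) \<le> integral {a..b} (\<lambda>t. 4 / T * (2 * l + 4 / T))"
      proof (rule integral_norm_bound_integral)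
        fix t assume t: "t \<in> {a..b}"
        let ?x = "norm (zeta_line \<sigma> t)" and ?y = "norm (D t)"
        have d: "\<bar>?x - ?y\<bar> \<le> 4 / T" using norm_triangle_ineq3[of "zeta_line \<sigma> t" "D t"] zD[of t] t ab by auto
        then have "?x + ?y \<le> 2 * l + 4 / T" using Dl[of t] by linarith
        then have "\<bar>?x - ?y\<bar> * (?x + ?y) \<le> 4 / T * (2 * l + 4 / T)" using d T by (intro mult_mono) auto
        moreover have "\<bar>?x\<^sup>2 - ?y\<^sup>2\<bar> = \<bar>?x - ?y\<bar> * (?x + ?y)" by (simp add: power2_eq_square square_diff_square_factored abs_mult)
        ultimately show "norm (?x\<^sup>2 - ?y\<^sup>2) \<le> 4 / T * (2 * l + 4 / T)" by simp
      qed (use Di Zi in \<open>auto intro: integrable_diff\<close>)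
      also have "\<dots> = (b - a) * (4 / T * (2 * l + 4 / T))" using ab by simp
      also have "\<dots> \<le> T * (4 / T * (2 * l + 4 / T))" using ab T l by (intro mult_right_mono) auto
      finally have 1: "\<bar>?L - integral {a..b} (\<lambda>t. (norm (D t))\<^sup>2)\<bar> \<le> T * (4 / T * (2 * l + 4 / T))"
        unfolding line_moment_def using Di Zi by (simp add: Henstock_Kurzweil_Integration.integral_diff)
      have "\<bar>integral {a..b} (\<lambda>t. (norm (D t))\<^sup>2) - (b - a) * Z ?M\<bar> \<le> 8 * (1 + ln (real ?M))\<^sup>2"
        unfolding D_def Z_def by (rule dirichlet_polynomial_mean) (use \<sigma> ab in auto)
      also have "\<dots> \<le> 8 * l\<^sup>2" using l(1) by (intro mult_left_mono power_mono) auto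
      finally have 2: "\<bar>integral {a..b} (\<lambda>t. (norm (D t))\<^sup>2) - (b - a) * Z ?M\<bar> \<le> 8 * l\<^sup>2" .
      have "\<bar>(b - a) * (Z ?M - zeta_real (2 * \<sigma>))\<bar> \<le> (b - a) * e"
        unfolding abs_mult using ab M0[OF MM] by (intro mult_mono) auto
      then have 3: "\<bar>(b - a) * Z ?M - zeta_real (2 * \<sigma>) * (b - a)\<bar> \<le> e * (b - a)" by (simp add: algebra_simps)
      have 4: "8 * l\<^sup>2 + T * (4 / T * (2 * l + 4 / T)) \<le> T powr (24/25)" using elim(1) unfolding l_def .
      show "\<bar>?L - zeta_real (2 * \<sigma>) * (b - a)\<bar> \<le> e * (b - a) + T powr (24/25)"
        using 1 2 3 4 by linarith
    qed
  qed
qed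

subsection \<open>The Laplace transform of the second moment\<close>

lemma line_moment_asymptotic:
  assumes "\<sigma> > 1/2" "e > 0"
  shows "\<forall>\<^sub>F T in at_top. \<forall>a b. T \<le> a \<and> a \<le> b \<and> b \<le> 2 * T \<longrightarrow>
      \<bar>line_moment \<sigma> a b - zeta_real (2 * \<sigma>) * (b - a)\<bar> \<le> e * (b - a) + T powr (24/25)"
proof (cases "\<sigma> < 1")
  case True
  have "mean_primitive \<sigma> b - mean_primitive \<sigma> a = zeta_real (2 * \<sigma>) * (b - a)" for a b
    using assms by (simp add: mean_primitive_def log_coeff_def mean_const_def algebra_simps)
  then show ?thesis using line_moment_asymptotic_lt_1[of \<sigma> e] assms True by simp
next
  case False
  then show ?thesis using line_moment_asymptotic_ge_1 assms by simp
qed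

abbreviation "crit_moment \<equiv> line_moment (1/2) 0"

section \<open>Global asymptotics of the second moment on the critical line\<close>

lemma crit_continuous: "continuous_on S (\<lambda>t. (norm (zeta_line (1/2) t))\<^sup>2)"
  by (intro continuous_intros zeta_line_continuous) simp

lemma crit_moment_diff:
  assumes "0 \<le> a" "a \<le> b" shows "crit_moment b - crit_moment a = line_moment (1/2) a b"
  using Henstock_Kurzweil_Integration.integral_combine[OF assms integrable_continuous_interval[OF crit_continuous]]
  unfolding line_moment_def by linarith

lemma crit_moment_mono: "0 \<le> a \<Longrightarrow> a \<le> b \<Longrightarrow> crit_moment a \<le> crit_moment b"
  using crit_moment_diff[of a b] line_moment_nonneg[of "1/2" a b] by linarith

lemma crit_moment_deriv:
  assumes "t \<in> {0..M}"
  shows "(crit_moment has_vector_derivative (norm (zeta_line (1/2) t))\<^sup>2) (at t within {0..M})"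
proof -
  have "((\<lambda>x. integral {0..x} (\<lambda>t. (norm (zeta_line (1/2) t))\<^sup>2)) has_vector_derivative (norm (zeta_line (1/2) t))\<^sup>2) (at t within {0..M})"
    by (rule integral_has_vector_derivative[OF crit_continuous assms])
  then show ?thesis by (simp only: line_moment_def[abs_def])
qed

lemma crit_moment_continuous: "continuous_on {0..M} crit_moment"
  unfolding continuous_on_eq_continuous_within
  using crit_moment_deriv has_vector_derivative_continuous by blast

text \<open>Descending from t by halving, the increments e t/2 + e t/4 + ... add up to at most e t.
  This turns control on [t, 2 t] into a global linear bound.\<close>

lemma dyadic_growth:
  fixes f :: "real \<Rightarrow> real"
  assumes T0: "T0 > 0" and B: "\<And>t. T0 \<le> t \<Longrightarrow> t \<le> 2 * T0 \<Longrightarrow> \<bar>f t\<bar> \<le> B"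
    and step: "\<And>t. t \<ge> T0 \<Longrightarrow> \<bar>f (2 * t) - f t\<bar> \<le> e * t" and e: "e \<ge> 0" and t: "t \<ge> T0"
  shows "\<bar>f t\<bar> \<le> B + e * t"
proof -
  have main: "\<forall>t. T0 \<le> t \<and> t \<le> 2 ^ Suc n * T0 \<longrightarrow> \<bar>f t\<bar> \<le> B + e * t" for n
  proof (induction n)
    case 0
    show ?case
    proof (intro allI impI)
      fix t assume t: "T0 \<le> t \<and> t \<le> 2 ^ Suc 0 * T0"
      then have "0 \<le> e * t" using e T0 by (intro mult_nonneg_nonneg) auto
      then show "\<bar>f t\<bar> \<le> B + e * t" using B[of t] t by simp
    qed
  next
    case (Suc n)
    show ?case
    proof (intro allI impI)
      fix t assume t: "T0 \<le> t \<and> t \<le> 2 ^ Suc (Suc n) * T0"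
      show "\<bar>f t\<bar> \<le> B + e * t"
      proof (cases "t \<le> 2 * T0")
        case True
        have "0 \<le> e * t" using e T0 t by (intro mult_nonneg_nonneg) auto
        then show ?thesis using B[of t] t True by simp
      next
        case False
        define s where "s = t / 2"
        have s: "T0 \<le> s" "s \<le> 2 ^ Suc n * T0" "t = 2 * s" using t False by (auto simp: s_def)
        have "\<bar>f s\<bar> \<le> B + e * s" using Suc.IH s by blast
        moreover have "\<bar>f (2 * s) - f s\<bar> \<le> e * s" by (rule step[OF s(1)])
        moreover have "e * (2 * s) = e * s + e * s" by simp
        ultimately show ?thesis unfolding s(3) by linarith
      qed
    qed
  qed
  obtain n where "t / T0 < 2 ^ n" using real_arch_pow[of 2 "t / T0"] by auto
  then have "t < 2 ^ n * T0" using T0 by (simp add: pos_divide_less_eq)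
  moreover have "0 < 2 ^ n * T0" using T0 by simp
  ultimately have "t \<le> 2 ^ Suc n * T0" unfolding power_Suc mult.assoc by linarith
  then show ?thesis using main t by blast
qed

lemma abs_t_ln_t: "0 \<le> t \<Longrightarrow> \<bar>t * ln t\<bar> \<le> 1 + t\<^sup>2" for t :: real
proof (cases "t > 0")
  case True
  have "ln t \<le> t - 1" using ln_le_minus_one[OF True] .
  then have "t * ln t \<le> t * (t - 1)" using True by (intro mult_left_mono) auto
  moreover have "ln (1 / t) \<le> 1 / t - 1" by (rule ln_le_minus_one) (use True in simp)
  then have "- ln t \<le> 1 / t - 1" using True by (simp add: ln_div)
  then have "t * (- ln t) \<le> t * (1 / t - 1)" using True by (intro mult_left_mono) auto
  then have "- (t * ln t) \<le> 1 - t" using True by (simp add: algebra_simps)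
  moreover have "t * (t - 1) = t\<^sup>2 - t" by (simp add: power2_eq_square algebra_simps)
  ultimately show ?thesis using True zero_le_power2[of t] by linarith
qed simp

lemma mean_primitive_half: "mean_primitive (1/2) t = t * ln t + (mean_const (1/2) - 1) * t"
  by (simp add: mean_primitive_def log_coeff_def algebra_simps)

text \<open>The bound starts at t = 0, with an additive constant for small t, because the Laplace
  integral below starts there. The slope e is arbitrary, as it must be smaller than the gain in
  \<open>crit_laplace_lower\<close>.\<close>

lemma crit_moment_asymptotic:
  assumes e: "e > 0"
  obtains K where "K \<ge> 0" "\<And>t. t \<ge> 0 \<Longrightarrow> \<bar>crit_moment t - mean_primitive (1/2) t\<bar> \<le> e * t + K"
proof -
  define f where "f t = crit_moment t - mean_primitive (1/2) t" for t
  have "\<forall>\<^sub>F T in at_top. \<forall>a b. T \<le> a \<and> a \<le> b \<and> b \<le> 2 * T \<longrightarrow>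
      \<bar>line_moment (1/2) a b - (mean_primitive (1/2) b - mean_primitive (1/2) a)\<bar> \<le> e/2 * (b - a) + T powr (24/25)"
    by (rule line_moment_asymptotic_lt_1) (use e in auto)
  moreover have "\<forall>\<^sub>F T in at_top. (T::real) powr (24/25) \<le> e/2 * T" using e by real_asymp
  ultimately have "\<forall>\<^sub>F T in at_top. T \<ge> 1 \<and> (\<forall>b. T \<le> b \<and> b \<le> 2 * T \<longrightarrow> \<bar>f b - f T\<bar> \<le> e * T)"
    using eventually_ge_at_top[of 1]
  proof eventually_elim
    case (elim T)
    show ?case
    proof (intro conjI allI impI)
      fix b assume b: "T \<le> b \<and> b \<le> 2 * T"
      have "\<bar>line_moment (1/2) T b - (mean_primitive (1/2) b - mean_primitive (1/2) T)\<bar> \<le> e/2 * (b - T) + T powr (24/25)"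
        using elim(1) b by blast
      moreover have "e/2 * (b - T) \<le> e/2 * T" using b e by (intro mult_left_mono) auto
      moreover have "crit_moment b - crit_moment T = line_moment (1/2) T b" using b elim(3) by (intro crit_moment_diff) auto
      moreover have "e/2 * T + e/2 * T = e * T" by simp
      ultimately show "\<bar>f b - f T\<bar> \<le> e * T" using elim(2) unfolding f_def by linarith
    qed (fact elim(3))
  qed
  then obtain T0 where T0: "\<And>T. T \<ge> T0 \<Longrightarrow> T \<ge> 1 \<and> (\<forall>b. T \<le> b \<and> b \<le> 2 * T \<longrightarrow> \<bar>f b - f T\<bar> \<le> e * T)"
    unfolding eventually_at_top_linorder by blast
  have T1: "T0 \<ge> 1" using T0 by blast
  define B where "B = \<bar>f T0\<bar> + e * T0"
  have large: "\<bar>f t\<bar> \<le> B + e * t" if "t \<ge> T0" for t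
  proof (rule dyadic_growth[of T0 f B e t])
    fix t assume t: "T0 \<le> t" "t \<le> 2 * T0"
    then have "\<bar>f t - f T0\<bar> \<le> e * T0" using T0[of T0] by blast
    then show "\<bar>f t\<bar> \<le> B" unfolding B_def by linarith
  next
    fix t assume "T0 \<le> t"
    then show "\<bar>f (2 * t) - f t\<bar> \<le> e * t" using T0[of t] by auto
  qed (use T1 that e in auto)
  define c where "c = \<bar>mean_const (1/2) - 1\<bar>"
  define S where "S = crit_moment T0 + 1 + T0\<^sup>2 + c * T0"
  have small: "\<bar>f t\<bar> \<le> S" if t: "0 \<le> t" "t \<le> T0" for t
  proof -
    have "\<bar>mean_primitive (1/2) t\<bar> \<le> \<bar>t * ln t\<bar> + c * t"
      unfolding mean_primitive_half c_def using abs_triangle_ineq[of "t * ln t" "(mean_const (1/2) - 1) * t"] t by (simp add: abs_mult)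
    moreover have "c * t \<le> c * T0" using t by (intro mult_left_mono) (auto simp: c_def)
    moreover have "t\<^sup>2 \<le> T0\<^sup>2" using t by (intro power_mono)
    ultimately show ?thesis unfolding f_def S_def
      using abs_t_ln_t[OF t(1)] crit_moment_mono[OF t] line_moment_nonneg[of "1/2" 0 t] by linarith
  qed
  have S0: "S \<ge> 0" using small[of 0] T1 by (meson abs_ge_zero order_refl order_trans zero_le_one)
  have B0: "B \<ge> 0" unfolding B_def using e T1 by (intro add_nonneg_nonneg mult_nonneg_nonneg) auto
  show ?thesis
  proof (rule that[of "B + S"])
    fix t :: real assume t: "t \<ge> 0"
    have "0 \<le> e * t" using e t by simp
    then show "\<bar>crit_moment t - mean_primitive (1/2) t\<bar> \<le> e * t + (B + S)"
      using large[of t] small[of t] t S0 B0 unfolding f_def by linarith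
  qed (use S0 B0 in auto)
qed

definition crit_laplace :: "real \<Rightarrow> real \<Rightarrow> real" where
  "crit_laplace u M = integral {0..M} (\<lambda>t. (norm (zeta_line (1/2) t))\<^sup>2 * exp (- t / u))"

text \<open>Asymptotics are available for \<open>crit_moment\<close> and not for its oscillating
  derivative, so the transform is rewritten in terms of the former.\<close>

lemma crit_laplace_parts:
  assumes u: "u > 0" and M: "M \<ge> 0"
  shows "crit_laplace u M = crit_moment M * exp (- M / u) + integral {0..M} (\<lambda>t. crit_moment t * (exp (- t / u) / u))"
proof -
  let ?g = "\<lambda>t. (norm (zeta_line (1/2) t))\<^sup>2"
  have "((\<lambda>t. ?g t * exp (- t / u) - crit_moment t * (exp (- t / u) / u)) has_integral
      (crit_moment M * exp (- M / u) - crit_moment 0 * exp (- 0 / u))) {0..M}"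
  proof (rule fundamental_theorem_of_calculus[OF M])
    fix t assume t: "t \<in> {0..M}"
    have "(crit_moment has_real_derivative ?g t) (at t within {0..M})"
      using crit_moment_deriv[OF t] by (simp add: has_real_derivative_iff_has_vector_derivative)
    then have "((\<lambda>t. crit_moment t * exp (- t / u)) has_real_derivative ?g t * exp (- t / u) - crit_moment t * (exp (- t / u) / u)) (at t within {0..M})"
      using u by (auto intro!: derivative_eq_intros simp: field_simps)
    then show "((\<lambda>t. crit_moment t * exp (- t / u)) has_vector_derivative ?g t * exp (- t / u) - crit_moment t * (exp (- t / u) / u)) (at t within {0..M})"
      by (simp add: has_real_derivative_iff_has_vector_derivative)
  qed
  then have "integral {0..M} (\<lambda>t. ?g t * exp (- t / u) - crit_moment t * (exp (- t / u) / u)) = crit_moment M * exp (- M / u)"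
    by (simp add: integral_unique line_moment_def)
  moreover have "(\<lambda>t. ?g t * exp (- t / u)) integrable_on {0..M}"
    using u by (intro integrable_continuous_interval continuous_intros crit_continuous zeta_line_continuous) auto
  moreover have "(\<lambda>t. crit_moment t * (exp (- t / u) / u)) integrable_on {0..M}"
    using u by (intro integrable_continuous_interval continuous_intros crit_moment_continuous) auto
  ultimately show ?thesis unfolding crit_laplace_def by (simp add: Henstock_Kurzweil_Integration.integral_diff)
qed

text \<open>\<open>Q\<close> is q + u q' + u^2 q'' for the quadratic q, as repeated integration by
  parts produces it.\<close>

lemma quadratic_exp_integral:
  fixes u A B D :: real
  assumes "u > 0" "a \<le> b"
  defines "Q \<equiv> \<lambda>t. A * t\<^sup>2 + B * t + D + u * (2 * A * t + B) + 2 * A * u\<^sup>2"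
  shows "((\<lambda>t. (A * t\<^sup>2 + B * t + D) * (exp (- t / u) / u)) has_integral (Q a * exp (- a / u) - Q b * exp (- b / u))) {a..b}"
proof -
  have "((\<lambda>t. (A * t\<^sup>2 + B * t + D) * (exp (- t / u) / u)) has_integral (- Q b * exp (- b / u) - (- Q a * exp (- a / u)))) {a..b}"
  proof (rule fundamental_theorem_of_calculus[OF assms(2)])
    fix t
    have "((\<lambda>t. - Q t * exp (- t / u)) has_real_derivative (A * t\<^sup>2 + B * t + D) * (exp (- t / u) / u)) (at t within {a..b})"
      unfolding Q_def using assms(1)
      by (auto intro!: derivative_eq_intros simp: field_simps power2_eq_square)
    then show "((\<lambda>t. - Q t * exp (- t / u)) has_vector_derivative (A * t\<^sup>2 + B * t + D) * (exp (- t / u) / u)) (at t within {a..b})"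
      by (simp add: has_real_derivative_iff_has_vector_derivative)
  qed
  then show ?thesis by (simp add: algebra_simps)
qed

lemma square_exp_minus_le: "m > 0 \<Longrightarrow> m\<^sup>2 * exp (- m) \<le> 27 / m" for m :: real
proof -
  assume m: "m > 0"
  have "m / 3 \<le> exp (m / 3)" using exp_ge_add_one_self[of "m / 3"] by linarith
  then have "(m / 3) ^ 3 \<le> exp (m / 3) ^ 3" using m by (intro power_mono) auto
  also have "exp (m / 3) ^ 3 = exp m" by (simp flip: exp_of_nat_mult)
  finally have "m ^ 3 \<le> 27 * exp m" by (simp add: power_divide)
  then show ?thesis using m by (simp add: exp_minus field_simps power3_eq_cube power2_eq_square)
qed

section \<open>Linear and quadratic bounds for t ln t at scale u\<close>

lemma t_ln_t_ge:
  assumes "t > 0" "u > 0" shows "t * ln t \<ge> t * ln u + t - (u::real)"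
proof -
  have "ln (u / t) \<le> u / t - 1" by (rule ln_le_minus_one) (use assms in simp)
  then have "t * (ln u - ln t) \<le> t * (u / t - 1)" using assms by (intro mult_left_mono) (auto simp: ln_div)
  then show ?thesis using assms by (simp add: algebra_simps)
qed

lemma t_ln_t_ge_far:
  assumes "t \<ge> 3 * u" "u > 0" shows "t * ln t \<ge> t * ln u + (t::real)"
proof -
  have "1 \<le> ln (3::real)" using exp_le by (simp add: ln_ge_iff)
  also have "ln 3 \<le> ln (t / u)" using assms by (simp add: field_simps)
  finally have "1 \<le> ln t - ln u" using assms by (simp add: ln_div)
  then have "t * 1 \<le> t * (ln t - ln u)" using assms by (intro mult_left_mono) auto
  then show ?thesis by (simp add: algebra_simps)
qed

text \<open>A quadratic majorant with an elementary transform. It loses a multiple of u, which is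
  affordable because the resulting upper bound only has to stay below the moment over [0, 2 u],
  whose main term is twice as large.\<close>

lemma t_ln_t_le:
  assumes "t > 0" "u > 0" shows "t * ln t \<le> t * ln u + t\<^sup>2 / u - (t::real)"
proof -
  have "ln (t / u) \<le> t / u - 1" by (rule ln_le_minus_one) (use assms in simp)
  then have "t * (ln t - ln u) \<le> t * (t / u - 1)" using assms by (intro mult_left_mono) (auto simp: ln_div)
  then show ?thesis by (simp add: algebra_simps power2_eq_square)
qed

text \<open>With \<open>x = t / u\<close>, the bound \<open>x ln x \<ge> x - 1\<close> would only give \<open>0\<close> for the integral of \<open>x ln x e^{-x}\<close>. It improves by
  \<open>1\<close> for \<open>x \<ge> 3\<close>, which is where the gain \<open>u * exp (- 3)\<close> comes from.\<close>

lemma crit_laplace_lower: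
  assumes u: "u > 0" and M: "M \<ge> 3 * u" and e: "e > 0" and K: "K \<ge> 0"
    and IP: "\<And>t. t \<ge> 0 \<Longrightarrow> \<bar>crit_moment t - mean_primitive (1/2) t\<bar> \<le> e * t + K"
  defines "b \<equiv> ln u + mean_const (1/2) - e"
  shows "crit_laplace u M \<ge> u * b - u - K + u * exp (- 3) - (b * M + u * b) * exp (- M / u)"
proof -
  let ?E = "\<lambda>t. exp (- t / u) / u"
  have low: "b * t + (- u - K) \<le> crit_moment t" if "t \<ge> 0" for t
  proof (cases "t = 0")
    case True then show ?thesis using u K line_moment_nonneg[of "1/2" 0 t] by simp
  next
    case False
    then have t: "t > 0" using that by simp
    show ?thesis using IP[OF that] t_ln_t_ge[OF t u] unfolding mean_primitive_half b_def by (simp add: algebra_simps)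
  qed
  have far: "b * t - K \<le> crit_moment t" if "t \<ge> 3 * u" for t
  proof -
    have "t \<ge> 0" using that u by simp
    then show ?thesis using IP[of t] t_ln_t_ge_far[OF that u] unfolding mean_primitive_half b_def by (simp add: algebra_simps)
  qed
  have ci: "(\<lambda>t. crit_moment t * ?E t) integrable_on {0..M}"
    using u by (intro integrable_continuous_interval continuous_intros crit_moment_continuous) auto
  have split: "integral {0..3 * u} (\<lambda>t. crit_moment t * ?E t) + integral {3 * u..M} (\<lambda>t. crit_moment t * ?E t) = integral {0..M} (\<lambda>t. crit_moment t * ?E t)"
    by (rule Henstock_Kurzweil_Integration.integral_combine[OF _ M ci]) (use u in simp)
  have i1: "(\<lambda>t. crit_moment t * ?E t) integrable_on {0..3 * u}" and i2: "(\<lambda>t. crit_moment t * ?E t) integrable_on {3 * u..M}"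
    by (rule integrable_on_subinterval[OF ci]; use u M in auto)+
  have "0 \<le> 3 * u" using u by simp
  note q1 = quadratic_exp_integral[OF u this, of 0 b "- u - K"] and q2 = quadratic_exp_integral[OF u M, of 0 b "- K"]
  have E: "0 \<le> ?E t" for t using u by simp
  let ?I1 = "integral {0..3 * u} (\<lambda>t. crit_moment t * ?E t)" and ?I2 = "integral {3 * u..M} (\<lambda>t. crit_moment t * ?E t)"
  have "(0 * 0\<^sup>2 + b * 0 + (- u - K) + u * (2 * 0 * 0 + b) + 2 * 0 * u\<^sup>2) * exp (- 0 / u)
      - (0 * (3 * u)\<^sup>2 + b * (3 * u) + (- u - K) + u * (2 * 0 * (3 * u) + b) + 2 * 0 * u\<^sup>2) * exp (- (3 * u) / u) \<le> ?I1"
    by (rule has_integral_le[OF q1 integrable_integral[OF i1]], rule mult_right_mono[OF _ E]) (use low in simp)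
  moreover have "- (3 * u) / u = - 3" using u by simp
  ultimately have r1: "- u - K + u * b - (b * (3 * u) + (- u - K) + u * b) * exp (- 3) \<le> ?I1" by simp
  have "(0 * (3 * u)\<^sup>2 + b * (3 * u) + (- K) + u * (2 * 0 * (3 * u) + b) + 2 * 0 * u\<^sup>2) * exp (- (3 * u) / u)
      - (0 * M\<^sup>2 + b * M + (- K) + u * (2 * 0 * M + b) + 2 * 0 * u\<^sup>2) * exp (- M / u) \<le> ?I2"
    by (rule has_integral_le[OF q2 integrable_integral[OF i2]], rule mult_right_mono[OF _ E]) (use far in simp)
  moreover have "- (3 * u) / u = - 3" using u by simp
  ultimately have r2: "(b * (3 * u) - K + u * b) * exp (- 3) - (b * M - K + u * b) * exp (- M / u) \<le> ?I2" by simp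
  have "(b * (3 * u) + (- u - K) + u * b) * exp (- 3) = (b * (3 * u) - K + u * b) * exp (- 3) - u * exp (- 3)"
    "(b * M - K + u * b) * exp (- M / u) = (b * M + u * b) * exp (- M / u) - K * exp (- M / u)" by (simp_all add: algebra_simps)
  moreover have "0 \<le> K * exp (- M / u)" using K by simp
  moreover have "0 \<le> crit_moment M * exp (- M / u)" using line_moment_nonneg[of "1/2" 0 M] by simp
  moreover have "M \<ge> 0" using M u by simp
  ultimately show ?thesis unfolding crit_laplace_parts[OF u \<open>M \<ge> 0\<close>] split[symmetric] using r1 r2 by linarith
qed

lemma crit_laplace_upper:
  assumes u: "u \<ge> 1" and M: "M \<ge> 0" and K: "K \<ge> 0"
    and IP: "\<And>t. t \<ge> 0 \<Longrightarrow> \<bar>crit_moment t - mean_primitive (1/2) t\<bar> \<le> 1 * t + K"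
  defines "b \<equiv> ln u + \<bar>mean_const (1/2)\<bar>"
  shows "crit_laplace u M \<le> K + u * b + 2 * u + (1 / u * M\<^sup>2 + b * M + K) * exp (- M / u)"
proof -
  let ?E = "\<lambda>t. exp (- t / u) / u"
  have u0: "u > 0" using u by simp
  have b0: "b \<ge> 0" using u by (simp add: b_def)
  have up: "crit_moment t \<le> 1 / u * t\<^sup>2 + b * t + K" if "t \<ge> 0" for t
  proof (cases "t = 0")
    case True then show ?thesis using K by (simp add: line_moment_def)
  next
    case False
    then have t: "t > 0" using that by simp
    have "mean_const (1/2) * t \<le> \<bar>mean_const (1/2)\<bar> * t" using that by (intro mult_right_mono) auto
    moreover have "(mean_const (1/2) - 1) * t = mean_const (1/2) * t - t" "b * t = t * ln u + \<bar>mean_const (1/2)\<bar> * t" "1 / u * t\<^sup>2 = t\<^sup>2 / u"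
      by (simp_all add: b_def algebra_simps)
    ultimately show ?thesis using IP[OF that] t_ln_t_le[OF t u0] t unfolding mean_primitive_half by linarith
  qed
  have ci: "(\<lambda>t. crit_moment t * ?E t) integrable_on {0..M}"
    using u by (intro integrable_continuous_interval continuous_intros crit_moment_continuous) auto
  let ?Q = "1 / u * M\<^sup>2 + b * M + K + u * (2 * (1 / u) * M + b) + 2 * (1 / u) * u\<^sup>2"
  have "integral {0..M} (\<lambda>t. crit_moment t * ?E t) \<le> (K + u * b + 2 * (1 / u) * u\<^sup>2) - ?Q * exp (- M / u)"
    by (rule has_integral_le[OF integrable_integral[OF ci]])
       (use quadratic_exp_integral[of u 0 M "1 / u" b K] u M up in \<open>auto intro!: divide_right_mono mult_right_mono\<close>)
  moreover have "0 \<le> ?Q * exp (- M / u)" using u M K b0 by (intro mult_nonneg_nonneg add_nonneg_nonneg) auto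
  moreover have "2 * (1 / u) * u\<^sup>2 = 2 * u" using u by (simp add: power2_eq_square)
  moreover have "crit_moment M * exp (- M / u) \<le> (1 / u * M\<^sup>2 + b * M + K) * exp (- M / u)"
    by (intro mult_right_mono up M) simp
  ultimately show ?thesis unfolding crit_laplace_parts[OF u0 M] by linarith
qed

text \<open>The threshold 14 u ln (2 u) is the lower bound 7 y ln y for \<mu> at y = 2 u. It makes
  M/u at least 14 ln (2 u), so that the boundary terms at M are O(u / ln u).\<close>

lemma crit_laplace_bounds:
  obtains c where "c > 0"
    "\<forall>\<^sub>F u in at_top. \<forall>M. M \<ge> 14 * u * ln (2 * u) \<longrightarrow> crit_moment u + c * u \<le> crit_laplace u M \<and> crit_laplace u M < crit_moment (2 * u)"
proof -
  \<comment> \<open>The gain u e^{-3} is four units of e u: two are lost to the error terms, one in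
    the transform and one in \<open>crit_moment u\<close>, a third covers boundary terms and
    constants, and one remains.\<close>
  define e where "e = exp (- 3) / (4::real)"
  have e: "e > 0" by (simp add: e_def)
  obtain K where K: "K \<ge> 0" "\<And>t. t \<ge> 0 \<Longrightarrow> \<bar>crit_moment t - mean_primitive (1/2) t\<bar> \<le> e * t + K"
    using crit_moment_asymptotic[OF e] by blast
  obtain K1 where K1: "K1 \<ge> 0" "\<And>t. t \<ge> 0 \<Longrightarrow> \<bar>crit_moment t - mean_primitive (1/2) t\<bar> \<le> 1 * t + K1"
    using crit_moment_asymptotic[of 1] by auto
  define c1 where "c1 = mean_const (1/2)"
  have "\<forall>\<^sub>F u in at_top. 0 < ln u + c1 - e" by real_asymp
  moreover have "\<forall>\<^sub>F u in at_top. ln u + \<bar>c1\<bar> \<le> 14 * ln (2 * u)" by real_asymp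
  moreover have "\<forall>\<^sub>F u in at_top. 3 \<le> 14 * ln (2 * (u::real))" by real_asymp
  moreover have "\<forall>\<^sub>F u in at_top. 2 * u * (27 / (14 * ln (2 * u))) + 2 * K \<le> e * u" using e by real_asymp
  moreover have "\<forall>\<^sub>F u in at_top. u * (ln u + \<bar>c1\<bar>) + 2 * u + 2 * u * (27 / (14 * ln (2 * u))) + 2 * K1 < 2 * u * ln (2 * u) + (c1 - 1) * (2 * u) - (2 * u + K1)"
    by real_asymp
  ultimately have "\<forall>\<^sub>F u in at_top. \<forall>M. M \<ge> 14 * u * ln (2 * u) \<longrightarrow> crit_moment u + e * u \<le> crit_laplace u M \<and> crit_laplace u M < crit_moment (2 * u)"
    using eventually_ge_at_top[of 1]
  proof eventually_elim
    case (elim u)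
    have u: "u > 0" "u \<ge> 1" using elim by auto
    show ?case
    proof (intro allI impI)
      fix M assume M: "M \<ge> 14 * u * ln (2 * u)"
      define m where "m = M / u"
      have Mm: "M = m * u" using u by (simp add: m_def)
      have m: "m \<ge> 14 * ln (2 * u)" using M u by (simp add: m_def field_simps)
      have m3: "m \<ge> 3" using m elim(3) by linarith
      have M3: "M \<ge> 3 * u" using m3 u unfolding Mm by simp
      have M0: "M \<ge> 0" using M3 u by simp
      have l0: "14 * ln (2 * u) > 0" using elim(3) by linarith
      have sq: "m\<^sup>2 * exp (- m) \<le> 27 / (14 * ln (2 * u))"
        using square_exp_minus_le[of m] m3 divide_left_mono[OF m, of 27] l0 m by (meson less_le_trans mult_pos_pos order_trans zero_less_numeral zero_le_numeral)
      have gen: "(\<beta> * M + u * \<beta>) * exp (- m) \<le> 2 * u * (27 / (14 * ln (2 * u)))" if b: "0 \<le> \<beta>" "\<beta> \<le> m" for \<beta>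
      proof -
        have "\<beta> * M + u * \<beta> = u * (\<beta> * (m + 1))" by (simp add: Mm algebra_simps)
        also have "\<dots> \<le> u * (m * (2 * m))" using b m3 u by (intro mult_left_mono mult_mono) auto
        finally have "(\<beta> * M + u * \<beta>) * exp (- m) \<le> u * (m * (2 * m)) * exp (- m)" by (intro mult_right_mono) auto
        also have "\<dots> = 2 * u * (m\<^sup>2 * exp (- m))" by (simp add: power2_eq_square)
        also have "\<dots> \<le> 2 * u * (27 / (14 * ln (2 * u)))" using u sq by (intro mult_left_mono) auto
        finally show ?thesis .
      qed
      have mM: "- M / u = - m" by (simp add: m_def)
      define b where "b = ln u + c1 - e"
      have b: "0 \<le> b" "b \<le> m" using elim(1,2) m e unfolding b_def by linarith+
      have "u * b - u - K + u * exp (- 3) - (b * M + u * b) * exp (- m) \<le> crit_laplace u M"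
        using crit_laplace_lower[OF u(1) M3 e K] unfolding mM b_def c1_def .
      moreover have "crit_moment u \<le> u * b - u + 2 * (e * u) + K"
        using K(2)[of u] u unfolding mean_primitive_half b_def c1_def by (simp add: algebra_simps)
      moreover have "u * exp (- 3) = 4 * (e * u)" by (simp add: e_def)
      ultimately have 1: "crit_moment u + e * u \<le> crit_laplace u M" using gen[OF b] elim(4) by linarith
      define b' where "b' = ln u + \<bar>c1\<bar>"
      have b': "0 \<le> b'" "b' \<le> m" using elim(2) m u unfolding b'_def by (auto intro: order_trans)
      have "crit_laplace u M \<le> K1 + u * b' + 2 * u + (1 / u * M\<^sup>2 + b' * M + K1) * exp (- m)"
        using crit_laplace_upper[OF u(2) M0 K1] unfolding mM b'_def c1_def .
      also have "(1 / u * M\<^sup>2 + b' * M + K1) * exp (- m) \<le> 2 * u * (m\<^sup>2 * exp (- m)) + K1"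
      proof -
        have "b' * M \<le> m * M" using b' M3 u by (intro mult_right_mono) auto
        then have "1 / u * M\<^sup>2 + b' * M + K1 \<le> 2 * u * m\<^sup>2 + K1" using u by (simp add: Mm power2_eq_square)
        then have "(1 / u * M\<^sup>2 + b' * M + K1) * exp (- m) \<le> (2 * u * m\<^sup>2 + K1) * exp (- m)" by (rule mult_right_mono) simp
        moreover have "K1 * exp (- m) \<le> K1 * 1" using K1 m3 by (intro mult_left_mono) auto
        ultimately show ?thesis by (simp add: algebra_simps)
      qed
      also have "2 * u * (m\<^sup>2 * exp (- m)) \<le> 2 * u * (27 / (14 * ln (2 * u)))" using u sq by (intro mult_left_mono) auto
      finally have "crit_laplace u M \<le> u * (ln u + \<bar>c1\<bar>) + 2 * u + 2 * u * (27 / (14 * ln (2 * u))) + 2 * K1" by (simp add: b'_def)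
      moreover have "2 * u * ln (2 * u) + (c1 - 1) * (2 * u) - (2 * u + K1) \<le> crit_moment (2 * u)"
        using K1(2)[of "2 * u"] u unfolding mean_primitive_half c1_def by linarith
      ultimately have 2: "crit_laplace u M < crit_moment (2 * u)" using elim(5) by linarith
      show "crit_moment u + e * u \<le> crit_laplace u M \<and> crit_laplace u M < crit_moment (2 * u)" using 1 2 by blast
    qed
  qed
  with e show ?thesis by (rule that)
qed

subsection \<open>The ladder\<close>

lemma crit_laplace_mono:
  assumes "0 < u" "u \<le> w" "M \<le> N"
  shows "crit_laplace u M \<le> crit_laplace w N"
proof -
  let ?g = "\<lambda>t. (norm (zeta_line (1/2) t))\<^sup>2"
  have i: "(\<lambda>t. ?g t * exp (- t / x)) integrable_on {0..L}" if "x > 0" for x L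
    using that by (intro integrable_continuous_interval continuous_intros crit_continuous zeta_line_continuous) auto
  have "crit_laplace u M \<le> integral {0..M} (\<lambda>t. ?g t * exp (- t / w))" unfolding crit_laplace_def
  proof (rule integral_le[OF i i])
    fix t assume t: "t \<in> {0..M}"
    then have "t / w \<le> t / u" using assms by (intro divide_left_mono) auto
    then show "?g t * exp (- t / u) \<le> ?g t * exp (- t / w)" by (intro mult_left_mono) auto
  qed (use assms in auto)
  also have "\<dots> \<le> crit_laplace w N" unfolding crit_laplace_def
    by (rule integral_subset_le[OF _ i i]) (use assms in auto)
  finally show ?thesis .
qed

text \<open>Equality would force zeta to vanish on the critical line at all heights in (0, M],
  against the positive moment. Strictness is what determines the value of the ladder in
  \<open>jacobs_ladder_inverse\<close>.\<close>

lemma crit_laplace_strict_mono: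
  assumes "0 < u" "u < w" "M \<le> N" and pos: "crit_moment M > 0"
  shows "crit_laplace u M < crit_laplace w N"
proof -
  let ?g = "\<lambda>t. (norm (zeta_line (1/2) t))\<^sup>2"
  have M: "M > 0"
  proof (rule ccontr)
    assume "\<not> M > 0"
    then have "crit_moment M = 0" by (cases "M = 0") (simp_all add: line_moment_def)
    then show False using pos by simp
  qed
  have c: "continuous_on {0..M} (\<lambda>t. ?g t * exp (- t / x))" if "x > 0" for x
    using that by (intro continuous_intros crit_continuous zeta_line_continuous) auto
  have i: "(\<lambda>t. ?g t * exp (- t / x)) integrable_on {0..M}" if "x > 0" for x
    using c[OF that] by (rule integrable_continuous_interval)
  have w: "w > 0" using assms by simp
  have lt: "exp (- t / u) < exp (- t / w)" if "t > 0" for t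
    using that assms by (simp add: divide_strict_left_mono)
  have "crit_laplace u M \<noteq> crit_laplace w M"
  proof
    assume eq: "crit_laplace u M = crit_laplace w M"
    let ?d = "\<lambda>t. ?g t * exp (- t / w) - ?g t * exp (- t / u)"
    have "integral {0..M} ?d = 0"
      using eq unfolding crit_laplace_def by (subst Henstock_Kurzweil_Integration.integral_diff[OF i[OF w] i[OF assms(1)]]) simp
    moreover have "?d t \<ge> 0" if "t \<in> {0..M}" for t
    proof -
      have "exp (- t / u) \<le> exp (- t / w)" using lt[of t] that by (cases "t = 0") (auto intro: less_imp_le)
      then show ?thesis by (simp add: mult_left_mono)
    qed
    moreover have "continuous_on {0..M} ?d" by (intro continuous_on_diff c w assms)
    ultimately have z: "\<forall>t\<in>{0..M}. ?d t = 0" using integral_eq_0_iff[of 0 M ?d] M by auto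
    have g0: "?g t = 0" if "t \<in> {0..M} - {0}" for t
    proof -
      have "?g t * (exp (- t / w) - exp (- t / u)) = 0" using z that unfolding right_diff_distrib by blast
      then show ?thesis using lt[of t] that by auto
    qed
    have "(?g has_integral 0) {0..M}"
      by (rule has_integral_spike[of "{0}" _ _ "\<lambda>_. 0"]) (use g0 in auto)
    then have "crit_moment M = 0" unfolding line_moment_def by (rule integral_unique)
    then show False using pos by simp
  qed
  moreover have "crit_laplace u M \<le> crit_laplace w M" using assms by (intro crit_laplace_mono) auto
  moreover have "crit_laplace w M \<le> crit_laplace w N" using assms by (intro crit_laplace_mono) auto
  ultimately show ?thesis by linarith
qed

lemma norm_hardy_Z: "norm (hardy_Z t) = norm (zeta_line (1/2) t)"
  by (simp add: hardy_Z_def zeta_line_def norm_mult norm_exp_i_times)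

lemma crit_moment_unbounded: "\<forall>\<^sub>F T in at_top. crit_moment T > B"
proof -
  obtain K where K: "K \<ge> 0" "\<And>t. t \<ge> 0 \<Longrightarrow> \<bar>crit_moment t - mean_primitive (1/2) t\<bar> \<le> 1 * t + K"
    using crit_moment_asymptotic[of 1] by auto
  define c where "c = mean_const (1/2)"
  have "\<forall>\<^sub>F T in at_top. B < T * ln T + (c - 1) * T - (1 * T + K)" by real_asymp
  then show ?thesis using eventually_ge_at_top[of 0]
  proof eventually_elim
    case (elim T)
    then show ?case using K(2)[of T] unfolding mean_primitive_half c_def by linarith
  qed
qed

text \<open>A ladder is only some solution of the integral equation, so u must first be shown to lie
  in its range. The intermediate value theorem gives v whose moment equals F(2 u); the equation at v
  then reads F(\<phi> v) = F(2 u), and strict monotonicity forces \<phi> v = 2 u. Whatever preimage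
  \<open>inv_into\<close> chooses satisfies the same equation.\<close>

lemma jacobs_ladder_inverse:
  assumes "jacobs_ladder T0 \<phi>1"
  shows "\<forall>\<^sub>F u in at_top. ladder_inv T0 \<phi>1 u \<ge> T0 \<and>
    (\<exists>M. M \<ge> 14 * u * ln (2 * u) \<and> crit_moment (ladder_inv T0 \<phi>1 u) = crit_laplace u M)"
proof -
  obtain \<mu> \<phi> y0 where T0: "T0 > 0" and y0: "y0 > 0" and \<mu>m: "mono_on {y0..} \<mu>" and \<mu>: "\<And>y. y \<ge> y0 \<Longrightarrow> \<mu> y \<ge> 7 * y * ln y"
    and \<phi>: "\<And>T. T \<ge> T0 \<Longrightarrow> \<phi> T \<ge> y0"
      "\<And>T. T \<ge> T0 \<Longrightarrow> integral {0..\<mu> (\<phi> T)} (\<lambda>t. norm (hardy_Z t) ^ 2 * exp (- (2 / \<phi> T) * t)) =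
             integral {0..T} (\<lambda>t. norm (hardy_Z t) ^ 2)"
      "\<And>T. T \<ge> T0 \<Longrightarrow> \<phi>1 T = \<phi> T / 2"
    using assms unfolding jacobs_ladder_def by blast
  define F where "F y = crit_laplace (y / 2) (\<mu> y)" for y
  have ladder: "F (\<phi> T) = crit_moment T" if "T \<ge> T0" for T
  proof -
    have "- (2 / \<phi> T) * t = - t / (\<phi> T / 2)" for t by simp
    then show ?thesis using \<phi>(2)[OF that] unfolding F_def crit_laplace_def line_moment_def norm_hardy_Z by (simp only:)
  qed
  have Fm: "F y \<le> F z" if "y0 \<le> y" "y \<le> z" for y z
    unfolding F_def using that y0 \<mu>m by (intro crit_laplace_mono) (auto simp: mono_on_def)
  have "\<forall>\<^sub>F T in at_top. crit_moment T > 0" by (rule crit_moment_unbounded)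
  then obtain m0 where m0: "\<And>m. m \<ge> m0 \<Longrightarrow> crit_moment m > 0" by (auto simp: eventually_at_top_linorder)
  have "\<forall>\<^sub>F y in at_top. 7 * y * ln y \<ge> m0" by real_asymp
  then obtain Y where Y: "\<And>y. y \<ge> Y \<Longrightarrow> 7 * y * ln y \<ge> m0" by (auto simp: eventually_at_top_linorder)
  define Z where "Z = max Y y0"
  \<comment> \<open>Only the larger argument has to exceed \<open>Z\<close>, beyond which \<mu>
    reaches far enough for a positive moment; of \<open>\<phi> v\<close> nothing is known at first
    except that it is at least \<open>y0\<close>.\<close>
  have Fs: "F y < F z" if "y0 \<le> y" "y < z" "Z < z" for y z
  proof -
    define w where "w = max y Z"
    have w: "y \<le> w" "w < z" "Y \<le> w" "y0 \<le> w" using that by (auto simp: w_def Z_def)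
    have "\<mu> w \<ge> m0" using Y[OF w(3)] \<mu>[OF w(4)] by linarith
    then have "F w < F z" unfolding F_def using w y0 \<mu>m m0 by (intro crit_laplace_strict_mono) (auto simp: mono_on_def)
    then show ?thesis using Fm[OF that(1) w(1)] by linarith
  qed
  obtain c where c: "c > 0"
    "\<forall>\<^sub>F u in at_top. \<forall>M. M \<ge> 14 * u * ln (2 * u) \<longrightarrow> crit_moment u + c * u \<le> crit_laplace u M \<and> crit_laplace u M < crit_moment (2 * u)"
    by (rule crit_laplace_bounds)
  show ?thesis using c(2) eventually_ge_at_top[of "max T0 (max y0 Z)"]
  proof eventually_elim
    case (elim u)
    have u: "u \<ge> T0" "u \<ge> y0" "u \<ge> Z" "u > 0" using elim(2) T0 by auto
    have M: "\<mu> (2 * u) \<ge> 14 * u * ln (2 * u)" using \<mu>[of "2 * u"] u by simp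
    have F: "F (2 * u) = crit_laplace u (\<mu> (2 * u))" by (simp add: F_def)
    have b: "crit_moment u + c * u \<le> F (2 * u)" "F (2 * u) < crit_moment (2 * u)" using elim(1) M unfolding F by blast+
    have "0 \<le> c * u" using c(1) u by simp
    then have "\<exists>v\<ge>u. v \<le> 2 * u \<and> crit_moment v = F (2 * u)"
      by (intro IVT' continuous_on_subset[OF crit_moment_continuous]) (use b u in auto)
    then obtain v where v: "v \<ge> u" "crit_moment v = F (2 * u)" by blast
    have vT: "v \<ge> T0" using v u by linarith
    have eq: "F (\<phi> v) = F (2 * u)" using ladder[OF vT] v by simp
    have "\<phi> v = 2 * u"
    proof (rule antisym)
      show "\<phi> v \<le> 2 * u" using Fs[of "2 * u" "\<phi> v"] eq u by (cases "\<phi> v \<le> 2 * u") auto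
      show "2 * u \<le> \<phi> v" using Fs[of "\<phi> v" "2 * u"] eq u \<phi>(1)[OF vT] by (cases "2 * u \<le> \<phi> v") auto
    qed
    then have img: "u \<in> \<phi>1 ` {T0..}" using \<phi>(3)[OF vT] vT by (intro image_eqI[of _ _ v]) auto
    let ?v = "ladder_inv T0 \<phi>1 u"
    have 1: "?v \<ge> T0" using inv_into_into[OF img] by (simp add: ladder_inv_def)
    have "\<phi>1 ?v = u" unfolding ladder_inv_def by (rule f_inv_into_f[OF img])
    then have "\<phi> ?v = 2 * u" using \<phi>(3)[OF 1] by simp
    then have "crit_moment ?v = crit_laplace u (\<mu> (2 * u))" using ladder[OF 1] F by simp
    then show ?case using 1 M by blast
  qed
qed

text \<open>Monotonicity of the moment carries the bounds of \<open>crit_laplace_bounds\<close> over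
  from its values to its arguments.\<close>

lemma ladder_inv_bounds:
  assumes "jacobs_ladder T0 \<phi>1"
  obtains c where "c > 0" "\<forall>\<^sub>F u in at_top. u < ladder_inv T0 \<phi>1 u \<and> ladder_inv T0 \<phi>1 u < 2 * u \<and>
    crit_moment u + c * u \<le> crit_moment (ladder_inv T0 \<phi>1 u)"
proof -
  obtain c where c: "c > 0"
    "\<forall>\<^sub>F u in at_top. \<forall>M. M \<ge> 14 * u * ln (2 * u) \<longrightarrow> crit_moment u + c * u \<le> crit_laplace u M \<and> crit_laplace u M < crit_moment (2 * u)"
    by (rule crit_laplace_bounds)
  have T0: "T0 > 0" using assms by (simp add: jacobs_ladder_def)
  have "\<forall>\<^sub>F u in at_top. u < ladder_inv T0 \<phi>1 u \<and> ladder_inv T0 \<phi>1 u < 2 * u \<and>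
    crit_moment u + c * u \<le> crit_moment (ladder_inv T0 \<phi>1 u)"
    using c(2) jacobs_ladder_inverse[OF assms] eventually_gt_at_top[of 0]
  proof eventually_elim
    case (elim u)
    let ?v = "ladder_inv T0 \<phi>1 u"
    obtain M where M: "M \<ge> 14 * u * ln (2 * u)" "crit_moment ?v = crit_laplace u M" using elim(2) by blast
    have b: "crit_moment u + c * u \<le> crit_moment ?v" "crit_moment ?v < crit_moment (2 * u)" using elim(1) M by simp_all
    have v0: "?v \<ge> 0" using elim(2) T0 by linarith
    have "c * u > 0" using c(1) elim(3) by simp
    then have "\<not> ?v \<le> u" using crit_moment_mono[OF v0, of u] b by linarith
    moreover have "\<not> 2 * u \<le> ?v" using crit_moment_mono[of "2 * u" ?v] b elim(3) by linarith
    ultimately show ?case using b by simp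
  qed
  with c(1) show ?thesis by (rule that)
qed

section \<open>Moments over the ladder interval and the limit of the quotient\<close>

lemma zeta_moment_2: "zeta_moment 2 \<sigma> = line_moment \<sigma>"
  by (simp add: fun_eq_iff zeta_moment_def line_moment_def zeta_line_def)

text \<open>The length w = v - u cancels in the ratio, so its asymptotics do not matter. It has to
  be at least of order u / ln u, so that the error u^{24/25} of both moments is negligible against
  w.\<close>

lemma ladder_moment_ratio:
  assumes \<sigma>: "\<sigma> > 1/2" and "jacobs_ladder T0 \<phi>1"
  defines "V \<equiv> ladder_inv T0 \<phi>1"
  shows "\<forall>\<^sub>F u in at_top. line_moment \<sigma> u (V u) > 0"
    and "((\<lambda>u. line_moment (1/2) u (V u) / line_moment \<sigma> u (V u) / ln u) \<longlongrightarrow> 1 / zeta_real (2 * \<sigma>)) at_top"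
proof -
  obtain c where c: "c > 0" and "\<forall>\<^sub>F u in at_top. u < V u \<and> V u < 2 * u \<and>
    crit_moment u + c * u \<le> crit_moment (V u)" unfolding V_def by (rule ladder_inv_bounds[OF assms(2)])
  define w where "w u = V u - u" for u
  define C where "C = 2 + \<bar>mean_const (1/2)\<bar>"
  have Vb: "\<forall>\<^sub>F u in at_top. u < V u \<and> V u < 2 * u \<and> c * u \<le> line_moment (1/2) u (V u)"
    using \<open>\<forall>\<^sub>F u in at_top. u < V u \<and> V u < 2 * u \<and> crit_moment u + c * u \<le> crit_moment (V u)\<close> eventually_ge_at_top[of 0]
  proof eventually_elim
    case (elim u)
    then show ?case using crit_moment_diff[of u "V u"] by linarith
  qed
  have "\<forall>\<^sub>F T in at_top. \<forall>a b. T \<le> a \<and> a \<le> b \<and> b \<le> 2 * T \<longrightarrow>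
      \<bar>line_moment (1/2) a b - (mean_primitive (1/2) b - mean_primitive (1/2) a)\<bar> \<le> 1 * (b - a) + T powr (24/25)"
    by (rule line_moment_asymptotic_lt_1) auto
  then have B: "\<forall>\<^sub>F u in at_top. \<bar>line_moment (1/2) u (V u) - w u * ln u\<bar> \<le> C * w u + u powr (24/25)"
    using Vb eventually_ge_at_top[of 1]
  proof eventually_elim
    case (elim u)
    let ?P = "mean_primitive (1/2)"
    have "u < V u" using elim(2) by blast
    \<comment> \<open>The increment of the primitive is w times ln z up to a constant, and ln z is
      within ln 2 of ln u since u < z < 2 u.\<close>
    then obtain z where z: "u < z" "z < V u" "?P (V u) - ?P u = (V u - u) * mean_density (1/2) z"
      using MVT2[of u "V u" ?P "mean_density (1/2)"] mean_primitive_deriv elim(3) by fastforce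
    have lz: "\<bar>ln z - ln u\<bar> \<le> 1"
    proof -
      have "ln z \<le> ln (2 * u)" using z elim by (subst ln_le_cancel_iff) auto
      also have "\<dots> = ln 2 + ln u" using elim(3) by (simp add: ln_mult)
      also have "ln 2 \<le> (1::real)" using ln_le_minus_one[of 2] by simp
      finally have "ln z - ln u \<le> 1" by simp
      moreover have "ln u \<le> ln z" using z elim(3) by simp
      ultimately show ?thesis by linarith
    qed
    have "\<bar>mean_density (1/2) z - ln u\<bar> \<le> C - 1" using lz by (simp add: mean_density_def log_coeff_def C_def)
    then have "w u * \<bar>mean_density (1/2) z - ln u\<bar> \<le> w u * (C - 1)" using \<open>u < V u\<close> by (intro mult_left_mono) (auto simp: w_def)
    moreover have "w u * \<bar>mean_density (1/2) z - ln u\<bar> = \<bar>(?P (V u) - ?P u) - w u * ln u\<bar>"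
      using \<open>u < V u\<close> unfolding z(3) w_def[symmetric] by (simp add: abs_mult w_def flip: right_diff_distrib)
    moreover have "\<bar>line_moment (1/2) u (V u) - (?P (V u) - ?P u)\<bar> \<le> 1 * (V u - u) + u powr (24/25)"
      using elim(1,2) by auto
    moreover have "w u * (C - 1) + 1 * (V u - u) = C * w u" by (simp add: w_def algebra_simps)
    ultimately show ?case by linarith
  qed
  \<comment> \<open>The moment lies between c u and 2 w ln u + c u / 2, whence u \<le> (4 / c) w ln
    u; multiplying by u^{-1/25} shows that \<eta> is the size of the error relative to w.\<close>
  define \<eta> where "\<eta> u = 4 / c * ln u * u powr (- (1/25))" for u
  have \<eta>0: "(\<eta> \<longlongrightarrow> 0) at_top" unfolding \<eta>_def[abs_def] using c by real_asymp
  have "\<forall>\<^sub>F u in at_top. u powr (24/25) \<le> c / 2 * u" using c by real_asymp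
  moreover have "\<forall>\<^sub>F u in at_top. C \<le> ln (u::real)" by real_asymp
  ultimately have W: "\<forall>\<^sub>F u in at_top. w u > 0 \<and> u powr (24/25) \<le> \<eta> u * w u"
    using Vb B eventually_gt_at_top[of 1]
  proof eventually_elim
    case (elim u)
    have w: "w u > 0" using elim(3) by (simp add: w_def)
    have l: "ln u > 0" using elim(5) by simp
    have "C * w u \<le> ln u * w u" using elim(2) w by (intro mult_right_mono) auto
    moreover have "ln u * w u = w u * ln u" by simp
    moreover have "c * u \<le> line_moment (1/2) u (V u)" using elim(3) by blast
    ultimately have "c / 2 * u \<le> 2 * (w u * ln u)" using elim(1,4) by linarith
    then have "u \<le> 4 / c * ln u * w u" using c by (simp add: field_simps)
    then have "u * u powr (- (1/25)) \<le> 4 / c * ln u * w u * u powr (- (1/25))" by (rule mult_right_mono) simp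
    moreover have "u * u powr (- (1/25)) = u powr (24/25)" using elim(5) powr_add[of u 1 "- (1/25)"] by simp
    ultimately show ?case using w by (simp add: \<eta>_def mult_ac)
  qed
  have "((\<lambda>u. line_moment (1/2) u (V u) / (w u * ln u) - 1) \<longlongrightarrow> 0) at_top"
  proof (rule Lim_null_comparison)
    show "\<forall>\<^sub>F u in at_top. norm (line_moment (1/2) u (V u) / (w u * ln u) - 1) \<le> (C + \<eta> u) / ln u"
      using B W eventually_gt_at_top[of 1]
    proof eventually_elim
      case (elim u)
      have p: "w u * ln u > 0" using elim by simp
      have "\<bar>line_moment (1/2) u (V u) - w u * ln u\<bar> \<le> (C + \<eta> u) * w u" using elim(1,2) by (simp add: algebra_simps)
      then have "\<bar>line_moment (1/2) u (V u) - w u * ln u\<bar> / (w u * ln u) \<le> (C + \<eta> u) * w u / (w u * ln u)"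
        using p by (intro divide_right_mono) auto
      moreover have "norm (line_moment (1/2) u (V u) / (w u * ln u) - 1) = \<bar>line_moment (1/2) u (V u) - w u * ln u\<bar> / \<bar>w u * ln u\<bar>"
        unfolding abs_divide[symmetric] using elim by (simp add: diff_divide_distrib)
      moreover have "(C + \<eta> u) * w u / (w u * ln u) = (C + \<eta> u) / ln u" using elim by simp
      ultimately show ?case using p by simp
    qed
    have "((\<lambda>u. (C + \<eta> u) * inverse (ln u)) \<longlongrightarrow> (C + 0) * 0) at_top"
      by (intro tendsto_intros \<eta>0 tendsto_inverse_0_at_top ln_at_top)
    then show "((\<lambda>u. (C + \<eta> u) / ln u) \<longlongrightarrow> 0) at_top" by (simp add: divide_inverse)
  qed
  then have limB: "((\<lambda>u. line_moment (1/2) u (V u) / (w u * ln u)) \<longlongrightarrow> 1) at_top" by (simp add: LIM_zero_iff)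
  let ?z = "zeta_real (2 * \<sigma>)"
  have z: "?z > 0" by (rule zeta_real_pos) (use \<sigma> in simp)
  have limA: "((\<lambda>u. line_moment \<sigma> u (V u) / w u) \<longlongrightarrow> ?z) at_top"
  proof (rule tendstoI)
    fix e :: real assume e: "e > 0"
    have "\<forall>\<^sub>F u in at_top. \<bar>\<eta> u\<bar> < e / 2" using tendstoD[OF \<eta>0, of "e / 2"] e by simp
    then show "\<forall>\<^sub>F u in at_top. dist (line_moment \<sigma> u (V u) / w u) ?z < e"
      using line_moment_asymptotic[OF \<sigma> half_gt_zero[OF e]] Vb W
    proof eventually_elim
      case (elim u)
      have w: "w u > 0" using elim by blast
      have "\<bar>line_moment \<sigma> u (V u) - ?z * w u\<bar> \<le> e / 2 * w u + u powr (24/25)"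
        using elim(2,3) unfolding w_def by auto
      also have "\<dots> \<le> e / 2 * w u + \<eta> u * w u" using elim(4) by simp
      also have "\<dots> < e / 2 * w u + e / 2 * w u"
        using elim(1) w by (intro add_strict_left_mono mult_strict_right_mono) auto
      finally have "\<bar>line_moment \<sigma> u (V u) - ?z * w u\<bar> < e * w u" by simp
      then have "\<bar>line_moment \<sigma> u (V u) - ?z * w u\<bar> / \<bar>w u\<bar> < e" using w by (simp add: divide_less_eq)
      then show ?case unfolding abs_divide[symmetric] dist_real_def using w by (simp add: diff_divide_distrib)
    qed
  qed
  have "\<forall>\<^sub>F u in at_top. line_moment \<sigma> u (V u) / w u > 0" by (rule order_tendstoD(1)[OF limA z])
  then show "\<forall>\<^sub>F u in at_top. line_moment \<sigma> u (V u) > 0" using W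
    by eventually_elim (auto simp: zero_less_divide_iff)
  have "((\<lambda>u. (line_moment (1/2) u (V u) / (w u * ln u)) / (line_moment \<sigma> u (V u) / w u)) \<longlongrightarrow> 1 / ?z) at_top"
    by (intro tendsto_divide limA limB) (use z in simp)
  moreover have "\<forall>\<^sub>F u in at_top. (line_moment (1/2) u (V u) / (w u * ln u)) / (line_moment \<sigma> u (V u) / w u)
      = line_moment (1/2) u (V u) / line_moment \<sigma> u (V u) / ln u"
    using W by eventually_elim auto
  ultimately show "((\<lambda>u. line_moment (1/2) u (V u) / line_moment \<sigma> u (V u) / ln u) \<longlongrightarrow> 1 / ?z) at_top"
    by (rule Lim_transform_eventually)
qed

lemma fourth_moment_asymptotic:
  assumes "fourth_moment_constants a"
  shows "((\<lambda>u. zeta_moment 4 (1/2) 0 u / (u * ln u ^ 4)) \<longlongrightarrow> 1 / (2 * pi\<^sup>2)) at_top"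
proof -
  let ?S = "\<lambda>T. \<Sum>s\<le>4. a s * ln T ^ (4 - s)"
  have a0: "a 0 = 1 / (2 * pi\<^sup>2)" using assms by (simp add: fourth_moment_constants_def)
  \<comment> \<open>The choice \<epsilon> = 1/16 keeps the exponent 15/16 below 1.\<close>
  have "(\<lambda>T. zeta_moment 4 (1/2) 0 T - T * ?S T) \<in> O(\<lambda>T. T powr (7/8 + 1/16))"
    using assms unfolding fourth_moment_constants_def by (meson zero_less_divide_1_iff zero_less_numeral)
  also have "(\<lambda>T::real. T powr (7/8 + 1/16)) \<in> o(\<lambda>T. T * ln T ^ 4)" by real_asymp
  finally have "((\<lambda>T. (zeta_moment 4 (1/2) 0 T - T * ?S T) / (T * ln T ^ 4)) \<longlongrightarrow> 0) at_top"
    by (rule smalloD_tendsto)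
  moreover have "((\<lambda>T. T * ?S T / (T * ln T ^ 4)) \<longlongrightarrow> a 0) at_top"
  proof (rule Lim_transform_eventually)
    have "((\<lambda>T. \<Sum>s\<le>4. a s * inverse (ln T) ^ s) \<longlongrightarrow> (\<Sum>s\<le>4. a s * 0 ^ s)) at_top"
      by (intro tendsto_intros tendsto_inverse_0_at_top ln_at_top)
    then show "((\<lambda>T. \<Sum>s\<le>4. a s * inverse (ln T) ^ s) \<longlongrightarrow> a 0) at_top" by (simp add: eval_nat_numeral)
    show "\<forall>\<^sub>F T in at_top. (\<Sum>s\<le>4. a s * inverse (ln T) ^ s) = T * ?S T / (T * ln T ^ 4)"
      using eventually_gt_at_top[of 1]
    proof eventually_elim
      case (elim T)
      have "a s * inverse (ln T) ^ s = a s * ln T ^ (4 - s) / ln T ^ 4" if "s \<le> 4" for s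
        using that elim by (simp add: power_diff power_inverse divide_inverse)
      then show ?case using elim by (simp add: sum_divide_distrib)
    qed
  qed
  ultimately have "((\<lambda>T. (zeta_moment 4 (1/2) 0 T - T * ?S T) / (T * ln T ^ 4) + T * ?S T / (T * ln T ^ 4)) \<longlongrightarrow> 0 + a 0) at_top"
    by (rule tendsto_add)
  then show ?thesis unfolding add_divide_distrib[symmetric] diff_add_cancel a0 by simp
qed

text \<open>Taking (A ln u)^4 out of the denominator leaves a polynomial in R = B / (A ln u) and 1 /
  ln u, in which only s = 0 survives and gives zeta(2 \<sigma>)^{-4}. The factor
  \<open>\<kappa>\<close> of \<tau> in the argument is such that the limit zeta(2 \<sigma>)^4 / (2
  pi^2) of the rest cancels against it up to the Fermat ratio.\<close>

lemma fermat_quotient_limit: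
  assumes \<sigma>: "\<sigma> > 1/2" and a: "fourth_moment_constants a" and L: "jacobs_ladder T0 \<phi>1"
    and pos: "x > 0" "y > 0" "z > 0"
  shows "(fermat_quotient a T0 \<phi>1 \<sigma> x y z n \<longlongrightarrow> (real x ^ n + real y ^ n) / real z ^ n) at_top"
proof -
  define q where "q = (real x ^ n + real y ^ n) / real z ^ n"
  define \<zeta> where "\<zeta> = zeta_real (2 * \<sigma>)"
  have \<zeta>: "\<zeta> > 0" unfolding \<zeta>_def by (rule zeta_real_pos) (use \<sigma> in simp)
  have q: "q > 0" unfolding q_def using pos by (intro divide_pos_pos add_pos_pos) auto
  define \<kappa> where "\<kappa> = 2 * pi\<^sup>2 / \<zeta> ^ 4 * q"
  have \<kappa>: "\<kappa> > 0" unfolding \<kappa>_def using \<zeta> q by simp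
  have arg: "fermat_arg \<sigma> x y z n \<tau> = \<kappa> * \<tau>" for \<tau> by (simp add: fermat_arg_def \<kappa>_def \<zeta>_def q_def)
  let ?V = "ladder_inv T0 \<phi>1"
  define A where "A u = line_moment \<sigma> u (?V u)" for u
  define B where "B u = line_moment (1/2) u (?V u)" for u
  define R where "R u = B u / A u / ln u" for u
  define M where "M u = zeta_moment 4 (1/2) 0 u" for u
  define c where "c = moment_coeff a \<sigma>"
  have c0: "c 0 = 1" by (simp add: c_def moment_coeff_def)
  define D where "D u = (\<Sum>s\<le>4. c s * R u ^ (4 - s) * inverse (ln u) ^ s)" for u
  define G where "G u = M u / (u * ln u ^ 4) / D u" for u
  have A0: "\<forall>\<^sub>F u in at_top. A u > 0" and R: "(R \<longlongrightarrow> 1 / \<zeta>) at_top"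
    using ladder_moment_ratio[OF \<sigma> L] unfolding A_def R_def[abs_def] B_def \<zeta>_def by auto
  have M: "((\<lambda>u. M u / (u * ln u ^ 4)) \<longlongrightarrow> 1 / (2 * pi\<^sup>2)) at_top"
    unfolding M_def by (rule fourth_moment_asymptotic[OF a])
  have "(D \<longlongrightarrow> (\<Sum>s\<le>4. c s * (1 / \<zeta>) ^ (4 - s) * 0 ^ s)) at_top" unfolding D_def[abs_def]
    by (intro tendsto_intros R tendsto_inverse_0_at_top ln_at_top)
  also have "(\<Sum>s\<le>4. c s * (1 / \<zeta>) ^ (4 - s) * 0 ^ s) = 1 / \<zeta> ^ 4"
    by (simp add: eval_nat_numeral c0 power_divide)
  finally have D: "(D \<longlongrightarrow> 1 / \<zeta> ^ 4) at_top" .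
  have "(G \<longlongrightarrow> 1 / (2 * pi\<^sup>2) / (1 / \<zeta> ^ 4)) at_top" unfolding G_def[abs_def]
    by (intro tendsto_divide M D) (use \<zeta> in simp)
  moreover have "filterlim (\<lambda>\<tau>. \<kappa> * \<tau>) at_top at_top"
    using \<kappa> by (intro filterlim_tendsto_pos_mult_at_top[OF tendsto_const] filterlim_ident)
  ultimately have "((\<lambda>\<tau>. \<kappa> * G (\<kappa> * \<tau>)) \<longlongrightarrow> \<kappa> * (1 / (2 * pi\<^sup>2) / (1 / \<zeta> ^ 4))) at_top"
    by (intro tendsto_mult tendsto_const) (rule filterlim_compose)
  also have "\<kappa> * (1 / (2 * pi\<^sup>2) / (1 / \<zeta> ^ 4)) = q" using \<zeta> by (simp add: \<kappa>_def)
  finally have lim: "((\<lambda>\<tau>. \<kappa> * G (\<kappa> * \<tau>)) \<longlongrightarrow> q) at_top" .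
  have "\<forall>\<^sub>F u in at_top. M u * A u ^ 4 / (\<Sum>s\<le>4. c s * B u ^ (4 - s) * A u ^ s) = u * G u"
    using A0 eventually_gt_at_top[of 1]
  proof eventually_elim
    case (elim u)
    have l: "ln u > 0" using elim(2) by simp
    have "c s * B u ^ (4 - s) * A u ^ s = (A u * ln u) ^ 4 * (c s * R u ^ (4 - s) * inverse (ln u) ^ s)" if "s \<le> 4" for s
    proof -
      have e1: "B u = R u * (A u * ln u)" using elim l by (simp add: R_def)
      have e2: "A u * ln u * inverse (ln u) = A u" using l by simp
      have "c s * B u ^ (4 - s) * A u ^ s = c s * R u ^ (4 - s) * ((A u * ln u) ^ (4 - s) * (A u * ln u * inverse (ln u)) ^ s)"
        unfolding e2 e1 power_mult_distrib[of "R u"] by (simp only: mult_ac)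
      also have "(A u * ln u) ^ (4 - s) * (A u * ln u * inverse (ln u)) ^ s = (A u * ln u) ^ (4 - s + s) * inverse (ln u) ^ s"
        unfolding power_mult_distrib[of "A u * ln u"] power_add by simp
      finally show ?thesis using that by (simp add: mult_ac)
    qed
    then have "(\<Sum>s\<le>4. c s * B u ^ (4 - s) * A u ^ s) = (A u * ln u) ^ 4 * D u"
      unfolding D_def sum_distrib_left by (intro sum.cong) auto
    then show ?case using elim l by (simp add: G_def power_mult_distrib)
  qed
  then have "\<forall>\<^sub>F \<tau> in at_top. M (\<kappa> * \<tau>) * A (\<kappa> * \<tau>) ^ 4 / (\<Sum>s\<le>4. c s * B (\<kappa> * \<tau>) ^ (4 - s) * A (\<kappa> * \<tau>) ^ s) = \<kappa> * \<tau> * G (\<kappa> * \<tau>)"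
    using \<open>filterlim (\<lambda>\<tau>. \<kappa> * \<tau>) at_top at_top\<close> by (rule eventually_compose_filterlim)
  then have "\<forall>\<^sub>F \<tau> in at_top. \<kappa> * G (\<kappa> * \<tau>) = fermat_quotient a T0 \<phi>1 \<sigma> x y z n \<tau>"
    using eventually_gt_at_top[of 0]
  proof eventually_elim
    case (elim \<tau>)
    have "fermat_quotient a T0 \<phi>1 \<sigma> x y z n \<tau> = 1 / \<tau> * (M (\<kappa> * \<tau>) * A (\<kappa> * \<tau>) ^ 4 / (\<Sum>s\<le>4. c s * B (\<kappa> * \<tau>) ^ (4 - s) * A (\<kappa> * \<tau>) ^ s))"
      unfolding fermat_quotient_def Let_def arg zeta_moment_2 A_def B_def M_def c_def by (simp only: mult.commute)
    then show ?case using elim by simp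
  qed
  then show ?thesis using lim unfolding q_def by (rule Lim_transform_eventually[rotated])
qed

text \<open>\<open>Lim\<close> denotes a limit only where one exists; the convergence statement in
  the conclusion makes \<open>fermat_limit\<close> meaningful.\<close>

theorem theorem2:
  fixes \<epsilon> \<sigma> T0 :: real and \<phi>1 :: "real \<Rightarrow> real" and a :: "nat \<Rightarrow> real"
  assumes "\<epsilon> > 0" and "\<sigma> > 1 / 2 + \<epsilon>"
    and "fourth_moment_constants a"
    and "jacobs_ladder T0 \<phi>1"
  shows "(\<forall>(x::nat) (y::nat) (z::nat) (n::nat). x > 0 \<and> y > 0 \<and> z > 0 \<and> n \<ge> 3 \<longrightarrow>
            (\<exists>l. (fermat_quotient a T0 \<phi>1 \<sigma> x y z n \<longlongrightarrow> l) at_top)) \<and>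
         ((\<forall>(x::nat) (y::nat) (z::nat) (n::nat). x > 0 \<and> y > 0 \<and> z > 0 \<and> n \<ge> 3 \<longrightarrow>
            fermat_limit a T0 \<phi>1 \<sigma> x y z n \<noteq> 1) \<longleftrightarrow> fermat_wiles)"
proof -
  have \<sigma>: "\<sigma> > 1/2" using assms by linarith
  note lim = fermat_quotient_limit[OF \<sigma> assms(3,4)]
  have eq: "fermat_limit a T0 \<phi>1 \<sigma> x y z n = 1 \<longleftrightarrow> x ^ n + y ^ n = z ^ n" if "x > 0" "y > 0" "z > 0" for x y z n
  proof -
    have "fermat_limit a T0 \<phi>1 \<sigma> x y z n = (real x ^ n + real y ^ n) / real z ^ n"
      unfolding fermat_limit_def using lim[OF that] by (intro tendsto_Lim) auto
    also have "\<dots> = 1 \<longleftrightarrow> real x ^ n + real y ^ n = real z ^ n" using that by auto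
    also have "\<dots> \<longleftrightarrow> x ^ n + y ^ n = z ^ n" by (simp flip: of_nat_power of_nat_add)
    finally show ?thesis .
  qed
  have iff: "(x > 0 \<and> y > 0 \<and> z > 0 \<and> n \<ge> 3 \<longrightarrow> fermat_limit a T0 \<phi>1 \<sigma> x y z n \<noteq> 1) \<longleftrightarrow>
      (x > 0 \<and> y > 0 \<and> z > 0 \<and> n \<ge> 3 \<longrightarrow> x ^ n + y ^ n \<noteq> z ^ n)" for x y z n :: nat
    using eq by auto
  have ex: "\<exists>l. (fermat_quotient a T0 \<phi>1 \<sigma> x y z n \<longlongrightarrow> l) at_top" if "x > 0 \<and> y > 0 \<and> z > 0 \<and> n \<ge> 3" for x y z n
    using that by (intro exI[of _ "(real x ^ n + real y ^ n) / real z ^ n"] lim) auto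
  show ?thesis unfolding fermat_wiles_def iff by (intro conjI allI impI refl ex) auto
qed

end
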